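(* Let $B$ be an associative/coassociative, unital/counital bialgebra over a field $k$. Let $X$ be a (left) $B$-module coalgebra and let $Y$ be a $0$-stable $B$-module/comodule. Then: (1) The graded $B$-module $\mathbb{PCM}_*(X,Y)=\mathbb{T}_*(X,Y)/I_{[B,\mathcal{C}]}$ is a cosimplicial $B$-module, which falls short of being a para-cocyclic $B$-module only in that the induced operators $\tau_n^{-1}$ may fail to be invertible. (2) If $B$ is a Hopf algebra (with bijective antipode), then $\mathbb{PCM}_*(X,Y)$ is a para-cocyclic $B$-module. (3) Regardless of whether $B$ is a Hopf algebra, $\mathbb{CM}_*(X,Y):={}_B\mathbb{PCM}_*(X,Y)$ is always a cocyclic module. (4) If $X=B$ is a Hopf algebra (with bijective antipode) and $Y$ is a stable anti-Yetter-Drinfeld module, then the cyclic homology of $\mathbb{CM}_*(B,Y)$ is the Connes--Moscovici cyclic homology of $B$ with coefficients in $Y$, i.e. the cyclic homology of the Connes--Moscovici cocyclic module $\mathcal{C}_*(B,Y)$.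
   Context: A $B$-module/comodule $Y$ is a left $B$-module that is also a left $B$-comodule, coaction $y\mapsto y_{(-1)}\otimes y_{(0)}$. It is $0$-stable if $y_{(-1)}y_{(0)}=y$ for all $y$. When $B$ is Hopf with antipode $S$, $Y$ is stable if moreover $S(y_{(-1)})y_{(0)}=y$ for all $y$, and anti-Yetter-Drinfeld if $(by)_{(-1)}\otimes(by)_{(0)}=b_{(1)}y_{(-1)}S^{-1}(b_{(3)})\otimes b_{(2)}y_{(0)}$ for all $b\in B,y\in Y$. No codegeneracies are considered. A cosimplicial module is a graded module with coface maps $\partial_j$ ($0\le j\le n+1$) in degree $n$ satisfying $\partial_i\partial_j=\partial_{j+1}\partial_i$ for $i\le j$. A para-cocyclic module has in addition invertible operators $\tau_n$ in degree $n$ with $\tau_{n+1}\partial_j=\partial_{j+1}\tau_n$ for $0\le j\le n$ and $\tau_{n+1}\partial_{n+1}=\partial_0$; equivalently in terms of $\tau^{-1}$: $\partial_j\tau_n^{-1}=\tau_{n+1}^{-1}\partial_{j+1}$ for $0\le j\le n$ and $\partial_{n+1}=\tau_{n+1}^{-1}\partial_0$. It is cocyclic if also $\tau_n^{n+1}=\mathrm{id}$. A cosimplicial or para-cocyclic $B$-module is one where each degree is a left $B$-module and all structure maps are $B$-linear. ${}_BM=M/\{\epsilon(b)m-bm\}$ (quotient by the span) denotes the $B$-coinvariants of a left $B$-module $M$. Cyclic homology of a cocyclic module without codegeneracies is computed by the cyclic bicomplex. $\mathbb{T}_n(X,Y)=X^{\otimes n+1}\otimes Y$ with diagonal action $L_b(x^0\otimes\cdots\otimes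 x^n\otimes y)=b_{(1)}x^0\otimes\cdots\otimes b_{(n+1)}x^n\otimes b_{(n+2)}y$. Coface maps: for $0\le j\le n$, $\partial_j$ applies the comultiplication of $X$ to $x^j$; $\partial_{n+1}(x^0\otimes\cdots\otimes x^n\otimes y)=x^0_{(2)}\otimes x^1\otimes\cdots\otimes x^n\otimes y_{(-1)}x^0_{(1)}\otimes y_{(0)}$. Also $\tau_n^{-1}(x^0\otimes\cdots\otimes x^n\otimes y)=x^1\otimes\cdots\otimes x^n\otimes y_{(-1)}x^0\otimes y_{(0)}$, not necessarily invertible; if $B$ is Hopf with bijective antipode it is invertible and its inverse is $\tau_n$. $I_{[B,\mathcal{C}]}$ is the graded $k$-submodule spanned by all $[L_b,\tau_n^{-j}](\xi)=L_b\tau_n^{-j}(\xi)-\tau_n^{-j}L_b(\xi)$ with $b\in B$, $n\ge0$, $\xi\in\mathbb{T}_n(X,Y)$ and $j\ge 0$ (all $j\in\mathbb{Z}$ when $B$ is a Hopf algebra). $\mathbb{PCM}_*(X,Y)$ and $\mathbb{CM}_*(X,Y)$ carry the induced coface maps and operators. For $H$ a Hopf algebra with bijective antipode and $Y$ stable anti-Yetter-Drinfeld, the Connes--Moscovici cocyclic module is $\mathcal{C}_n(H,Y)=H^{\otimes n}\otimes Y$ with coface maps $\widetilde d_0(h^0\otimes\cdots\otimes h^{n-1}\otimes y)=1\otimes h^0\otimes\cdots\otimes h^{n-1}\otimes y$; $\widetilde d_j$ applies the comultiplication to $h^{j-1}$ for $1\le j\le n$; $\widetilde d_{n+1}(h^0\otimes\cdots\otimes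 h^{n-1}\otimes y)=h^0\otimes\cdots\otimes h^{n-1}\otimes y_{(-1)}\otimes y_{(0)}$; and cyclic operators $t_n$ with $t_0=\mathrm{id}$ and, for $n\ge1$, $t_n$ the inverse of $t_n^{-1}(h^0\otimes\cdots\otimes h^{n-1}\otimes y)=S(h^0_{(n+1)})h^1\otimes\cdots\otimes S(h^0_{(3)})h^{n-1}\otimes S(h^0_{(2)})y_{(-1)}\otimes S(h^0_{(1)})y_{(0)}$. *)

theory Defs
  imports "HOL-Algebra.Module" "HOL-Algebra.AbelCoset" "HOL.Hull"
begin

section \<open>Linear algebra over HOL-Algebra modules\<close>

definition mod_hom ::
  "('a, 'r) ring_scheme \<Rightarrow> ('a, 'm, 's) module_scheme \<Rightarrow> ('a, 'n, 't) module_scheme \<Rightarrow> ('m \<Rightarrow> 'n) set"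
  where "mod_hom R M N =
    {f \<in> carrier M \<rightarrow> carrier N.
      (\<forall>x \<in> carrier M. \<forall>y \<in> carrier M. f (x \<oplus>\<^bsub>M\<^esub> y) = f x \<oplus>\<^bsub>N\<^esub> f y) \<and>
      (\<forall>a \<in> carrier R. \<forall>x \<in> carrier M. f (a \<odot>\<^bsub>M\<^esub> x) = a \<odot>\<^bsub>N\<^esub> f x)}"

definition mod_isomorphic ::
  "('a, 'r) ring_scheme \<Rightarrow> ('a, 'm, 's) module_scheme \<Rightarrow> ('a, 'n, 't) module_scheme \<Rightarrow> bool"
  where "mod_isomorphic R M N \<longleftrightarrow>
    (\<exists>f \<in> mod_hom R M N. bij_betw f (carrier M) (carrier N))"

definition mod_span :: "('a, 'r) ring_scheme \<Rightarrow> ('a, 'm, 's) module_scheme \<Rightarrow> 'm set \<Rightarrow> 'm set"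
  where "mod_span R M A = (\<lambda>N. submodule N R M) hull A"

text \<open>The record type of modules extends that of rings; the ring multiplication
  and unit of the modules constructed below are irrelevant and set to zero.\<close>

definition quot_mod :: "('a, 'm, 's) module_scheme \<Rightarrow> 'm set \<Rightarrow> ('a, 'm set) module"
  where "quot_mod M N =
    \<lparr>carrier = A_RCOSETS M N, monoid.mult = (\<lambda>A C. N), one = N, zero = N, add = set_add M,
     smult = (\<lambda>a A. \<Union>x\<in>A. N +>\<^bsub>M\<^esub> (a \<odot>\<^bsub>M\<^esub> x))\<rparr>"

text \<open>The map induced by \<open>f\<close> into the quotient of \<open>M'\<close> by \<open>N'\<close>.  Its value is a coset of
  \<open>N'\<close> only if \<open>f\<close> is compatible with the submodules, so that saying that
  the induced map lands in the quotient includes its well-definedness.\<close>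

definition quot_map :: "('a, 'n, 't) module_scheme \<Rightarrow> 'n set \<Rightarrow> ('m \<Rightarrow> 'n) \<Rightarrow> 'm set \<Rightarrow> 'n set"
  where "quot_map M' N' f A = (\<Union>x\<in>A. N' +>\<^bsub>M'\<^esub> f x)"

definition inv_op ::
  "(nat \<Rightarrow> ('a, 'm, 's) module_scheme) \<Rightarrow> (nat \<Rightarrow> 'm \<Rightarrow> 'm) \<Rightarrow> nat \<Rightarrow> 'm \<Rightarrow> 'm"
  where "inv_op C u n = inv_into (carrier (C n)) (u n)"


section \<open>Tensor products\<close>

definition free_mod :: "('a, 'r) ring_scheme \<Rightarrow> 'g set \<Rightarrow> ('a, 'g \<Rightarrow> 'a) module"
  where "free_mod R G =
    \<lparr>carrier = {p. (\<forall>g. p g \<in> carrier R) \<and> finite {g. p g \<noteq> \<zero>\<^bsub>R\<^esub>} \<and> {g. p g \<noteq> \<zero>\<^bsub>R\<^esub>} \<subseteq> G},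
     monoid.mult = (\<lambda>p q g. \<zero>\<^bsub>R\<^esub>), one = (\<lambda>g. \<zero>\<^bsub>R\<^esub>), zero = (\<lambda>g. \<zero>\<^bsub>R\<^esub>),
     add = (\<lambda>p q g. p g \<oplus>\<^bsub>R\<^esub> q g), smult = (\<lambda>a p g. a \<otimes>\<^bsub>R\<^esub> p g)\<rparr>"

definition free_gen :: "('a, 'r) ring_scheme \<Rightarrow> 'g \<Rightarrow> 'g \<Rightarrow> 'a"
  where "free_gen R g = (\<lambda>h. if h = g then \<one>\<^bsub>R\<^esub> else \<zero>\<^bsub>R\<^esub>)"

text \<open>\<open>tens R X n Y\<close> is the tensor product over \<open>R\<close> of \<open>n\<close> copies of \<open>X\<close> followed by one
  copy of \<open>Y\<close>: the free module on the pairs of a list of length \<open>n\<close> over \<open>X\<close> and an element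
  of \<open>Y\<close>, modulo the relations of multilinearity.  In particular \<open>tens R X 1 Y\<close> is the
  tensor product of \<open>X\<close> and \<open>Y\<close>, and \<open>tens R X n X\<close> is the tensor power of \<open>X\<close> with
  exponent \<open>n + 1\<close>.\<close>

definition tens_gens ::
  "('a, 'x, 's) module_scheme \<Rightarrow> nat \<Rightarrow> ('a, 'y, 't) module_scheme \<Rightarrow> ('x list \<times> 'y) set"
  where "tens_gens X n Y = {(xs, y). length xs = n \<and> set xs \<subseteq> carrier X \<and> y \<in> carrier Y}"

definition tens_free ::
  "('a, 'r) ring_scheme \<Rightarrow> ('a, 'x, 's) module_scheme \<Rightarrow> nat \<Rightarrow> ('a, 'y, 't) module_scheme
    \<Rightarrow> ('a, 'x list \<times> 'y \<Rightarrow> 'a) module"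
  where "tens_free R X n Y = free_mod R (tens_gens X n Y)"

definition tens_rels ::
  "('a, 'r) ring_scheme \<Rightarrow> ('a, 'x, 's) module_scheme \<Rightarrow> nat \<Rightarrow> ('a, 'y, 't) module_scheme
    \<Rightarrow> ('x list \<times> 'y \<Rightarrow> 'a) set"
  where "tens_rels R X n Y =
    (let F = tens_free R X n Y; e = (\<lambda>xs y. free_gen R (xs, y)) in
     mod_span R F
      ({e (xs[i := u \<oplus>\<^bsub>X\<^esub> v]) y \<ominus>\<^bsub>F\<^esub> (e (xs[i := u]) y \<oplus>\<^bsub>F\<^esub> e (xs[i := v]) y) | xs y i u v.
          (xs, y) \<in> tens_gens X n Y \<and> i < n \<and> u \<in> carrier X \<and> v \<in> carrier X} \<union>
       {e (xs[i := a \<odot>\<^bsub>X\<^esub> u]) y \<ominus>\<^bsub>F\<^esub> (a \<odot>\<^bsub>F\<^esub> e (xs[i := u]) y) | xs y i a u.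
          (xs, y) \<in> tens_gens X n Y \<and> i < n \<and> a \<in> carrier R \<and> u \<in> carrier X} \<union>
       {e xs (y \<oplus>\<^bsub>Y\<^esub> z) \<ominus>\<^bsub>F\<^esub> (e xs y \<oplus>\<^bsub>F\<^esub> e xs z) | xs y z.
          (xs, y) \<in> tens_gens X n Y \<and> z \<in> carrier Y} \<union>
       {e xs (a \<odot>\<^bsub>Y\<^esub> y) \<ominus>\<^bsub>F\<^esub> (a \<odot>\<^bsub>F\<^esub> e xs y) | xs y a.
          (xs, y) \<in> tens_gens X n Y \<and> a \<in> carrier R}))"

definition tens ::
  "('a, 'r) ring_scheme \<Rightarrow> ('a, 'x, 's) module_scheme \<Rightarrow> nat \<Rightarrow> ('a, 'y, 't) module_scheme
    \<Rightarrow> ('a, ('x list \<times> 'y \<Rightarrow> 'a) set) module"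
  where "tens R X n Y = quot_mod (tens_free R X n Y) (tens_rels R X n Y)"

definition ptens ::
  "('a, 'r) ring_scheme \<Rightarrow> ('a, 'x, 's) module_scheme \<Rightarrow> ('a, 'y, 't) module_scheme
    \<Rightarrow> 'x list \<Rightarrow> 'y \<Rightarrow> ('x list \<times> 'y \<Rightarrow> 'a) set"
  where "ptens R X Y xs y =
    tens_rels R X (length xs) Y +>\<^bsub>tens_free R X (length xs) Y\<^esub> free_gen R (xs, y)"

text \<open>\<open>tens_lift R M f\<close> is the linear map from a tensor product to \<open>M\<close> determined by a
  multilinear \<open>f\<close>; the result does not depend on the representative \<open>p\<close>.  A Sweedler
  expression \<open>f x\<^sub>(\<^sub>1\<^sub>) x\<^sub>(\<^sub>2\<^sub>)\<close> is rendered as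
  \<open>tens_lift R M (\<lambda>(xs, x''). f (hd xs) x'') (comult C x)\<close>.\<close>

definition tens_lift ::
  "('a, 'r) ring_scheme \<Rightarrow> ('a, 'm, 's) module_scheme \<Rightarrow> ('x list \<times> 'y \<Rightarrow> 'm)
    \<Rightarrow> ('x list \<times> 'y \<Rightarrow> 'a) set \<Rightarrow> 'm"
  where "tens_lift R M f A =
    (let p = (SOME p. p \<in> A) in \<Oplus>\<^bsub>M\<^esub>g\<in>{g. p g \<noteq> \<zero>\<^bsub>R\<^esub>}. p g \<odot>\<^bsub>M\<^esub> f g)"


section \<open>Bialgebras, Hopf algebras, modules and comodules\<close>

record ('a, 'c) coalg = "('a, 'c) module" +
  comult :: "'c \<Rightarrow> ('c list \<times> 'c \<Rightarrow> 'a) set"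
  counit :: "'c \<Rightarrow> 'a"

locale coalgebra = module R C for R and C :: "('a, 'c, 's) coalg_scheme" +
  assumes comult_hom: "comult C \<in> mod_hom R C (tens R C 1 C)"
    and counit_closed: "counit C \<in> carrier C \<rightarrow> carrier R"
    and counit_add: "\<lbrakk>x \<in> carrier C; y \<in> carrier C\<rbrakk> \<Longrightarrow>
      counit C (x \<oplus>\<^bsub>C\<^esub> y) = counit C x \<oplus>\<^bsub>R\<^esub> counit C y"
    and counit_smult: "\<lbrakk>a \<in> carrier R; x \<in> carrier C\<rbrakk> \<Longrightarrow>
      counit C (a \<odot>\<^bsub>C\<^esub> x) = a \<otimes>\<^bsub>R\<^esub> counit C x"
    and coassoc: "x \<in> carrier C \<Longrightarrow>
      tens_lift R (tens R C 2 C)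
        (\<lambda>(us, v). tens_lift R (tens R C 2 C)
          (\<lambda>(ws, z). ptens R C C (ws @ [z]) v) (comult C (hd us))) (comult C x) =
      tens_lift R (tens R C 2 C)
        (\<lambda>(us, v). tens_lift R (tens R C 2 C)
          (\<lambda>(ws, z). ptens R C C (us @ ws) z) (comult C v)) (comult C x)"
    and counit_left: "x \<in> carrier C \<Longrightarrow>
      tens_lift R C (\<lambda>(us, v). counit C (hd us) \<odot>\<^bsub>C\<^esub> v) (comult C x) = x"
    and counit_right: "x \<in> carrier C \<Longrightarrow>
      tens_lift R C (\<lambda>(us, v). counit C v \<odot>\<^bsub>C\<^esub> hd us) (comult C x) = x"

text \<open>The algebra axioms are spelled out because the locale \<open>algebra\<close> of HOL-Algebra
  requires commutativity.\<close>

locale bialgebra = coalgebra R B + ring B for R and B :: "('a, 'b, 's) coalg_scheme" +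
  assumes smult_mult_left: "\<lbrakk>a \<in> carrier R; x \<in> carrier B; y \<in> carrier B\<rbrakk> \<Longrightarrow>
      (a \<odot>\<^bsub>B\<^esub> x) \<otimes>\<^bsub>B\<^esub> y = a \<odot>\<^bsub>B\<^esub> (x \<otimes>\<^bsub>B\<^esub> y)"
    and smult_mult_right: "\<lbrakk>a \<in> carrier R; x \<in> carrier B; y \<in> carrier B\<rbrakk> \<Longrightarrow>
      x \<otimes>\<^bsub>B\<^esub> (a \<odot>\<^bsub>B\<^esub> y) = a \<odot>\<^bsub>B\<^esub> (x \<otimes>\<^bsub>B\<^esub> y)"
    and comult_one: "comult B \<one>\<^bsub>B\<^esub> = ptens R B B [\<one>\<^bsub>B\<^esub>] \<one>\<^bsub>B\<^esub>"
    and comult_mult: "\<lbrakk>x \<in> carrier B; y \<in> carrier B\<rbrakk> \<Longrightarrow>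
      comult B (x \<otimes>\<^bsub>B\<^esub> y) =
      tens_lift R (tens R B 1 B)
        (\<lambda>(us, v). tens_lift R (tens R B 1 B)
          (\<lambda>(ws, z). ptens R B B [hd us \<otimes>\<^bsub>B\<^esub> hd ws] (v \<otimes>\<^bsub>B\<^esub> z)) (comult B y)) (comult B x)"
    and counit_one: "counit B \<one>\<^bsub>B\<^esub> = \<one>\<^bsub>R\<^esub>"
    and counit_mult: "\<lbrakk>x \<in> carrier B; y \<in> carrier B\<rbrakk> \<Longrightarrow>
      counit B (x \<otimes>\<^bsub>B\<^esub> y) = counit B x \<otimes>\<^bsub>R\<^esub> counit B y"

definition antipode :: "('a, 'r) ring_scheme \<Rightarrow> ('a, 'b, 's) coalg_scheme \<Rightarrow> ('b \<Rightarrow> 'b) \<Rightarrow> bool"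
  where "antipode R B S \<longleftrightarrow> S \<in> mod_hom R B B \<and>
    (\<forall>b \<in> carrier B.
      tens_lift R B (\<lambda>(us, v). S (hd us) \<otimes>\<^bsub>B\<^esub> v) (comult B b) = counit B b \<odot>\<^bsub>B\<^esub> \<one>\<^bsub>B\<^esub> \<and>
      tens_lift R B (\<lambda>(us, v). hd us \<otimes>\<^bsub>B\<^esub> S v) (comult B b) = counit B b \<odot>\<^bsub>B\<^esub> \<one>\<^bsub>B\<^esub>)"

definition bijective_antipode ::
  "('a, 'r) ring_scheme \<Rightarrow> ('a, 'b, 's) coalg_scheme \<Rightarrow> ('b \<Rightarrow> 'b) \<Rightarrow> bool"
  where "bijective_antipode R B S \<longleftrightarrow> antipode R B S \<and> bij_betw S (carrier B) (carrier B)"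

text \<open>Hopf algebras are understood to have a bijective antipode.\<close>

definition hopf :: "('a, 'r) ring_scheme \<Rightarrow> ('a, 'b, 's) coalg_scheme \<Rightarrow> bool"
  where "hopf R B \<longleftrightarrow> (\<exists>S. bijective_antipode R B S)"

definition antipode_inv :: "('a, 'b, 's) coalg_scheme \<Rightarrow> ('b \<Rightarrow> 'b) \<Rightarrow> 'b \<Rightarrow> 'b"
  where "antipode_inv B S = inv_into (carrier B) S"

locale left_module = module R M
  for R and B :: "('a, 'b, 's) coalg_scheme" and M :: "('a, 'm, 't) module_scheme"
    and act :: "'b \<Rightarrow> 'm \<Rightarrow> 'm" +
  assumes act_closed: "\<lbrakk>b \<in> carrier B; x \<in> carrier M\<rbrakk> \<Longrightarrow> act b x \<in> carrier M"
    and act_add_left: "\<lbrakk>b \<in> carrier B; c \<in> carrier B; x \<in> carrier M\<rbrakk> \<Longrightarrow>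
      act (b \<oplus>\<^bsub>B\<^esub> c) x = act b x \<oplus>\<^bsub>M\<^esub> act c x"
    and act_smult_left: "\<lbrakk>a \<in> carrier R; b \<in> carrier B; x \<in> carrier M\<rbrakk> \<Longrightarrow>
      act (a \<odot>\<^bsub>B\<^esub> b) x = a \<odot>\<^bsub>M\<^esub> act b x"
    and act_add_right: "\<lbrakk>b \<in> carrier B; x \<in> carrier M; y \<in> carrier M\<rbrakk> \<Longrightarrow>
      act b (x \<oplus>\<^bsub>M\<^esub> y) = act b x \<oplus>\<^bsub>M\<^esub> act b y"
    and act_smult_right: "\<lbrakk>a \<in> carrier R; b \<in> carrier B; x \<in> carrier M\<rbrakk> \<Longrightarrow>
      act b (a \<odot>\<^bsub>M\<^esub> x) = a \<odot>\<^bsub>M\<^esub> act b x"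
    and act_mult: "\<lbrakk>b \<in> carrier B; c \<in> carrier B; x \<in> carrier M\<rbrakk> \<Longrightarrow>
      act (b \<otimes>\<^bsub>B\<^esub> c) x = act b (act c x)"
    and act_one: "x \<in> carrier M \<Longrightarrow> act \<one>\<^bsub>B\<^esub> x = x"

locale module_coalgebra = coalgebra R X + left_module R B X act
  for R and B :: "('a, 'b, 's) coalg_scheme" and X :: "('a, 'x, 't) coalg_scheme"
    and act :: "'b \<Rightarrow> 'x \<Rightarrow> 'x" +
  assumes comult_act: "\<lbrakk>b \<in> carrier B; x \<in> carrier X\<rbrakk> \<Longrightarrow>
      comult X (act b x) =
      tens_lift R (tens R X 1 X)
        (\<lambda>(bs, c). tens_lift R (tens R X 1 X)
          (\<lambda>(us, v). ptens R X X [act (hd bs) (hd us)] (act c v)) (comult X x)) (comult B b)"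
    and counit_act: "\<lbrakk>b \<in> carrier B; x \<in> carrier X\<rbrakk> \<Longrightarrow>
      counit X (act b x) = counit B b \<otimes>\<^bsub>R\<^esub> counit X x"

locale left_comodule = module R Y
  for R and B :: "('a, 'b, 's) coalg_scheme" and Y :: "('a, 'y, 't) module_scheme"
    and coact :: "'y \<Rightarrow> ('b list \<times> 'y \<Rightarrow> 'a) set" +
  assumes coact_hom: "coact \<in> mod_hom R Y (tens R B 1 Y)"
    and coact_coassoc: "y \<in> carrier Y \<Longrightarrow>
      tens_lift R (tens R B 2 Y)
        (\<lambda>(bs, z). tens_lift R (tens R B 2 Y)
          (\<lambda>(cs, c). ptens R B Y (cs @ [c]) z) (comult B (hd bs))) (coact y) =
      tens_lift R (tens R B 2 Y)
        (\<lambda>(bs, z). tens_lift R (tens R B 2 Y)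
          (\<lambda>(cs, w). ptens R B Y (bs @ cs) w) (coact z)) (coact y)"
    and coact_counit: "y \<in> carrier Y \<Longrightarrow>
      tens_lift R Y (\<lambda>(bs, z). counit B (hd bs) \<odot>\<^bsub>Y\<^esub> z) (coact y) = y"

text \<open>No compatibility between action and coaction is required.\<close>

locale module_comodule = left_module R B Y act + left_comodule R B Y coact
  for R and B :: "('a, 'b, 's) coalg_scheme" and Y :: "('a, 'y, 't) module_scheme"
    and act :: "'b \<Rightarrow> 'y \<Rightarrow> 'y" and coact :: "'y \<Rightarrow> ('b list \<times> 'y \<Rightarrow> 'a) set"

definition zero_stable ::
  "('a, 'r) ring_scheme \<Rightarrow> ('a, 'y, 't) module_scheme \<Rightarrow> ('b \<Rightarrow> 'y \<Rightarrow> 'y)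
    \<Rightarrow> ('y \<Rightarrow> ('b list \<times> 'y \<Rightarrow> 'a) set) \<Rightarrow> bool"
  where "zero_stable R Y act coact \<longleftrightarrow>
    (\<forall>y \<in> carrier Y. tens_lift R Y (\<lambda>(bs, z). act (hd bs) z) (coact y) = y)"

definition stable ::
  "('a, 'r) ring_scheme \<Rightarrow> ('b \<Rightarrow> 'b) \<Rightarrow> ('a, 'y, 't) module_scheme
    \<Rightarrow> ('b \<Rightarrow> 'y \<Rightarrow> 'y) \<Rightarrow> ('y \<Rightarrow> ('b list \<times> 'y \<Rightarrow> 'a) set) \<Rightarrow> bool"
  where "stable R S Y act coact \<longleftrightarrow> zero_stable R Y act coact \<and>
    (\<forall>y \<in> carrier Y. tens_lift R Y (\<lambda>(bs, z). act (S (hd bs)) z) (coact y) = y)"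

text \<open>Iterated comultiplication \<open>b\<^sub>(\<^sub>1\<^sub>) \<otimes> \<dots> \<otimes> b\<^sub>(\<^sub>n\<^sub>+\<^sub>1\<^sub>)\<close>.\<close>

primrec icomult ::
  "('a, 'r) ring_scheme \<Rightarrow> ('a, 'b, 's) coalg_scheme \<Rightarrow> nat \<Rightarrow> 'b \<Rightarrow> ('b list \<times> 'b \<Rightarrow> 'a) set"
  where
    "icomult R B 0 b = ptens R B B [] b"
  | "icomult R B (Suc n) b =
      tens_lift R (tens R B (Suc n) B)
        (\<lambda>(bs, c). tens_lift R (tens R B (Suc n) B)
          (\<lambda>(us, v). ptens R B B (bs @ us) v) (comult B c)) (icomult R B n b)"

definition anti_yetter_drinfeld ::
  "('a, 'r) ring_scheme \<Rightarrow> ('a, 'b, 's) coalg_scheme \<Rightarrow> ('b \<Rightarrow> 'b) \<Rightarrow> ('a, 'y, 't) module_scheme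
    \<Rightarrow> ('b \<Rightarrow> 'y \<Rightarrow> 'y) \<Rightarrow> ('y \<Rightarrow> ('b list \<times> 'y \<Rightarrow> 'a) set) \<Rightarrow> bool"
  where "anti_yetter_drinfeld R B S Y act coact \<longleftrightarrow>
    (\<forall>b \<in> carrier B. \<forall>y \<in> carrier Y.
      coact (act b y) =
      tens_lift R (tens R B 1 Y)
        (\<lambda>(bs, b3). tens_lift R (tens R B 1 Y)
          (\<lambda>(cs, z). ptens R B Y [(bs ! 0 \<otimes>\<^bsub>B\<^esub> hd cs) \<otimes>\<^bsub>B\<^esub> antipode_inv B S b3] (act (bs ! 1) z))
          (coact y)) (icomult R B 2 b))"


section \<open>Cosimplicial, para-cocyclic and cocyclic modules\<close>

text \<open>\<open>d n j\<close> is the coface map \<open>\<partial>\<^sub>j\<close> on degree \<open>n\<close>; there are no codegeneracies.\<close>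

definition cosimplicial_module ::
  "('a, 'r) ring_scheme \<Rightarrow> (nat \<Rightarrow> ('a, 'm, 's) module_scheme) \<Rightarrow> (nat \<Rightarrow> nat \<Rightarrow> 'm \<Rightarrow> 'm) \<Rightarrow> bool"
  where "cosimplicial_module R C d \<longleftrightarrow>
    (\<forall>n. module R (C n)) \<and>
    (\<forall>n. \<forall>j \<le> n + 1. d n j \<in> mod_hom R (C n) (C (n + 1))) \<and>
    (\<forall>n i j. i \<le> j \<and> j \<le> n + 1 \<longrightarrow>
      (\<forall>x \<in> carrier (C n). d (n + 1) i (d n j x) = d (n + 1) (j + 1) (d n i x)))"

definition para_cocyclic_module ::
  "('a, 'r) ring_scheme \<Rightarrow> (nat \<Rightarrow> ('a, 'm, 's) module_scheme) \<Rightarrow> (nat \<Rightarrow> nat \<Rightarrow> 'm \<Rightarrow> 'm)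
    \<Rightarrow> (nat \<Rightarrow> 'm \<Rightarrow> 'm) \<Rightarrow> bool"
  where "para_cocyclic_module R C d t \<longleftrightarrow>
    cosimplicial_module R C d \<and>
    (\<forall>n. t n \<in> mod_hom R (C n) (C n) \<and> bij_betw (t n) (carrier (C n)) (carrier (C n))) \<and>
    (\<forall>n. \<forall>j \<le> n. \<forall>x \<in> carrier (C n). t (n + 1) (d n j x) = d n (j + 1) (t n x)) \<and>
    (\<forall>n. \<forall>x \<in> carrier (C n). t (n + 1) (d n (n + 1) x) = d n 0 x)"

definition cocyclic_module ::
  "('a, 'r) ring_scheme \<Rightarrow> (nat \<Rightarrow> ('a, 'm, 's) module_scheme) \<Rightarrow> (nat \<Rightarrow> nat \<Rightarrow> 'm \<Rightarrow> 'm)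
    \<Rightarrow> (nat \<Rightarrow> 'm \<Rightarrow> 'm) \<Rightarrow> bool"
  where "cocyclic_module R C d t \<longleftrightarrow>
    para_cocyclic_module R C d t \<and> (\<forall>n. \<forall>x \<in> carrier (C n). (t n ^^ (n + 1)) x = x)"

text \<open>The axioms of a para-cocyclic module in terms of \<open>u = \<tau>\<^sup>-\<^sup>1\<close>, except for the
  invertibility of \<open>u\<close>.\<close>

definition almost_para_cocyclic_module ::
  "('a, 'r) ring_scheme \<Rightarrow> (nat \<Rightarrow> ('a, 'm, 's) module_scheme) \<Rightarrow> (nat \<Rightarrow> nat \<Rightarrow> 'm \<Rightarrow> 'm)
    \<Rightarrow> (nat \<Rightarrow> 'm \<Rightarrow> 'm) \<Rightarrow> bool"
  where "almost_para_cocyclic_module R C d u \<longleftrightarrow>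
    cosimplicial_module R C d \<and>
    (\<forall>n. u n \<in> mod_hom R (C n) (C n)) \<and>
    (\<forall>n. \<forall>j \<le> n. \<forall>x \<in> carrier (C n). d n j (u n x) = u (n + 1) (d n (j + 1) x)) \<and>
    (\<forall>n. \<forall>x \<in> carrier (C n). d n (n + 1) x = u (n + 1) (d n 0 x))"

definition graded_left_module ::
  "('a, 'r) ring_scheme \<Rightarrow> ('a, 'b, 's) coalg_scheme \<Rightarrow> (nat \<Rightarrow> ('a, 'm, 't) module_scheme)
    \<Rightarrow> (nat \<Rightarrow> 'b \<Rightarrow> 'm \<Rightarrow> 'm) \<Rightarrow> bool"
  where "graded_left_module R B C L \<longleftrightarrow> (\<forall>n. left_module R B (C n) (L n))"

definition cofaces_equivariant ::
  "('a, 'b, 's) coalg_scheme \<Rightarrow> (nat \<Rightarrow> ('a, 'm, 't) module_scheme)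
    \<Rightarrow> (nat \<Rightarrow> 'b \<Rightarrow> 'm \<Rightarrow> 'm) \<Rightarrow> (nat \<Rightarrow> nat \<Rightarrow> 'm \<Rightarrow> 'm) \<Rightarrow> bool"
  where "cofaces_equivariant B C L d \<longleftrightarrow>
    (\<forall>n. \<forall>j \<le> n + 1. \<forall>b \<in> carrier B. \<forall>x \<in> carrier (C n). d n j (L n b x) = L (n + 1) b (d n j x))"

definition operators_equivariant ::
  "('a, 'b, 's) coalg_scheme \<Rightarrow> (nat \<Rightarrow> ('a, 'm, 't) module_scheme)
    \<Rightarrow> (nat \<Rightarrow> 'b \<Rightarrow> 'm \<Rightarrow> 'm) \<Rightarrow> (nat \<Rightarrow> 'm \<Rightarrow> 'm) \<Rightarrow> bool"
  where "operators_equivariant B C L t \<longleftrightarrow>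
    (\<forall>n. \<forall>b \<in> carrier B. \<forall>x \<in> carrier (C n). t n (L n b x) = L n b (t n x))"

definition cosimplicial_B_module ::
  "('a, 'r) ring_scheme \<Rightarrow> ('a, 'b, 's) coalg_scheme \<Rightarrow> (nat \<Rightarrow> ('a, 'm, 't) module_scheme)
    \<Rightarrow> (nat \<Rightarrow> 'b \<Rightarrow> 'm \<Rightarrow> 'm) \<Rightarrow> (nat \<Rightarrow> nat \<Rightarrow> 'm \<Rightarrow> 'm) \<Rightarrow> bool"
  where "cosimplicial_B_module R B C L d \<longleftrightarrow>
    cosimplicial_module R C d \<and> graded_left_module R B C L \<and> cofaces_equivariant B C L d"

definition para_cocyclic_B_module ::
  "('a, 'r) ring_scheme \<Rightarrow> ('a, 'b, 's) coalg_scheme \<Rightarrow> (nat \<Rightarrow> ('a, 'm, 't) module_scheme)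
    \<Rightarrow> (nat \<Rightarrow> 'b \<Rightarrow> 'm \<Rightarrow> 'm) \<Rightarrow> (nat \<Rightarrow> nat \<Rightarrow> 'm \<Rightarrow> 'm) \<Rightarrow> (nat \<Rightarrow> 'm \<Rightarrow> 'm) \<Rightarrow> bool"
  where "para_cocyclic_B_module R B C L d t \<longleftrightarrow>
    para_cocyclic_module R C d t \<and> graded_left_module R B C L \<and>
    cofaces_equivariant B C L d \<and> operators_equivariant B C L t"

definition almost_para_cocyclic_B_module ::
  "('a, 'r) ring_scheme \<Rightarrow> ('a, 'b, 's) coalg_scheme \<Rightarrow> (nat \<Rightarrow> ('a, 'm, 't) module_scheme)
    \<Rightarrow> (nat \<Rightarrow> 'b \<Rightarrow> 'm \<Rightarrow> 'm) \<Rightarrow> (nat \<Rightarrow> nat \<Rightarrow> 'm \<Rightarrow> 'm) \<Rightarrow> (nat \<Rightarrow> 'm \<Rightarrow> 'm) \<Rightarrow> bool"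
  where "almost_para_cocyclic_B_module R B C L d u \<longleftrightarrow>
    almost_para_cocyclic_module R C d u \<and> graded_left_module R B C L \<and>
    cofaces_equivariant B C L d \<and> operators_equivariant B C L u"


section \<open>Cyclic homology via the cyclic bicomplex\<close>

definition signed :: "('a, 'm, 's) module_scheme \<Rightarrow> nat \<Rightarrow> 'm \<Rightarrow> 'm"
  where "signed M n x = (if even n then x else \<ominus>\<^bsub>M\<^esub> x)"

definition bdiff ::
  "(nat \<Rightarrow> ('a, 'm, 's) module_scheme) \<Rightarrow> (nat \<Rightarrow> nat \<Rightarrow> 'm \<Rightarrow> 'm) \<Rightarrow> nat \<Rightarrow> 'm \<Rightarrow> 'm"
  where "bdiff C d q x = (\<Oplus>\<^bsub>C (q + 1)\<^esub>j\<in>{..q + 1}. signed (C (q + 1)) j (d q j x))"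

definition bdiff' ::
  "(nat \<Rightarrow> ('a, 'm, 's) module_scheme) \<Rightarrow> (nat \<Rightarrow> nat \<Rightarrow> 'm \<Rightarrow> 'm) \<Rightarrow> nat \<Rightarrow> 'm \<Rightarrow> 'm"
  where "bdiff' C d q x = (\<Oplus>\<^bsub>C (q + 1)\<^esub>j\<in>{..q}. signed (C (q + 1)) j (d q j x))"

text \<open>The signed cyclic operator is \<open>\<lambda> = (-1)\<^sup>q \<tau>\<^sub>q\<^sup>-\<^sup>1\<close>.  The relations
  \<open>\<partial>\<^sub>j \<tau>\<^sup>-\<^sup>1 = \<tau>\<^sup>-\<^sup>1 \<partial>\<^sub>j\<^sub>+\<^sub>1\<close> and \<open>\<partial>\<^sub>q\<^sub>+\<^sub>1 = \<tau>\<^sup>-\<^sup>1 \<partial>\<^sub>0\<close> give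
  \<open>(1 - \<lambda>) b = b' (1 - \<lambda>)\<close> and \<open>N b' = b N\<close>; with \<open>\<tau>\<close> in place of \<open>\<tau>\<^sup>-\<^sup>1\<close> the
  differential \<open>b'\<close> would have to omit the first instead of the last coface map.\<close>

definition cyc_sign ::
  "(nat \<Rightarrow> ('a, 'm, 's) module_scheme) \<Rightarrow> (nat \<Rightarrow> 'm \<Rightarrow> 'm) \<Rightarrow> nat \<Rightarrow> 'm \<Rightarrow> 'm"
  where "cyc_sign C t q x = signed (C q) q (inv_op C t q x)"

definition cyc_norm ::
  "(nat \<Rightarrow> ('a, 'm, 's) module_scheme) \<Rightarrow> (nat \<Rightarrow> 'm \<Rightarrow> 'm) \<Rightarrow> nat \<Rightarrow> 'm \<Rightarrow> 'm"
  where "cyc_norm C t q x = (\<Oplus>\<^bsub>C q\<^esub>i\<in>{..q}. (cyc_sign C t q ^^ i) x)"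

text \<open>The first quadrant bicomplex has \<open>C q\<close> in position \<open>(p, q)\<close>, the vertical differential
  \<open>b\<close> in even and \<open>- b'\<close> in odd columns, and the horizontal differential \<open>1 - \<lambda>\<close> out of
  even and \<open>N\<close> out of odd columns.\<close>

definition cyc_vert ::
  "(nat \<Rightarrow> ('a, 'm, 's) module_scheme) \<Rightarrow> (nat \<Rightarrow> nat \<Rightarrow> 'm \<Rightarrow> 'm) \<Rightarrow> nat \<Rightarrow> nat \<Rightarrow> 'm \<Rightarrow> 'm"
  where "cyc_vert C d p q x =
    (if even p then bdiff C d q x else \<ominus>\<^bsub>C (q + 1)\<^esub> (bdiff' C d q x))"

definition cyc_horiz ::
  "(nat \<Rightarrow> ('a, 'm, 's) module_scheme) \<Rightarrow> (nat \<Rightarrow> 'm \<Rightarrow> 'm) \<Rightarrow> nat \<Rightarrow> nat \<Rightarrow> 'm \<Rightarrow> 'm"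
  where "cyc_horiz C t p q x =
    (if even p then x \<ominus>\<^bsub>C q\<^esub> cyc_sign C t q x else cyc_norm C t q x)"

text \<open>An element of the total complex in degree \<open>n\<close> is a family \<open>x\<close> with
  \<open>x p \<in> C (n - p)\<close> for \<open>p \<le> n\<close>.\<close>

definition tot_mod :: "(nat \<Rightarrow> ('a, 'm, 's) module_scheme) \<Rightarrow> nat \<Rightarrow> ('a, nat \<Rightarrow> 'm) module"
  where "tot_mod C n =
    \<lparr>carrier = (\<Pi>\<^sub>E p\<in>{..n}. carrier (C (n - p))),
     monoid.mult = (\<lambda>x y. \<lambda>p\<in>{..n}. \<zero>\<^bsub>C (n - p)\<^esub>), one = (\<lambda>p\<in>{..n}. \<zero>\<^bsub>C (n - p)\<^esub>),
     zero = (\<lambda>p\<in>{..n}. \<zero>\<^bsub>C (n - p)\<^esub>),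
     add = (\<lambda>x y. \<lambda>p\<in>{..n}. x p \<oplus>\<^bsub>C (n - p)\<^esub> y p),
     smult = (\<lambda>a x. \<lambda>p\<in>{..n}. a \<odot>\<^bsub>C (n - p)\<^esub> x p)\<rparr>"

definition tot_diff ::
  "(nat \<Rightarrow> ('a, 'm, 's) module_scheme) \<Rightarrow> (nat \<Rightarrow> nat \<Rightarrow> 'm \<Rightarrow> 'm) \<Rightarrow> (nat \<Rightarrow> 'm \<Rightarrow> 'm)
    \<Rightarrow> nat \<Rightarrow> (nat \<Rightarrow> 'm) \<Rightarrow> nat \<Rightarrow> 'm"
  where "tot_diff C d t n x =
    (\<lambda>p\<in>{..n + 1}.
      (if p \<le> n then cyc_vert C d p (n - p) (x p) else \<zero>\<^bsub>C (n + 1 - p)\<^esub>) \<oplus>\<^bsub>C (n + 1 - p)\<^esub>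
      (if p \<ge> 1 then cyc_horiz C t (p - 1) (n + 1 - p) (x (p - 1)) else \<zero>\<^bsub>C (n + 1 - p)\<^esub>))"

definition cochain_homology ::
  "(nat \<Rightarrow> ('a, 'm, 's) module_scheme) \<Rightarrow> (nat \<Rightarrow> 'm \<Rightarrow> 'm) \<Rightarrow> nat \<Rightarrow> ('a, 'm set) module"
  where "cochain_homology K D n =
    quot_mod ((K n)\<lparr>carrier := a_kernel (K n) (K (n + 1)) (D n)\<rparr>)
      (case n of 0 \<Rightarrow> {\<zero>\<^bsub>K 0\<^esub>} | Suc m \<Rightarrow> D m ` carrier (K m))"

definition cyclic_homology ::
  "(nat \<Rightarrow> ('a, 'm, 's) module_scheme) \<Rightarrow> (nat \<Rightarrow> nat \<Rightarrow> 'm \<Rightarrow> 'm) \<Rightarrow> (nat \<Rightarrow> 'm \<Rightarrow> 'm)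
    \<Rightarrow> nat \<Rightarrow> ('a, (nat \<Rightarrow> 'm) set) module"
  where "cyclic_homology C d t = cochain_homology (tot_mod C) (tot_diff C d t)"


section \<open>The modules \<open>\<bbbT>\<^sub>*(X,Y)\<close>, \<open>\<bbbP>\<bbbC>\<bbbM>\<^sub>*(X,Y)\<close> and \<open>\<bbbC>\<bbbM>\<^sub>*(X,Y)\<close>\<close>

text \<open>Comultiplication applied to the tensor factor with index \<open>j\<close> (counting from \<open>0\<close>).\<close>

definition split_at ::
  "('a, 'r) ring_scheme \<Rightarrow> ('a, 'x, 's) coalg_scheme \<Rightarrow> ('a, 'y, 't) module_scheme \<Rightarrow> nat \<Rightarrow> nat
    \<Rightarrow> ('x list \<times> 'y \<Rightarrow> 'a) set \<Rightarrow> ('x list \<times> 'y \<Rightarrow> 'a) set"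
  where "split_at R X Y m j =
    tens_lift R (tens R X (m + 1) Y)
      (\<lambda>(xs, y). tens_lift R (tens R X (m + 1) Y)
        (\<lambda>(us, v). ptens R X Y (take j xs @ us @ [v] @ drop (j + 1) xs) y) (comult X (xs ! j)))"

definition T_mod ::
  "('a, 'r) ring_scheme \<Rightarrow> ('a, 'x, 's) coalg_scheme \<Rightarrow> ('a, 'y, 't) module_scheme \<Rightarrow> nat
    \<Rightarrow> ('a, ('x list \<times> 'y \<Rightarrow> 'a) set) module"
  where "T_mod R X Y n = tens R X (n + 1) Y"

definition T_act ::
  "('a, 'r) ring_scheme \<Rightarrow> ('a, 'b, 'q) coalg_scheme \<Rightarrow>
   ('a, 'x, 's) coalg_scheme \<Rightarrow> ('b \<Rightarrow> 'x \<Rightarrow> 'x) \<Rightarrow>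
   ('a, 'y, 't) module_scheme \<Rightarrow> ('b \<Rightarrow> 'y \<Rightarrow> 'y) \<Rightarrow>
   nat \<Rightarrow> 'b \<Rightarrow> ('x list \<times> 'y \<Rightarrow> 'a) set \<Rightarrow> ('x list \<times> 'y \<Rightarrow> 'a) set"
  where "T_act R B X actX Y actY n b =
    tens_lift R (T_mod R X Y n)
      (\<lambda>(xs, y). tens_lift R (T_mod R X Y n)
        (\<lambda>(bs, c). ptens R X Y (map2 actX bs xs) (actY c y)) (icomult R B (n + 1) b))"

definition T_coface ::
  "('a, 'r) ring_scheme \<Rightarrow> ('a, 'x, 's) coalg_scheme \<Rightarrow> ('b \<Rightarrow> 'x \<Rightarrow> 'x) \<Rightarrow>
   ('a, 'y, 't) module_scheme \<Rightarrow> ('y \<Rightarrow> ('b list \<times> 'y \<Rightarrow> 'a) set) \<Rightarrow>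
   nat \<Rightarrow> nat \<Rightarrow> ('x list \<times> 'y \<Rightarrow> 'a) set \<Rightarrow> ('x list \<times> 'y \<Rightarrow> 'a) set"
  where "T_coface R X actX Y coact n j =
    (if j \<le> n then split_at R X Y (n + 1) j
     else tens_lift R (T_mod R X Y (n + 1))
       (\<lambda>(xs, y). tens_lift R (T_mod R X Y (n + 1))
         (\<lambda>(us, v). tens_lift R (T_mod R X Y (n + 1))
           (\<lambda>(bs, z). ptens R X Y ([v] @ tl xs @ [actX (hd bs) (hd us)]) z) (coact y))
         (comult X (hd xs))))"

definition T_tauinv ::
  "('a, 'r) ring_scheme \<Rightarrow> ('a, 'x, 's) coalg_scheme \<Rightarrow> ('b \<Rightarrow> 'x \<Rightarrow> 'x) \<Rightarrow>
   ('a, 'y, 't) module_scheme \<Rightarrow> ('y \<Rightarrow> ('b list \<times> 'y \<Rightarrow> 'a) set) \<Rightarrow>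
   nat \<Rightarrow> ('x list \<times> 'y \<Rightarrow> 'a) set \<Rightarrow> ('x list \<times> 'y \<Rightarrow> 'a) set"
  where "T_tauinv R X actX Y coact n =
    tens_lift R (T_mod R X Y n)
      (\<lambda>(xs, y). tens_lift R (T_mod R X Y n)
        (\<lambda>(bs, z). ptens R X Y (tl xs @ [actX (hd bs) (hd xs)]) z) (coact y))"

text \<open>\<open>\<tau>\<^sub>n\<^sup>-\<^sup>j\<close> for an integer \<open>j\<close>; negative \<open>j\<close> are only used when \<open>\<tau>\<^sub>n\<^sup>-\<^sup>1\<close> is invertible.\<close>

definition T_taupow ::
  "('a, 'r) ring_scheme \<Rightarrow> ('a, 'x, 's) coalg_scheme \<Rightarrow> ('b \<Rightarrow> 'x \<Rightarrow> 'x) \<Rightarrow>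
   ('a, 'y, 't) module_scheme \<Rightarrow> ('y \<Rightarrow> ('b list \<times> 'y \<Rightarrow> 'a) set) \<Rightarrow>
   nat \<Rightarrow> int \<Rightarrow> ('x list \<times> 'y \<Rightarrow> 'a) set \<Rightarrow> ('x list \<times> 'y \<Rightarrow> 'a) set"
  where "T_taupow R X actX Y coact n j =
    (if j \<ge> 0 then T_tauinv R X actX Y coact n ^^ nat j
     else inv_op (T_mod R X Y) (T_tauinv R X actX Y coact) n ^^ nat (- j))"

definition comm_sub ::
  "('a, 'r) ring_scheme \<Rightarrow> ('a, 'b, 'q) coalg_scheme \<Rightarrow>
   ('a, 'x, 's) coalg_scheme \<Rightarrow> ('b \<Rightarrow> 'x \<Rightarrow> 'x) \<Rightarrow>
   ('a, 'y, 't) module_scheme \<Rightarrow> ('b \<Rightarrow> 'y \<Rightarrow> 'y) \<Rightarrow> ('y \<Rightarrow> ('b list \<times> 'y \<Rightarrow> 'a) set) \<Rightarrow>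
   nat \<Rightarrow> ('x list \<times> 'y \<Rightarrow> 'a) set set"
  where "comm_sub R B X actX Y actY coact n =
    (let L = T_act R B X actX Y actY n; P = T_taupow R X actX Y coact n in
     mod_span R (T_mod R X Y n)
       {L b (P j \<xi>) \<ominus>\<^bsub>T_mod R X Y n\<^esub> P j (L b \<xi>) | b j \<xi>.
          b \<in> carrier B \<and> \<xi> \<in> carrier (T_mod R X Y n) \<and> (hopf R B \<or> j \<ge> 0)})"

definition PCM_mod ::
  "('a, 'r) ring_scheme \<Rightarrow> ('a, 'b, 'q) coalg_scheme \<Rightarrow>
   ('a, 'x, 's) coalg_scheme \<Rightarrow> ('b \<Rightarrow> 'x \<Rightarrow> 'x) \<Rightarrow>
   ('a, 'y, 't) module_scheme \<Rightarrow> ('b \<Rightarrow> 'y \<Rightarrow> 'y) \<Rightarrow> ('y \<Rightarrow> ('b list \<times> 'y \<Rightarrow> 'a) set) \<Rightarrow>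
   nat \<Rightarrow> ('a, ('x list \<times> 'y \<Rightarrow> 'a) set set) module"
  where "PCM_mod R B X actX Y actY coact n =
    quot_mod (T_mod R X Y n) (comm_sub R B X actX Y actY coact n)"

definition PCM_act ::
  "('a, 'r) ring_scheme \<Rightarrow> ('a, 'b, 'q) coalg_scheme \<Rightarrow>
   ('a, 'x, 's) coalg_scheme \<Rightarrow> ('b \<Rightarrow> 'x \<Rightarrow> 'x) \<Rightarrow>
   ('a, 'y, 't) module_scheme \<Rightarrow> ('b \<Rightarrow> 'y \<Rightarrow> 'y) \<Rightarrow> ('y \<Rightarrow> ('b list \<times> 'y \<Rightarrow> 'a) set) \<Rightarrow>
   nat \<Rightarrow> 'b \<Rightarrow> ('x list \<times> 'y \<Rightarrow> 'a) set set \<Rightarrow> ('x list \<times> 'y \<Rightarrow> 'a) set set"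
  where "PCM_act R B X actX Y actY coact n b =
    quot_map (T_mod R X Y n) (comm_sub R B X actX Y actY coact n) (T_act R B X actX Y actY n b)"

definition PCM_coface ::
  "('a, 'r) ring_scheme \<Rightarrow> ('a, 'b, 'q) coalg_scheme \<Rightarrow>
   ('a, 'x, 's) coalg_scheme \<Rightarrow> ('b \<Rightarrow> 'x \<Rightarrow> 'x) \<Rightarrow>
   ('a, 'y, 't) module_scheme \<Rightarrow> ('b \<Rightarrow> 'y \<Rightarrow> 'y) \<Rightarrow> ('y \<Rightarrow> ('b list \<times> 'y \<Rightarrow> 'a) set) \<Rightarrow>
   nat \<Rightarrow> nat \<Rightarrow> ('x list \<times> 'y \<Rightarrow> 'a) set set \<Rightarrow> ('x list \<times> 'y \<Rightarrow> 'a) set set"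
  where "PCM_coface R B X actX Y actY coact n j =
    quot_map (T_mod R X Y (n + 1)) (comm_sub R B X actX Y actY coact (n + 1))
      (T_coface R X actX Y coact n j)"

definition PCM_tauinv ::
  "('a, 'r) ring_scheme \<Rightarrow> ('a, 'b, 'q) coalg_scheme \<Rightarrow>
   ('a, 'x, 's) coalg_scheme \<Rightarrow> ('b \<Rightarrow> 'x \<Rightarrow> 'x) \<Rightarrow>
   ('a, 'y, 't) module_scheme \<Rightarrow> ('b \<Rightarrow> 'y \<Rightarrow> 'y) \<Rightarrow> ('y \<Rightarrow> ('b list \<times> 'y \<Rightarrow> 'a) set) \<Rightarrow>
   nat \<Rightarrow> ('x list \<times> 'y \<Rightarrow> 'a) set set \<Rightarrow> ('x list \<times> 'y \<Rightarrow> 'a) set set"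
  where "PCM_tauinv R B X actX Y actY coact n =
    quot_map (T_mod R X Y n) (comm_sub R B X actX Y actY coact n) (T_tauinv R X actX Y coact n)"

definition coinv_sub ::
  "('a, 'r) ring_scheme \<Rightarrow> ('a, 'b, 's) coalg_scheme \<Rightarrow> ('a, 'm, 't) module_scheme
    \<Rightarrow> ('b \<Rightarrow> 'm \<Rightarrow> 'm) \<Rightarrow> 'm set"
  where "coinv_sub R B M act =
    mod_span R M {(counit B b \<odot>\<^bsub>M\<^esub> x) \<ominus>\<^bsub>M\<^esub> act b x | b x. b \<in> carrier B \<and> x \<in> carrier M}"

definition coinvariants ::
  "('a, 'r) ring_scheme \<Rightarrow> ('a, 'b, 's) coalg_scheme \<Rightarrow> ('a, 'm, 't) module_scheme
    \<Rightarrow> ('b \<Rightarrow> 'm \<Rightarrow> 'm) \<Rightarrow> ('a, 'm set) module"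
  where "coinvariants R B M act = quot_mod M (coinv_sub R B M act)"

definition CM_mod ::
  "('a, 'r) ring_scheme \<Rightarrow> ('a, 'b, 'q) coalg_scheme \<Rightarrow>
   ('a, 'x, 's) coalg_scheme \<Rightarrow> ('b \<Rightarrow> 'x \<Rightarrow> 'x) \<Rightarrow>
   ('a, 'y, 't) module_scheme \<Rightarrow> ('b \<Rightarrow> 'y \<Rightarrow> 'y) \<Rightarrow> ('y \<Rightarrow> ('b list \<times> 'y \<Rightarrow> 'a) set) \<Rightarrow>
   nat \<Rightarrow> ('a, ('x list \<times> 'y \<Rightarrow> 'a) set set set) module"
  where "CM_mod R B X actX Y actY coact n =
    coinvariants R B (PCM_mod R B X actX Y actY coact n) (PCM_act R B X actX Y actY coact n)"

definition CM_coface ::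
  "('a, 'r) ring_scheme \<Rightarrow> ('a, 'b, 'q) coalg_scheme \<Rightarrow>
   ('a, 'x, 's) coalg_scheme \<Rightarrow> ('b \<Rightarrow> 'x \<Rightarrow> 'x) \<Rightarrow>
   ('a, 'y, 't) module_scheme \<Rightarrow> ('b \<Rightarrow> 'y \<Rightarrow> 'y) \<Rightarrow> ('y \<Rightarrow> ('b list \<times> 'y \<Rightarrow> 'a) set) \<Rightarrow>
   nat \<Rightarrow> nat \<Rightarrow> ('x list \<times> 'y \<Rightarrow> 'a) set set set \<Rightarrow> ('x list \<times> 'y \<Rightarrow> 'a) set set set"
  where "CM_coface R B X actX Y actY coact n j =
    quot_map (PCM_mod R B X actX Y actY coact (n + 1))
      (coinv_sub R B (PCM_mod R B X actX Y actY coact (n + 1))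
        (PCM_act R B X actX Y actY coact (n + 1)))
      (PCM_coface R B X actX Y actY coact n j)"

definition CM_tauinv ::
  "('a, 'r) ring_scheme \<Rightarrow> ('a, 'b, 'q) coalg_scheme \<Rightarrow>
   ('a, 'x, 's) coalg_scheme \<Rightarrow> ('b \<Rightarrow> 'x \<Rightarrow> 'x) \<Rightarrow>
   ('a, 'y, 't) module_scheme \<Rightarrow> ('b \<Rightarrow> 'y \<Rightarrow> 'y) \<Rightarrow> ('y \<Rightarrow> ('b list \<times> 'y \<Rightarrow> 'a) set) \<Rightarrow>
   nat \<Rightarrow> ('x list \<times> 'y \<Rightarrow> 'a) set set set \<Rightarrow> ('x list \<times> 'y \<Rightarrow> 'a) set set set"
  where "CM_tauinv R B X actX Y actY coact n =
    quot_map (PCM_mod R B X actX Y actY coact n)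
      (coinv_sub R B (PCM_mod R B X actX Y actY coact n) (PCM_act R B X actX Y actY coact n))
      (PCM_tauinv R B X actX Y actY coact n)"


section \<open>The Connes--Moscovici cocyclic module\<close>

definition conmos_mod ::
  "('a, 'r) ring_scheme \<Rightarrow> ('a, 'b, 's) coalg_scheme \<Rightarrow> ('a, 'y, 't) module_scheme \<Rightarrow> nat
    \<Rightarrow> ('a, ('b list \<times> 'y \<Rightarrow> 'a) set) module"
  where "conmos_mod R H Y n = tens R H n Y"

definition conmos_coface ::
  "('a, 'r) ring_scheme \<Rightarrow> ('a, 'b, 's) coalg_scheme \<Rightarrow> ('a, 'y, 't) module_scheme
    \<Rightarrow> ('y \<Rightarrow> ('b list \<times> 'y \<Rightarrow> 'a) set) \<Rightarrow> nat \<Rightarrow> nat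
    \<Rightarrow> ('b list \<times> 'y \<Rightarrow> 'a) set \<Rightarrow> ('b list \<times> 'y \<Rightarrow> 'a) set"
  where "conmos_coface R H Y coact n j =
    (if j = 0 then
       tens_lift R (conmos_mod R H Y (n + 1)) (\<lambda>(hs, y). ptens R H Y (\<one>\<^bsub>H\<^esub> # hs) y)
     else if j \<le> n then split_at R H Y n (j - 1)
     else
       tens_lift R (conmos_mod R H Y (n + 1))
         (\<lambda>(hs, y). tens_lift R (conmos_mod R H Y (n + 1))
           (\<lambda>(bs, z). ptens R H Y (hs @ bs) z) (coact y)))"

text \<open>For \<open>n \<ge> 1\<close> and \<open>h = h\<^sup>0\<close>, the list \<open>c # rev as\<close> consists of
  \<open>h\<^sub>(\<^sub>n\<^sub>+\<^sub>1\<^sub>), \<dots>, h\<^sub>(\<^sub>1\<^sub>)\<close>, and \<open>map2\<close> pairs all entries but the last with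
  \<open>h\<^sup>1, \<dots>, h\<^sup>n\<^sup>-\<^sup>1, y\<^sub>(\<^sub>-\<^sub>1\<^sub>)\<close>.\<close>

definition conmos_tinv ::
  "('a, 'r) ring_scheme \<Rightarrow> ('a, 'b, 's) coalg_scheme \<Rightarrow> ('b \<Rightarrow> 'b) \<Rightarrow> ('a, 'y, 't) module_scheme
    \<Rightarrow> ('b \<Rightarrow> 'y \<Rightarrow> 'y) \<Rightarrow> ('y \<Rightarrow> ('b list \<times> 'y \<Rightarrow> 'a) set) \<Rightarrow> nat
    \<Rightarrow> ('b list \<times> 'y \<Rightarrow> 'a) set \<Rightarrow> ('b list \<times> 'y \<Rightarrow> 'a) set"
  where "conmos_tinv R H S Y act coact n =
    (if n = 0 then id
     else tens_lift R (conmos_mod R H Y n)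
       (\<lambda>(hs, y). tens_lift R (conmos_mod R H Y n)
         (\<lambda>(as, c). tens_lift R (conmos_mod R H Y n)
           (\<lambda>(bs, z). ptens R H Y
              (map2 (\<lambda>g k. S g \<otimes>\<^bsub>H\<^esub> k) (c # rev as) (tl hs @ bs)) (act (S (hd as)) z))
           (coact y)) (icomult R H n (hd hs))))"

end

theory Submission imports Defs begin

text \<open>The operators on \<open>\<bbbT>\<^sub>n(X,Y) = X\<^sup>\<otimes>\<^sup>n\<^sup>+\<^sup>1 \<otimes> Y\<close> fall into two groups.  The maps
  \<open>\<partial>\<^sub>0, \<dots>, \<partial>\<^sub>n\<close> split a factor of \<open>X\<close>; they are \<open>B\<close>-linear because the coproduct of \<open>X\<close> is.  The
  operator \<open>\<tau>\<^sup>-\<^sup>1\<close>, and with it \<open>\<partial>\<^sub>n\<^sub>+\<^sub>1 = \<tau>\<^sup>-\<^sup>1 \<partial>\<^sub>0\<close>, is in general not \<open>B\<close>-linear.  The cosimplicial and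
  para-cocyclic identities already hold on \<open>\<bbbT>\<^sub>*\<close>: coassociativity gives \<open>spl_spl\<close>, and since the
  last factor of \<open>\<tau>\<^sup>-\<^sup>1 \<xi>\<close> is \<open>y\<^sub>(\<^sub>-\<^sub>1\<^sub>) x\<^sup>0\<close>, linearity of the coproduct of \<open>X\<close> and coassociativity of
  the coaction give \<open>\<partial>\<^sub>n \<tau>\<^sup>-\<^sup>1 = \<tau>\<^sup>-\<^sup>1 \<tau>\<^sup>-\<^sup>1 \<partial>\<^sub>0\<close> (\<open>spl_last_tinv\<close>).  The remaining
  identities concern different factors or follow formally from these.

  Dividing by the commutators of the action with the powers of \<open>\<tau>\<^sup>-\<^sup>1\<close> makes \<open>\<tau>\<^sup>-\<^sup>1\<close> linear, and the
  point is that the structure maps descend.  For \<open>\<tau>\<^sup>-\<^sup>1\<close> and the action this is a commutator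
  identity.  For a splitting one moves it past the power of \<open>\<tau>\<^sup>-\<^sup>1\<close>, where it comes out as another
  splitting and a possibly different power (\<open>spl_P\<close>); so commutators go to commutators.  Over a
  Hopf algebra the inverse of the antipode undoes the multiplication by \<open>y\<^sub>(\<^sub>-\<^sub>1\<^sub>)\<close>, so \<open>\<tau>\<^sup>-\<^sup>1\<close> is
  invertible on \<open>\<bbbT>\<^sub>*\<close> (\<open>tinv_bij\<close>); negative powers then also occur in the commutators, and the
  inverse descends.

  After \<open>n + 1\<close> applications of \<open>\<tau>\<^sup>-\<^sup>1\<close>, every factor of \<open>X\<close> has been multiplied by one factor of an
  iterated coaction of \<open>y\<close>, so \<open>0\<close>-stability yields the diagonal action of \<open>y\<^sub>(\<^sub>-\<^sub>1\<^sub>)\<close> on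
  \<open>x\<^sup>0 \<otimes> \<dots> \<otimes> x\<^sup>n \<otimes> y\<^sub>(\<^sub>0\<^sub>)\<close> (\<open>tinv_power_pure\<close>).  On coinvariants the action is the counit, and
  \<open>\<tau>\<^sup>-\<^sup>(\<^sup>n\<^sup>+\<^sup>1\<^sup>)\<close> is the identity (\<open>coinvariant_tinv_power\<close>).  In particular \<open>\<tau>\<^sup>-\<^sup>1\<close> is invertible there for
  every bialgebra.

  For \<open>X = B\<close> Hopf, the map \<open>h \<otimes> \<xi> \<mapsto> S(h) \<xi>\<close> (\<open>collapse\<close>) identifies the coinvariants of \<open>\<bbbT>\<^sub>n(B,Y)\<close>
  with \<open>B\<^sup>\<otimes>\<^sup>n \<otimes> Y\<close>, with inverse \<open>\<xi> \<mapsto> 1 \<otimes> \<xi>\<close>.  The anti-Yetter-Drinfeld condition makes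
  \<open>\<tau>\<^sup>-\<^sup>1\<close> descend to these coinvariants (\<open>collapse_tinv_act\<close>).  It has finite order there, so all its
  integral powers descend, hence the commutators vanish in the coinvariants of \<open>\<bbbT>\<^sub>n(B,Y)\<close> and these are
  already \<open>\<bbbC>\<bbbM>\<^sub>n(B,Y)\<close>.  Evaluating the structure maps on \<open>1 \<otimes> \<xi>\<close> gives exactly those of Connes and
  Moscovici (\<open>collapse_coface\<close>, \<open>tC_eq_conmos_tinv\<close>), and isomorphic cocyclic modules have
  isomorphic cyclic homology.

  Throughout, the operators on tensor powers are handled by recursion: \<open>X\<^sup>\<otimes>\<^sup>n\<^sup>+\<^sup>1 \<otimes> Y\<close> is the tensor
  product of \<open>X\<close> with \<open>X\<^sup>\<otimes>\<^sup>n \<otimes> Y\<close> through the bilinear map \<open>tcons\<close>, each operator is described by its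
  value on \<open>tcons x \<xi>\<close>, and identities are proved by induction on \<open>n\<close>.\<close>

section \<open>Linear maps, spans and quotients\<close>

lemma mod_homI:
  assumes "\<And>x. x \<in> carrier M \<Longrightarrow> f x \<in> carrier N"
    and "\<And>x y. \<lbrakk>x \<in> carrier M; y \<in> carrier M\<rbrakk> \<Longrightarrow> f (x \<oplus>\<^bsub>M\<^esub> y) = f x \<oplus>\<^bsub>N\<^esub> f y"
    and "\<And>a x. \<lbrakk>a \<in> carrier R; x \<in> carrier M\<rbrakk> \<Longrightarrow> f (a \<odot>\<^bsub>M\<^esub> x) = a \<odot>\<^bsub>N\<^esub> f x"
  shows "f \<in> mod_hom R M N"
  using assms by (auto simp: mod_hom_def)

lemma mod_hom_closed: "f \<in> mod_hom R M N \<Longrightarrow> x \<in> carrier M \<Longrightarrow> f x \<in> carrier N"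
  by (auto simp: mod_hom_def)

lemma mod_hom_add:
  "f \<in> mod_hom R M N \<Longrightarrow> x \<in> carrier M \<Longrightarrow> y \<in> carrier M \<Longrightarrow> f (x \<oplus>\<^bsub>M\<^esub> y) = f x \<oplus>\<^bsub>N\<^esub> f y"
  by (auto simp: mod_hom_def)

lemma mod_hom_smult:
  "f \<in> mod_hom R M N \<Longrightarrow> a \<in> carrier R \<Longrightarrow> x \<in> carrier M \<Longrightarrow> f (a \<odot>\<^bsub>M\<^esub> x) = a \<odot>\<^bsub>N\<^esub> f x"
  by (auto simp: mod_hom_def)

lemma mod_hom_zero:
  assumes "f \<in> mod_hom R M N" "module R M" "module R N"
  shows "f \<zero>\<^bsub>M\<^esub> = \<zero>\<^bsub>N\<^esub>"
proof -
  interpret M: module R M by fact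
  interpret N: module R N by fact
  have "f (\<zero>\<^bsub>R\<^esub> \<odot>\<^bsub>M\<^esub> \<zero>\<^bsub>M\<^esub>) = \<zero>\<^bsub>R\<^esub> \<odot>\<^bsub>N\<^esub> f \<zero>\<^bsub>M\<^esub>"
    using mod_hom_smult[OF assms(1), of "\<zero>\<^bsub>R\<^esub>" "\<zero>\<^bsub>M\<^esub>"] by simp
  then show ?thesis using mod_hom_closed[OF assms(1), of "\<zero>\<^bsub>M\<^esub>"] by simp
qed

lemma mod_hom_a_inv:
  assumes "f \<in> mod_hom R M N" "module R M" "module R N" "x \<in> carrier M"
  shows "f (\<ominus>\<^bsub>M\<^esub> x) = \<ominus>\<^bsub>N\<^esub> f x"
proof -
  interpret M: module R M by fact
  interpret N: module R N by fact
  have "f (\<ominus>\<^bsub>M\<^esub> x) \<oplus>\<^bsub>N\<^esub> f x = \<zero>\<^bsub>N\<^esub>"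
    using mod_hom_add[OF assms(1), of "\<ominus>\<^bsub>M\<^esub> x" x] assms mod_hom_zero[OF assms(1-3)] by (simp add: M.l_neg)
  then show ?thesis using mod_hom_closed[OF assms(1)] assms(4) by (simp add: N.minus_equality)
qed

lemma mod_hom_diff:
  assumes "f \<in> mod_hom R M N" "module R M" "module R N" "x \<in> carrier M" "y \<in> carrier M"
  shows "f (x \<ominus>\<^bsub>M\<^esub> y) = f x \<ominus>\<^bsub>N\<^esub> f y"
proof -
  interpret M: module R M by fact
  show ?thesis using assms by (simp add: a_minus_def mod_hom_add[OF assms(1)] mod_hom_a_inv[OF assms(1-3)])
qed

lemma mod_hom_id: "(\<lambda>x. x) \<in> mod_hom R M M"
  by (auto simp: mod_hom_def)

lemma mod_hom_comp:
  "g \<in> mod_hom R N P \<Longrightarrow> f \<in> mod_hom R M N \<Longrightarrow> (\<lambda>x. g (f x)) \<in> mod_hom R M P"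
  by (auto simp: mod_hom_def Pi_def)

lemma mod_hom_cong:
  assumes "f \<in> mod_hom R M N" "module R M" "\<And>x. x \<in> carrier M \<Longrightarrow> g x = f x"
  shows "g \<in> mod_hom R M N"
proof -
  interpret M: module R M by fact
  show ?thesis using assms by (auto simp: mod_hom_def Pi_def)
qed

lemma mod_hom_smult_fun:
  assumes "f \<in> mod_hom R M N" "module R N" "a \<in> carrier R"
  shows "(\<lambda>x. a \<odot>\<^bsub>N\<^esub> f x) \<in> mod_hom R M N"
proof -
  interpret N: module R N by fact
  show ?thesis using assms
    by (intro mod_homI)
      (auto simp: mod_hom_closed[OF assms(1)] mod_hom_add[OF assms(1)] mod_hom_smult[OF assms(1)]
        N.smult_r_distr N.smult_assoc1[symmetric] N.R.m_comm)
qed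

lemma mod_hom_finsum_fun:
  assumes "module R N" "finite A" "\<And>i. i \<in> A \<Longrightarrow> f i \<in> mod_hom R M N"
  shows "(\<lambda>x. \<Oplus>\<^bsub>N\<^esub>i\<in>A. f i x) \<in> mod_hom R M N"
proof -
  interpret N: module R N by fact
  note fc = mod_hom_closed[OF assms(3)]
  show ?thesis
  proof (rule mod_homI)
    show "(\<Oplus>\<^bsub>N\<^esub>i\<in>A. f i x) \<in> carrier N" if "x \<in> carrier M" for x
      using that by (intro N.finsum_closed) (auto intro: fc)
  next
    fix x y assume xy: "x \<in> carrier M" "y \<in> carrier M"
    have "(\<Oplus>\<^bsub>N\<^esub>i\<in>A. f i (x \<oplus>\<^bsub>M\<^esub> y)) = (\<Oplus>\<^bsub>N\<^esub>i\<in>A. f i x \<oplus>\<^bsub>N\<^esub> f i y)"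
      using xy by (intro N.finsum_cong') (auto intro: fc mod_hom_add[OF assms(3)])
    also have "\<dots> = (\<Oplus>\<^bsub>N\<^esub>i\<in>A. f i x) \<oplus>\<^bsub>N\<^esub> (\<Oplus>\<^bsub>N\<^esub>i\<in>A. f i y)"
      using xy assms(2) by (intro N.finsum_addf) (auto intro: fc)
    finally show "(\<Oplus>\<^bsub>N\<^esub>i\<in>A. f i (x \<oplus>\<^bsub>M\<^esub> y)) = (\<Oplus>\<^bsub>N\<^esub>i\<in>A. f i x) \<oplus>\<^bsub>N\<^esub> (\<Oplus>\<^bsub>N\<^esub>i\<in>A. f i y)" .
  next
    fix a x assume ax: "a \<in> carrier R" "x \<in> carrier M"
    have "(\<Oplus>\<^bsub>N\<^esub>i\<in>A. f i (a \<odot>\<^bsub>M\<^esub> x)) = (\<Oplus>\<^bsub>N\<^esub>i\<in>A. a \<odot>\<^bsub>N\<^esub> f i x)"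
      using ax by (intro N.finsum_cong') (auto intro: fc mod_hom_smult[OF assms(3)])
    also have "\<dots> = a \<odot>\<^bsub>N\<^esub> (\<Oplus>\<^bsub>N\<^esub>i\<in>A. f i x)"
      using ax assms(2) by (intro N.finsum_smult_ldistr[symmetric]) (auto intro: fc)
    finally show "(\<Oplus>\<^bsub>N\<^esub>i\<in>A. f i (a \<odot>\<^bsub>M\<^esub> x)) = a \<odot>\<^bsub>N\<^esub> (\<Oplus>\<^bsub>N\<^esub>i\<in>A. f i x)" .
  qed
qed

lemma mod_hom_finsum:
  assumes "f \<in> mod_hom R M N" "module R M" "module R N" "finite A" "\<And>i. i \<in> A \<Longrightarrow> g i \<in> carrier M"
  shows "f (\<Oplus>\<^bsub>M\<^esub>i\<in>A. g i) = (\<Oplus>\<^bsub>N\<^esub>i\<in>A. f (g i))"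
proof -
  interpret M: module R M by fact
  interpret N: module R N by fact
  show ?thesis using assms(4,5)
  proof (induction A rule: finite_induct)
    case empty then show ?case by (simp add: mod_hom_zero[OF assms(1-3)])
  next
    case (insert i A)
    then have g: "g \<in> A \<rightarrow> carrier M" "g i \<in> carrier M" by auto
    then have fg: "(\<lambda>i. f (g i)) \<in> A \<rightarrow> carrier N" "f (g i) \<in> carrier N"
      using mod_hom_closed[OF assms(1)] by auto
    show ?case
      using insert g fg by (simp add: M.finsum_insert N.finsum_insert mod_hom_add[OF assms(1)])
  qed
qed

lemma module_smult_diff:
  assumes "module R M" "a \<in> carrier R" "x \<in> carrier M" "y \<in> carrier M"
  shows "a \<odot>\<^bsub>M\<^esub> (x \<ominus>\<^bsub>M\<^esub> y) = a \<odot>\<^bsub>M\<^esub> x \<ominus>\<^bsub>M\<^esub> a \<odot>\<^bsub>M\<^esub> y"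
  using mod_hom_diff[OF mod_hom_smult_fun[OF mod_hom_id assms(1,2)] assms(1,1,3,4)] .

lemma submodule_preimage:
  assumes "f \<in> mod_hom R M N" "module R M" "module R N" "submodule K R N"
  shows "submodule {x \<in> carrier M. f x \<in> K} R M"
proof -
  interpret M: module R M by fact
  interpret N: module R N by fact
  note K = N.submoduleE[OF assms(4)]
  have z: "\<zero>\<^bsub>N\<^esub> \<in> K" using subgroup.one_closed[OF submodule.axioms(1)[OF assms(4)]] by simp
  show ?thesis
    by (rule M.submoduleI)
      (auto simp: mod_hom_zero[OF assms(1-3)] mod_hom_a_inv[OF assms(1-3)] mod_hom_add[OF assms(1)]
        mod_hom_smult[OF assms(1)] K z)
qed

lemma submodule_zero:
  assumes "module R M" shows "submodule {\<zero>\<^bsub>M\<^esub>} R M"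
proof -
  interpret M: module R M by fact
  show ?thesis by (rule M.submoduleI) auto
qed

lemma submodule_subset: "submodule K R M \<Longrightarrow> K \<subseteq> carrier M"
  using subgroup.subset[OF submodule.axioms(1)] by auto

lemma submodule_zero_mem: "submodule K R M \<Longrightarrow> \<zero>\<^bsub>M\<^esub> \<in> K"
  using subgroup.one_closed[OF submodule.axioms(1)] by auto

lemma submodule_add_mem: "submodule K R M \<Longrightarrow> x \<in> K \<Longrightarrow> y \<in> K \<Longrightarrow> x \<oplus>\<^bsub>M\<^esub> y \<in> K"
  using subgroup.m_closed[OF submodule.axioms(1)] by auto

lemma submodule_smult_mem: "submodule K R M \<Longrightarrow> a \<in> carrier R \<Longrightarrow> x \<in> K \<Longrightarrow> a \<odot>\<^bsub>M\<^esub> x \<in> K"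
  by (rule submodule.smult_closed)

lemma submodule_a_inv_mem: "module R M \<Longrightarrow> submodule K R M \<Longrightarrow> x \<in> K \<Longrightarrow> \<ominus>\<^bsub>M\<^esub> x \<in> K"
  using module.submoduleE(3) by metis

lemma submodule_diff_mem:
  "module R M \<Longrightarrow> submodule K R M \<Longrightarrow> x \<in> K \<Longrightarrow> y \<in> K \<Longrightarrow> x \<ominus>\<^bsub>M\<^esub> y \<in> K"
  by (simp add: a_minus_def submodule_a_inv_mem submodule_add_mem)

lemma mod_span_submodule:
  assumes "module R M" "A \<subseteq> carrier M"
  shows "submodule (mod_span R M A) R M"
proof -
  interpret M: module R M by fact
  have c: "submodule (carrier M) R M" by (rule M.carrier_is_submodule)
  show ?thesis unfolding mod_span_def hull_def
    by (rule M.submoduleI)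
      (use c assms in \<open>auto intro: submodule_zero_mem submodule_a_inv_mem[OF assms(1)] submodule_add_mem submodule_smult_mem\<close>)
qed

lemma mod_span_incl: "x \<in> A \<Longrightarrow> x \<in> mod_span R M A"
  unfolding mod_span_def by (rule hull_inc)

lemma mod_span_least: "submodule K R M \<Longrightarrow> A \<subseteq> K \<Longrightarrow> mod_span R M A \<subseteq> K"
  unfolding mod_span_def by (rule hull_minimal)

lemma mod_span_hom_image:
  assumes "f \<in> mod_hom R M N" "module R M" "module R N" "submodule K R N" "A \<subseteq> carrier M"
    and "\<And>x. x \<in> A \<Longrightarrow> f x \<in> K" and "x \<in> mod_span R M A"
  shows "f x \<in> K"
  using mod_span_least[OF submodule_preimage[OF assms(1-4)], of A] assms(5-) by auto

text \<open>Equality of cosets is congruence modulo the submodule, so identities in a quotient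
  reduce to membership of a difference.\<close>

lemma rcoset_eq_iff:
  assumes "module R M" "submodule N R M" "x \<in> carrier M" "y \<in> carrier M"
  shows "N +>\<^bsub>M\<^esub> x = N +>\<^bsub>M\<^esub> y \<longleftrightarrow> x \<ominus>\<^bsub>M\<^esub> y \<in> N"
proof -
  interpret M: module R M by fact
  note sub = submodule_subset[OF assms(2)]
  show ?thesis
  proof
    assume "N +>\<^bsub>M\<^esub> x = N +>\<^bsub>M\<^esub> y"
    moreover have "x \<in> N +>\<^bsub>M\<^esub> x"
      using submodule_zero_mem[OF assms(2)] assms(3) by (force simp: a_r_coset_def')
    ultimately obtain n where "n \<in> N" "x = n \<oplus>\<^bsub>M\<^esub> y" by (auto simp: a_r_coset_def')
    then have "x \<ominus>\<^bsub>M\<^esub> y = n" using sub assms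
      by (auto simp: a_minus_def M.a_assoc M.r_neg subsetD)
    with \<open>n \<in> N\<close> show "x \<ominus>\<^bsub>M\<^esub> y \<in> N" by simp
  next
    assume d: "x \<ominus>\<^bsub>M\<^esub> y \<in> N"
    have 1: "n \<oplus>\<^bsub>M\<^esub> x = (n \<oplus>\<^bsub>M\<^esub> (x \<ominus>\<^bsub>M\<^esub> y)) \<oplus>\<^bsub>M\<^esub> y" if "n \<in> N" for n
      using that sub assms(3,4) by (auto simp: a_minus_def M.a_assoc M.l_neg subsetD)
    have 2: "n \<oplus>\<^bsub>M\<^esub> y = (n \<ominus>\<^bsub>M\<^esub> (x \<ominus>\<^bsub>M\<^esub> y)) \<oplus>\<^bsub>M\<^esub> x" if "n \<in> N" for n
    proof -
      have n: "n \<in> carrier M" using that sub by auto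
      have "\<ominus>\<^bsub>M\<^esub> (x \<ominus>\<^bsub>M\<^esub> y) \<oplus>\<^bsub>M\<^esub> x = (y \<oplus>\<^bsub>M\<^esub> \<ominus>\<^bsub>M\<^esub> x) \<oplus>\<^bsub>M\<^esub> x"
        using assms(3,4) by (simp add: a_minus_def M.minus_add M.a_comm)
      also have "\<dots> = y" using assms(3,4) by (simp add: M.a_assoc M.l_neg)
      finally have "\<ominus>\<^bsub>M\<^esub> (x \<ominus>\<^bsub>M\<^esub> y) \<oplus>\<^bsub>M\<^esub> x = y" .
      then show ?thesis using n assms(3,4) by (simp add: a_minus_def M.a_assoc)
    qed
    show "N +>\<^bsub>M\<^esub> x = N +>\<^bsub>M\<^esub> y"
    proof (rule subset_antisym; rule subsetI)
      fix z assume "z \<in> N +>\<^bsub>M\<^esub> x"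
      then obtain n where n: "n \<in> N" "z = n \<oplus>\<^bsub>M\<^esub> x" by (auto simp: a_r_coset_def')
      have "n \<oplus>\<^bsub>M\<^esub> (x \<ominus>\<^bsub>M\<^esub> y) \<in> N" using submodule_add_mem[OF assms(2) n(1) d] .
      with 1[OF n(1)] n(2) show "z \<in> N +>\<^bsub>M\<^esub> y" by (auto simp: a_r_coset_def')
    next
      fix z assume "z \<in> N +>\<^bsub>M\<^esub> y"
      then obtain n where n: "n \<in> N" "z = n \<oplus>\<^bsub>M\<^esub> y" by (auto simp: a_r_coset_def')
      have "n \<ominus>\<^bsub>M\<^esub> (x \<ominus>\<^bsub>M\<^esub> y) \<in> N" using submodule_diff_mem[OF assms(1,2) n(1) d] .
      with 2[OF n(1)] n(2) show "z \<in> N +>\<^bsub>M\<^esub> x" by (auto simp: a_r_coset_def')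
    qed
  qed
qed

lemma rcoset_self: "module R M \<Longrightarrow> submodule N R M \<Longrightarrow> x \<in> carrier M \<Longrightarrow> x \<in> N +>\<^bsub>M\<^esub> x"
  using submodule_zero_mem[of N R M] abelian_monoid.l_zero[of M x]
  by (force simp: a_r_coset_def' module_def abelian_group_def)

lemma rcoset_eqI:
  assumes "module R M" "submodule N R M" "x \<in> carrier M" "z \<in> N +>\<^bsub>M\<^esub> x"
  shows "z \<in> carrier M" "N +>\<^bsub>M\<^esub> z = N +>\<^bsub>M\<^esub> x"
proof -
  interpret M: module R M by fact
  from assms(4) obtain n where n: "n \<in> N" "z = n \<oplus>\<^bsub>M\<^esub> x" by (auto simp: a_r_coset_def')
  have nc: "n \<in> carrier M" using n submodule_subset[OF assms(2)] by auto
  show z: "z \<in> carrier M" using n nc assms by auto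
  have "z \<ominus>\<^bsub>M\<^esub> x = n" using n nc assms by (simp add: a_minus_def M.a_assoc M.r_neg)
  then show "N +>\<^bsub>M\<^esub> z = N +>\<^bsub>M\<^esub> x" using rcoset_eq_iff[OF assms(1,2) z assms(3)] n by simp
qed

lemma rcoset_UN:
  assumes "module R M" "submodule N R M" "x \<in> carrier M"
    and "\<And>z. z \<in> carrier M \<Longrightarrow> N +>\<^bsub>M\<^esub> z = N +>\<^bsub>M\<^esub> x \<Longrightarrow> g z = g x"
  shows "(\<Union>z\<in>N +>\<^bsub>M\<^esub> x. g z) = g x"
  using rcoset_self[OF assms(1-3)] rcoset_eqI[OF assms(1-3)] assms(4) by blast

lemma quot_carrier: "carrier (quot_mod M N) = (\<lambda>x. N +>\<^bsub>M\<^esub> x) ` carrier M"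
  by (auto simp: quot_mod_def A_RCOSETS_def')

text \<open>The zero of a quotient module is the submodule itself, so it has to be recognized as a coset.\<close>

lemma quot_zero: 
  assumes "module R M" "submodule N R M"
  shows "\<zero>\<^bsub>quot_mod M N\<^esub> = N +>\<^bsub>M\<^esub> \<zero>\<^bsub>M\<^esub>"
proof -
  interpret M: module R M by fact
  show ?thesis using submodule_subset[OF assms(2)] by (auto simp: quot_mod_def a_r_coset_def' subsetD)
qed

lemma quot_add:
  assumes "module R M" "submodule N R M" "x \<in> carrier M" "y \<in> carrier M"
  shows "(N +>\<^bsub>M\<^esub> x) \<oplus>\<^bsub>quot_mod M N\<^esub> (N +>\<^bsub>M\<^esub> y) = N +>\<^bsub>M\<^esub> (x \<oplus>\<^bsub>M\<^esub> y)"
proof -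
  interpret M: module R M by fact
  have "abelian_subgroup N M"
    by (rule abelian_subgroupI3) (use assms in \<open>auto simp: additive_subgroup_def submodule_def M.abelian_group_axioms\<close>)
  then interpret A: abelian_subgroup N M .
  show ?thesis using A.a_rcos_sum[OF assms(3,4)] by (simp add: quot_mod_def)
qed

lemma quot_smult:
  assumes "module R M" "submodule N R M" "a \<in> carrier R" "x \<in> carrier M"
  shows "a \<odot>\<^bsub>quot_mod M N\<^esub> (N +>\<^bsub>M\<^esub> x) = N +>\<^bsub>M\<^esub> (a \<odot>\<^bsub>M\<^esub> x)"
proof -
  interpret M: module R M by fact
  have "(\<Union>z\<in>N +>\<^bsub>M\<^esub> x. N +>\<^bsub>M\<^esub> (a \<odot>\<^bsub>M\<^esub> z)) = N +>\<^bsub>M\<^esub> (a \<odot>\<^bsub>M\<^esub> x)"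
  proof (rule rcoset_UN[OF assms(1,2,4)])
    fix z assume z: "z \<in> carrier M" "N +>\<^bsub>M\<^esub> z = N +>\<^bsub>M\<^esub> x"
    then have "z \<ominus>\<^bsub>M\<^esub> x \<in> N" using rcoset_eq_iff[OF assms(1,2)] assms(4) by blast
    then have "a \<odot>\<^bsub>M\<^esub> z \<ominus>\<^bsub>M\<^esub> a \<odot>\<^bsub>M\<^esub> x \<in> N"
      using module_smult_diff[OF assms(1,3) z(1) assms(4)] submodule_smult_mem[OF assms(2,3)] by metis
    then show "N +>\<^bsub>M\<^esub> (a \<odot>\<^bsub>M\<^esub> z) = N +>\<^bsub>M\<^esub> (a \<odot>\<^bsub>M\<^esub> x)"
      using rcoset_eq_iff[OF assms(1,2)] z assms by auto
  qed
  then show ?thesis by (simp add: quot_mod_def)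
qed

lemma quot_module:
  assumes "module R M" "submodule N R M"
  shows "module R (quot_mod M N)"
proof -
  interpret M: module R M by fact
  note q = quot_carrier quot_zero[OF assms] quot_add[OF assms] quot_smult[OF assms]
  show ?thesis
  proof (rule moduleI)
    show "cring R" by (rule M.R.is_cring)
    show "abelian_group (quot_mod M N)"
    proof (rule abelian_groupI)
      fix x assume "x \<in> carrier (quot_mod M N)"
      then obtain a where a: "a \<in> carrier M" "x = N +>\<^bsub>M\<^esub> a" by (auto simp: q)
      show "\<exists>y\<in>carrier (quot_mod M N). y \<oplus>\<^bsub>quot_mod M N\<^esub> x = \<zero>\<^bsub>quot_mod M N\<^esub>"
        by (rule bexI[of _ "N +>\<^bsub>M\<^esub> (\<ominus>\<^bsub>M\<^esub> a)"]) (use a in \<open>auto simp: q M.l_neg\<close>)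
    next
      fix x y assume "x \<in> carrier (quot_mod M N)" "y \<in> carrier (quot_mod M N)"
      then show "x \<oplus>\<^bsub>quot_mod M N\<^esub> y = y \<oplus>\<^bsub>quot_mod M N\<^esub> x"
        by (auto simp: q M.a_comm)
    qed (auto simp: q M.a_assoc)
  next
    fix a x assume "a \<in> carrier R" "x \<in> carrier (quot_mod M N)"
    then show "a \<odot>\<^bsub>quot_mod M N\<^esub> x \<in> carrier (quot_mod M N)" by (auto simp: q)
  next
    fix a b x assume "a \<in> carrier R" "b \<in> carrier R" "x \<in> carrier (quot_mod M N)"
    then show "(a \<oplus>\<^bsub>R\<^esub> b) \<odot>\<^bsub>quot_mod M N\<^esub> x = a \<odot>\<^bsub>quot_mod M N\<^esub> x \<oplus>\<^bsub>quot_mod M N\<^esub> b \<odot>\<^bsub>quot_mod M N\<^esub> x"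
      by (auto simp: q M.smult_l_distr)
  next
    fix a x y assume "a \<in> carrier R" "x \<in> carrier (quot_mod M N)" "y \<in> carrier (quot_mod M N)"
    then show "a \<odot>\<^bsub>quot_mod M N\<^esub> (x \<oplus>\<^bsub>quot_mod M N\<^esub> y) = a \<odot>\<^bsub>quot_mod M N\<^esub> x \<oplus>\<^bsub>quot_mod M N\<^esub> a \<odot>\<^bsub>quot_mod M N\<^esub> y"
      by (auto simp: q M.smult_r_distr)
  next
    fix a b x assume "a \<in> carrier R" "b \<in> carrier R" "x \<in> carrier (quot_mod M N)"
    then show "(a \<otimes>\<^bsub>R\<^esub> b) \<odot>\<^bsub>quot_mod M N\<^esub> x = a \<odot>\<^bsub>quot_mod M N\<^esub> (b \<odot>\<^bsub>quot_mod M N\<^esub> x)"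
      by (auto simp: q M.smult_assoc1)
  next
    fix x assume "x \<in> carrier (quot_mod M N)"
    then show "\<one>\<^bsub>R\<^esub> \<odot>\<^bsub>quot_mod M N\<^esub> x = x" by (auto simp: q)
  qed
qed

lemma quot_proj_hom:
  assumes "module R M" "submodule N R M"
  shows "(\<lambda>x. N +>\<^bsub>M\<^esub> x) \<in> mod_hom R M (quot_mod M N)"
  by (rule mod_homI) (auto simp: quot_carrier quot_add[OF assms] quot_smult[OF assms])

lemma quot_map_rcoset:
  assumes "module R M" "submodule N R M" "module R M'" "submodule N' R M'"
    and "f \<in> mod_hom R M M'" "\<And>x. x \<in> N \<Longrightarrow> f x \<in> N'" "x \<in> carrier M"
  shows "quot_map M' N' f (N +>\<^bsub>M\<^esub> x) = N' +>\<^bsub>M'\<^esub> f x"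
  unfolding quot_map_def
proof (rule rcoset_UN[OF assms(1,2,7)])
  fix z assume z: "z \<in> carrier M" "N +>\<^bsub>M\<^esub> z = N +>\<^bsub>M\<^esub> x"
  then have "z \<ominus>\<^bsub>M\<^esub> x \<in> N" using rcoset_eq_iff[OF assms(1,2)] assms(7) by blast
  then have "f z \<ominus>\<^bsub>M'\<^esub> f x \<in> N'"
    using mod_hom_diff[OF assms(5,1,3) z(1) assms(7)] assms(6) by metis
  then show "N' +>\<^bsub>M'\<^esub> f z = N' +>\<^bsub>M'\<^esub> f x"
    using rcoset_eq_iff[OF assms(3,4)] z assms(7) mod_hom_closed[OF assms(5)] by blast
qed

lemma quot_map_hom:
  assumes "module R M" "submodule N R M" "module R M'" "submodule N' R M'"
    and "f \<in> mod_hom R M M'" "\<And>x. x \<in> N \<Longrightarrow> f x \<in> N'"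
  shows "quot_map M' N' f \<in> mod_hom R (quot_mod M N) (quot_mod M' N')"
proof -
  interpret M: module R M by fact
  note q = quot_map_rcoset[OF assms]
  note f = mod_hom_closed[OF assms(5)] mod_hom_add[OF assms(5)] mod_hom_smult[OF assms(5)]
  show ?thesis
  proof (rule mod_homI)
    fix x assume "x \<in> carrier (quot_mod M N)"
    then obtain u where u: "u \<in> carrier M" "x = N +>\<^bsub>M\<^esub> u" by (auto simp: quot_carrier)
    then show "quot_map M' N' f x \<in> carrier (quot_mod M' N')" by (simp add: q quot_carrier f)
    fix y assume "y \<in> carrier (quot_mod M N)"
    then obtain v where v: "v \<in> carrier M" "y = N +>\<^bsub>M\<^esub> v" by (auto simp: quot_carrier)
    show "quot_map M' N' f (x \<oplus>\<^bsub>quot_mod M N\<^esub> y) = quot_map M' N' f x \<oplus>\<^bsub>quot_mod M' N'\<^esub> quot_map M' N' f y"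
      using u v by (simp add: q quot_add[OF assms(1,2)] quot_add[OF assms(3,4)] f)
  next
    fix a x assume a: "a \<in> carrier R" and "x \<in> carrier (quot_mod M N)"
    then obtain u where u: "u \<in> carrier M" "x = N +>\<^bsub>M\<^esub> u" by (auto simp: quot_carrier)
    show "quot_map M' N' f (a \<odot>\<^bsub>quot_mod M N\<^esub> x) = a \<odot>\<^bsub>quot_mod M' N'\<^esub> quot_map M' N' f x"
      using u a by (simp add: q quot_smult[OF assms(1,2)] quot_smult[OF assms(3,4)] f)
  qed
qed

lemma module_diff_eq_zeroD:
  assumes "module R M" "x \<in> carrier M" "y \<in> carrier M" "x \<ominus>\<^bsub>M\<^esub> y = \<zero>\<^bsub>M\<^esub>"
  shows "x = y"
proof -
  interpret M: module R M by fact
  show ?thesis using assms by (metis M.add.inv_closed M.minus_equality M.minus_minus M.minus_eq)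
qed

text \<open>A finite sum depends only on the values of the summand on the index set, even if these
  lie outside the carrier.  So the rewriting of the body of a sum, with the bound variables in
  their carriers, needs no closure conditions.\<close>

lemma foldSetD_agree:
  "(A, x) \<in> foldSetD D f e \<Longrightarrow> (\<And>a. a \<in> A \<Longrightarrow> f a = g a) \<Longrightarrow> (A, x) \<in> foldSetD D g e"
proof (induction A x rule: foldSetD.induct)
  case (insertI x A y)
  have "(A, y) \<in> foldSetD D g e" using insertI by auto
  moreover have "g x y \<in> D" "f x y = g x y" using insertI.hyps(2) insertI.prems[of x] by auto
  ultimately show ?case using foldSetD.insertI[OF insertI.hyps(1), of g y D e] by simp
qed (simp add: foldSetD.emptyI)

lemma finsum_agree:
  assumes "\<And>a. a \<in> A \<Longrightarrow> f a = g a"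
  shows "finsum M f A = finsum M g A"
proof -
  have "(A, x) \<in> foldSetD D (mult (add_monoid M) \<circ> f) e \<longleftrightarrow> (A, x) \<in> foldSetD D (mult (add_monoid M) \<circ> g) e" for D e x
    using foldSetD_agree[of A x D "mult (add_monoid M) \<circ> f" e "mult (add_monoid M) \<circ> g"]
      foldSetD_agree[of A x D "mult (add_monoid M) \<circ> g" e "mult (add_monoid M) \<circ> f"] assms
    by auto
  then show ?thesis by (simp add: finsum_def finprod_def foldD_def)
qed

section \<open>Free modules and the universal property of tensor products\<close>

definition free_ext ::
  "('a, 'r) ring_scheme \<Rightarrow> ('a, 'm, 's) module_scheme \<Rightarrow> ('g \<Rightarrow> 'm) \<Rightarrow> ('g \<Rightarrow> 'a) \<Rightarrow> 'm"
  where "free_ext R M f p = (\<Oplus>\<^bsub>M\<^esub>g\<in>{g. p g \<noteq> \<zero>\<^bsub>R\<^esub>}. p g \<odot>\<^bsub>M\<^esub> f g)"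

lemma free_mod_module:
  assumes "cring R" shows "module R (free_mod R G)"
proof -
  interpret R: cring R by fact
  have sup: "finite {g. p g \<oplus>\<^bsub>R\<^esub> q g \<noteq> \<zero>\<^bsub>R\<^esub>} \<and> {g. p g \<oplus>\<^bsub>R\<^esub> q g \<noteq> \<zero>\<^bsub>R\<^esub>} \<subseteq> G"
    if "finite {g. p g \<noteq> \<zero>\<^bsub>R\<^esub>}" "{g. p g \<noteq> \<zero>\<^bsub>R\<^esub>} \<subseteq> G"
      "finite {g. q g \<noteq> \<zero>\<^bsub>R\<^esub>}" "{g. q g \<noteq> \<zero>\<^bsub>R\<^esub>} \<subseteq> G" for p q :: "'c \<Rightarrow> 'a"
  proof -
    have "{g. p g \<oplus>\<^bsub>R\<^esub> q g \<noteq> \<zero>\<^bsub>R\<^esub>} \<subseteq> {g. p g \<noteq> \<zero>\<^bsub>R\<^esub>} \<union> {g. q g \<noteq> \<zero>\<^bsub>R\<^esub>}" by auto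
    with that show ?thesis by (meson Un_least finite_Un finite_subset subset_trans)
  qed
  have sups: "finite {g. a \<otimes>\<^bsub>R\<^esub> p g \<noteq> \<zero>\<^bsub>R\<^esub>} \<and> {g. a \<otimes>\<^bsub>R\<^esub> p g \<noteq> \<zero>\<^bsub>R\<^esub>} \<subseteq> G"
    if "a \<in> carrier R" "finite {g. p g \<noteq> \<zero>\<^bsub>R\<^esub>}" "{g. p g \<noteq> \<zero>\<^bsub>R\<^esub>} \<subseteq> G" for a and p :: "'c \<Rightarrow> 'a"
  proof -
    have "{g. a \<otimes>\<^bsub>R\<^esub> p g \<noteq> \<zero>\<^bsub>R\<^esub>} \<subseteq> {g. p g \<noteq> \<zero>\<^bsub>R\<^esub>}" using that(1) by auto
    with that show ?thesis by (meson finite_subset subset_trans)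
  qed
  show ?thesis
  proof (rule moduleI)
    show "abelian_group (free_mod R G)"
    proof (rule abelian_groupI)
      fix p assume p: "p \<in> carrier (free_mod R G)"
      have "(\<lambda>g. \<ominus>\<^bsub>R\<^esub> p g) \<in> carrier (free_mod R G)"
      proof -
        have "{g. \<ominus>\<^bsub>R\<^esub> p g \<noteq> \<zero>\<^bsub>R\<^esub>} \<subseteq> {g. p g \<noteq> \<zero>\<^bsub>R\<^esub>}" by auto
        then show ?thesis using p by (auto simp: free_mod_def intro: finite_subset)
      qed
      then show "\<exists>q\<in>carrier (free_mod R G). q \<oplus>\<^bsub>free_mod R G\<^esub> p = \<zero>\<^bsub>free_mod R G\<^esub>"
        using p by (intro bexI[of _ "\<lambda>g. \<ominus>\<^bsub>R\<^esub> p g"]) (auto simp: free_mod_def R.l_neg)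
    next
      fix p q assume "p \<in> carrier (free_mod R G)" "q \<in> carrier (free_mod R G)"
      then show "p \<oplus>\<^bsub>free_mod R G\<^esub> q \<in> carrier (free_mod R G)"
        using sup[of p q] by (simp add: free_mod_def)
    next
      fix p q r assume "p \<in> carrier (free_mod R G)" "q \<in> carrier (free_mod R G)" "r \<in> carrier (free_mod R G)"
      then show "p \<oplus>\<^bsub>free_mod R G\<^esub> q \<oplus>\<^bsub>free_mod R G\<^esub> r = p \<oplus>\<^bsub>free_mod R G\<^esub> (q \<oplus>\<^bsub>free_mod R G\<^esub> r)"
        by (simp add: free_mod_def R.a_assoc)
    next
      fix p q assume "p \<in> carrier (free_mod R G)" "q \<in> carrier (free_mod R G)"
      then show "p \<oplus>\<^bsub>free_mod R G\<^esub> q = q \<oplus>\<^bsub>free_mod R G\<^esub> p"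
        by (simp add: free_mod_def R.a_comm)
    qed (simp_all add: free_mod_def)
  next
    fix a p assume "a \<in> carrier R" "p \<in> carrier (free_mod R G)"
    then show "a \<odot>\<^bsub>free_mod R G\<^esub> p \<in> carrier (free_mod R G)"
      using sups[of a p] by (simp add: free_mod_def)
  qed (simp_all add: free_mod_def R.is_cring R.l_distr R.r_distr R.m_assoc)
qed

lemma free_gen_carrier:
  assumes "cring R" "g \<in> G" shows "free_gen R g \<in> carrier (free_mod R G)"
proof -
  interpret R: cring R by fact
  have "{h. free_gen R g h \<noteq> \<zero>\<^bsub>R\<^esub>} \<subseteq> {g}" by (auto simp: free_gen_def)
  then show ?thesis using assms(2) by (auto simp: free_mod_def free_gen_def)
qed

lemma free_ext_superset:
  assumes "module R M" "f \<in> G \<rightarrow> carrier M" "p \<in> carrier (free_mod R G)"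
    and "finite A" "{g. p g \<noteq> \<zero>\<^bsub>R\<^esub>} \<subseteq> A" "A \<subseteq> G"
  shows "free_ext R M f p = (\<Oplus>\<^bsub>M\<^esub>g\<in>A. p g \<odot>\<^bsub>M\<^esub> f g)"
proof -
  interpret M: module R M by fact
  have p: "p g \<in> carrier R" for g using assms(3) by (simp add: free_mod_def)
  have fc: "g \<in> A \<Longrightarrow> f g \<in> carrier M" for g using assms by auto
  show ?thesis unfolding free_ext_def
    by (rule M.add.finprod_mono_neutral_cong_left) (use assms(4,5) p fc in auto)
qed

lemma free_ext_hom:
  assumes "module R M" "f \<in> G \<rightarrow> carrier M"
  shows "free_ext R M f \<in> mod_hom R (free_mod R G) M"
proof -
  interpret M: module R M by fact
  interpret F: module R "free_mod R G" by (rule free_mod_module[OF M.R.is_cring])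
  have supp: "finite {g. p g \<noteq> \<zero>\<^bsub>R\<^esub>}" "{g. p g \<noteq> \<zero>\<^bsub>R\<^esub>} \<subseteq> G" "\<And>g. p g \<in> carrier R"
    if "p \<in> carrier (free_mod R G)" for p using that by (auto simp: free_mod_def)
  show ?thesis
  proof (rule mod_homI)
    fix p assume p: "p \<in> carrier (free_mod R G)"
    show "free_ext R M f p \<in> carrier M"
      unfolding free_ext_def using assms(2) supp[OF p] by (intro M.finsum_closed) auto
  next
    fix p q assume p: "p \<in> carrier (free_mod R G)" and q: "q \<in> carrier (free_mod R G)"
    let ?A = "{g. p g \<noteq> \<zero>\<^bsub>R\<^esub>} \<union> {g. q g \<noteq> \<zero>\<^bsub>R\<^esub>}"
    have A: "finite ?A" "?A \<subseteq> G" using supp[OF p] supp[OF q] by auto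
    have fc: "g \<in> ?A \<Longrightarrow> f g \<in> carrier M" for g using assms(2) A(2) by auto
    have sub: "{g. (p \<oplus>\<^bsub>free_mod R G\<^esub> q) g \<noteq> \<zero>\<^bsub>R\<^esub>} \<subseteq> ?A" by (auto simp: free_mod_def)
    have "free_ext R M f (p \<oplus>\<^bsub>free_mod R G\<^esub> q) = (\<Oplus>\<^bsub>M\<^esub>g\<in>?A. (p \<oplus>\<^bsub>free_mod R G\<^esub> q) g \<odot>\<^bsub>M\<^esub> f g)"
      by (rule free_ext_superset[OF assms F.add.m_closed[OF p q] A(1) sub A(2)])
    also have "\<dots> = (\<Oplus>\<^bsub>M\<^esub>g\<in>?A. p g \<odot>\<^bsub>M\<^esub> f g \<oplus>\<^bsub>M\<^esub> q g \<odot>\<^bsub>M\<^esub> f g)"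
      by (rule M.finsum_cong')
        (use fc supp(3)[OF p] supp(3)[OF q] in \<open>auto simp: free_mod_def M.smult_l_distr\<close>)
    also have "\<dots> = (\<Oplus>\<^bsub>M\<^esub>g\<in>?A. p g \<odot>\<^bsub>M\<^esub> f g) \<oplus>\<^bsub>M\<^esub> (\<Oplus>\<^bsub>M\<^esub>g\<in>?A. q g \<odot>\<^bsub>M\<^esub> f g)"
      by (rule M.finsum_addf) (use fc supp(3)[OF p] supp(3)[OF q] in auto)
    also have "\<dots> = free_ext R M f p \<oplus>\<^bsub>M\<^esub> free_ext R M f q"
      using free_ext_superset[OF assms p A(1) _ A(2)] free_ext_superset[OF assms q A(1) _ A(2)] by simp
    finally show "free_ext R M f (p \<oplus>\<^bsub>free_mod R G\<^esub> q) = free_ext R M f p \<oplus>\<^bsub>M\<^esub> free_ext R M f q" .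
  next
    fix a p assume a: "a \<in> carrier R" and p: "p \<in> carrier (free_mod R G)"
    let ?A = "{g. p g \<noteq> \<zero>\<^bsub>R\<^esub>}"
    have fc: "g \<in> ?A \<Longrightarrow> f g \<in> carrier M" for g using assms(2) supp(2)[OF p] by auto
    have sub: "{g. (a \<odot>\<^bsub>free_mod R G\<^esub> p) g \<noteq> \<zero>\<^bsub>R\<^esub>} \<subseteq> ?A" using a by (auto simp: free_mod_def)
    have "free_ext R M f (a \<odot>\<^bsub>free_mod R G\<^esub> p) = (\<Oplus>\<^bsub>M\<^esub>g\<in>?A. (a \<odot>\<^bsub>free_mod R G\<^esub> p) g \<odot>\<^bsub>M\<^esub> f g)"
      by (rule free_ext_superset[OF assms F.smult_closed[OF a p] supp(1)[OF p] sub supp(2)[OF p]])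
    also have "\<dots> = (\<Oplus>\<^bsub>M\<^esub>g\<in>?A. a \<odot>\<^bsub>M\<^esub> (p g \<odot>\<^bsub>M\<^esub> f g))"
      by (rule M.finsum_cong') (use fc supp(3)[OF p] a in \<open>auto simp: free_mod_def M.smult_assoc1\<close>)
    also have "\<dots> = a \<odot>\<^bsub>M\<^esub> free_ext R M f p" unfolding free_ext_def
      by (rule M.finsum_smult_ldistr[symmetric]) (use fc supp[OF p] a in auto)
    finally show "free_ext R M f (a \<odot>\<^bsub>free_mod R G\<^esub> p) = a \<odot>\<^bsub>M\<^esub> free_ext R M f p" .
  qed
qed

lemma free_ext_gen:
  assumes "module R M" "f g \<in> carrier M"
  shows "free_ext R M f (free_gen R g) = f g"
proof -
  interpret M: module R M by fact
  \<comment> \<open>over the zero ring, \<open>free_gen R g\<close> has empty support\<close>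
  have triv: "\<one>\<^bsub>R\<^esub> = \<zero>\<^bsub>R\<^esub> \<Longrightarrow> f g = \<zero>\<^bsub>M\<^esub>"
    using M.smult_one[OF assms(2)] M.smult_l_null[OF assms(2)] by simp
  have "free_ext R M f (free_gen R g) = (\<Oplus>\<^bsub>M\<^esub>h\<in>{g}. free_gen R g h \<odot>\<^bsub>M\<^esub> f h)"
    unfolding free_ext_def
    by (rule M.add.finprod_mono_neutral_cong_left) (use assms triv in \<open>auto simp: free_gen_def\<close>)
  then show ?thesis using assms(2) by (simp add: free_gen_def)
qed

lemma free_ext_id:
  assumes "cring R" "p \<in> carrier (free_mod R G)"
  shows "free_ext R (free_mod R G) (free_gen R) p = p"
proof -
  interpret R: cring R by fact
  let ?F = "free_mod R G"
  interpret F: module R ?F by (rule free_mod_module[OF assms(1)])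
  have ev: "(\<Oplus>\<^bsub>?F\<^esub>g\<in>A. c g \<odot>\<^bsub>?F\<^esub> free_gen R g) h = (if h \<in> A then c h else \<zero>\<^bsub>R\<^esub>)"
    if "finite A" "A \<subseteq> G" "\<And>g. c g \<in> carrier R" for A c h
    using that
  proof (induction A rule: finite_induct)
    case empty then show ?case by (simp only: F.finsum_empty) (simp add: free_mod_def)
  next
    case (insert g A)
    have gen: "g' \<in> insert g A \<Longrightarrow> c g' \<odot>\<^bsub>?F\<^esub> free_gen R g' \<in> carrier ?F" for g'
      using insert.prems by (intro F.smult_closed free_gen_carrier[OF assms(1)]) auto
    have "(\<Oplus>\<^bsub>?F\<^esub>g\<in>insert g A. c g \<odot>\<^bsub>?F\<^esub> free_gen R g) =
      c g \<odot>\<^bsub>?F\<^esub> free_gen R g \<oplus>\<^bsub>?F\<^esub> (\<Oplus>\<^bsub>?F\<^esub>g\<in>A. c g \<odot>\<^bsub>?F\<^esub> free_gen R g)"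
      using insert.hyps gen by (intro F.finsum_insert) auto
    then have "(\<Oplus>\<^bsub>?F\<^esub>g\<in>insert g A. c g \<odot>\<^bsub>?F\<^esub> free_gen R g) h =
      c g \<otimes>\<^bsub>R\<^esub> free_gen R g h \<oplus>\<^bsub>R\<^esub> (\<Oplus>\<^bsub>?F\<^esub>g\<in>A. c g \<odot>\<^bsub>?F\<^esub> free_gen R g) h"
      by (simp only:) (simp add: free_mod_def)
    also have "\<dots> = c g \<otimes>\<^bsub>R\<^esub> free_gen R g h \<oplus>\<^bsub>R\<^esub> (if h \<in> A then c h else \<zero>\<^bsub>R\<^esub>)"
      using insert by simp
    also have "\<dots> = (if h \<in> insert g A then c h else \<zero>\<^bsub>R\<^esub>)"
      using insert.hyps insert.prems(2) by (auto simp: free_gen_def)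
    finally show ?case .
  qed
  show ?thesis unfolding free_ext_def
    by (rule ext, subst ev) (use assms(2) in \<open>auto simp: free_mod_def\<close>)
qed

definition multilinear ::
  "('a, 'r) ring_scheme \<Rightarrow> ('a, 'x, 's) module_scheme \<Rightarrow> nat \<Rightarrow> ('a, 'y, 't) module_scheme
    \<Rightarrow> ('a, 'm, 'u) module_scheme \<Rightarrow> ('x list \<times> 'y \<Rightarrow> 'm) \<Rightarrow> bool"
  where "multilinear R X n Y M f \<longleftrightarrow>
    f \<in> tens_gens X n Y \<rightarrow> carrier M \<and>
    (\<forall>(xs, y) \<in> tens_gens X n Y. (\<lambda>z. f (xs, z)) \<in> mod_hom R Y M \<and>
      (\<forall>i<n. (\<lambda>u. f (xs[i := u], y)) \<in> mod_hom R X M))"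

lemma tens_lift_alt: "tens_lift R M f t = free_ext R M f (SOME p. p \<in> t)"
  by (simp add: tens_lift_def free_ext_def Let_def)

lemma tens_gens_update:
  "(xs, y) \<in> tens_gens X n Y \<Longrightarrow> u \<in> carrier X \<Longrightarrow> (xs[i := u], y) \<in> tens_gens X n Y"
  using set_update_subset_insert[of xs i u] by (auto simp: tens_gens_def)

lemma tens_gens_snd:
  "(xs, y) \<in> tens_gens X n Y \<Longrightarrow> z \<in> carrier Y \<Longrightarrow> (xs, z) \<in> tens_gens X n Y"
  by (auto simp: tens_gens_def)

context
  fixes R :: "('a, 'r) ring_scheme" and X :: "('a, 'x, 's) module_scheme"
    and Y :: "('a, 'y, 't) module_scheme"
  assumes mX: "module R X" and mY: "module R Y"
begin

interpretation X: module R X by (rule mX)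
interpretation Y: module R Y by (rule mY)

lemma tens_free_module: "module R (tens_free R X n Y)"
  unfolding tens_free_def by (rule free_mod_module[OF X.R.is_cring])

lemma tens_gen_closed: "g \<in> tens_gens X n Y \<Longrightarrow> free_gen R g \<in> carrier (tens_free R X n Y)"
  unfolding tens_free_def by (rule free_gen_carrier[OF X.R.is_cring])

lemma tens_rels_gens_subset:
  fixes n
  defines "F \<equiv> tens_free R X n Y" and "e \<equiv> (\<lambda>xs y. free_gen R (xs, y))"
  shows "({e (xs[i := u \<oplus>\<^bsub>X\<^esub> v]) y \<ominus>\<^bsub>F\<^esub> (e (xs[i := u]) y \<oplus>\<^bsub>F\<^esub> e (xs[i := v]) y) | xs y i u v.
          (xs, y) \<in> tens_gens X n Y \<and> i < n \<and> u \<in> carrier X \<and> v \<in> carrier X} \<union>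
       {e (xs[i := a \<odot>\<^bsub>X\<^esub> u]) y \<ominus>\<^bsub>F\<^esub> (a \<odot>\<^bsub>F\<^esub> e (xs[i := u]) y) | xs y i a u.
          (xs, y) \<in> tens_gens X n Y \<and> i < n \<and> a \<in> carrier R \<and> u \<in> carrier X} \<union>
       {e xs (y \<oplus>\<^bsub>Y\<^esub> z) \<ominus>\<^bsub>F\<^esub> (e xs y \<oplus>\<^bsub>F\<^esub> e xs z) | xs y z.
          (xs, y) \<in> tens_gens X n Y \<and> z \<in> carrier Y} \<union>
       {e xs (a \<odot>\<^bsub>Y\<^esub> y) \<ominus>\<^bsub>F\<^esub> (a \<odot>\<^bsub>F\<^esub> e xs y) | xs y a.
          (xs, y) \<in> tens_gens X n Y \<and> a \<in> carrier R}) \<subseteq> carrier F"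
proof -
  interpret F: module R F unfolding F_def by (rule tens_free_module)
  have e: "e (xs[i := u]) y \<in> carrier F" if "(xs, y) \<in> tens_gens X n Y" "u \<in> carrier X" for xs y i u
    using tens_gen_closed[OF tens_gens_update[OF that]] by (simp add: e_def F_def)
  have e': "e xs y \<in> carrier F" if "(xs, y) \<in> tens_gens X n Y" for xs y
    using tens_gen_closed[OF that] by (simp add: e_def F_def)
  have y: "(xs, y) \<in> tens_gens X n Y \<Longrightarrow> y \<in> carrier Y" for xs y by (simp add: tens_gens_def)
  show ?thesis
  proof (rule subsetI, elim UnE CollectE exE conjE)
    fix x xs y i u v
    assume x: "x = e (xs[i := u \<oplus>\<^bsub>X\<^esub> v]) y \<ominus>\<^bsub>F\<^esub> (e (xs[i := u]) y \<oplus>\<^bsub>F\<^esub> e (xs[i := v]) y)"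
      and g: "(xs, y) \<in> tens_gens X n Y" and u: "u \<in> carrier X" and v: "v \<in> carrier X"
    show "x \<in> carrier F" unfolding x
      by (intro F.minus_closed F.add.m_closed e[OF g] X.add.m_closed u v)
  next
    fix x xs y i a u
    assume x: "x = e (xs[i := a \<odot>\<^bsub>X\<^esub> u]) y \<ominus>\<^bsub>F\<^esub> (a \<odot>\<^bsub>F\<^esub> e (xs[i := u]) y)"
      and g: "(xs, y) \<in> tens_gens X n Y" and a: "a \<in> carrier R" and u: "u \<in> carrier X"
    show "x \<in> carrier F" unfolding x
      by (intro F.minus_closed F.smult_closed e[OF g] X.smult_closed a u)
  next
    fix x xs y z
    assume x: "x = e xs (y \<oplus>\<^bsub>Y\<^esub> z) \<ominus>\<^bsub>F\<^esub> (e xs y \<oplus>\<^bsub>F\<^esub> e xs z)"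
      and g: "(xs, y) \<in> tens_gens X n Y" and z: "z \<in> carrier Y"
    show "x \<in> carrier F" unfolding x
      by (intro F.minus_closed F.add.m_closed e' tens_gens_snd[OF g] g Y.add.m_closed y[OF g] z)
  next
    fix x xs y a
    assume x: "x = e xs (a \<odot>\<^bsub>Y\<^esub> y) \<ominus>\<^bsub>F\<^esub> (a \<odot>\<^bsub>F\<^esub> e xs y)"
      and g: "(xs, y) \<in> tens_gens X n Y" and a: "a \<in> carrier R"
    show "x \<in> carrier F" unfolding x
      by (intro F.minus_closed F.smult_closed e' tens_gens_snd[OF g] g Y.smult_closed y[OF g] a)
  qed
qed

lemma tens_rels_submodule: "submodule (tens_rels R X n Y) R (tens_free R X n Y)"
  unfolding tens_rels_def Let_def
  by (rule mod_span_submodule[OF tens_free_module tens_rels_gens_subset])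

lemma tens_module: "module R (tens R X n Y)"
  unfolding tens_def by (rule quot_module[OF tens_free_module tens_rels_submodule])

lemma tens_carrier:
  "t \<in> carrier (tens R X n Y) \<longleftrightarrow>
    (\<exists>p\<in>carrier (tens_free R X n Y). t = tens_rels R X n Y +>\<^bsub>tens_free R X n Y\<^esub> p)"
  unfolding tens_def quot_carrier by auto

lemma ptens_closed: "(xs, y) \<in> tens_gens X n Y \<Longrightarrow> ptens R X Y xs y \<in> carrier (tens R X n Y)"
  unfolding ptens_def tens_carrier using tens_gen_closed[of "(xs, y)" n] by (auto simp: tens_gens_def)

lemma tens_rep:
  assumes "t \<in> carrier (tens R X n Y)"
  shows "(SOME p. p \<in> t) \<in> carrier (tens_free R X n Y)"
    and "t = tens_rels R X n Y +>\<^bsub>tens_free R X n Y\<^esub> (SOME p. p \<in> t)"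
proof -
  from assms obtain p where p: "p \<in> carrier (tens_free R X n Y)"
    "t = tens_rels R X n Y +>\<^bsub>tens_free R X n Y\<^esub> p" by (auto simp: tens_carrier)
  note rs = tens_free_module[of n] tens_rels_submodule[of n] p(1)
  have "p \<in> t" using rcoset_self[OF rs] p by simp
  then have "(SOME p. p \<in> t) \<in> t" by (rule someI[of "\<lambda>p. p \<in> t"])
  then show "(SOME p. p \<in> t) \<in> carrier (tens_free R X n Y)"
    and "t = tens_rels R X n Y +>\<^bsub>tens_free R X n Y\<^esub> (SOME p. p \<in> t)"
    using rcoset_eqI[OF rs] p(2) by auto
qed

lemma tens_rep_supp:
  assumes "t \<in> carrier (tens R X n Y)"
  shows "finite {g. (SOME p. p \<in> t) g \<noteq> \<zero>\<^bsub>R\<^esub>}"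
    and "(SOME p. p \<in> t) g \<noteq> \<zero>\<^bsub>R\<^esub> \<Longrightarrow> g \<in> tens_gens X n Y"
    and "(SOME p. p \<in> t) g \<in> carrier R"
  using tens_rep(1)[OF assms] unfolding tens_free_def free_mod_def by (auto simp del: split_paired_All)

lemma tens_lift_closed:
  assumes "module R M" "t \<in> carrier (tens R X n Y)"
    and "\<And>g. g \<in> tens_gens X n Y \<Longrightarrow> f g \<in> carrier M"
  shows "tens_lift R M f t \<in> carrier M"
proof -
  interpret M: module R M by fact
  show ?thesis unfolding tens_lift_alt free_ext_def
    by (rule M.finsum_closed) (auto intro!: M.smult_closed assms(3) tens_rep_supp(2,3)[OF assms(2)])
qed

lemma tens_lift_agree:
  assumes "t \<in> carrier (tens R X n Y)" "\<And>g. g \<in> tens_gens X n Y \<Longrightarrow> f g = f' g"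
  shows "tens_lift R M f t = tens_lift R M f' t"
  unfolding tens_lift_alt free_ext_def
  by (rule finsum_agree) (use tens_rep_supp(2)[OF assms(1)] assms(2) in auto)

text \<open>Since the lift is a finite sum over a chosen representative, linear maps may be pulled
  inside and two lifts may be exchanged, whether or not the integrands are multilinear.\<close>

lemma mod_hom_tens_lift:
  assumes "\<phi> \<in> mod_hom R M N" "module R M" "module R N" "t \<in> carrier (tens R X n Y)"
    and "\<And>g. g \<in> tens_gens X n Y \<Longrightarrow> f g \<in> carrier M"
  shows "\<phi> (tens_lift R M f t) = tens_lift R N (\<lambda>g. \<phi> (f g)) t"
proof -
  interpret M: module R M by fact
  interpret N: module R N by fact
  note s = tens_rep_supp[OF assms(4)]
  have "\<phi> (tens_lift R M f t) = (\<Oplus>\<^bsub>N\<^esub>g\<in>{g. (SOME p. p \<in> t) g \<noteq> \<zero>\<^bsub>R\<^esub>}. \<phi> ((SOME p. p \<in> t) g \<odot>\<^bsub>M\<^esub> f g))"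
    unfolding tens_lift_alt free_ext_def
    by (rule mod_hom_finsum[OF assms(1-3)]) (auto intro!: s M.smult_closed assms(5))
  also have "\<dots> = tens_lift R N (\<lambda>g. \<phi> (f g)) t"
    unfolding tens_lift_alt free_ext_def
    by (rule N.finsum_cong')
      (auto intro!: s N.smult_closed mod_hom_closed[OF assms(1)] mod_hom_smult[OF assms(1)] assms(5))
  finally show ?thesis .
qed

lemma tens_lift_fun_hom:
  assumes "module R M" "t \<in> carrier (tens R X n Y)"
    and "\<And>g. g \<in> tens_gens X n Y \<Longrightarrow> (\<lambda>u. F u g) \<in> mod_hom R N M"
  shows "(\<lambda>u. tens_lift R M (F u) t) \<in> mod_hom R N M"
  unfolding tens_lift_alt free_ext_def
  by (rule mod_hom_finsum_fun[OF assms(1)])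
    (auto intro!: tens_rep_supp[OF assms(2)] mod_hom_smult_fun[OF _ assms(1)] assms(3))

text \<open>A multilinear map kills the relations, so its linear extension does not depend on
  representatives.\<close>

lemma free_ext_tens_rels:
  assumes "module R M" "multilinear R X n Y M f" "r \<in> tens_rels R X n Y"
  shows "free_ext R M f r = \<zero>\<^bsub>M\<^esub>"
proof -
  interpret M: module R M by fact
  let ?F = "tens_free R X n Y"
  interpret F: module R ?F by (rule tens_free_module)
  have fG: "f \<in> tens_gens X n Y \<rightarrow> carrier M" using assms(2) by (simp add: multilinear_def)
  have hom: "free_ext R M f \<in> mod_hom R ?F M"
    unfolding tens_free_def by (rule free_ext_hom[OF assms(1) fG])
  note hs = mod_hom_add[OF hom] mod_hom_smult[OF hom] mod_hom_diff[OF hom F.module_axioms M.module_axioms]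
  have gen: "free_ext R M f (free_gen R g) = f g" if "g \<in> tens_gens X n Y" for g
    using fG that by (intro free_ext_gen[OF assms(1)]) auto
  have fy: "(xs, y) \<in> tens_gens X n Y \<Longrightarrow> (\<lambda>z. f (xs, z)) \<in> mod_hom R Y M" for xs y
    using assms(2) by (auto simp: multilinear_def)
  have fx: "(xs, y) \<in> tens_gens X n Y \<Longrightarrow> i < n \<Longrightarrow> (\<lambda>u. f (xs[i := u], y)) \<in> mod_hom R X M" for xs y i
    using assms(2) by (auto simp: multilinear_def)
  note cl = tens_gen_closed tens_gens_update tens_gens_snd
  have yc: "(xs, y) \<in> tens_gens X n Y \<Longrightarrow> y \<in> carrier Y" for xs y by (simp add: tens_gens_def)
  have z: "u \<in> carrier M \<Longrightarrow> u \<ominus>\<^bsub>M\<^esub> u = \<zero>\<^bsub>M\<^esub>" for u by (simp add: a_minus_def M.r_neg)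
  have fc: "(xs, y) \<in> tens_gens X n Y \<Longrightarrow> f (xs, y) \<in> carrier M" for xs y using fG by auto
  have "free_ext R M f r \<in> {\<zero>\<^bsub>M\<^esub>}"
  proof (rule mod_span_hom_image[OF hom F.module_axioms M.module_axioms submodule_zero[OF M.module_axioms]
          tens_rels_gens_subset _ assms(3)[unfolded tens_rels_def Let_def]], elim UnE CollectE exE conjE)
    fix x xs y i u v
    assume x: "x = free_gen R (xs[i := u \<oplus>\<^bsub>X\<^esub> v], y) \<ominus>\<^bsub>?F\<^esub>
        (free_gen R (xs[i := u], y) \<oplus>\<^bsub>?F\<^esub> free_gen R (xs[i := v], y))"
      and g: "(xs, y) \<in> tens_gens X n Y" and i: "i < n" and u: "u \<in> carrier X" and v: "v \<in> carrier X"
    have uv: "u \<oplus>\<^bsub>X\<^esub> v \<in> carrier X" using u v by simp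
    show "free_ext R M f x \<in> {\<zero>\<^bsub>M\<^esub>}"
      using mod_hom_add[OF fx[OF g i] u v] g u v uv
      by (simp add: x hs cl gen z fc)
  next
    fix x xs y i a u
    assume x: "x = free_gen R (xs[i := a \<odot>\<^bsub>X\<^esub> u], y) \<ominus>\<^bsub>?F\<^esub> (a \<odot>\<^bsub>?F\<^esub> free_gen R (xs[i := u], y))"
      and g: "(xs, y) \<in> tens_gens X n Y" and i: "i < n" and a: "a \<in> carrier R" and u: "u \<in> carrier X"
    show "free_ext R M f x \<in> {\<zero>\<^bsub>M\<^esub>}"
      using mod_hom_smult[OF fx[OF g i] a u] g u a
      by (simp add: x hs cl gen z fc)
  next
    fix x xs y w
    assume x: "x = free_gen R (xs, y \<oplus>\<^bsub>Y\<^esub> w) \<ominus>\<^bsub>?F\<^esub> (free_gen R (xs, y) \<oplus>\<^bsub>?F\<^esub> free_gen R (xs, w))"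
      and g: "(xs, y) \<in> tens_gens X n Y" and w: "w \<in> carrier Y"
    have gs: "(xs, w) \<in> tens_gens X n Y" "(xs, y \<oplus>\<^bsub>Y\<^esub> w) \<in> tens_gens X n Y"
      using tens_gens_snd[OF g] yc[OF g] w by auto
    show "free_ext R M f x \<in> {\<zero>\<^bsub>M\<^esub>}"
      using mod_hom_add[OF fy[OF g] yc[OF g] w] g gs
      by (simp add: x hs tens_gen_closed gen z fc)
  next
    fix x xs y a
    assume x: "x = free_gen R (xs, a \<odot>\<^bsub>Y\<^esub> y) \<ominus>\<^bsub>?F\<^esub> (a \<odot>\<^bsub>?F\<^esub> free_gen R (xs, y))"
      and g: "(xs, y) \<in> tens_gens X n Y" and a: "a \<in> carrier R"
    have gs: "(xs, a \<odot>\<^bsub>Y\<^esub> y) \<in> tens_gens X n Y"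
      using tens_gens_snd[OF g] yc[OF g] a by auto
    show "free_ext R M f x \<in> {\<zero>\<^bsub>M\<^esub>}"
      using mod_hom_smult[OF fy[OF g] a yc[OF g]] g gs a
      by (simp add: x hs tens_gen_closed gen z fc)
  qed
  then show ?thesis by simp
qed

lemma tens_lift_rcoset:
  assumes "module R M" "multilinear R X n Y M f" "p \<in> carrier (tens_free R X n Y)"
  shows "tens_lift R M f (tens_rels R X n Y +>\<^bsub>tens_free R X n Y\<^esub> p) = free_ext R M f p"
proof -
  interpret M: module R M by fact
  let ?F = "tens_free R X n Y" and ?t = "tens_rels R X n Y +>\<^bsub>tens_free R X n Y\<^esub> p"
  let ?q = "SOME p. p \<in> ?t"
  have fG: "f \<in> tens_gens X n Y \<rightarrow> carrier M" using assms(2) by (simp add: multilinear_def)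
  have hom: "free_ext R M f \<in> mod_hom R ?F M"
    unfolding tens_free_def by (rule free_ext_hom[OF assms(1) fG])
  have t: "?t \<in> carrier (tens R X n Y)" using assms(3) by (auto simp: tens_carrier)
  have q: "?q \<in> carrier ?F" by (rule tens_rep(1)[OF t])
  have "?q \<ominus>\<^bsub>?F\<^esub> p \<in> tens_rels R X n Y"
    using tens_rep(2)[OF t] rcoset_eq_iff[OF tens_free_module tens_rels_submodule q assms(3)] by simp
  then have "free_ext R M f (?q \<ominus>\<^bsub>?F\<^esub> p) = \<zero>\<^bsub>M\<^esub>" by (rule free_ext_tens_rels[OF assms(1,2)])
  then have "free_ext R M f ?q \<ominus>\<^bsub>M\<^esub> free_ext R M f p = \<zero>\<^bsub>M\<^esub>"
    using mod_hom_diff[OF hom tens_free_module M.module_axioms q assms(3)] by simp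
  then show ?thesis
    unfolding tens_lift_alt
    using module_diff_eq_zeroD[OF assms(1) mod_hom_closed[OF hom q] mod_hom_closed[OF hom assms(3)]] by simp
qed

lemma tens_lift_ptens:
  assumes "module R M" "multilinear R X n Y M f" "(xs, y) \<in> tens_gens X n Y"
  shows "tens_lift R M f (ptens R X Y xs y) = f (xs, y)"
proof -
  have n: "length xs = n" using assms(3) by (simp add: tens_gens_def)
  have "f (xs, y) \<in> carrier M" using assms(2,3) by (auto simp: multilinear_def)
  then show ?thesis
    unfolding ptens_def n tens_lift_rcoset[OF assms(1,2) tens_gen_closed[OF assms(3)]]
    by (rule free_ext_gen[OF assms(1)])
qed

lemma tens_lift_hom:
  assumes "module R M" "multilinear R X n Y M f"
  shows "tens_lift R M f \<in> mod_hom R (tens R X n Y) M"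
proof -
  let ?F = "tens_free R X n Y"
  interpret F: module R ?F by (rule tens_free_module)
  have fG: "f \<in> tens_gens X n Y \<rightarrow> carrier M" using assms(2) by (simp add: multilinear_def)
  have hom: "free_ext R M f \<in> mod_hom R ?F M"
    unfolding tens_free_def by (rule free_ext_hom[OF assms(1) fG])
  note q = tens_lift_rcoset[OF assms] quot_add[OF F.module_axioms tens_rels_submodule]
     quot_smult[OF F.module_axioms tens_rels_submodule]
  show ?thesis
    unfolding tens_def
    by (rule mod_homI)
      (auto simp: quot_carrier q mod_hom_closed[OF hom] mod_hom_add[OF hom] mod_hom_smult[OF hom])
qed

text \<open>Every tensor is the sum of pure tensors given by its representative; hence linear maps
  that agree on pure tensors agree.\<close>

lemma tens_lift_pure:
  assumes "t \<in> carrier (tens R X n Y)"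
  shows "tens_lift R (tens R X n Y) (\<lambda>(xs, y). ptens R X Y xs y) t = t"
proof -
  let ?F = "tens_free R X n Y" and ?p = "SOME p. p \<in> t"
  interpret F: module R ?F by (rule tens_free_module)
  interpret T: module R "tens R X n Y" by (rule tens_module)
  note s = tens_rep_supp[OF assms]
  have proj: "(\<lambda>p. tens_rels R X n Y +>\<^bsub>?F\<^esub> p) \<in> mod_hom R ?F (tens R X n Y)"
    unfolding tens_def by (rule quot_proj_hom[OF tens_free_module tens_rels_submodule])
  have pt: "ptens R X Y xs y = tens_rels R X n Y +>\<^bsub>?F\<^esub> free_gen R (xs, y)"
    if "(xs, y) \<in> tens_gens X n Y" for xs y
    using that by (simp add: ptens_def tens_gens_def)
  have "t = tens_rels R X n Y +>\<^bsub>?F\<^esub> free_ext R ?F (free_gen R) ?p"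
    using tens_rep[OF assms] free_ext_id[OF X.R.is_cring, of ?p "tens_gens X n Y"]
    unfolding tens_free_def by simp
  also have "\<dots> = (\<Oplus>\<^bsub>tens R X n Y\<^esub>g\<in>{g. ?p g \<noteq> \<zero>\<^bsub>R\<^esub>}. tens_rels R X n Y +>\<^bsub>?F\<^esub> (?p g \<odot>\<^bsub>?F\<^esub> free_gen R g))"
    unfolding free_ext_def
    by (rule mod_hom_finsum[OF proj F.module_axioms T.module_axioms])
      (auto intro!: s F.smult_closed tens_gen_closed)
  also have "\<dots> = tens_lift R (tens R X n Y) (\<lambda>(xs, y). ptens R X Y xs y) t"
    unfolding tens_lift_alt free_ext_def
  proof (rule T.finsum_cong')
    fix g assume "g \<in> {g. ?p g \<noteq> \<zero>\<^bsub>R\<^esub>}"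
    then have g: "g \<in> tens_gens X n Y" using s(2) by auto
    then show "tens_rels R X n Y +>\<^bsub>?F\<^esub> (?p g \<odot>\<^bsub>?F\<^esub> free_gen R g) =
        ?p g \<odot>\<^bsub>tens R X n Y\<^esub> (case g of (xs, y) \<Rightarrow> ptens R X Y xs y)"
      using mod_hom_smult[OF proj s(3) tens_gen_closed[OF g]] by (cases g) (simp add: pt)
  qed (auto intro!: s(3) T.smult_closed ptens_closed s(2))
  finally show ?thesis by simp
qed

lemma tens_lift_eqI:
  assumes "\<phi> \<in> mod_hom R (tens R X n Y) M" "module R M" "t \<in> carrier (tens R X n Y)"
    and "\<And>xs y. (xs, y) \<in> tens_gens X n Y \<Longrightarrow> f (xs, y) = \<phi> (ptens R X Y xs y)"
  shows "tens_lift R M f t = \<phi> t"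
proof -
  have pc: "(case g of (xs, y) \<Rightarrow> ptens R X Y xs y) \<in> carrier (tens R X n Y)"
    if "g \<in> tens_gens X n Y" for g using that ptens_closed by (cases g) simp
  have "\<phi> t = \<phi> (tens_lift R (tens R X n Y) (\<lambda>(xs, y). ptens R X Y xs y) t)"
    using tens_lift_pure[OF assms(3)] by simp
  also have "\<dots> = tens_lift R M (\<lambda>g. \<phi> (case g of (xs, y) \<Rightarrow> ptens R X Y xs y)) t"
    by (rule mod_hom_tens_lift[OF assms(1) tens_module assms(2,3) pc])
  also have "\<dots> = tens_lift R M f t"
    by (rule tens_lift_agree[OF assms(3)]) (use assms(4) in auto)
  finally show ?thesis by simp
qed

lemma tens_hom_eqI:
  assumes "\<phi> \<in> mod_hom R (tens R X n Y) M" "\<psi> \<in> mod_hom R (tens R X n Y) M" "module R M"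
    and "t \<in> carrier (tens R X n Y)"
    and "\<And>xs y. (xs, y) \<in> tens_gens X n Y \<Longrightarrow> \<phi> (ptens R X Y xs y) = \<psi> (ptens R X Y xs y)"
  shows "\<phi> t = \<psi> t"
  using tens_lift_eqI[OF assms(1,3,4), of "\<lambda>(xs, y). \<phi> (ptens R X Y xs y)"]
    tens_lift_eqI[OF assms(2,3,4), of "\<lambda>(xs, y). \<phi> (ptens R X Y xs y)"] assms(5) by simp

lemma ptens_multilinear: "multilinear R X n Y (tens R X n Y) (\<lambda>(xs, y). ptens R X Y xs y)"
proof -
  let ?F = "tens_free R X n Y" and ?K = "tens_rels R X n Y"
  let ?e = "\<lambda>xs y. free_gen R (xs, y)"
  interpret F: module R ?F by (rule tens_free_module)
  note K = tens_free_module[of n] tens_rels_submodule[of n]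
  have pt: "ptens R X Y xs y = ?K +>\<^bsub>?F\<^esub> ?e xs y"
    if "(xs, y) \<in> tens_gens X n Y" for xs y
    using that by (simp add: ptens_def tens_gens_def)
  note gc = tens_gen_closed[of _ n]
  have rel: "?K +>\<^bsub>?F\<^esub> u = ?K +>\<^bsub>?F\<^esub> v"
    if "u \<ominus>\<^bsub>?F\<^esub> v \<in> ?K" "u \<in> carrier ?F" "v \<in> carrier ?F" for u v
    using that rcoset_eq_iff[OF K] by blast
  have yc: "(xs, y) \<in> tens_gens X n Y \<Longrightarrow> y \<in> carrier Y" for xs y by (simp add: tens_gens_def)
  have 1: "(\<lambda>z. ptens R X Y xs z) \<in> mod_hom R Y (tens R X n Y)" if g: "(xs, y) \<in> tens_gens X n Y" for xs y
  proof (rule mod_homI)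
    fix u assume u: "u \<in> carrier Y"
    note gu = tens_gens_snd[OF g u]
    show "ptens R X Y xs u \<in> carrier (tens R X n Y)" by (rule ptens_closed[OF gu])
    fix v assume v: "v \<in> carrier Y"
    note gv = tens_gens_snd[OF g v] and guv = tens_gens_snd[OF g Y.add.m_closed[OF u v]]
    have "?e xs (u \<oplus>\<^bsub>Y\<^esub> v) \<ominus>\<^bsub>?F\<^esub> (?e xs u \<oplus>\<^bsub>?F\<^esub> ?e xs v) \<in> ?K"
      unfolding tens_rels_def Let_def by (rule mod_span_incl) (use gu v in blast)
    from rel[OF this] show "ptens R X Y xs (u \<oplus>\<^bsub>Y\<^esub> v) = ptens R X Y xs u \<oplus>\<^bsub>tens R X n Y\<^esub> ptens R X Y xs v"
      by (simp add: pt gu gv guv gc tens_def quot_add[OF K])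
  next
    fix a u assume a: "a \<in> carrier R" and u: "u \<in> carrier Y"
    note gu = tens_gens_snd[OF g u] and gau = tens_gens_snd[OF g Y.smult_closed[OF a u]]
    have "?e xs (a \<odot>\<^bsub>Y\<^esub> u) \<ominus>\<^bsub>?F\<^esub> (a \<odot>\<^bsub>?F\<^esub> ?e xs u) \<in> ?K"
      unfolding tens_rels_def Let_def by (rule mod_span_incl) (use gu a in blast)
    from rel[OF this] show "ptens R X Y xs (a \<odot>\<^bsub>Y\<^esub> u) = a \<odot>\<^bsub>tens R X n Y\<^esub> ptens R X Y xs u"
      by (simp add: pt gu gau a gc tens_def quot_smult[OF K])
  qed
  have 2: "(\<lambda>u. ptens R X Y (xs[i := u]) y) \<in> mod_hom R X (tens R X n Y)"
    if g: "(xs, y) \<in> tens_gens X n Y" and i: "i < n" for xs y i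
  proof (rule mod_homI)
    fix u assume u: "u \<in> carrier X"
    note gu = tens_gens_update[OF g u]
    show "ptens R X Y (xs[i := u]) y \<in> carrier (tens R X n Y)" by (rule ptens_closed[OF gu])
    fix v assume v: "v \<in> carrier X"
    note gv = tens_gens_update[OF g v] and guv = tens_gens_update[OF g X.add.m_closed[OF u v]]
    have "?e (xs[i := u \<oplus>\<^bsub>X\<^esub> v]) y \<ominus>\<^bsub>?F\<^esub> (?e (xs[i := u]) y \<oplus>\<^bsub>?F\<^esub> ?e (xs[i := v]) y) \<in> ?K"
      unfolding tens_rels_def Let_def by (rule mod_span_incl) (use g i u v in blast)
    from rel[OF this] show "ptens R X Y (xs[i := u \<oplus>\<^bsub>X\<^esub> v]) y =
        ptens R X Y (xs[i := u]) y \<oplus>\<^bsub>tens R X n Y\<^esub> ptens R X Y (xs[i := v]) y"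
      by (simp add: pt gu gv guv gc tens_def quot_add[OF K])
  next
    fix a u assume a: "a \<in> carrier R" and u: "u \<in> carrier X"
    note gu = tens_gens_update[OF g u] and gau = tens_gens_update[OF g X.smult_closed[OF a u]]
    have "?e (xs[i := a \<odot>\<^bsub>X\<^esub> u]) y \<ominus>\<^bsub>?F\<^esub> (a \<odot>\<^bsub>?F\<^esub> ?e (xs[i := u]) y) \<in> ?K"
      unfolding tens_rels_def Let_def by (rule mod_span_incl) (use g i u a in blast)
    from rel[OF this] show "ptens R X Y (xs[i := a \<odot>\<^bsub>X\<^esub> u]) y = a \<odot>\<^bsub>tens R X n Y\<^esub> ptens R X Y (xs[i := u]) y"
      by (simp add: pt gu gau a gc tens_def quot_smult[OF K])
  qed
  show ?thesis unfolding multilinear_def using 1 2 ptens_closed by fastforce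
qed

end

text \<open>Both sides are the same finite double sum over the two chosen representatives.\<close>

lemma tens_lift_swap:
  fixes M :: "('a, 'm, 'u) module_scheme"
  assumes "module R X" "module R Y" "module R X'" "module R Y'" "module R M"
    and "s \<in> carrier (tens R X n Y)" "t \<in> carrier (tens R X' m Y')"
    and "\<And>g h. g \<in> tens_gens X n Y \<Longrightarrow> h \<in> tens_gens X' m Y' \<Longrightarrow> F g h \<in> carrier M"
  shows "tens_lift R M (\<lambda>g. tens_lift R M (F g) t) s = tens_lift R M (\<lambda>h. tens_lift R M (\<lambda>g. F g h) s) t"
proof -
  interpret M: module R M by fact
  let ?p = "SOME p. p \<in> s" and ?q = "SOME p. p \<in> t"
  note sp = tens_rep_supp[OF assms(1,2,6)] and tp = tens_rep_supp[OF assms(3,4,7)]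
  have hom: "(\<lambda>x. ?p g \<odot>\<^bsub>M\<^esub> x) \<in> mod_hom R M M" for g
    by (rule mod_hom_smult_fun[OF mod_hom_id assms(5) sp(3)])
  have c: "g \<in> tens_gens X n Y \<Longrightarrow> tens_lift R M (F g) t \<in> carrier M" for g
    by (rule tens_lift_closed[OF assms(3,4,5,7)]) (rule assms(8))
  have "tens_lift R M (\<lambda>g. tens_lift R M (F g) t) s =
      (\<Oplus>\<^bsub>M\<^esub>g\<in>{g. ?p g \<noteq> \<zero>\<^bsub>R\<^esub>}. ?p g \<odot>\<^bsub>M\<^esub> tens_lift R M (F g) t)"
    unfolding tens_lift_alt[of R M _ s] free_ext_def ..
  also have "\<dots> = (\<Oplus>\<^bsub>M\<^esub>g\<in>{g. ?p g \<noteq> \<zero>\<^bsub>R\<^esub>}. tens_lift R M (\<lambda>h. ?p g \<odot>\<^bsub>M\<^esub> F g h) t)"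
    by (rule M.finsum_cong')
      (auto intro!: tens_lift_closed[OF assms(3,4,5,7)] M.smult_closed sp(2,3) assms(8)
        mod_hom_tens_lift[OF assms(3,4) hom assms(5,5,7)])
  also have "\<dots> = tens_lift R M (\<lambda>h. \<Oplus>\<^bsub>M\<^esub>g\<in>{g. ?p g \<noteq> \<zero>\<^bsub>R\<^esub>}. ?p g \<odot>\<^bsub>M\<^esub> F g h) t"
  proof -
    have "(\<Oplus>\<^bsub>M\<^esub>g\<in>A. tens_lift R M (G g) t) = tens_lift R M (\<lambda>h. \<Oplus>\<^bsub>M\<^esub>g\<in>A. G g h) t"
      if "finite A" "\<And>g h. g \<in> A \<Longrightarrow> h \<in> tens_gens X' m Y' \<Longrightarrow> G g h \<in> carrier M" for A and G :: "_ \<Rightarrow> _ \<Rightarrow> 'm"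
      using that
    proof (induction A rule: finite_induct)
      case empty
      have "\<zero>\<^bsub>M\<^esub> = tens_lift R M (\<lambda>h. \<zero>\<^bsub>M\<^esub>) t"
        unfolding tens_lift_alt free_ext_def using tp(3) by (simp add: M.add.finprod_one_eqI)
      then show ?case by simp
    next
      case (insert g A)
      have cl: "h \<in> tens_gens X' m Y' \<Longrightarrow> k \<in> insert g A \<Longrightarrow> G k h \<in> carrier M" for h k using insert.prems by auto
      have "(\<Oplus>\<^bsub>M\<^esub>g\<in>insert g A. tens_lift R M (G g) t) = tens_lift R M (G g) t \<oplus>\<^bsub>M\<^esub> (\<Oplus>\<^bsub>M\<^esub>g\<in>A. tens_lift R M (G g) t)"
        using insert.hyps cl by (intro M.finsum_insert) (auto intro!: tens_lift_closed[OF assms(3,4,5,7)])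
      also have "\<dots> = tens_lift R M (G g) t \<oplus>\<^bsub>M\<^esub> tens_lift R M (\<lambda>h. \<Oplus>\<^bsub>M\<^esub>g\<in>A. G g h) t"
        using insert.IH insert.prems by simp
      also have "\<dots> = tens_lift R M (\<lambda>h. G g h \<oplus>\<^bsub>M\<^esub> (\<Oplus>\<^bsub>M\<^esub>g\<in>A. G g h)) t"
      proof -
        have fc: "h \<in> tens_gens X' m Y' \<Longrightarrow> (\<Oplus>\<^bsub>M\<^esub>g\<in>A. G g h) \<in> carrier M" for h
          using cl by (intro M.finsum_closed) auto
        show ?thesis unfolding tens_lift_alt free_ext_def
          by (subst M.finsum_addf[symmetric])
            (auto intro!: M.finsum_cong' M.smult_closed tp(2,3) cl fc simp: M.smult_r_distr[OF tp(3) cl fc] tp(2))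
      qed
      also have "\<dots> = tens_lift R M (\<lambda>h. \<Oplus>\<^bsub>M\<^esub>g\<in>insert g A. G g h) t"
      proof (rule tens_lift_agree[OF assms(3,4,7)])
        fix h assume h: "h \<in> tens_gens X' m Y'"
        show "G g h \<oplus>\<^bsub>M\<^esub> (\<Oplus>\<^bsub>M\<^esub>g\<in>A. G g h) = (\<Oplus>\<^bsub>M\<^esub>g\<in>insert g A. G g h)"
          using cl[OF h] insert.hyps by (subst M.finsum_insert) auto
      qed
      finally show ?case .
    qed
    from this[OF sp(1), of "\<lambda>g h. ?p g \<odot>\<^bsub>M\<^esub> F g h"] show ?thesis using sp(2,3) assms(8) by auto
  qed
  also have "\<dots> = tens_lift R M (\<lambda>h. tens_lift R M (\<lambda>g. F g h) s) t"
    unfolding tens_lift_alt[of R M _ s] free_ext_def ..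
  finally show ?thesis .
qed

section \<open>Tensor products built one factor at a time\<close>

definition bilinear ::
  "('a, 'r) ring_scheme \<Rightarrow> ('a, 'm, 's) module_scheme \<Rightarrow> ('a, 'n, 't) module_scheme
    \<Rightarrow> ('a, 'p, 'u) module_scheme \<Rightarrow> ('m \<Rightarrow> 'n \<Rightarrow> 'p) \<Rightarrow> bool"
  where "bilinear R M N P \<beta> \<longleftrightarrow>
    (\<forall>x \<in> carrier M. \<beta> x \<in> mod_hom R N P) \<and> (\<forall>y \<in> carrier N. (\<lambda>x. \<beta> x y) \<in> mod_hom R M P)"

lemma bilinearI:
  assumes "\<And>x. x \<in> carrier M \<Longrightarrow> (\<lambda>y. \<beta> x y) \<in> mod_hom R N P"
    and "\<And>y. y \<in> carrier N \<Longrightarrow> (\<lambda>x. \<beta> x y) \<in> mod_hom R M P"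
  shows "bilinear R M N P \<beta>"
  using assms by (simp add: bilinear_def)

lemma bilinearD:
  assumes "bilinear R M N P \<beta>"
  shows "x \<in> carrier M \<Longrightarrow> (\<lambda>y. \<beta> x y) \<in> mod_hom R N P"
    and "y \<in> carrier N \<Longrightarrow> (\<lambda>x. \<beta> x y) \<in> mod_hom R M P"
  using assms by (simp_all add: bilinear_def)

lemma bilinear_closed:
  "bilinear R M N P \<beta> \<Longrightarrow> x \<in> carrier M \<Longrightarrow> y \<in> carrier N \<Longrightarrow> \<beta> x y \<in> carrier P"
  using mod_hom_closed[of "\<beta> x" R N P y] by (simp add: bilinear_def)

lemma bilinear_lin1:
  "bilinear R M N P \<beta> \<Longrightarrow> f \<in> mod_hom R Q M \<Longrightarrow> y \<in> carrier N \<Longrightarrow> (\<lambda>z. \<beta> (f z) y) \<in> mod_hom R Q P"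
  using mod_hom_comp[OF bilinearD(2)] by metis

lemma bilinear_lin2:
  "bilinear R M N P \<beta> \<Longrightarrow> x \<in> carrier M \<Longrightarrow> f \<in> mod_hom R Q N \<Longrightarrow> (\<lambda>z. \<beta> x (f z)) \<in> mod_hom R Q P"
  using mod_hom_comp[OF bilinearD(1)] by metis

text \<open>The product of an element of \<open>X\<close> with a tensor, extending \<open>ptens\<close> on pure tensors.\<close>

definition tcons ::
  "('a, 'r) ring_scheme \<Rightarrow> ('a, 'x, 's) module_scheme \<Rightarrow> ('a, 'y, 't) module_scheme \<Rightarrow> nat
    \<Rightarrow> 'x \<Rightarrow> ('x list \<times> 'y \<Rightarrow> 'a) set \<Rightarrow> ('x list \<times> 'y \<Rightarrow> 'a) set"
  where "tcons R X Y n x = tens_lift R (tens R X (Suc n) Y) (\<lambda>(xs, y). ptens R X Y (x # xs) y)"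

text \<open>The three lifts describe linear maps out of a tensor product by curried functions: of the
  first factor and the remaining tensor, of two single factors, and of the only factor \<open>Y\<close>.\<close>

definition cons_lift ::
  "('a, 'r) ring_scheme \<Rightarrow> ('a, 'x, 's) module_scheme \<Rightarrow> ('a, 'y, 't) module_scheme
    \<Rightarrow> ('a, 'm, 'u) module_scheme \<Rightarrow> ('x \<Rightarrow> ('x list \<times> 'y \<Rightarrow> 'a) set \<Rightarrow> 'm)
    \<Rightarrow> ('x list \<times> 'y \<Rightarrow> 'a) set \<Rightarrow> 'm"
  where "cons_lift R X Y M \<beta> = tens_lift R M (\<lambda>(xs, y). \<beta> (hd xs) (ptens R X Y (tl xs) y))"

definition pair_lift ::
  "('a, 'r) ring_scheme \<Rightarrow> ('a, 'm, 'u) module_scheme \<Rightarrow> ('x \<Rightarrow> 'y \<Rightarrow> 'm)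
    \<Rightarrow> ('x list \<times> 'y \<Rightarrow> 'a) set \<Rightarrow> 'm"
  where "pair_lift R M \<beta> = tens_lift R M (\<lambda>(us, v). \<beta> (hd us) v)"

definition nil_lift ::
  "('a, 'r) ring_scheme \<Rightarrow> ('a, 'm, 'u) module_scheme \<Rightarrow> ('y \<Rightarrow> 'm)
    \<Rightarrow> ('x list \<times> 'y \<Rightarrow> 'a) set \<Rightarrow> 'm"
  where "nil_lift R M f = tens_lift R M (\<lambda>(us, v). f v)"

lemma tens_gens_0: "(xs, y) \<in> tens_gens X 0 Y \<longleftrightarrow> xs = [] \<and> y \<in> carrier Y"
  by (auto simp: tens_gens_def)

lemma tens_gens_Suc:
  "(xs, y) \<in> tens_gens X (Suc n) Y \<longleftrightarrow> (\<exists>x xs'. xs = x # xs' \<and> x \<in> carrier X \<and> (xs', y) \<in> tens_gens X n Y)"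
  by (cases xs) (auto simp: tens_gens_def)

lemma tens_gens_Cons [simp]:
  "(x # xs, y) \<in> tens_gens X (Suc n) Y \<longleftrightarrow> x \<in> carrier X \<and> (xs, y) \<in> tens_gens X n Y"
  by (auto simp: tens_gens_def)

lemma tens_gens_Nil [simp]: "([], y) \<in> tens_gens X 0 Y \<longleftrightarrow> y \<in> carrier Y"
  by (auto simp: tens_gens_def)

context
  fixes R :: "('a, 'r) ring_scheme" and X :: "('a, 'x, 's) module_scheme"
    and Y :: "('a, 'y, 't) module_scheme"
  assumes mX: "module R X" and mY: "module R Y"
begin

interpretation X: module R X by (rule mX)
interpretation Y: module R Y by (rule mY)

lemma ptens_snd_hom: "(xs, y) \<in> tens_gens X n Y \<Longrightarrow> (\<lambda>z. ptens R X Y xs z) \<in> mod_hom R Y (tens R X n Y)"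
  using ptens_multilinear[OF mX mY, of n] by (auto simp: multilinear_def)

lemma ptens_update_hom:
  "(xs, y) \<in> tens_gens X n Y \<Longrightarrow> i < n \<Longrightarrow> (\<lambda>u. ptens R X Y (xs[i := u]) y) \<in> mod_hom R X (tens R X n Y)"
  using ptens_multilinear[OF mX mY, of n] by (auto simp: multilinear_def)

lemma ptens_Nil_hom: "(\<lambda>z. ptens R X Y [] z) \<in> mod_hom R Y (tens R X 0 Y)"
  using ptens_snd_hom[of "[]" "\<zero>\<^bsub>Y\<^esub>" 0] by simp

lemma ptens_Cons_hom:
  assumes "(xs, y) \<in> tens_gens X n Y"
  shows "(\<lambda>u. ptens R X Y (u # xs) y) \<in> mod_hom R X (tens R X (Suc n) Y)"
  using ptens_update_hom[of "\<zero>\<^bsub>X\<^esub> # xs" y "Suc n" 0] assms by simp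

lemma tcons_ptens_multilinear:
  assumes "x \<in> carrier X"
  shows "multilinear R X n Y (tens R X (Suc n) Y) (\<lambda>(xs, y). ptens R X Y (x # xs) y)"
  unfolding multilinear_def
  using ptens_snd_hom[of "x # _" _ "Suc n"] ptens_update_hom[of "x # _" _ "Suc n" "Suc _"]
    ptens_closed[OF mX mY, of "x # _" _ "Suc n"] assms
  by auto

lemma tcons_hom: "x \<in> carrier X \<Longrightarrow> tcons R X Y n x \<in> mod_hom R (tens R X n Y) (tens R X (Suc n) Y)"
  unfolding tcons_def
  by (rule tens_lift_hom[OF mX mY tens_module[OF mX mY] tcons_ptens_multilinear])

lemma tcons_ptens:
  "x \<in> carrier X \<Longrightarrow> (xs, y) \<in> tens_gens X n Y \<Longrightarrow> tcons R X Y n x (ptens R X Y xs y) = ptens R X Y (x # xs) y"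
  unfolding tcons_def
  by (subst tens_lift_ptens[OF mX mY tens_module[OF mX mY] tcons_ptens_multilinear]) auto

lemma tcons_bilinear: "bilinear R X (tens R X n Y) (tens R X (Suc n) Y) (tcons R X Y n)"
proof (rule bilinearI)
  show "(\<lambda>y. tcons R X Y n x y) \<in> mod_hom R (tens R X n Y) (tens R X (Suc n) Y)" if "x \<in> carrier X" for x
    by (rule tcons_hom[OF that])
  fix t assume "t \<in> carrier (tens R X n Y)"
  then show "(\<lambda>x. tcons R X Y n x t) \<in> mod_hom R X (tens R X (Suc n) Y)"
    unfolding tcons_def
    by (rule tens_lift_fun_hom[OF mX mY tens_module[OF mX mY]]) (auto intro: ptens_Cons_hom)
qed

lemma cons_lift_multilinear:
  assumes "bilinear R X (tens R X n Y) M \<beta>"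
  shows "multilinear R X (Suc n) Y M (\<lambda>(xs, y). \<beta> (hd xs) (ptens R X Y (tl xs) y))"
proof -
  have 1: "(\<lambda>z. \<beta> x (ptens R X Y xs z)) \<in> mod_hom R Y M" if "x \<in> carrier X" "(xs, y) \<in> tens_gens X n Y" for x xs y
    by (rule bilinear_lin2[OF assms that(1) ptens_snd_hom[OF that(2)]])
  have 2: "(\<lambda>u. \<beta> u (ptens R X Y xs y)) \<in> mod_hom R X M" if "(xs, y) \<in> tens_gens X n Y" for xs y
    by (rule bilinearD(2)[OF assms ptens_closed[OF mX mY that]])
  have 3: "(\<lambda>u. \<beta> x (ptens R X Y (xs[i := u]) y)) \<in> mod_hom R X M"
    if "x \<in> carrier X" "(xs, y) \<in> tens_gens X n Y" "i < n" for x xs y i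
    by (rule bilinear_lin2[OF assms that(1) ptens_update_hom[OF that(2,3)]])
  have 4: "\<beta> x (ptens R X Y xs y) \<in> carrier M" if "x \<in> carrier X" "(xs, y) \<in> tens_gens X n Y" for x xs y
    by (rule bilinear_closed[OF assms that(1) ptens_closed[OF mX mY that(2)]])
  show ?thesis unfolding multilinear_def
  proof (intro conjI ballI)
    show "(\<lambda>(xs, y). \<beta> (hd xs) (ptens R X Y (tl xs) y)) \<in> tens_gens X (Suc n) Y \<rightarrow> carrier M"
      using 4 by (auto simp: tens_gens_Suc)
    fix g assume "g \<in> tens_gens X (Suc n) Y"
    then obtain x xs y where g: "g = (x # xs, y)" "x \<in> carrier X" "(xs, y) \<in> tens_gens X n Y"
      by (cases g) (auto simp: tens_gens_Suc)
    have "(\<lambda>u. \<beta> (hd ((x # xs)[i := u])) (ptens R X Y (tl ((x # xs)[i := u])) y)) \<in> mod_hom R X M" if "i < Suc n" for i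
      using that 2[OF g(3)] 3[OF g(2,3)] by (cases i) auto
    then show "case g of (xs, y) \<Rightarrow>
        (\<lambda>z. case (xs, z) of (xs, y) \<Rightarrow> \<beta> (hd xs) (ptens R X Y (tl xs) y)) \<in> mod_hom R Y M \<and>
        (\<forall>i<Suc n. (\<lambda>u. case (xs[i := u], y) of (xs, y) \<Rightarrow> \<beta> (hd xs) (ptens R X Y (tl xs) y)) \<in> mod_hom R X M)"
      using 1[OF g(2,3)] by (simp add: g(1))
  qed
qed

lemma cons_lift_hom:
  "module R M \<Longrightarrow> bilinear R X (tens R X n Y) M \<beta> \<Longrightarrow> cons_lift R X Y M \<beta> \<in> mod_hom R (tens R X (Suc n) Y) M"
  unfolding cons_lift_def by (rule tens_lift_hom[OF mX mY _ cons_lift_multilinear])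

lemma tens_hom_Suc_eqI:
  assumes "\<phi> \<in> mod_hom R (tens R X (Suc n) Y) M" "\<psi> \<in> mod_hom R (tens R X (Suc n) Y) M" "module R M"
    and "t \<in> carrier (tens R X (Suc n) Y)"
    and "\<And>x \<xi>. x \<in> carrier X \<Longrightarrow> \<xi> \<in> carrier (tens R X n Y) \<Longrightarrow>
      \<phi> (tcons R X Y n x \<xi>) = \<psi> (tcons R X Y n x \<xi>)"
  shows "\<phi> t = \<psi> t"
proof (rule tens_hom_eqI[OF mX mY assms(1-4)])
  fix xs y assume "(xs, y) \<in> tens_gens X (Suc n) Y"
  then obtain x xs' where "xs = x # xs'" "x \<in> carrier X" "(xs', y) \<in> tens_gens X n Y" by (auto simp: tens_gens_Suc)
  then show "\<phi> (ptens R X Y xs y) = \<psi> (ptens R X Y xs y)"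
    using assms(5)[of x "ptens R X Y xs' y"] by (simp add: tcons_ptens ptens_closed[OF mX mY])
qed

lemma tens_hom_0_eqI:
  assumes "\<phi> \<in> mod_hom R (tens R X 0 Y) M" "\<psi> \<in> mod_hom R (tens R X 0 Y) M" "module R M"
    and "t \<in> carrier (tens R X 0 Y)"
    and "\<And>y. y \<in> carrier Y \<Longrightarrow> \<phi> (ptens R X Y [] y) = \<psi> (ptens R X Y [] y)"
  shows "\<phi> t = \<psi> t"
  by (rule tens_hom_eqI[OF mX mY assms(1-4)]) (auto simp: tens_gens_0 assms(5))

text \<open>Bilinearity extends \<open>cons_lift\<close> from pure tensors to all products
  \<open>tcons x \<xi>\<close>: this makes \<open>tens R X (Suc n) Y\<close> a tensor product of \<open>X\<close>
  with \<open>tens R X n Y\<close>.\<close>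

lemma cons_lift_tcons:
  assumes "module R M" "bilinear R X (tens R X n Y) M \<beta>" "x \<in> carrier X" "\<xi> \<in> carrier (tens R X n Y)"
  shows "cons_lift R X Y M \<beta> (tcons R X Y n x \<xi>) = \<beta> x \<xi>"
proof (rule tens_hom_eqI[OF mX mY _ _ assms(1,4)])
  show "(\<lambda>\<xi>. cons_lift R X Y M \<beta> (tcons R X Y n x \<xi>)) \<in> mod_hom R (tens R X n Y) M"
    by (rule mod_hom_comp[OF cons_lift_hom[OF assms(1,2)] tcons_hom[OF assms(3)]])
  show "\<beta> x \<in> mod_hom R (tens R X n Y) M" using bilinearD(1)[OF assms(2,3)] .
  fix xs y assume g: "(xs, y) \<in> tens_gens X n Y"
  have "cons_lift R X Y M \<beta> (ptens R X Y (x # xs) y) = \<beta> x (ptens R X Y xs y)"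
    unfolding cons_lift_def
    by (subst tens_lift_ptens[OF mX mY assms(1) cons_lift_multilinear[OF assms(2)]]) (use g assms(3) in auto)
  then show "cons_lift R X Y M \<beta> (tcons R X Y n x (ptens R X Y xs y)) = \<beta> x (ptens R X Y xs y)"
    by (simp add: tcons_ptens[OF assms(3) g])
qed

lemma nil_lift_multilinear: "f \<in> mod_hom R Y M \<Longrightarrow> multilinear R X 0 Y M (\<lambda>(us, v). f v)"
  by (auto simp: multilinear_def tens_gens_0 mod_hom_closed)

lemma nil_lift_hom: "module R M \<Longrightarrow> f \<in> mod_hom R Y M \<Longrightarrow> nil_lift R M f \<in> mod_hom R (tens R X 0 Y) M"
  unfolding nil_lift_def by (rule tens_lift_hom[OF mX mY _ nil_lift_multilinear])

lemma nil_lift_ptens: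
  "module R M \<Longrightarrow> f \<in> mod_hom R Y M \<Longrightarrow> y \<in> carrier Y \<Longrightarrow> nil_lift R M f (ptens R X Y [] y) = f y"
  unfolding nil_lift_def by (subst tens_lift_ptens[OF mX mY _ nil_lift_multilinear]) auto

lemma pair_lift_multilinear:
  "bilinear R X Y M \<beta> \<Longrightarrow> multilinear R X (Suc 0) Y M (\<lambda>(us, v). \<beta> (hd us) v)"
  by (auto simp: multilinear_def tens_gens_Suc tens_gens_0 bilinear_closed bilinearD)

lemma pair_lift_hom:
  "module R M \<Longrightarrow> bilinear R X Y M \<beta> \<Longrightarrow> pair_lift R M \<beta> \<in> mod_hom R (tens R X (Suc 0) Y) M"
  unfolding pair_lift_def by (rule tens_lift_hom[OF mX mY _ pair_lift_multilinear])

lemma pair_lift_ptens: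
  "module R M \<Longrightarrow> bilinear R X Y M \<beta> \<Longrightarrow> x \<in> carrier X \<Longrightarrow> y \<in> carrier Y \<Longrightarrow>
    pair_lift R M \<beta> (ptens R X Y [x] y) = \<beta> x y"
  unfolding pair_lift_def by (subst tens_lift_ptens[OF mX mY _ pair_lift_multilinear]) auto

lemma pair_lift_closed:
  assumes "module R M" "t \<in> carrier (tens R X (Suc 0) Y)"
    and "\<And>x y. x \<in> carrier X \<Longrightarrow> y \<in> carrier Y \<Longrightarrow> \<beta> x y \<in> carrier M"
  shows "pair_lift R M \<beta> t \<in> carrier M"
  unfolding pair_lift_def
  by (rule tens_lift_closed[OF mX mY assms(1,2)]) (auto simp: tens_gens_Suc tens_gens_0 assms(3))

lemma mod_hom_pair_lift:
  assumes "\<phi> \<in> mod_hom R M N" "module R M" "module R N" "t \<in> carrier (tens R X (Suc 0) Y)"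
    and "\<And>x y. x \<in> carrier X \<Longrightarrow> y \<in> carrier Y \<Longrightarrow> \<beta> x y \<in> carrier M"
  shows "\<phi> (pair_lift R M \<beta> t) = pair_lift R N (\<lambda>x y. \<phi> (\<beta> x y)) t"
proof -
  have "\<phi> (pair_lift R M \<beta> t) = tens_lift R N (\<lambda>g. \<phi> (case g of (us, v) \<Rightarrow> \<beta> (hd us) v)) t"
    unfolding pair_lift_def
    by (rule mod_hom_tens_lift[OF mX mY assms(1-4)]) (auto simp: tens_gens_Suc tens_gens_0 assms(5))
  also have "(\<lambda>g. \<phi> (case g of (us, v) \<Rightarrow> \<beta> (hd us) v)) = (\<lambda>(us, v). \<phi> (\<beta> (hd us) v))" by auto
  finally show ?thesis unfolding pair_lift_def .
qed

lemma pair_lift_fun_hom: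
  assumes "module R M" "t \<in> carrier (tens R X (Suc 0) Y)"
    and "\<And>x y. x \<in> carrier X \<Longrightarrow> y \<in> carrier Y \<Longrightarrow> (\<lambda>u. F u x y) \<in> mod_hom R N M"
  shows "(\<lambda>u. pair_lift R M (F u) t) \<in> mod_hom R N M"
  unfolding pair_lift_def
  by (rule tens_lift_fun_hom[OF mX mY assms(1,2)]) (auto simp: tens_gens_Suc tens_gens_0 assms(3))

lemma pair_lift_bilinear_hom:
  assumes "module R M" "f \<in> mod_hom R N (tens R X (Suc 0) Y)" "bilinear R X Y M \<beta>"
  shows "(\<lambda>u. pair_lift R M \<beta> (f u)) \<in> mod_hom R N M"
  by (rule mod_hom_comp[OF pair_lift_hom[OF assms(1,3)] assms(2)])

text \<open>The trilinear case serves to evaluate both sides of a coassociativity law.\<close>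

lemma triple_lift_ex:
  assumes "module R M"
    and "\<And>u v. u \<in> carrier X \<Longrightarrow> v \<in> carrier X \<Longrightarrow> (\<lambda>y. G u v y) \<in> mod_hom R Y M"
    and "\<And>u y. u \<in> carrier X \<Longrightarrow> y \<in> carrier Y \<Longrightarrow> (\<lambda>v. G u v y) \<in> mod_hom R X M"
    and "\<And>v y. v \<in> carrier X \<Longrightarrow> y \<in> carrier Y \<Longrightarrow> (\<lambda>u. G u v y) \<in> mod_hom R X M"
  shows "\<exists>\<phi> \<in> mod_hom R (tens R X (Suc (Suc 0)) Y) M. \<forall>u v y. u \<in> carrier X \<longrightarrow> v \<in> carrier X \<longrightarrow> y \<in> carrier Y \<longrightarrow>
    \<phi> (ptens R X Y [u, v] y) = G u v y"
proof -
  let ?\<beta> = "\<lambda>u. pair_lift R M (G u)"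
  have bG: "bilinear R X Y M (G u)" if "u \<in> carrier X" for u
    using assms(2,3) that by (intro bilinearI)
  have b: "bilinear R X (tens R X (Suc 0) Y) M ?\<beta>"
    by (rule bilinearI) (auto intro!: pair_lift_hom[OF assms(1)] bG pair_lift_fun_hom[OF assms(1)] assms(4))
  show ?thesis
  proof (intro bexI allI impI)
    show "cons_lift R X Y M ?\<beta> \<in> mod_hom R (tens R X (Suc (Suc 0)) Y) M" by (rule cons_lift_hom[OF assms(1) b])
    fix u v y assume u: "u \<in> carrier X" and v: "v \<in> carrier X" and y: "y \<in> carrier Y"
    have "ptens R X Y [u, v] y = tcons R X Y (Suc 0) u (ptens R X Y [v] y)"
      using u v y by (subst tcons_ptens) auto
    then show "cons_lift R X Y M ?\<beta> (ptens R X Y [u, v] y) = G u v y"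
      using cons_lift_tcons[OF assms(1) b u ptens_closed[OF mX mY, of "[v]" y "Suc 0"]]
        pair_lift_ptens[OF assms(1) bG[OF u] v y] v y by simp
  qed
qed

end

lemma pair_lift_swap:
  assumes "module R X" "module R Y" "module R X'" "module R Y'" "module R M"
    and "s \<in> carrier (tens R X (Suc 0) Y)" "t \<in> carrier (tens R X' (Suc 0) Y')"
    and "\<And>x y x' y'. x \<in> carrier X \<Longrightarrow> y \<in> carrier Y \<Longrightarrow> x' \<in> carrier X' \<Longrightarrow> y' \<in> carrier Y' \<Longrightarrow>
      F x y x' y' \<in> carrier M"
  shows "pair_lift R M (\<lambda>x y. pair_lift R M (F x y) t) s =
    pair_lift R M (\<lambda>x' y'. pair_lift R M (\<lambda>x y. F x y x' y') s) t"
proof -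
  have "tens_lift R M (\<lambda>g. tens_lift R M (\<lambda>h. F (hd (fst g)) (snd g) (hd (fst h)) (snd h)) t) s =
     tens_lift R M (\<lambda>h. tens_lift R M (\<lambda>g. F (hd (fst g)) (snd g) (hd (fst h)) (snd h)) s) t"
    by (rule tens_lift_swap[OF assms(1-7)])
      (auto simp: tens_gens_Suc tens_gens_0 intro!: assms(8))
  then show ?thesis by (simp add: pair_lift_def case_prod_beta')
qed

lemma cons_lift_fun_hom:
  assumes "module R X" "module R Y" "module R M" "t \<in> carrier (tens R X (Suc n) Y)"
    and "\<And>x \<xi>. x \<in> carrier X \<Longrightarrow> \<xi> \<in> carrier (tens R X n Y) \<Longrightarrow> (\<lambda>u. F u x \<xi>) \<in> mod_hom R N M"
  shows "(\<lambda>u. cons_lift R X Y M (F u) t) \<in> mod_hom R N M"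
  unfolding cons_lift_def
  by (rule tens_lift_fun_hom[OF assms(1-4)])
    (auto simp: tens_gens_Suc intro!: assms(5) ptens_closed[OF assms(1,2)])

lemma nil_lift_fun_hom:
  assumes "module R X" "module R Y" "module R M" "t \<in> carrier (tens R X 0 Y)"
    and "\<And>y. y \<in> carrier Y \<Longrightarrow> (\<lambda>u. F u y) \<in> mod_hom R N M"
  shows "(\<lambda>u. nil_lift R M (F u) t) \<in> mod_hom R N M"
  unfolding nil_lift_def
  by (rule tens_lift_fun_hom[OF assms(1-4)]) (auto simp: tens_gens_0 intro!: assms(5))

lemma cons_lift_bilinear:
  assumes "module R X" "module R Y" "module R M"
    and "\<And>u x. u \<in> carrier N \<Longrightarrow> x \<in> carrier X \<Longrightarrow> (\<lambda>\<xi>. F u x \<xi>) \<in> mod_hom R (tens R X n Y) M"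
    and "\<And>u \<xi>. u \<in> carrier N \<Longrightarrow> \<xi> \<in> carrier (tens R X n Y) \<Longrightarrow> (\<lambda>x. F u x \<xi>) \<in> mod_hom R X M"
    and "\<And>x \<xi>. x \<in> carrier X \<Longrightarrow> \<xi> \<in> carrier (tens R X n Y) \<Longrightarrow> (\<lambda>u. F u x \<xi>) \<in> mod_hom R N M"
  shows "bilinear R N (tens R X (Suc n) Y) M (\<lambda>u. cons_lift R X Y M (F u))"
proof (rule bilinearI)
  fix u assume u: "u \<in> carrier N"
  show "(\<lambda>t. cons_lift R X Y M (F u) t) \<in> mod_hom R (tens R X (Suc n) Y) M"
    by (rule cons_lift_hom[OF assms(1-3)], rule bilinearI) (rule assms(4)[OF u] assms(5)[OF u]; assumption)+
next
  fix t assume t: "t \<in> carrier (tens R X (Suc n) Y)"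
  show "(\<lambda>u. cons_lift R X Y M (F u) t) \<in> mod_hom R N M"
    by (rule cons_lift_fun_hom[OF assms(1-3) t]) (rule assms(6))
qed

lemma nil_lift_bilinear:
  assumes "module R X" "module R Y" "module R M" "bilinear R N Y M F"
  shows "bilinear R N (tens R X 0 Y) M (\<lambda>u. nil_lift R M (F u))"
  by (intro bilinearI nil_lift_hom[OF assms(1-3)] nil_lift_fun_hom[OF assms(1-3)]
      bilinearD[OF assms(4)])

named_theorems lin "introduction rules for linearity in one variable"

declare mod_hom_id [lin]

section \<open>Sweedler sums\<close>

lemma tens_lift_pair:
  assumes "module R X" "module R Y" "t \<in> carrier (tens R X (Suc 0) Y)"
    and "\<And>x y. x \<in> carrier X \<Longrightarrow> y \<in> carrier Y \<Longrightarrow> f ([x], y) = \<beta> x y"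
  shows "tens_lift R M f t = pair_lift R M \<beta> t"
  unfolding pair_lift_def
  by (rule tens_lift_agree[OF assms(1-3)]) (auto simp: tens_gens_Suc tens_gens_0 assms(4))

lemma pair_lift_agree:
  assumes "module R X" "module R Y" "t \<in> carrier (tens R X (Suc 0) Y)"
    and "\<And>x y. x \<in> carrier X \<Longrightarrow> y \<in> carrier Y \<Longrightarrow> \<beta> x y = \<beta>' x y"
  shows "pair_lift R M \<beta> t = pair_lift R M \<beta>' t"
  by (subst pair_lift_def, rule tens_lift_pair[OF assms(1-3)]) (simp add: assms(4))

lemma left_module_bilinear:
  assumes "left_module R B M act"
  shows "bilinear R B M M act"
proof (intro bilinearI mod_homI)
  note l = left_module.act_closed[OF assms] left_module.act_add_left[OF assms] left_module.act_add_right[OF assms]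
    left_module.act_smult_left[OF assms] left_module.act_smult_right[OF assms]
  show "act b x \<in> carrier M" if "b \<in> carrier B" "x \<in> carrier M" for b x
    by (rule l(1)[OF that])
  show "act b x \<in> carrier M" if "x \<in> carrier M" "b \<in> carrier B" for b x
    by (rule l(1)[OF that(2,1)])
  show "act b (x \<oplus>\<^bsub>M\<^esub> y) = act b x \<oplus>\<^bsub>M\<^esub> act b y"
    if "b \<in> carrier B" "x \<in> carrier M" "y \<in> carrier M" for b x y by (rule l(3)[OF that])
  show "act (b \<oplus>\<^bsub>B\<^esub> c) x = act b x \<oplus>\<^bsub>M\<^esub> act c x"
    if "x \<in> carrier M" "b \<in> carrier B" "c \<in> carrier B" for b c x by (rule l(2)[OF that(2,3,1)])
  show "act b (a \<odot>\<^bsub>M\<^esub> x) = a \<odot>\<^bsub>M\<^esub> act b x"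
    if "b \<in> carrier B" "a \<in> carrier R" "x \<in> carrier M" for a b x by (rule l(5)[OF that(2,1,3)])
  show "act (a \<odot>\<^bsub>B\<^esub> b) x = a \<odot>\<^bsub>M\<^esub> act b x"
    if "x \<in> carrier M" "a \<in> carrier R" "b \<in> carrier B" for a b x by (rule l(4)[OF that(2,3,1)])
qed

lemma regular_left_module:
  assumes "bialgebra R B"
  shows "left_module R B B (\<lambda>x y. x \<otimes>\<^bsub>B\<^esub> y)"
proof -
  have mB: "module R B" and rB: "ring B"
    using assms by (simp_all add: bialgebra_def coalgebra_def)
  interpret B: ring B by (rule rB)
  show ?thesis
  proof (intro left_module.intro left_module_axioms.intro mB)
    fix a x y assume "a \<in> carrier R" "x \<in> carrier B" "y \<in> carrier B"
    then show "(a \<odot>\<^bsub>B\<^esub> x) \<otimes>\<^bsub>B\<^esub> y = a \<odot>\<^bsub>B\<^esub> (x \<otimes>\<^bsub>B\<^esub> y)"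
      by (rule bialgebra.smult_mult_left[OF assms])
  next
    fix a x y assume "a \<in> carrier R" "x \<in> carrier B" "y \<in> carrier B"
    then show "x \<otimes>\<^bsub>B\<^esub> (a \<odot>\<^bsub>B\<^esub> y) = a \<odot>\<^bsub>B\<^esub> (x \<otimes>\<^bsub>B\<^esub> y)"
      by (rule bialgebra.smult_mult_right[OF assms])
  qed (simp_all add: B.l_distr B.r_distr B.m_assoc)
qed

locale sweedler_data =
  fixes R :: "('a, 'r) ring_scheme"
    and B :: "('a, 'b, 'q) coalg_scheme"
    and X :: "('a, 'x, 's) coalg_scheme"
    and actX :: "'b \<Rightarrow> 'x \<Rightarrow> 'x"
    and Y :: "('a, 'y, 't) module_scheme"
    and actY :: "'b \<Rightarrow> 'y \<Rightarrow> 'y"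
    and coact :: "'y \<Rightarrow> ('b list \<times> 'y \<Rightarrow> 'a) set"
  assumes bialg: "bialgebra R B"
    and modcoalg: "module_coalgebra R B X actX"
    and modcomod: "module_comodule R B Y actY coact"
begin

abbreviation T :: "nat \<Rightarrow> ('a, ('x list \<times> 'y \<Rightarrow> 'a) set) module" where "T n \<equiv> tens R X n Y"

abbreviation cons :: "nat \<Rightarrow> 'x \<Rightarrow> ('x list \<times> 'y \<Rightarrow> 'a) set \<Rightarrow> ('x list \<times> 'y \<Rightarrow> 'a) set"
  where "cons n \<equiv> tcons R X Y n"

abbreviation unit :: "'y \<Rightarrow> ('x list \<times> 'y \<Rightarrow> 'a) set"
  where "unit y \<equiv> ptens R X Y [] y"

abbreviation mulB :: "'b \<Rightarrow> 'b \<Rightarrow> 'b" where "mulB x y \<equiv> x \<otimes>\<^bsub>B\<^esub> y"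

text \<open>Sweedler notation: \<open>SB M G b\<close>, \<open>SX M G x\<close> and \<open>SY M G y\<close> are the sums
  \<open>G b\<^sub>(\<^sub>1\<^sub>) b\<^sub>(\<^sub>2\<^sub>)\<close>, \<open>G x\<^sub>(\<^sub>1\<^sub>) x\<^sub>(\<^sub>2\<^sub>)\<close> and \<open>G y\<^sub>(\<^sub>-\<^sub>1\<^sub>) y\<^sub>(\<^sub>0\<^sub>)\<close> in \<open>M\<close>.  The parameter \<open>M\<close> only says where
  the sum is taken.\<close>

definition SB :: "('a, 'm, 'u) module_scheme \<Rightarrow> ('b \<Rightarrow> 'b \<Rightarrow> 'm) \<Rightarrow> 'b \<Rightarrow> 'm"
  where "SB M G b = pair_lift R M G (comult B b)"

definition SX :: "('a, 'm, 'u) module_scheme \<Rightarrow> ('x \<Rightarrow> 'x \<Rightarrow> 'm) \<Rightarrow> 'x \<Rightarrow> 'm"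
  where "SX M G x = pair_lift R M G (comult X x)"

definition SY :: "('a, 'm, 'u) module_scheme \<Rightarrow> ('b \<Rightarrow> 'y \<Rightarrow> 'm) \<Rightarrow> 'y \<Rightarrow> 'm"
  where "SY M G y = pair_lift R M G (coact y)"

lemma mB [simp]: "module R B"
  using bialg by (simp add: bialgebra_def coalgebra_def)

lemma mX [simp]: "module R X"
  using modcoalg by (simp add: module_coalgebra_def coalgebra_def)

lemma mY [simp]: "module R Y"
  using modcomod by (simp add: module_comodule_def left_comodule_def)

lemma mT [simp]: "module R (T n)"
  by (rule tens_module[OF mX mY])

lemma dB: "comult B \<in> mod_hom R B (tens R B (Suc 0) B)"
  using coalgebra.comult_hom[of R B] bialg by (simp add: bialgebra_def)

lemma dX: "comult X \<in> mod_hom R X (tens R X (Suc 0) X)"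
  using coalgebra.comult_hom[of R X] modcoalg by (simp add: module_coalgebra_def)

lemma dY: "coact \<in> mod_hom R Y (tens R B (Suc 0) Y)"
  using left_comodule.coact_hom[of R B Y coact] modcomod by (simp add: module_comodule_def)

lemmas dB_cl = mod_hom_closed[OF dB]
lemmas dX_cl = mod_hom_closed[OF dX]
lemmas dY_cl = mod_hom_closed[OF dY]

text \<open>As congruence rules these let the simplifier rewrite under a Sweedler sum with the bound
  variables in their carriers.\<close>

lemma SB_cong [cong]:
  "M = M' \<Longrightarrow> b = b' \<Longrightarrow> b' \<in> carrier B \<Longrightarrow> (\<And>u v. u \<in> carrier B \<Longrightarrow> v \<in> carrier B \<Longrightarrow> G u v = G' u v) \<Longrightarrow>
    SB M G b = SB M' G' b'"
  unfolding SB_def by (hypsubst, rule pair_lift_agree[OF mB mB dB_cl])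

lemma SB_body_eq:
  "b \<in> carrier B \<Longrightarrow> (\<And>u v. u \<in> carrier B \<Longrightarrow> v \<in> carrier B \<Longrightarrow> G u v = G' u v) \<Longrightarrow> SB M G b = SB M G' b"
  by (rule SB_cong) auto

lemma SX_cong [cong]:
  "M = M' \<Longrightarrow> x = x' \<Longrightarrow> x' \<in> carrier X \<Longrightarrow> (\<And>u v. u \<in> carrier X \<Longrightarrow> v \<in> carrier X \<Longrightarrow> G u v = G' u v) \<Longrightarrow>
    SX M G x = SX M' G' x'"
  unfolding SX_def by (hypsubst, rule pair_lift_agree[OF mX mX dX_cl])

lemma SY_cong [cong]:
  "M = M' \<Longrightarrow> y = y' \<Longrightarrow> y' \<in> carrier Y \<Longrightarrow> (\<And>u v. u \<in> carrier B \<Longrightarrow> v \<in> carrier Y \<Longrightarrow> G u v = G' u v) \<Longrightarrow>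
    SY M G y = SY M' G' y'"
  unfolding SY_def by (hypsubst, rule pair_lift_agree[OF mB mY dY_cl])

lemma SB_closed [simp]:
  "module R M \<Longrightarrow> b \<in> carrier B \<Longrightarrow> (\<And>u v. u \<in> carrier B \<Longrightarrow> v \<in> carrier B \<Longrightarrow> G u v \<in> carrier M) \<Longrightarrow>
    SB M G b \<in> carrier M"
  unfolding SB_def by (rule pair_lift_closed[OF mB mB _ dB_cl])

lemma SX_closed [simp]:
  "module R M \<Longrightarrow> x \<in> carrier X \<Longrightarrow> (\<And>u v. u \<in> carrier X \<Longrightarrow> v \<in> carrier X \<Longrightarrow> G u v \<in> carrier M) \<Longrightarrow>
    SX M G x \<in> carrier M"
  unfolding SX_def by (rule pair_lift_closed[OF mX mX _ dX_cl])

lemma SY_closed [simp]: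
  "module R M \<Longrightarrow> y \<in> carrier Y \<Longrightarrow> (\<And>u v. u \<in> carrier B \<Longrightarrow> v \<in> carrier Y \<Longrightarrow> G u v \<in> carrier M) \<Longrightarrow>
    SY M G y \<in> carrier M"
  unfolding SY_def by (rule pair_lift_closed[OF mB mY _ dY_cl])

text \<open>A Sweedler sum is linear in a parameter that occurs either in the element whose
  coproduct is taken or in the body.\<close>

lemma SB_arg:
  "module R M \<Longrightarrow> f \<in> mod_hom R N B \<Longrightarrow> bilinear R B B M G \<Longrightarrow> (\<lambda>z. SB M G (f z)) \<in> mod_hom R N M"
  unfolding SB_def by (rule pair_lift_bilinear_hom[OF mB mB _ mod_hom_comp[OF dB]])

lemma SX_arg:
  "module R M \<Longrightarrow> f \<in> mod_hom R N X \<Longrightarrow> bilinear R X X M G \<Longrightarrow> (\<lambda>z. SX M G (f z)) \<in> mod_hom R N M"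
  unfolding SX_def by (rule pair_lift_bilinear_hom[OF mX mX _ mod_hom_comp[OF dX]])

lemma SY_arg:
  "module R M \<Longrightarrow> f \<in> mod_hom R N Y \<Longrightarrow> bilinear R B Y M G \<Longrightarrow> (\<lambda>z. SY M G (f z)) \<in> mod_hom R N M"
  unfolding SY_def by (rule pair_lift_bilinear_hom[OF mB mY _ mod_hom_comp[OF dY]])

lemma SB_body:
  "module R M \<Longrightarrow> b \<in> carrier B \<Longrightarrow>
    (\<And>u v. u \<in> carrier B \<Longrightarrow> v \<in> carrier B \<Longrightarrow> (\<lambda>z. F z u v) \<in> mod_hom R N M) \<Longrightarrow>
    (\<lambda>z. SB M (F z) b) \<in> mod_hom R N M"
  unfolding SB_def by (rule pair_lift_fun_hom[OF mB mB _ dB_cl])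

lemma SX_body:
  "module R M \<Longrightarrow> x \<in> carrier X \<Longrightarrow>
    (\<And>u v. u \<in> carrier X \<Longrightarrow> v \<in> carrier X \<Longrightarrow> (\<lambda>z. F z u v) \<in> mod_hom R N M) \<Longrightarrow>
    (\<lambda>z. SX M (F z) x) \<in> mod_hom R N M"
  unfolding SX_def by (rule pair_lift_fun_hom[OF mX mX _ dX_cl])

lemma SY_body:
  "module R M \<Longrightarrow> y \<in> carrier Y \<Longrightarrow>
    (\<And>u v. u \<in> carrier B \<Longrightarrow> v \<in> carrier Y \<Longrightarrow> (\<lambda>z. F z u v) \<in> mod_hom R N M) \<Longrightarrow>
    (\<lambda>z. SY M (F z) y) \<in> mod_hom R N M"
  unfolding SY_def by (rule pair_lift_fun_hom[OF mB mY _ dY_cl])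

lemma SB_push:
  "\<phi> \<in> mod_hom R M N \<Longrightarrow> module R M \<Longrightarrow> module R N \<Longrightarrow> b \<in> carrier B \<Longrightarrow>
    (\<And>u v. u \<in> carrier B \<Longrightarrow> v \<in> carrier B \<Longrightarrow> G u v \<in> carrier M) \<Longrightarrow>
    \<phi> (SB M G b) = SB N (\<lambda>u v. \<phi> (G u v)) b"
  unfolding SB_def by (rule mod_hom_pair_lift[OF mB mB _ _ _ dB_cl])

lemma SX_push:
  "\<phi> \<in> mod_hom R M N \<Longrightarrow> module R M \<Longrightarrow> module R N \<Longrightarrow> x \<in> carrier X \<Longrightarrow>
    (\<And>u v. u \<in> carrier X \<Longrightarrow> v \<in> carrier X \<Longrightarrow> G u v \<in> carrier M) \<Longrightarrow>
    \<phi> (SX M G x) = SX N (\<lambda>u v. \<phi> (G u v)) x"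
  unfolding SX_def by (rule mod_hom_pair_lift[OF mX mX _ _ _ dX_cl])

lemma SY_push:
  "\<phi> \<in> mod_hom R M N \<Longrightarrow> module R M \<Longrightarrow> module R N \<Longrightarrow> y \<in> carrier Y \<Longrightarrow>
    (\<And>u v. u \<in> carrier B \<Longrightarrow> v \<in> carrier Y \<Longrightarrow> G u v \<in> carrier M) \<Longrightarrow>
    \<phi> (SY M G y) = SY N (\<lambda>u v. \<phi> (G u v)) y"
  unfolding SY_def by (rule mod_hom_pair_lift[OF mB mY _ _ _ dY_cl])

lemmas S_push = SB_push SX_push SY_push

lemma SB_SB_swap:
  "module R M \<Longrightarrow> b \<in> carrier B \<Longrightarrow> c \<in> carrier B \<Longrightarrow>
    (\<And>u v w z. u \<in> carrier B \<Longrightarrow> v \<in> carrier B \<Longrightarrow> w \<in> carrier B \<Longrightarrow> z \<in> carrier B \<Longrightarrow> F u v w z \<in> carrier M) \<Longrightarrow>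
    SB M (\<lambda>u v. SB M (F u v) c) b = SB M (\<lambda>w z. SB M (\<lambda>u v. F u v w z) b) c"
  unfolding SB_def by (rule pair_lift_swap[OF mB mB mB mB _ dB_cl dB_cl])

lemma SB_SX_swap:
  "module R M \<Longrightarrow> b \<in> carrier B \<Longrightarrow> c \<in> carrier X \<Longrightarrow>
    (\<And>u v w z. u \<in> carrier B \<Longrightarrow> v \<in> carrier B \<Longrightarrow> w \<in> carrier X \<Longrightarrow> z \<in> carrier X \<Longrightarrow> F u v w z \<in> carrier M) \<Longrightarrow>
    SB M (\<lambda>u v. SX M (F u v) c) b = SX M (\<lambda>w z. SB M (\<lambda>u v. F u v w z) b) c"
  unfolding SB_def SX_def by (rule pair_lift_swap[OF mB mB mX mX _ dB_cl dX_cl])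

lemma SB_SY_swap:
  "module R M \<Longrightarrow> b \<in> carrier B \<Longrightarrow> c \<in> carrier Y \<Longrightarrow>
    (\<And>u v w z. u \<in> carrier B \<Longrightarrow> v \<in> carrier B \<Longrightarrow> w \<in> carrier B \<Longrightarrow> z \<in> carrier Y \<Longrightarrow> F u v w z \<in> carrier M) \<Longrightarrow>
    SB M (\<lambda>u v. SY M (F u v) c) b = SY M (\<lambda>w z. SB M (\<lambda>u v. F u v w z) b) c"
  unfolding SB_def SY_def by (rule pair_lift_swap[OF mB mB mB mY _ dB_cl dY_cl])

lemma SX_SY_swap:
  "module R M \<Longrightarrow> b \<in> carrier X \<Longrightarrow> c \<in> carrier Y \<Longrightarrow>
    (\<And>u v w z. u \<in> carrier X \<Longrightarrow> v \<in> carrier X \<Longrightarrow> w \<in> carrier B \<Longrightarrow> z \<in> carrier Y \<Longrightarrow> F u v w z \<in> carrier M) \<Longrightarrow>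
    SX M (\<lambda>u v. SY M (F u v) c) b = SY M (\<lambda>w z. SX M (\<lambda>u v. F u v w z) b) c"
  unfolding SX_def SY_def by (rule pair_lift_swap[OF mX mX mB mY _ dX_cl dY_cl])

lemma tens_lift_SB:
  "b \<in> carrier B \<Longrightarrow> (\<And>u v. u \<in> carrier B \<Longrightarrow> v \<in> carrier B \<Longrightarrow> f ([u], v) = G u v) \<Longrightarrow>
    tens_lift R M f (comult B b) = SB M G b"
  unfolding SB_def by (rule tens_lift_pair[OF mB mB dB_cl])

lemma tens_lift_SX:
  "x \<in> carrier X \<Longrightarrow> (\<And>u v. u \<in> carrier X \<Longrightarrow> v \<in> carrier X \<Longrightarrow> f ([u], v) = G u v) \<Longrightarrow>
    tens_lift R M f (comult X x) = SX M G x"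
  unfolding SX_def by (rule tens_lift_pair[OF mX mX dX_cl])

lemma tens_lift_SY:
  "y \<in> carrier Y \<Longrightarrow> (\<And>u v. u \<in> carrier B \<Longrightarrow> v \<in> carrier Y \<Longrightarrow> f ([u], v) = G u v) \<Longrightarrow>
    tens_lift R M f (coact y) = SY M G y"
  unfolding SY_def by (rule tens_lift_pair[OF mB mY dY_cl])

lemma lmX: "left_module R B X actX"
  using modcoalg by (simp add: module_coalgebra_def)

lemma lmY: "left_module R B Y actY"
  using modcomod by (simp add: module_comodule_def)

lemmas bilinear_B = left_module_bilinear[OF regular_left_module[OF bialg]]
lemmas bilinear_actX = left_module_bilinear[OF lmX]
lemmas bilinear_actY = left_module_bilinear[OF lmY]

lemma one_B [simp]: "\<one>\<^bsub>B\<^esub> \<in> carrier B"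
proof -
  have "ring B" using bialg by (simp add: bialgebra_def)
  then show ?thesis by (rule monoid.one_closed[OF ring.is_monoid])
qed

lemmas mulB_closed [simp] = bilinear_closed[OF bilinear_B]
lemmas actX_closed [simp] = bilinear_closed[OF bilinear_actX]
lemmas actY_closed [simp] = bilinear_closed[OF bilinear_actY]

lemma counit_closed [simp]: "b \<in> carrier B \<Longrightarrow> counit B b \<in> carrier R"
  using bialg coalgebra.counit_closed[of R B] by (auto simp: bialgebra_def)

lemmas actX_mult = left_module.act_mult[OF lmX]
lemmas actX_one = left_module.act_one[OF lmX]
lemmas actY_mult = left_module.act_mult[OF lmY]
lemmas actY_one = left_module.act_one[OF lmY]

text \<open>The bialgebra, module coalgebra and comodule axioms equate tensors.  A bilinear or trilinear \<open>G\<close>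
  extends to a linear map on the tensor product, and applying it to both sides of an axiom gives the
  corresponding law for Sweedler sums.\<close>

lemma SX_act:
  assumes "module R M" "bilinear R X X M G" "b \<in> carrier B" "x \<in> carrier X"
  shows "SX M G (actX b x) = SB M (\<lambda>c d. SX M (\<lambda>u v. G (actX c u) (actX d v)) x) b"
proof -
  have p: "ptens R X X [u] v \<in> carrier (tens R X (Suc 0) X)" if "u \<in> carrier X" "v \<in> carrier X" for u v
    using that by (intro ptens_closed[OF mX mX]) simp
  note m1 = tens_module[OF mX mX]
  have "comult X (actX b x) = SB (tens R X (Suc 0) X) (\<lambda>c d. SX (tens R X (Suc 0) X) (\<lambda>u v. ptens R X X [actX c u] (actX d v)) x) b"
    using module_coalgebra.comult_act[OF modcoalg assms(3,4)] assms(3,4)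
    by (simp add: tens_lift_SB tens_lift_SX cong: SB_cong)
  then show ?thesis
    using assms p m1
    by (simp add: SX_def[of M G] S_push[OF pair_lift_hom[OF mX mX assms(1,2)]] pair_lift_ptens[OF mX mX])
qed

lemma SB_mult:
  assumes "module R M" "bilinear R B B M G" "b \<in> carrier B" "x \<in> carrier B"
  shows "SB M G (mulB b x) = SB M (\<lambda>c d. SB M (\<lambda>u v. G (mulB c u) (mulB d v)) x) b"
proof -
  have p: "ptens R B B [u] v \<in> carrier (tens R B (Suc 0) B)" if "u \<in> carrier B" "v \<in> carrier B" for u v
    using that by (intro ptens_closed[OF mB mB]) simp
  note m1 = tens_module[OF mB mB]
  have "comult B (mulB b x) = SB (tens R B (Suc 0) B) (\<lambda>c d. SB (tens R B (Suc 0) B) (\<lambda>u v. ptens R B B [mulB c u] (mulB d v)) x) b"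
    using bialgebra.comult_mult[OF bialg assms(3,4)] assms(3,4)
    by (simp add: tens_lift_SB)
  then show ?thesis
    using assms p m1
    by (simp add: SB_def[of M G] S_push[OF pair_lift_hom[OF mB mB assms(1,2)]] pair_lift_ptens[OF mB mB])
qed

lemma SB_one: "module R M \<Longrightarrow> bilinear R B B M G \<Longrightarrow> SB M G \<one>\<^bsub>B\<^esub> = G \<one>\<^bsub>B\<^esub> \<one>\<^bsub>B\<^esub>"
  using bialgebra.comult_one[OF bialg] by (simp add: SB_def pair_lift_ptens[OF mB mB])

lemma SB_coassoc:
  assumes "module R M"
    and "\<And>u v. u \<in> carrier B \<Longrightarrow> v \<in> carrier B \<Longrightarrow> (\<lambda>y. G u v y) \<in> mod_hom R B M"
    and "\<And>u y. u \<in> carrier B \<Longrightarrow> y \<in> carrier B \<Longrightarrow> (\<lambda>v. G u v y) \<in> mod_hom R B M"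
    and "\<And>v y. v \<in> carrier B \<Longrightarrow> y \<in> carrier B \<Longrightarrow> (\<lambda>u. G u v y) \<in> mod_hom R B M"
    and "x \<in> carrier B"
  shows "SB M (\<lambda>u v. SB M (\<lambda>w z. G w z v) u) x = SB M (\<lambda>u v. SB M (\<lambda>w z. G u w z) v) x"
proof -
  obtain \<phi> where \<phi>: "\<phi> \<in> mod_hom R (tens R B (Suc (Suc 0)) B) M"
    "\<And>u v y. u \<in> carrier B \<Longrightarrow> v \<in> carrier B \<Longrightarrow> y \<in> carrier B \<Longrightarrow> \<phi> (ptens R B B [u, v] y) = G u v y"
    using triple_lift_ex[OF mB mB assms(1-4)] by metis
  have p: "ptens R B B [u, v] w \<in> carrier (tens R B (Suc (Suc 0)) B)"
    if "u \<in> carrier B" "v \<in> carrier B" "w \<in> carrier B" for u v w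
    using that by (intro ptens_closed[OF mB mB]) simp
  note m2 = tens_module[OF mB mB, of "Suc (Suc 0)"]
  have "coalgebra R B" using bialg by (simp add: bialgebra_def)
  from coalgebra.coassoc[OF this assms(5)] assms(5)
  have "SB (tens R B (Suc (Suc 0)) B) (\<lambda>u v. SB (tens R B (Suc (Suc 0)) B) (\<lambda>w z. ptens R B B [w, z] v) u) x =
     SB (tens R B (Suc (Suc 0)) B) (\<lambda>u v. SB (tens R B (Suc (Suc 0)) B) (\<lambda>w z. ptens R B B [u, w] z) v) x"
    by (simp add: tens_lift_SB numeral_2_eq_2)
  from arg_cong[OF this, of \<phi>] show ?thesis
    using assms(1,5) m2 p by (simp add: S_push[OF \<phi>(1)] \<phi>(2))
qed

lemma SX_coassoc:
  assumes "module R M"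
    and "\<And>u v. u \<in> carrier X \<Longrightarrow> v \<in> carrier X \<Longrightarrow> (\<lambda>y. G u v y) \<in> mod_hom R X M"
    and "\<And>u y. u \<in> carrier X \<Longrightarrow> y \<in> carrier X \<Longrightarrow> (\<lambda>v. G u v y) \<in> mod_hom R X M"
    and "\<And>v y. v \<in> carrier X \<Longrightarrow> y \<in> carrier X \<Longrightarrow> (\<lambda>u. G u v y) \<in> mod_hom R X M"
    and "x \<in> carrier X"
  shows "SX M (\<lambda>u v. SX M (\<lambda>w z. G w z v) u) x = SX M (\<lambda>u v. SX M (\<lambda>w z. G u w z) v) x"
proof -
  obtain \<phi> where \<phi>: "\<phi> \<in> mod_hom R (tens R X (Suc (Suc 0)) X) M"
    "\<And>u v y. u \<in> carrier X \<Longrightarrow> v \<in> carrier X \<Longrightarrow> y \<in> carrier X \<Longrightarrow> \<phi> (ptens R X X [u, v] y) = G u v y"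
    using triple_lift_ex[OF mX mX assms(1-4)] by metis
  have p: "ptens R X X [u, v] w \<in> carrier (tens R X (Suc (Suc 0)) X)"
    if "u \<in> carrier X" "v \<in> carrier X" "w \<in> carrier X" for u v w
    using that by (intro ptens_closed[OF mX mX]) simp
  note m2 = tens_module[OF mX mX, of "Suc (Suc 0)"]
  have "coalgebra R X" using modcoalg by (simp add: module_coalgebra_def)
  from coalgebra.coassoc[OF this assms(5)] assms(5)
  have "SX (tens R X (Suc (Suc 0)) X) (\<lambda>u v. SX (tens R X (Suc (Suc 0)) X) (\<lambda>w z. ptens R X X [w, z] v) u) x =
     SX (tens R X (Suc (Suc 0)) X) (\<lambda>u v. SX (tens R X (Suc (Suc 0)) X) (\<lambda>w z. ptens R X X [u, w] z) v) x"
    by (simp add: tens_lift_SX numeral_2_eq_2)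
  from arg_cong[OF this, of \<phi>] show ?thesis
    using assms(1,5) m2 p by (simp add: S_push[OF \<phi>(1)] \<phi>(2))
qed

lemma SY_coassoc:
  assumes "module R M"
    and "\<And>u v. u \<in> carrier B \<Longrightarrow> v \<in> carrier B \<Longrightarrow> (\<lambda>y. G u v y) \<in> mod_hom R Y M"
    and "\<And>u y. u \<in> carrier B \<Longrightarrow> y \<in> carrier Y \<Longrightarrow> (\<lambda>v. G u v y) \<in> mod_hom R B M"
    and "\<And>v y. v \<in> carrier B \<Longrightarrow> y \<in> carrier Y \<Longrightarrow> (\<lambda>u. G u v y) \<in> mod_hom R B M"
    and "x \<in> carrier Y"
  shows "SY M (\<lambda>u v. SB M (\<lambda>w z. G w z v) u) x = SY M (\<lambda>u v. SY M (\<lambda>w z. G u w z) v) x"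
proof -
  obtain \<phi> where \<phi>: "\<phi> \<in> mod_hom R (tens R B (Suc (Suc 0)) Y) M"
    "\<And>u v y. u \<in> carrier B \<Longrightarrow> v \<in> carrier B \<Longrightarrow> y \<in> carrier Y \<Longrightarrow> \<phi> (ptens R B Y [u, v] y) = G u v y"
    using triple_lift_ex[OF mB mY assms(1-4)] by metis
  have p: "ptens R B Y [u, v] w \<in> carrier (tens R B (Suc (Suc 0)) Y)"
    if "u \<in> carrier B" "v \<in> carrier B" "w \<in> carrier Y" for u v w
    using that by (intro ptens_closed[OF mB mY]) simp
  note m2 = tens_module[OF mB mY, of "Suc (Suc 0)"]
  have "left_comodule R B Y coact" using modcomod by (simp add: module_comodule_def)
  from left_comodule.coact_coassoc[OF this assms(5)] assms(5)
  have "SY (tens R B (Suc (Suc 0)) Y) (\<lambda>u v. SB (tens R B (Suc (Suc 0)) Y) (\<lambda>w z. ptens R B Y [w, z] v) u) x =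
     SY (tens R B (Suc (Suc 0)) Y) (\<lambda>u v. SY (tens R B (Suc (Suc 0)) Y) (\<lambda>w z. ptens R B Y [u, w] z) v) x"
    by (simp add: tens_lift_SB tens_lift_SY numeral_2_eq_2)
  from arg_cong[OF this, of \<phi>] show ?thesis
    using assms(1,5) m2 p by (simp add: S_push[OF \<phi>(1)] \<phi>(2))
qed

lemma SB_counit_left:
  assumes "module R M" "f \<in> mod_hom R B M" "x \<in> carrier B"
  shows "SB M (\<lambda>u v. counit B u \<odot>\<^bsub>M\<^esub> f v) x = f x"
proof -
  have "coalgebra R B" using bialg by (simp add: bialgebra_def)
  from coalgebra.counit_left[OF this assms(3)] assms(3)
  have "SB B (\<lambda>u v. counit B u \<odot>\<^bsub>B\<^esub> v) x = x" by (simp add: tens_lift_SB)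
  from arg_cong[OF this, of f] show ?thesis
    using assms module.smult_closed[OF mB] by (simp add: S_push[OF assms(2)] mod_hom_smult[OF assms(2)])
qed

lemma SB_counit_right:
  assumes "module R M" "f \<in> mod_hom R B M" "x \<in> carrier B"
  shows "SB M (\<lambda>u v. counit B v \<odot>\<^bsub>M\<^esub> f u) x = f x"
proof -
  have "coalgebra R B" using bialg by (simp add: bialgebra_def)
  from coalgebra.counit_right[OF this assms(3)] assms(3)
  have "SB B (\<lambda>u v. counit B v \<odot>\<^bsub>B\<^esub> u) x = x" by (simp add: tens_lift_SB)
  from arg_cong[OF this, of f] show ?thesis
    using assms module.smult_closed[OF mB] by (simp add: S_push[OF assms(2)] mod_hom_smult[OF assms(2)])
qed

lemma SY_counit:
  assumes "module R M" "f \<in> mod_hom R Y M" "x \<in> carrier Y"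
  shows "SY M (\<lambda>u v. counit B u \<odot>\<^bsub>M\<^esub> f v) x = f x"
proof -
  have "left_comodule R B Y coact" using modcomod by (simp add: module_comodule_def)
  from left_comodule.coact_counit[OF this assms(3)] assms(3)
  have "SY Y (\<lambda>u v. counit B u \<odot>\<^bsub>Y\<^esub> v) x = x" by (simp add: tens_lift_SY)
  from arg_cong[OF this, of f] show ?thesis
    using assms module.smult_closed[OF mY] by (simp add: S_push[OF assms(2)] mod_hom_smult[OF assms(2)])
qed

section \<open>The operators on the tensor powers\<close>

lemmas [lin] = SB_arg SX_arg SY_arg SB_body SX_body SY_body
  bilinear_lin1[OF bilinear_B] bilinear_lin2[OF bilinear_B]
  bilinear_lin1[OF bilinear_actX] bilinear_lin2[OF bilinear_actX]
  bilinear_lin1[OF bilinear_actY] bilinear_lin2[OF bilinear_actY]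
  bilinear_lin1[OF tcons_bilinear[OF mX mY]] bilinear_lin2[OF tcons_bilinear[OF mX mY]]
  mod_hom_comp[OF ptens_Nil_hom[OF mX mY]]

lemmas cons_closed [simp] = bilinear_closed[OF tcons_bilinear[OF mX mY]]
lemmas unit_closed [simp] = mod_hom_closed[OF ptens_Nil_hom[OF mX mY]]
lemmas cons_push = S_push[OF tcons_hom[OF mX mY] mT mT]

text \<open>The diagonal action \<open>L\<^sub>b\<close>, by \<open>L\<^sub>b (x \<otimes> \<xi>) = b\<^sub>(\<^sub>1\<^sub>) x \<otimes> L\<^bsub>b(2)\<^esub> \<xi>\<close>.\<close>

primrec actn :: "nat \<Rightarrow> 'b \<Rightarrow> ('x list \<times> 'y \<Rightarrow> 'a) set \<Rightarrow> ('x list \<times> 'y \<Rightarrow> 'a) set"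
  where
    "actn 0 b = nil_lift R (T 0) (\<lambda>y. unit (actY b y))"
  | "actn (Suc n) b = cons_lift R X Y (T (Suc n))
      (\<lambda>x \<xi>. SB (T (Suc n)) (\<lambda>c d. cons n (actX c x) (actn n d \<xi>)) b)"

lemma actn_bilinear: "bilinear R B (T n) (T n) (actn n)"
proof (induction n)
  case 0
  show ?case unfolding actn.simps
    by (intro nil_lift_bilinear bilinearI lin) simp_all
next
  case (Suc n)
  note [lin] = bilinear_lin1[OF Suc] bilinear_lin2[OF Suc]
  show ?case unfolding actn.simps
    by (intro cons_lift_bilinear bilinearI lin) (simp_all add: bilinear_closed[OF Suc])
qed

lemmas [lin] = bilinear_lin1[OF actn_bilinear] bilinear_lin2[OF actn_bilinear]
lemmas actn_closed [simp] = bilinear_closed[OF actn_bilinear]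
lemmas actn_push = S_push[OF bilinearD(1)[OF actn_bilinear] mT mT]

lemma actn_unit: "b \<in> carrier B \<Longrightarrow> y \<in> carrier Y \<Longrightarrow> actn 0 b (unit y) = unit (actY b y)"
  unfolding actn.simps by (rule nil_lift_ptens[OF mX mY mT]) (intro lin; simp)

lemma actn_cons:
  assumes "b \<in> carrier B" "x \<in> carrier X" "\<xi> \<in> carrier (T n)"
  shows "actn (Suc n) b (cons n x \<xi>) = SB (T (Suc n)) (\<lambda>c d. cons n (actX c x) (actn n d \<xi>)) b"
proof -
  have "bilinear R X (T n) (T (Suc n)) (\<lambda>x \<xi>. SB (T (Suc n)) (\<lambda>c d. cons n (actX c x) (actn n d \<xi>)) b)"
    using assms(1) by (intro bilinearI lin) simp_all
  from cons_lift_tcons[OF mX mY mT this assms(2,3)] show ?thesis by simp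
qed

declare actn.simps [simp del]

text \<open>The operator \<open>\<tau>\<^sup>-\<^sup>1\<close> removes the first factor \<open>x\<close> and then inserts \<open>y\<^sub>(\<^sub>-\<^sub>1\<^sub>) x\<close> in front of
  \<open>y\<^sub>(\<^sub>0\<^sub>)\<close>.  The second half is \<open>rho n x\<close>; it acts at the far end and so commutes with
  multiplication by a first factor, which makes recursion possible.\<close>

primrec rho :: "nat \<Rightarrow> 'x \<Rightarrow> ('x list \<times> 'y \<Rightarrow> 'a) set \<Rightarrow> ('x list \<times> 'y \<Rightarrow> 'a) set"
  where
    "rho 0 x = nil_lift R (T (Suc 0)) (\<lambda>y. SY (T (Suc 0)) (\<lambda>b z. cons 0 (actX b x) (unit z)) y)"
  | "rho (Suc n) x = cons_lift R X Y (T (Suc (Suc n))) (\<lambda>u \<xi>. cons (Suc n) u (rho n x \<xi>))"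

lemma rho_bilinear: "bilinear R X (T n) (T (Suc n)) (rho n)"
proof (induction n)
  case 0
  show ?case unfolding rho.simps
    by (intro nil_lift_bilinear bilinearI lin) simp_all
next
  case (Suc n)
  note [lin] = bilinear_lin1[OF Suc] bilinear_lin2[OF Suc]
  show ?case unfolding rho.simps
    by (intro cons_lift_bilinear bilinearI lin) (simp_all add: bilinear_closed[OF Suc])
qed

lemmas [lin] = bilinear_lin1[OF rho_bilinear] bilinear_lin2[OF rho_bilinear]
lemmas rho_closed [simp] = bilinear_closed[OF rho_bilinear]
lemmas rho_push = S_push[OF bilinearD(1)[OF rho_bilinear] mT mT]

lemma rho_unit:
  assumes "x \<in> carrier X" "y \<in> carrier Y"
  shows "rho 0 x (unit y) = SY (T (Suc 0)) (\<lambda>b z. cons 0 (actX b x) (unit z)) y"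
  unfolding rho.simps
  by (rule nil_lift_ptens[OF mX mY mT _ assms(2)]) (use assms in \<open>intro bilinearI lin; simp\<close>)

lemma rho_cons:
  assumes "x \<in> carrier X" "u \<in> carrier X" "\<xi> \<in> carrier (T n)"
  shows "rho (Suc n) x (cons n u \<xi>) = cons (Suc n) u (rho n x \<xi>)"
proof -
  have "bilinear R X (T n) (T (Suc (Suc n))) (\<lambda>u \<xi>. cons (Suc n) u (rho n x \<xi>))"
    using assms(1) by (intro bilinearI lin) simp_all
  from cons_lift_tcons[OF mX mY mT this assms(2,3)] show ?thesis by simp
qed

declare rho.simps [simp del]

definition tinv :: "nat \<Rightarrow> ('x list \<times> 'y \<Rightarrow> 'a) set \<Rightarrow> ('x list \<times> 'y \<Rightarrow> 'a) set"
  where "tinv n = cons_lift R X Y (T (Suc n)) (rho n)"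

lemma tinv_hom: "tinv n \<in> mod_hom R (T (Suc n)) (T (Suc n))"
  unfolding tinv_def by (rule cons_lift_hom[OF mX mY mT rho_bilinear])

lemmas [lin] = mod_hom_comp[OF tinv_hom]
lemmas tinv_closed [simp] = mod_hom_closed[OF tinv_hom]
lemmas tinv_push = S_push[OF tinv_hom mT mT]

lemma tinv_cons: "x \<in> carrier X \<Longrightarrow> \<xi> \<in> carrier (T n) \<Longrightarrow> tinv n (cons n x \<xi>) = rho n x \<xi>"
  unfolding tinv_def by (rule cons_lift_tcons[OF mX mY mT rho_bilinear])

text \<open>The coproduct of \<open>X\<close> applied to the factor with index \<open>j\<close>, that is, the coface maps other than the
  last one.\<close>

primrec spl :: "nat \<Rightarrow> nat \<Rightarrow> ('x list \<times> 'y \<Rightarrow> 'a) set \<Rightarrow> ('x list \<times> 'y \<Rightarrow> 'a) set"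
  where
    "spl 0 n = cons_lift R X Y (T (Suc (Suc n)))
      (\<lambda>x \<xi>. SX (T (Suc (Suc n))) (\<lambda>u v. cons (Suc n) u (cons n v \<xi>)) x)"
  | "spl (Suc j) n = cons_lift R X Y (T (Suc (Suc n))) (\<lambda>x \<xi>. cons (Suc n) x (spl j (n - 1) \<xi>))"

lemma spl_0_bilinear: "bilinear R X (T n) (T (Suc (Suc n)))
    (\<lambda>x \<xi>. SX (T (Suc (Suc n))) (\<lambda>u v. cons (Suc n) u (cons n v \<xi>)) x)"
  by (intro bilinearI lin) simp_all

lemma spl_hom: "j \<le> n \<Longrightarrow> spl j n \<in> mod_hom R (T (Suc n)) (T (Suc (Suc n)))"
proof (induction j arbitrary: n)
  case 0
  show ?case unfolding spl.simps by (rule cons_lift_hom[OF mX mY mT spl_0_bilinear])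
next
  case (Suc j)
  then obtain m where n: "n = Suc m" "j \<le> m" by (cases n) auto
  note hom = Suc.IH[OF n(2)]
  note [lin] = mod_hom_comp[OF hom]
  show ?case unfolding spl.simps n(1)
    by (intro cons_lift_hom[OF mX mY mT] bilinearI) (simp_all, (intro lin, simp_all add: mod_hom_closed[OF hom])+)
qed

lemmas spl_lin [lin] = mod_hom_comp[OF spl_hom]
lemmas spl_closed [simp] = mod_hom_closed[OF spl_hom]
lemmas spl_push = S_push[OF spl_hom mT mT]

lemma spl_0_cons:
  "x \<in> carrier X \<Longrightarrow> \<xi> \<in> carrier (T n) \<Longrightarrow>
    spl 0 n (cons n x \<xi>) = SX (T (Suc (Suc n))) (\<lambda>u v. cons (Suc n) u (cons n v \<xi>)) x"
  unfolding spl.simps by (rule cons_lift_tcons[OF mX mY mT spl_0_bilinear])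

lemma spl_Suc_cons:
  assumes "j \<le> n" "x \<in> carrier X" "\<xi> \<in> carrier (T (Suc n))"
  shows "spl (Suc j) (Suc n) (cons (Suc n) x \<xi>) = cons (Suc (Suc n)) x (spl j n \<xi>)"
proof -
  have "bilinear R X (T (Suc n)) (T (Suc (Suc (Suc n)))) (\<lambda>x \<xi>. cons (Suc (Suc n)) x (spl j n \<xi>))"
    using assms(1) by (intro bilinearI lin) simp_all
  from cons_lift_tcons[OF mX mY mT this assms(2,3)] show ?thesis by simp
qed

declare spl.simps [simp del]

lemmas push = cons_push actn_push rho_push tinv_push spl_push

lemma Suc_eqI:
  assumes "\<phi> \<in> mod_hom R (T (Suc n)) (T k)" "\<psi> \<in> mod_hom R (T (Suc n)) (T k)" "t \<in> carrier (T (Suc n))"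
    and "\<And>x \<xi>. x \<in> carrier X \<Longrightarrow> \<xi> \<in> carrier (T n) \<Longrightarrow> \<phi> (cons n x \<xi>) = \<psi> (cons n x \<xi>)"
  shows "\<phi> t = \<psi> t"
  by (rule tens_hom_Suc_eqI[OF mX mY assms(1,2) mT assms(3,4)])

lemma nil_eqI:
  assumes "\<phi> \<in> mod_hom R (T 0) (T k)" "\<psi> \<in> mod_hom R (T 0) (T k)" "t \<in> carrier (T 0)"
    and "\<And>y. y \<in> carrier Y \<Longrightarrow> \<phi> (unit y) = \<psi> (unit y)"
  shows "\<phi> t = \<psi> t"
  by (rule tens_hom_0_eqI[OF mX mY assms(1,2) mT assms(3,4)])

section \<open>The cosimplicial and cyclic identities on the tensor powers\<close>

text \<open>For \<open>i = j = 0\<close> this is coassociativity; for \<open>i = 0 < j\<close> the two splittings act on different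
  factors; the rest follows by removing the first factor.\<close>

lemma spl_spl:
  assumes "i \<le> j" "j \<le> n" "\<xi> \<in> carrier (T (Suc n))"
  shows "spl i (Suc n) (spl j n \<xi>) = spl (Suc j) (Suc n) (spl i n \<xi>)"
  using assms
proof (induction i arbitrary: j n \<xi>)
  case 0
  note prems = 0
  show ?case
  proof (cases j)
    case [simp]: 0
    show ?thesis
    proof (rule Suc_eqI[where k = "Suc (Suc (Suc n))", OF _ _ prems(3)])
      fix x \<xi> assume x: "x \<in> carrier X" and \<xi>: "\<xi> \<in> carrier (T n)"
      let ?M = "T (Suc (Suc (Suc n)))"
      have "spl 0 (Suc n) (spl 0 n (cons n x \<xi>)) =
          SX ?M (\<lambda>u v. SX ?M (\<lambda>w z. cons (Suc (Suc n)) w (cons (Suc n) z (cons n v \<xi>))) u) x"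
        using x \<xi> by (simp add: spl_0_cons push)
      also have "\<dots> = SX ?M (\<lambda>u v. SX ?M (\<lambda>w z. cons (Suc (Suc n)) u (cons (Suc n) w (cons n z \<xi>))) v) x"
        using x \<xi> by (intro SX_coassoc lin) simp_all
      also have "\<dots> = spl (Suc 0) (Suc n) (spl 0 n (cons n x \<xi>))"
        using x \<xi> by (simp add: spl_0_cons spl_Suc_cons push)
      finally show "spl 0 (Suc n) (spl j n (cons n x \<xi>)) = spl (Suc j) (Suc n) (spl 0 n (cons n x \<xi>))" by simp
    qed (intro lin; simp)+
  next
    case (Suc j')
    with prems obtain m where [simp]: "n = Suc m" "j = Suc j'" and j: "j' \<le> m" by (cases n) auto
    show ?thesis
    proof (rule Suc_eqI[where k = "Suc (Suc (Suc n))", OF _ _ prems(3)])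
      fix x \<xi> assume x: "x \<in> carrier X" and \<xi>: "\<xi> \<in> carrier (T n)"
      then show "spl 0 (Suc n) (spl j n (cons n x \<xi>)) = spl (Suc j) (Suc n) (spl 0 n (cons n x \<xi>))"
        using j by (simp add: spl_0_cons spl_Suc_cons push)
    qed (use prems j in \<open>intro lin; simp\<close>)+
  qed
next
  case (Suc i)
  then obtain m j' where [simp]: "n = Suc m" "j = Suc j'" and j: "j' \<le> m" "i \<le> j'" by (cases n; cases j) auto
  show ?case
  proof (rule Suc_eqI[where k = "Suc (Suc (Suc n))", OF _ _ Suc(4)])
    fix x \<xi> assume x: "x \<in> carrier X" and \<xi>: "\<xi> \<in> carrier (T n)"
    then show "spl (Suc i) (Suc n) (spl j n (cons n x \<xi>)) = spl (Suc j) (Suc n) (spl (Suc i) n (cons n x \<xi>))"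
      using j Suc.IH[OF j(2,1), of \<xi>] by (simp add: spl_Suc_cons)
  qed (use Suc j in \<open>intro lin; simp\<close>)+
qed

lemma rho_spl:
  assumes "j \<le> m" "x \<in> carrier X" "\<xi> \<in> carrier (T (Suc m))"
  shows "rho (Suc (Suc m)) x (spl j m \<xi>) = spl j (Suc m) (rho (Suc m) x \<xi>)"
  using assms(1,3)
proof (induction j arbitrary: m \<xi>)
  case 0
  show ?case
  proof (rule Suc_eqI[where k = "Suc (Suc (Suc m))", OF _ _ 0(2)])
    fix u \<zeta> assume u: "u \<in> carrier X" and \<zeta>: "\<zeta> \<in> carrier (T m)"
    then show "rho (Suc (Suc m)) x (spl 0 m (cons m u \<zeta>)) = spl 0 (Suc m) (rho (Suc m) x (cons m u \<zeta>))"
      using assms(2) by (simp add: spl_0_cons rho_cons push)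
  qed (use assms(2) in \<open>intro lin; simp\<close>)+
next
  case (Suc j)
  then obtain k where [simp]: "m = Suc k" and j: "j \<le> k" by (cases m) auto
  show ?case
  proof (rule Suc_eqI[where k = "Suc (Suc (Suc m))", OF _ _ Suc(3)])
    fix u \<zeta> assume u: "u \<in> carrier X" and \<zeta>: "\<zeta> \<in> carrier (T m)"
    then show "rho (Suc (Suc m)) x (spl (Suc j) m (cons m u \<zeta>)) = spl (Suc j) (Suc m) (rho (Suc m) x (cons m u \<zeta>))"
      using assms(2) j Suc.IH[OF j, of \<zeta>] by (simp add: spl_Suc_cons rho_cons)
  qed (use assms(2) j in \<open>intro lin; simp\<close>)+
qed

text \<open>A factor other than the last one of \<open>tinv n \<xi>\<close> is a factor of \<open>\<xi>\<close>, with index one higher.\<close>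

lemma spl_tinv_shift:
  assumes "j < n" "\<xi> \<in> carrier (T (Suc n))"
  shows "spl j n (tinv n \<xi>) = tinv (Suc n) (spl (Suc j) n \<xi>)"
proof -
  from assms(1) obtain m where [simp]: "n = Suc m" and j: "j \<le> m" by (cases n) auto
  show ?thesis
  proof (rule Suc_eqI[where k = "Suc (Suc n)", OF _ _ assms(2)])
    fix x \<zeta> assume "x \<in> carrier X" "\<zeta> \<in> carrier (T n)"
    then show "spl j n (tinv n (cons n x \<zeta>)) = tinv (Suc n) (spl (Suc j) n (cons n x \<zeta>))"
      using j by (simp add: spl_Suc_cons tinv_cons rho_spl)
  qed (use j in \<open>intro lin; simp\<close>)+
qed

text \<open>Splitting the last factor of \<open>rho n x \<xi>\<close>, which is \<open>y\<^sub>(\<^sub>-\<^sub>1\<^sub>) x\<close>: the coproduct of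
  \<open>X\<close> is \<open>B\<close>-linear and the coaction is coassociative.\<close>

lemma spl_last_rho:
  assumes "x \<in> carrier X" "\<xi> \<in> carrier (T n)"
  shows "spl n n (rho n x \<xi>) = SX (T (Suc (Suc n))) (\<lambda>u v. rho (Suc n) v (rho n u \<xi>)) x"
  using assms(2)
proof (induction n arbitrary: \<xi>)
  case 0
  show ?case
  proof (rule nil_eqI[where k = "Suc (Suc 0)", OF _ _ 0])
    fix y assume y: "y \<in> carrier Y"
    let ?M = "T (Suc (Suc 0))"
    have "spl 0 0 (rho 0 x (unit y)) =
        SY ?M (\<lambda>b z. SX ?M (\<lambda>u v. cons (Suc 0) u (cons 0 v (unit z))) (actX b x)) y"
      using assms(1) y by (simp add: rho_unit spl_0_cons push)
    also have "\<dots> = SY ?M (\<lambda>b z. SB ?M (\<lambda>c d. SX ?M (\<lambda>u v. cons (Suc 0) (actX c u) (cons 0 (actX d v) (unit z))) x) b) y"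
    proof (rule SY_cong)
      fix b z assume b: "b \<in> carrier B" and z: "z \<in> carrier Y"
      show "SX ?M (\<lambda>u v. cons (Suc 0) u (cons 0 v (unit z))) (actX b x) =
          SB ?M (\<lambda>c d. SX ?M (\<lambda>u v. cons (Suc 0) (actX c u) (cons 0 (actX d v) (unit z))) x) b"
        using assms(1) b z by (intro SX_act bilinearI lin) simp_all
    qed (use y in simp_all)
    also have "\<dots> = SY ?M (\<lambda>b z. SY ?M (\<lambda>c w. SX ?M (\<lambda>u v. cons (Suc 0) (actX b u) (cons 0 (actX c v) (unit w))) x) z) y"
      using assms(1) y by (intro SY_coassoc bilinearI lin) simp_all
    also have "\<dots> = SY ?M (\<lambda>b z. SX ?M (\<lambda>u v. SY ?M (\<lambda>c w. cons (Suc 0) (actX b u) (cons 0 (actX c v) (unit w))) z) x) y"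
      using assms(1) y by (simp add: SX_SY_swap)
    also have "\<dots> = SX ?M (\<lambda>u v. SY ?M (\<lambda>b z. SY ?M (\<lambda>c w. cons (Suc 0) (actX b u) (cons 0 (actX c v) (unit w))) z) y) x"
      using assms(1) y by (subst SX_SY_swap) simp_all
    also have "\<dots> = SX ?M (\<lambda>u v. rho (Suc 0) v (rho 0 u (unit y))) x"
      using assms(1) y by (simp add: rho_unit rho_cons push)
    finally show "spl 0 0 (rho 0 x (unit y)) = SX ?M (\<lambda>u v. rho (Suc 0) v (rho 0 u (unit y))) x" .
  qed (use assms in \<open>intro lin; simp\<close>)+
next
  case (Suc n)
  show ?case
  proof (rule Suc_eqI[where k = "Suc (Suc (Suc n))", OF _ _ Suc(2)])
    fix u \<zeta> assume "u \<in> carrier X" "\<zeta> \<in> carrier (T n)"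
    then show "spl (Suc n) (Suc n) (rho (Suc n) x (cons n u \<zeta>)) =
        SX (T (Suc (Suc (Suc n)))) (\<lambda>a b. rho (Suc (Suc n)) b (rho (Suc n) a (cons n u \<zeta>))) x"
      using assms(1) Suc.IH[of \<zeta>] by (simp add: spl_Suc_cons rho_cons push)
  qed (use assms in \<open>intro lin; simp\<close>)+
qed

text \<open>On \<open>x \<otimes> \<zeta>\<close>, both applications of \<open>tinv\<close> on the right move a half of the coproduct of \<open>x\<close>
  to the end, which is what \<open>spl_last_rho\<close> finds on the left.\<close>

lemma spl_last_tinv:
  assumes "\<xi> \<in> carrier (T (Suc n))"
  shows "spl n n (tinv n \<xi>) = tinv (Suc n) (tinv (Suc n) (spl 0 n \<xi>))"
proof (rule Suc_eqI[where k = "Suc (Suc n)", OF _ _ assms])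
  fix x \<zeta> assume "x \<in> carrier X" "\<zeta> \<in> carrier (T n)"
  then show "spl n n (tinv n (cons n x \<zeta>)) = tinv (Suc n) (tinv (Suc n) (spl 0 n (cons n x \<zeta>)))"
    by (simp add: spl_0_cons tinv_cons spl_last_rho rho_cons push)
qed (intro lin; simp)+

text \<open>The coproduct of \<open>X\<close> is \<open>B\<close>-linear, and by coassociativity of \<open>B\<close> both sides use the
  same iterated coproduct of \<open>b\<close>.\<close>

lemma actn_spl:
  assumes "j \<le> n" "b \<in> carrier B" "\<xi> \<in> carrier (T (Suc n))"
  shows "spl j n (actn (Suc n) b \<xi>) = actn (Suc (Suc n)) b (spl j n \<xi>)"
  using assms
proof (induction j arbitrary: n b \<xi>)
  case 0
  show ?case
  proof (rule Suc_eqI[where k = "Suc (Suc n)", OF _ _ 0(3)])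
    fix x \<zeta> assume x: "x \<in> carrier X" and \<zeta>: "\<zeta> \<in> carrier (T n)"
    let ?M = "T (Suc (Suc n))"
    have "spl 0 n (actn (Suc n) b (cons n x \<zeta>)) =
        SB ?M (\<lambda>c d. SX ?M (\<lambda>u v. cons (Suc n) u (cons n v (actn n d \<zeta>))) (actX c x)) b"
      using 0 x \<zeta> by (simp add: actn_cons spl_0_cons push)
    also have "\<dots> = SB ?M (\<lambda>c d. SB ?M (\<lambda>e f. SX ?M (\<lambda>u v. cons (Suc n) (actX e u) (cons n (actX f v) (actn n d \<zeta>))) x) c) b"
    proof (rule SB_cong)
      fix c d assume c: "c \<in> carrier B" and d: "d \<in> carrier B"
      show "SX ?M (\<lambda>u v. cons (Suc n) u (cons n v (actn n d \<zeta>))) (actX c x) =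
          SB ?M (\<lambda>e f. SX ?M (\<lambda>u v. cons (Suc n) (actX e u) (cons n (actX f v) (actn n d \<zeta>))) x) c"
        using c d x \<zeta> by (intro SX_act bilinearI lin) simp_all
    qed (use 0 in simp_all)
    also have "\<dots> = SB ?M (\<lambda>c d. SB ?M (\<lambda>e f. SX ?M (\<lambda>u v. cons (Suc n) (actX c u) (cons n (actX e v) (actn n f \<zeta>))) x) d) b"
      using 0 x \<zeta> by (intro SB_coassoc bilinearI lin) simp_all
    also have "\<dots> = SB ?M (\<lambda>c d. SX ?M (\<lambda>u v. SB ?M (\<lambda>e f. cons (Suc n) (actX c u) (cons n (actX e v) (actn n f \<zeta>))) d) x) b"
      using 0 x \<zeta> by (simp add: SB_SX_swap)
    also have "\<dots> = SX ?M (\<lambda>u v. SB ?M (\<lambda>c d. SB ?M (\<lambda>e f. cons (Suc n) (actX c u) (cons n (actX e v) (actn n f \<zeta>))) d) b) x"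
      using 0 x \<zeta> by (subst SB_SX_swap) simp_all
    also have "\<dots> = actn (Suc (Suc n)) b (spl 0 n (cons n x \<zeta>))"
      using 0 x \<zeta> by (simp add: actn_cons spl_0_cons push)
    finally show "spl 0 n (actn (Suc n) b (cons n x \<zeta>)) = actn (Suc (Suc n)) b (spl 0 n (cons n x \<zeta>))" .
  qed (use 0 in \<open>intro lin; simp\<close>)+
next
  case (Suc j)
  then obtain k where [simp]: "n = Suc k" and j: "j \<le> k" by (cases n) auto
  show ?case
  proof (rule Suc_eqI[where k = "Suc (Suc n)", OF _ _ Suc(4)])
    fix x \<zeta> assume "x \<in> carrier X" "\<zeta> \<in> carrier (T n)"
    then show "spl (Suc j) n (actn (Suc n) b (cons n x \<zeta>)) = actn (Suc (Suc n)) b (spl (Suc j) n (cons n x \<zeta>))"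
      using Suc.prems j Suc.IH[OF j] by (simp add: spl_Suc_cons actn_cons push)
  qed (use Suc.prems j in \<open>intro lin; simp\<close>)+
qed

text \<open>The coproduct of \<open>B\<close> is multiplicative.\<close>

lemma actn_mult:
  assumes "b \<in> carrier B" "c \<in> carrier B" "\<xi> \<in> carrier (T n)"
  shows "actn n (mulB b c) \<xi> = actn n b (actn n c \<xi>)"
  using assms
proof (induction n arbitrary: b c \<xi>)
  case 0
  show ?case
    by (rule nil_eqI[where k = "0", OF _ _ 0(3)]) (use 0 in \<open>(intro lin; simp) | simp add: actn_unit actY_mult\<close>)+
next
  case (Suc n)
  show ?case
  proof (rule Suc_eqI[where k = "Suc n", OF _ _ Suc(4)])
    fix x \<zeta> assume x: "x \<in> carrier X" and \<zeta>: "\<zeta> \<in> carrier (T n)"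
    let ?M = "T (Suc n)"
    have "actn (Suc n) (mulB b c) (cons n x \<zeta>) = SB ?M (\<lambda>d e. cons n (actX d x) (actn n e \<zeta>)) (mulB b c)"
      using Suc x \<zeta> by (simp add: actn_cons)
    also have "\<dots> = SB ?M (\<lambda>d e. SB ?M (\<lambda>f g. cons n (actX (mulB d f) x) (actn n (mulB e g) \<zeta>)) c) b"
      using Suc x \<zeta> by (intro SB_mult bilinearI lin) simp_all
    also have "\<dots> = SB ?M (\<lambda>d e. SB ?M (\<lambda>f g. cons n (actX d (actX f x)) (actn n e (actn n g \<zeta>))) c) b"
      using Suc x \<zeta> by (simp add: actX_mult)
    also have "\<dots> = actn (Suc n) b (actn (Suc n) c (cons n x \<zeta>))"
      using Suc x \<zeta> by (simp add: actn_cons push SB_SB_swap[of ?M b c])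
    finally show "actn (Suc n) (mulB b c) (cons n x \<zeta>) = actn (Suc n) b (actn (Suc n) c (cons n x \<zeta>))" .
  qed (use Suc in \<open>intro lin; simp\<close>)+
qed

lemma actn_one:
  assumes "\<xi> \<in> carrier (T n)"
  shows "actn n \<one>\<^bsub>B\<^esub> \<xi> = \<xi>"
  using assms
proof (induction n arbitrary: \<xi>)
  case 0
  show ?case
    by (rule nil_eqI[where k = "0", OF _ _ 0]) (use 0 in \<open>(intro lin; simp) | simp add: actn_unit actY_one\<close>)+
next
  case (Suc n)
  show ?case
  proof (rule Suc_eqI[where k = "Suc n", OF _ _ Suc(2)])
    fix x \<zeta> assume x: "x \<in> carrier X" and \<zeta>: "\<zeta> \<in> carrier (T n)"
    have "SB (T (Suc n)) (\<lambda>c d. cons n (actX c x) (actn n d \<zeta>)) \<one>\<^bsub>B\<^esub> = cons n (actX \<one>\<^bsub>B\<^esub> x) (actn n \<one>\<^bsub>B\<^esub> \<zeta>)"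
      using x \<zeta> by (intro SB_one bilinearI lin) simp_all
    then show "actn (Suc n) \<one>\<^bsub>B\<^esub> (cons n x \<zeta>) = cons n x \<zeta>"
      using x \<zeta> Suc.IH by (simp add: actn_cons actX_one)
  qed (intro lin; simp)+
qed

lemma actn_left_module: "left_module R B (T n) (actn n)"
proof (intro left_module.intro left_module_axioms.intro mT)
  note a1 = bilinearD(1)[OF actn_bilinear] and a2 = bilinearD(2)[OF actn_bilinear]
  fix a b c x y assume "a \<in> carrier R" "b \<in> carrier B" "x \<in> carrier (T n)"
  then show "actn n (a \<odot>\<^bsub>B\<^esub> b) x = a \<odot>\<^bsub>T n\<^esub> actn n b x" "actn n b (a \<odot>\<^bsub>T n\<^esub> x) = a \<odot>\<^bsub>T n\<^esub> actn n b x"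
    using mod_hom_smult[OF a1, of b a x n] mod_hom_smult[OF a2, of x n a b] by simp_all
next
  note a1 = bilinearD(1)[OF actn_bilinear] and a2 = bilinearD(2)[OF actn_bilinear]
  fix b c x y assume "b \<in> carrier B" "c \<in> carrier B" "x \<in> carrier (T n)"
  then show "actn n (b \<oplus>\<^bsub>B\<^esub> c) x = actn n b x \<oplus>\<^bsub>T n\<^esub> actn n c x"
    using mod_hom_add[OF a2, of x n b c] by simp
next
  note a1 = bilinearD(1)[OF actn_bilinear] and a2 = bilinearD(2)[OF actn_bilinear]
  fix b x y assume "b \<in> carrier B" "x \<in> carrier (T n)" "y \<in> carrier (T n)"
  then show "actn n b (x \<oplus>\<^bsub>T n\<^esub> y) = actn n b x \<oplus>\<^bsub>T n\<^esub> actn n b y"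
    using mod_hom_add[OF a1, of b x n y] by simp
qed (simp_all add: actn_mult actn_one)

end

section \<open>The operators on pure tensors\<close>

lemma module_coalgebra_regular:
  assumes "bialgebra R B"
  shows "module_coalgebra R B B (monoid.mult B)"
proof -
  have c: "coalgebra R B" using assms by (simp add: bialgebra_def)
  show ?thesis
    by (intro module_coalgebra.intro c regular_left_module[OF assms] module_coalgebra_axioms.intro
        bialgebra.comult_mult[OF assms] bialgebra.counit_mult[OF assms])
qed

lemma module_comodule_regular:
  assumes "bialgebra R B"
  shows "module_comodule R B B (monoid.mult B) (comult B)"
proof -
  have c: "coalgebra R B" using assms by (simp add: bialgebra_def)
  then have m: "module R B" by (simp add: coalgebra_def)
  show ?thesis
    by (intro module_comodule.intro left_comodule.intro left_comodule_axioms.intro m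
        regular_left_module[OF assms] coalgebra.comult_hom[OF c] coalgebra.coassoc[OF c]
        coalgebra.counit_left[OF c])
qed

text \<open>Taking \<open>X = Y = B\<close> makes the operators above available on tensor powers of \<open>B\<close>, where iterated
  coproducts live.\<close>

lemma sweedler_data_regular:
  "bialgebra R B \<Longrightarrow> sweedler_data R B B (monoid.mult B) B (monoid.mult B) (comult B)"
  by (intro sweedler_data.intro module_coalgebra_regular module_comodule_regular)

lemma tens_lift_tcons:
  assumes "module R X" "module R Y" "module R M" "multilinear R X (Suc n) Y M F"
    and "x \<in> carrier X" "t \<in> carrier (tens R X n Y)"
  shows "tens_lift R M F (tcons R X Y n x t) = tens_lift R M (\<lambda>(xs, y). F (x # xs, y)) t"
  using assms(5)
  by (intro tens_lift_eqI[OF assms(1,2) mod_hom_comp[OF tens_lift_hom[OF assms(1-4)] tcons_hom[OF assms(1,2,5)]] assms(3,6), symmetric])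
    (simp add: tcons_ptens[OF assms(1,2)] tens_lift_ptens[OF assms(1-4)])

lemma map2_update:
  "length xs = length ys \<Longrightarrow> i < length xs \<Longrightarrow> map2 f (xs[i := u]) ys = (map2 f xs ys)[i := f u (ys ! i)]"
  by (rule nth_equalityI) (auto simp: nth_list_update)

lemma tens_gens_snoc [simp]:
  "(xs @ [x], y) \<in> tens_gens X (Suc n) Y \<longleftrightarrow> x \<in> carrier X \<and> (xs, y) \<in> tens_gens X n Y"
  by (auto simp: tens_gens_def)

context sweedler_data
begin

lemmas cons_pure [simp] = tcons_ptens[OF mX mY]
lemmas ptens_closed' [simp] = ptens_closed[OF mX mY]

lemma gens_snd: "(xs, y) \<in> tens_gens X n Y \<Longrightarrow> z \<in> carrier Y \<Longrightarrow> (xs, z) \<in> tens_gens X n Y"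
  by (rule tens_gens_snd)

lemma gens_Y: "(xs, y) \<in> tens_gens X n Y \<Longrightarrow> y \<in> carrier Y"
  by (simp add: tens_gens_def)

text \<open>The recursively defined operators have the expected values on pure tensors, so they are the
  operators of the definition of \<open>\<bbbT>\<^sub>*(X,Y)\<close>.\<close>

lemma rho_pure:
  assumes "x \<in> carrier X" "(xs, y) \<in> tens_gens X n Y"
  shows "rho n x (ptens R X Y xs y) = SY (T (Suc n)) (\<lambda>b z. ptens R X Y (xs @ [actX b x]) z) y"
  using assms(2)
proof (induction n arbitrary: xs)
  case 0
  then show ?case using assms(1) by (simp add: tens_gens_0 rho_unit)
next
  case (Suc n)
  then obtain u xs' where xs: "xs = u # xs'" "u \<in> carrier X" "(xs', y) \<in> tens_gens X n Y"
    by (auto simp: tens_gens_Suc)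
  have "rho (Suc n) x (cons n u (ptens R X Y xs' y)) =
      SY (T (Suc (Suc n))) (\<lambda>b z. ptens R X Y (u # xs' @ [actX b x]) z) y"
    using xs(2,3) assms(1) Suc.IH[OF xs(3)] gens_snd[OF xs(3)] gens_Y[OF xs(3)]
    by (simp add: rho_cons push del: cons_pure) simp
  then show ?case using xs gens_Y[OF xs(3)] by simp
qed

lemma spl_pure:
  assumes "j \<le> n" "(xs, y) \<in> tens_gens X (Suc n) Y"
  shows "spl j n (ptens R X Y xs y) =
    SX (T (Suc (Suc n))) (\<lambda>u v. ptens R X Y (take j xs @ [u] @ [v] @ drop (Suc j) xs) y) (xs ! j)"
  using assms
proof (induction j arbitrary: n xs)
  case 0
  then obtain x xs' where xs: "xs = x # xs'" "x \<in> carrier X" "(xs', y) \<in> tens_gens X n Y"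
    by (auto simp: tens_gens_Suc)
  have "spl 0 n (cons n x (ptens R X Y xs' y)) = SX (T (Suc (Suc n))) (\<lambda>u v. ptens R X Y (u # v # xs') y) x"
    using xs(2,3) by (simp add: spl_0_cons del: cons_pure) simp
  then show ?case using xs by simp
next
  case (Suc j)
  then obtain m where n: "n = Suc m" "j \<le> m" by (cases n) auto
  with Suc obtain x xs' where xs: "xs = x # xs'" "x \<in> carrier X" "(xs', y) \<in> tens_gens X n Y"
    by (auto simp: tens_gens_Suc)
  have l: "length xs' = Suc m" "set xs' \<subseteq> carrier X" "y \<in> carrier Y" using xs(3) n by (auto simp: tens_gens_def)
  have c: "xs' ! j \<in> carrier X" using l n(2) by (auto simp: subset_iff)
  have g: "(take j xs' @ u # v # drop (Suc j) xs', y) \<in> tens_gens X (Suc (Suc m)) Y"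
    if "u \<in> carrier X" "v \<in> carrier X" for u v
    using l n(2) that by (auto simp: tens_gens_def dest: in_set_takeD in_set_dropD)
  have "spl (Suc j) n (cons n x (ptens R X Y xs' y)) =
      SX (T (Suc (Suc n))) (\<lambda>u v. ptens R X Y (x # take j xs' @ [u] @ [v] @ drop (Suc j) xs') y) (xs' ! j)"
    using xs(2,3) n Suc.IH[of m xs'] c g
    by (simp add: spl_Suc_cons push del: cons_pure) simp
  then show ?case using xs c by simp
qed

text \<open>The iterated comultiplication splits the last factor.  In the tensor powers of \<open>B\<close>, with \<open>B\<close>
  as a comodule over itself, this is the operator \<open>rho\<close> with second argument \<open>1\<close>.\<close>

lemma icomult_closed_Suc:
  assumes "b \<in> carrier B"
  shows "icomult R B n b \<in> carrier (tens R B n B)"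
    and "icomult R B (Suc n) b = SB (tens R B (Suc n) B) (\<lambda>u v. tcons R B B n u (icomult R B n v)) b"
proof -
  interpret D: sweedler_data R B B "monoid.mult B" B "monoid.mult B" "comult B"
    by (rule sweedler_data_regular[OF bialg])
  have rB: "ring B" using bialg by (simp add: bialgebra_def)
  have r_one: "mulB u \<one>\<^bsub>B\<^esub> = u" if "u \<in> carrier B" for u
    using monoid.r_one[OF ring.is_monoid[OF rB] that] .
  have SY: "D.SY M G c = SB M G c" for M :: "('a, ('b list \<times> 'b \<Rightarrow> 'a) set) module" and G c
    by (simp add: D.SY_def SB_def)
  have step: "icomult R B (Suc n) b = D.rho n \<one>\<^bsub>B\<^esub> (icomult R B n b)"
    if "icomult R B n b \<in> carrier (tens R B n B)" for n b
    unfolding icomult.simps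
  proof (rule tens_lift_eqI[OF mB mB _ D.mT that])
    show "D.rho n \<one>\<^bsub>B\<^esub> \<in> mod_hom R (tens R B n B) (tens R B (Suc n) B)"
      by (rule bilinearD(1)[OF D.rho_bilinear one_B])
    fix bs c assume g: "(bs, c) \<in> tens_gens B n B"
    have c: "c \<in> carrier B" using g by (simp add: tens_gens_def)
    have "tens_lift R (tens R B (Suc n) B) (\<lambda>(us, v). ptens R B B (bs @ us) v) (comult B c)
        = SB (tens R B (Suc n) B) (\<lambda>u v. ptens R B B (bs @ [u]) v) c"
      by (rule tens_lift_SB[OF c]) simp
    also have "\<dots> = D.rho n \<one>\<^bsub>B\<^esub> (ptens R B B bs c)"
      unfolding D.rho_pure[OF one_B g] SY using c by (intro SB_cong) (simp_all add: r_one)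
    finally show "(case (bs, c) of (bs, c) \<Rightarrow>
        tens_lift R (tens R B (Suc n) B) (\<lambda>(us, v). ptens R B B (bs @ us) v) (comult B c)) =
        D.rho n \<one>\<^bsub>B\<^esub> (ptens R B B bs c)" by simp
  qed
  have cl: "icomult R B n b \<in> carrier (tens R B n B)" if "b \<in> carrier B" for n b
    using that
  proof (induction n)
    case (Suc n)
    then show ?case by (simp only: step) (simp del: icomult.simps)
  qed simp
  show "icomult R B n b \<in> carrier (tens R B n B)" by (rule cl[OF assms])
  show "icomult R B (Suc n) b = SB (tens R B (Suc n) B) (\<lambda>u v. tcons R B B n u (icomult R B n v)) b"
  proof (induction n)
    case 0
    have "icomult R B (Suc 0) b = D.rho 0 \<one>\<^bsub>B\<^esub> (D.unit b)" using step[OF cl[OF assms], of 0] by simp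
    also have "\<dots> = SB (tens R B (Suc 0) B) (\<lambda>u v. tcons R B B 0 u (icomult R B 0 v)) b"
      unfolding D.rho_unit[OF one_B assms] SY using assms by (intro SB_cong) (simp_all add: r_one)
    finally show ?case .
  next
    case (Suc n)
    have "icomult R B (Suc (Suc n)) b = D.rho (Suc n) \<one>\<^bsub>B\<^esub> (icomult R B (Suc n) b)" by (rule step[OF cl[OF assms]])
    also have "\<dots> = SB (tens R B (Suc (Suc n)) B) (\<lambda>u v. D.rho (Suc n) \<one>\<^bsub>B\<^esub> (tcons R B B n u (icomult R B n v))) b"
      unfolding Suc using assms cl by (simp add: D.rho_push del: icomult.simps)
    also have "\<dots> = SB (tens R B (Suc (Suc n)) B) (\<lambda>u v. tcons R B B (Suc n) u (icomult R B (Suc n) v)) b"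
      using assms cl by (intro SB_cong) (simp_all add: D.rho_cons step del: icomult.simps)
    finally show ?case .
  qed
qed

lemmas icomult_closed [simp] = icomult_closed_Suc(1)
lemmas icomult_Suc = icomult_closed_Suc(2)

lemma act_pure_gens:
  assumes "(bs, c) \<in> tens_gens B n B" "(xs, y) \<in> tens_gens X n Y"
  shows "(map2 actX bs xs, actY c y) \<in> tens_gens X n Y"
proof -
  have "actX a b \<in> carrier X" if "(a, b) \<in> set (zip bs xs)" for a b
    using set_zip_leftD[OF that] set_zip_rightD[OF that] assms by (auto simp: tens_gens_def subset_iff)
  then show ?thesis using assms by (auto simp: tens_gens_def)
qed

lemma act_pure_multilinear:
  assumes "(xs, y) \<in> tens_gens X n Y"
  shows "multilinear R B n B (T n) (\<lambda>(bs, c). ptens R X Y (map2 actX bs xs) (actY c y))"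
proof -
  have xy: "length xs = n" "set xs \<subseteq> carrier X" "y \<in> carrier Y" using assms by (auto simp: tens_gens_def)
  have g: "(map2 actX bs xs, actY c y) \<in> tens_gens X n Y" if "(bs, c) \<in> tens_gens B n B" for bs c
    by (rule act_pure_gens[OF that assms])
  have 1: "(\<lambda>z. ptens R X Y (map2 actX bs xs) (actY z y)) \<in> mod_hom R B (T n)" if b: "(bs, c) \<in> tens_gens B n B" for bs c
    by (rule mod_hom_comp[OF ptens_snd_hom[OF mX mY g[OF b]] bilinearD(2)[OF bilinear_actY xy(3)]])
  have 2: "(\<lambda>u. ptens R X Y (map2 actX (bs[i := u]) xs) (actY c y)) \<in> mod_hom R B (T n)"
    if b: "(bs, c) \<in> tens_gens B n B" and i: "i < n" for bs c i
  proof -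
    have x: "xs ! i \<in> carrier X" using xy i by (auto simp: subset_iff)
    have "map2 actX (bs[i := u]) xs = (map2 actX bs xs)[i := actX u (xs ! i)]" for u
      using b i xy by (intro map2_update) (auto simp: tens_gens_def)
    then show ?thesis
      using mod_hom_comp[OF ptens_update_hom[OF mX mY g[OF b] i] bilinearD(2)[OF bilinear_actX x]] by simp
  qed
  show ?thesis unfolding multilinear_def using 1 2 g by auto
qed

lemma actn_pure:
  assumes "b \<in> carrier B" "(xs, y) \<in> tens_gens X n Y"
  shows "actn n b (ptens R X Y xs y) =
    tens_lift R (T n) (\<lambda>(bs, c). ptens R X Y (map2 actX bs xs) (actY c y)) (icomult R B n b)"
  using assms
proof (induction n arbitrary: xs b)
  case 0
  have "multilinear R B 0 B (T 0) (\<lambda>(bs, c). ptens R X Y (map2 actX bs xs) (actY c y))"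
    by (rule act_pure_multilinear[OF 0(2)])
  then show ?case using 0
    by (simp add: tens_gens_0 actn_unit tens_lift_ptens[OF mB mB mT, where n = 0])
next
  case (Suc n)
  then obtain x xs' where xs: "xs = x # xs'" "x \<in> carrier X" "(xs', y) \<in> tens_gens X n Y"
    by (auto simp: tens_gens_Suc)
  let ?F = "\<lambda>(bs, c). ptens R X Y (map2 actX bs xs) (actY c y)"
  let ?F' = "\<lambda>(bs, c). ptens R X Y (map2 actX bs xs') (actY c y)"
  have F: "multilinear R B (Suc n) B (T (Suc n)) ?F" by (rule act_pure_multilinear[OF Suc(3)])
  have F': "multilinear R B n B (T n) ?F'" by (rule act_pure_multilinear[OF xs(3)])
  have F'c: "?F' g \<in> carrier (T n)" if "g \<in> tens_gens B n B" for g
    using F' that unfolding multilinear_def by blast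
  have F'g: "(map2 actX bs xs', actY c y) \<in> tens_gens X n Y" if "(bs, c) \<in> tens_gens B n B" for bs c
    by (rule act_pure_gens[OF that xs(3)])
  have "actn (Suc n) b (ptens R X Y xs y) = actn (Suc n) b (cons n x (ptens R X Y xs' y))"
    using xs by simp
  also have "\<dots> = SB (T (Suc n)) (\<lambda>c d. cons n (actX c x) (tens_lift R (T n) ?F' (icomult R B n d))) b"
    using Suc.prems(1) xs(2,3) Suc.IH[OF _ xs(3)] by (simp add: actn_cons del: cons_pure)
  also have "\<dots> = SB (T (Suc n)) (\<lambda>c d. tens_lift R (T (Suc n)) ?F (tcons R B B n c (icomult R B n d))) b"
  proof (rule SB_cong)
    fix c d assume c: "c \<in> carrier B" and d: "d \<in> carrier B"
    have "cons n (actX c x) (tens_lift R (T n) ?F' (icomult R B n d)) =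
        tens_lift R (T (Suc n)) (\<lambda>g. cons n (actX c x) (?F' g)) (icomult R B n d)"
      using c d xs(2) by (intro mod_hom_tens_lift[OF mB mB tcons_hom[OF mX mY] mT mT _ F'c]) simp_all
    also have "\<dots> = tens_lift R (T (Suc n)) (\<lambda>(bs, e). ?F (c # bs, e)) (icomult R B n d)"
      using c xs(2) F'g by (intro tens_lift_agree[OF mB mB icomult_closed[OF d]]) (auto simp: xs(1))
    also have "\<dots> = tens_lift R (T (Suc n)) ?F (tcons R B B n c (icomult R B n d))"
      using c d by (intro tens_lift_tcons[OF mB mB mT F, symmetric]) simp_all
    finally show "cons n (actX c x) (tens_lift R (T n) ?F' (icomult R B n d)) =
        tens_lift R (T (Suc n)) ?F (tcons R B B n c (icomult R B n d))" .
  qed (use Suc.prems(1) in simp_all)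
  also have "\<dots> = tens_lift R (T (Suc n)) ?F (icomult R B (Suc n) b)"
    unfolding icomult_Suc[OF Suc.prems(1)]
    using Suc.prems(1) bilinear_closed[OF tcons_bilinear[OF mB mB]]
    by (intro SB_push[OF tens_lift_hom[OF mB mB mT F] tens_module[OF mB mB] mT, symmetric]) simp_all
  finally show ?case .
qed

lemma T_act_eq:
  assumes "b \<in> carrier B" "\<xi> \<in> carrier (T (Suc n))"
  shows "T_act R B X actX Y actY n b \<xi> = actn (Suc n) b \<xi>"
  unfolding T_act_def T_mod_def Suc_eq_plus1[symmetric]
  by (rule tens_lift_eqI[OF mX mY bilinearD(1)[OF actn_bilinear] mT assms(2)])
    (simp_all add: assms actn_pure del: icomult.simps)

lemma split_at_eq:
  assumes "j \<le> n" "\<xi> \<in> carrier (T (Suc n))"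
  shows "split_at R X Y (Suc n) j \<xi> = spl j n \<xi>"
  unfolding split_at_def Suc_eq_plus1[symmetric]
proof (rule tens_lift_eqI[OF mX mY spl_hom[OF assms(1)] mT assms(2)])
  fix xs y assume g: "(xs, y) \<in> tens_gens X (Suc n) Y"
  then have "xs ! j \<in> carrier X" using assms(1) by (auto simp: tens_gens_def subset_iff)
  then show "(case (xs, y) of (xs, y) \<Rightarrow>
      tens_lift R (T (Suc (Suc n))) (\<lambda>(us, v). ptens R X Y (take j xs @ us @ [v] @ drop (Suc j) xs) y) (comult X (xs ! j))) =
      spl j n (ptens R X Y xs y)"
    unfolding spl_pure[OF assms(1) g] by (simp add: tens_lift_SX)
qed

lemma T_tauinv_eq:
  assumes "\<xi> \<in> carrier (T (Suc n))"
  shows "T_tauinv R X actX Y coact n \<xi> = tinv n \<xi>"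
  unfolding T_tauinv_def T_mod_def Suc_eq_plus1[symmetric]
proof (rule tens_lift_eqI[OF mX mY tinv_hom mT assms])
  fix xs y assume g: "(xs, y) \<in> tens_gens X (Suc n) Y"
  then obtain x xs' where xs: "xs = x # xs'" "x \<in> carrier X" "(xs', y) \<in> tens_gens X n Y"
    by (auto simp: tens_gens_Suc)
  have "tinv n (cons n x (ptens R X Y xs' y)) = SY (T (Suc n)) (\<lambda>b z. ptens R X Y (xs' @ [actX b x]) z) y"
    using xs(2,3) by (simp add: tinv_cons rho_pure del: cons_pure)
  then show "(case (xs, y) of (xs, y) \<Rightarrow>
      tens_lift R (T (Suc n)) (\<lambda>(bs, z). ptens R X Y (tl xs @ [actX (hd bs) (hd xs)]) z) (coact y)) =
      tinv n (ptens R X Y xs y)"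
    using xs gens_Y[OF g] by (simp add: tens_lift_SY)
qed

definition cof :: "nat \<Rightarrow> nat \<Rightarrow> ('x list \<times> 'y \<Rightarrow> 'a) set \<Rightarrow> ('x list \<times> 'y \<Rightarrow> 'a) set"
  where "cof n j \<xi> = (if j \<le> n then spl j n \<xi> else tinv (Suc n) (spl 0 n \<xi>))"

lemma T_coface_eq:
  assumes "\<xi> \<in> carrier (T (Suc n))"
  shows "T_coface R X actX Y coact n j \<xi> = cof n j \<xi>"
proof (cases "j \<le> n")
  case True
  then show ?thesis using split_at_eq[OF True assms] by (simp add: T_coface_def cof_def)
next
  case False
  have hom: "(\<lambda>\<xi>. tinv (Suc n) (spl 0 n \<xi>)) \<in> mod_hom R (T (Suc n)) (T (Suc (Suc n)))"
    by (intro lin; simp)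
  have "tens_lift R (T (Suc (Suc n)))
       (\<lambda>(xs, y). tens_lift R (T (Suc (Suc n)))
         (\<lambda>(us, v). tens_lift R (T (Suc (Suc n)))
           (\<lambda>(bs, z). ptens R X Y ([v] @ tl xs @ [actX (hd bs) (hd us)]) z) (coact y))
         (comult X (hd xs))) \<xi> = tinv (Suc n) (spl 0 n \<xi>)"
  proof (rule tens_lift_eqI[OF mX mY hom mT assms])
    fix xs y assume g: "(xs, y) \<in> tens_gens X (Suc n) Y"
    then obtain x xs' where xs: "xs = x # xs'" "x \<in> carrier X" "(xs', y) \<in> tens_gens X n Y"
      by (auto simp: tens_gens_Suc)
    have "tinv (Suc n) (spl 0 n (cons n x (ptens R X Y xs' y))) =
        SX (T (Suc (Suc n))) (\<lambda>u v. rho (Suc n) u (cons n v (ptens R X Y xs' y))) x"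
      using xs(2,3) by (simp add: tinv_cons spl_0_cons push del: cons_pure)
    also have "\<dots> = SX (T (Suc (Suc n))) (\<lambda>u v. SY (T (Suc (Suc n))) (\<lambda>b z. ptens R X Y (v # xs' @ [actX b u]) z) y) x"
      using xs(2,3) gens_Y[OF xs(3)] by (simp add: rho_pure)
    finally show "(case (xs, y) of (xs, y) \<Rightarrow> tens_lift R (T (Suc (Suc n)))
         (\<lambda>(us, v). tens_lift R (T (Suc (Suc n)))
           (\<lambda>(bs, z). ptens R X Y ([v] @ tl xs @ [actX (hd bs) (hd us)]) z) (coact y))
         (comult X (hd xs))) = tinv (Suc n) (spl 0 n (ptens R X Y xs y))"
      using xs gens_Y[OF g] by (simp add: tens_lift_SX tens_lift_SY)
  qed
  with False show ?thesis by (simp add: T_coface_def T_mod_def cof_def)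
qed

section \<open>The cyclic operator has order n + 1 on coinvariants\<close>

text \<open>A pure tensor \<open>x\<^sub>1 \<otimes> \<dots> \<otimes> x\<^sub>k \<otimes> \<zeta>\<close> is \<open>conses xs m \<zeta>\<close>.  Applying \<open>tinv\<close> to it \<open>k\<close> times consumes
  the list from the left and inserts its entries at the end, which is \<open>rhos xs m \<zeta>\<close>.\<close>

primrec conses :: "'x list \<Rightarrow> nat \<Rightarrow> ('x list \<times> 'y \<Rightarrow> 'a) set \<Rightarrow> ('x list \<times> 'y \<Rightarrow> 'a) set"
  where
    "conses [] m \<zeta> = \<zeta>"
  | "conses (x # xs) m \<zeta> = cons (m + length xs) x (conses xs m \<zeta>)"

primrec rhos :: "'x list \<Rightarrow> nat \<Rightarrow> ('x list \<times> 'y \<Rightarrow> 'a) set \<Rightarrow> ('x list \<times> 'y \<Rightarrow> 'a) set"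
  where
    "rhos [] m \<zeta> = \<zeta>"
  | "rhos (x # xs) m \<zeta> = rhos xs (Suc m) (rho m x \<zeta>)"

lemma conses_closed [simp]:
  "set xs \<subseteq> carrier X \<Longrightarrow> \<zeta> \<in> carrier (T m) \<Longrightarrow> conses xs m \<zeta> \<in> carrier (T (m + length xs))"
  by (induction xs) auto

lemma rho_conses:
  "set xs \<subseteq> carrier X \<Longrightarrow> \<zeta> \<in> carrier (T m) \<Longrightarrow> x \<in> carrier X \<Longrightarrow>
    rho (m + length xs) x (conses xs m \<zeta>) = conses xs (Suc m) (rho m x \<zeta>)"
  by (induction xs) (auto simp: rho_cons)

lemma conses_unit: "set xs \<subseteq> carrier X \<Longrightarrow> y \<in> carrier Y \<Longrightarrow> conses xs 0 (unit y) = ptens R X Y xs y"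
proof (induction xs)
  case (Cons x xs)
  then have "(xs, y) \<in> tens_gens X (length xs) Y" by (auto simp: tens_gens_def)
  with Cons show ?case by simp
qed simp

lemma tinv_power_conses:
  "set xs \<subseteq> carrier X \<Longrightarrow> \<zeta> \<in> carrier (T m) \<Longrightarrow> Suc n = m + length xs \<Longrightarrow>
    (tinv n ^^ length xs) (conses xs m \<zeta>) = rhos xs m \<zeta>"
proof (induction xs arbitrary: m \<zeta>)
  case (Cons x xs)
  then have n: "n = m + length xs" by simp
  have "(tinv n ^^ length (x # xs)) (conses (x # xs) m \<zeta>) = (tinv n ^^ length xs) (tinv n (cons n x (conses xs m \<zeta>)))"
    by (simp add: n funpow_swap1)
  also have "tinv n (cons n x (conses xs m \<zeta>)) = conses xs (Suc m) (rho m x \<zeta>)"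
    unfolding n using Cons.prems by (simp add: tinv_cons rho_conses)
  also have "(tinv n ^^ length xs) (conses xs (Suc m) (rho m x \<zeta>)) = rhos xs (Suc m) (rho m x \<zeta>)"
    using Cons.prems by (intro Cons.IH) simp_all
  finally show ?case by simp
qed simp

lemma rhos_hom: "set xs \<subseteq> carrier X \<Longrightarrow> rhos xs m \<in> mod_hom R (T m) (T (m + length xs))"
proof (induction xs arbitrary: m)
  case Nil
  then show ?case using mod_hom_id[of R "T m"] by simp
next
  case (Cons x xs)
  then show ?case
    using mod_hom_comp[OF Cons.IH[of "Suc m"] bilinearD(1)[OF rho_bilinear, of x m]] by simp
qed

lemma rhos_cons:
  "set xs \<subseteq> carrier X \<Longrightarrow> u \<in> carrier X \<Longrightarrow> \<zeta> \<in> carrier (T m) \<Longrightarrow>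
    rhos xs (Suc m) (cons m u \<zeta>) = cons (m + length xs) u (rhos xs m \<zeta>)"
  by (induction xs arbitrary: m \<zeta>) (auto simp: rho_cons)

text \<open>Induction on the list: each step multiplies the next factor by one more part of the coaction of
  \<open>y\<close>.  Coassociativity of the coaction and the recursion for the diagonal action combine these parts.
  The induction starts with the empty list, where \<open>0\<close>-stability is the claim.\<close>

lemma rhos_unit:
  assumes "zero_stable R Y actY coact" "set xs \<subseteq> carrier X" "y \<in> carrier Y"
  shows "rhos xs 0 (unit y) = SY (T (length xs)) (\<lambda>b z. actn (length xs) b (ptens R X Y xs z)) y"
  using assms(2,3)
proof (induction xs arbitrary: y)
  case Nil
  then have "SY Y (\<lambda>b z. actY b z) y = y"
    using assms(1) by (simp add: zero_stable_def tens_lift_SY)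
  from arg_cong[OF this, of unit] show ?case
    using Nil by (simp add: S_push[OF ptens_Nil_hom[OF mX mY]] actn_unit)
next
  case (Cons x xs)
  let ?n = "length xs"
  have x: "x \<in> carrier X" and xs: "set xs \<subseteq> carrier X" using Cons.prems by auto
  have g: "(xs, z) \<in> tens_gens X ?n Y" if "z \<in> carrier Y" for z using xs that by (simp add: tens_gens_def)
  have p: "(\<lambda>z. ptens R X Y xs z) \<in> mod_hom R Y (T ?n)" by (rule ptens_snd_hom[OF mX mY g[OF Cons.prems(2)]])
  have rc: "rhos xs 0 \<zeta> \<in> carrier (T ?n)" if "\<zeta> \<in> carrier (T 0)" for \<zeta>
    using mod_hom_closed[OF rhos_hom[OF xs, of 0] that] by simp
  have "rhos (x # xs) 0 (unit y) = SY (T (Suc ?n)) (\<lambda>b z. rhos xs (Suc 0) (cons 0 (actX b x) (unit z))) y"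
    using x Cons.prems(2) SY_push[OF rhos_hom[OF xs, of "Suc 0"] mT mT Cons.prems(2)] by (simp add: rho_unit)
  also have "\<dots> = SY (T (Suc ?n)) (\<lambda>b z. cons ?n (actX b x) (SY (T ?n) (\<lambda>c w. actn ?n c (ptens R X Y xs w)) z)) y"
    using x xs Cons.prems(2) Cons.IH[OF xs] by (simp add: rhos_cons del: cons_pure)
  also have "\<dots> = SY (T (Suc ?n)) (\<lambda>b z. SY (T (Suc ?n)) (\<lambda>c w. cons ?n (actX b x) (actn ?n c (ptens R X Y xs w))) z) y"
    using x Cons.prems(2) g by (simp add: push)
  also have "\<dots> = SY (T (Suc ?n)) (\<lambda>b z. SB (T (Suc ?n)) (\<lambda>c d. cons ?n (actX c x) (actn ?n d (ptens R X Y xs z))) b) y"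
    using x Cons.prems(2) g by (intro SY_coassoc[symmetric] bilinearI lin mod_hom_comp[OF p]) simp_all
  also have "\<dots> = SY (T (Suc ?n)) (\<lambda>b z. actn (Suc ?n) b (cons ?n x (ptens R X Y xs z))) y"
    using x Cons.prems(2) g by (simp add: actn_cons del: cons_pure)
  also have "\<dots> = SY (T (length (x # xs))) (\<lambda>b z. actn (length (x # xs)) b (ptens R X Y (x # xs) z)) y"
    using x Cons.prems(2) g by simp
  finally show ?case .
qed

text \<open>By \<open>0\<close>-stability, applying the inverse cyclic operator \<open>n + 1\<close> times is acting by
  \<open>y\<^sub>(\<^sub>-\<^sub>1\<^sub>)\<close> on \<open>x\<^sup>0 \<otimes> \<dots> \<otimes> x\<^sup>n \<otimes> y\<^sub>(\<^sub>0\<^sub>)\<close>.\<close>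

lemma tinv_power_pure:
  assumes "zero_stable R Y actY coact" "(xs, y) \<in> tens_gens X (Suc n) Y"
  shows "(tinv n ^^ Suc n) (ptens R X Y xs y) = SY (T (Suc n)) (\<lambda>b z. actn (Suc n) b (ptens R X Y xs z)) y"
proof -
  have xs: "length xs = Suc n" "set xs \<subseteq> carrier X" "y \<in> carrier Y" using assms(2) by (auto simp: tens_gens_def)
  show ?thesis
    using tinv_power_conses[OF xs(2) unit_closed[OF xs(3)], of n] rhos_unit[OF assms(1) xs(2,3)] xs
    by (simp add: conses_unit del: funpow.simps)
qed

lemma tinv_power_closed: "\<xi> \<in> carrier (T (Suc n)) \<Longrightarrow> (tinv n ^^ k) \<xi> \<in> carrier (T (Suc n))"
  by (induction k) auto

lemma tinv_power_hom: "(tinv n ^^ k) \<in> mod_hom R (T (Suc n)) (T (Suc n))"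
proof (induction k)
  case 0 show ?case using mod_hom_id by (simp add: id_def)
next
  case (Suc k) then show ?case using mod_hom_comp[OF tinv_hom Suc] by (simp add: comp_def)
qed

text \<open>On coinvariants the action of \<open>y\<^sub>(\<^sub>-\<^sub>1\<^sub>)\<close> becomes multiplication by its counit, and
  \<open>\<epsilon>(y\<^sub>(\<^sub>-\<^sub>1\<^sub>)) y\<^sub>(\<^sub>0\<^sub>) = y\<close>.  The hypothesis is stated for an arbitrary \<open>\<pi>\<close> that turns the action into the
  counit, since it is used for two different models of the coinvariants.\<close>

lemma coinvariant_tinv_power:
  assumes "zero_stable R Y actY coact" "\<pi> \<in> mod_hom R (T (Suc n)) M" "module R M"
    and "\<And>b \<xi>. b \<in> carrier B \<Longrightarrow> \<xi> \<in> carrier (T (Suc n)) \<Longrightarrow> \<pi> (actn (Suc n) b \<xi>) = counit B b \<odot>\<^bsub>M\<^esub> \<pi> \<xi>"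
    and "\<xi> \<in> carrier (T (Suc n))"
  shows "\<pi> ((tinv n ^^ Suc n) \<xi>) = \<pi> \<xi>"
proof (rule tens_hom_eqI[OF mX mY mod_hom_comp[OF assms(2) tinv_power_hom] assms(2,3,5)])
  fix xs y assume g: "(xs, y) \<in> tens_gens X (Suc n) Y"
  have y: "y \<in> carrier Y" using g by (simp add: tens_gens_def)
  have p: "(\<lambda>z. \<pi> (ptens R X Y xs z)) \<in> mod_hom R Y M"
    by (rule mod_hom_comp[OF assms(2) ptens_snd_hom[OF mX mY g]])
  have "\<pi> ((tinv n ^^ Suc n) (ptens R X Y xs y)) = SY M (\<lambda>b z. counit B b \<odot>\<^bsub>M\<^esub> \<pi> (ptens R X Y xs z)) y"
    unfolding tinv_power_pure[OF assms(1) g]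
    using y gens_snd[OF g] assms(3) by (simp add: S_push[OF assms(2)] assms(4))
  also have "\<dots> = \<pi> (ptens R X Y xs y)" by (rule SY_counit[OF assms(3) p y])
  finally show "\<pi> ((tinv n ^^ Suc n) (ptens R X Y xs y)) = \<pi> (ptens R X Y xs y)" .
qed

end

section \<open>Antipodes\<close>

locale hopf_data = sweedler_data R B X actX Y actY coact
  for R :: "('a, 'r) ring_scheme"
    and B :: "('a, 'b, 'q) coalg_scheme"
    and X :: "('a, 'x, 's) coalg_scheme"
    and actX :: "'b \<Rightarrow> 'x \<Rightarrow> 'x"
    and Y :: "('a, 'y, 't) module_scheme"
    and actY :: "'b \<Rightarrow> 'y \<Rightarrow> 'y"
    and coact :: "'y \<Rightarrow> ('b list \<times> 'y \<Rightarrow> 'a) set" +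
  fixes S :: "'b \<Rightarrow> 'b"
  assumes bij_antipode: "bijective_antipode R B S"
begin

lemma S_hom: "S \<in> mod_hom R B B"
  using bij_antipode by (simp add: bijective_antipode_def antipode_def)

lemmas [lin] = mod_hom_comp[OF S_hom]
lemmas S_closed [simp] = mod_hom_closed[OF S_hom]
lemmas S_mod_push = S_push[OF S_hom mB mB]

lemma antipode_left: "b \<in> carrier B \<Longrightarrow> SB B (\<lambda>u v. mulB (S u) v) b = counit B b \<odot>\<^bsub>B\<^esub> \<one>\<^bsub>B\<^esub>"
  and antipode_right: "b \<in> carrier B \<Longrightarrow> SB B (\<lambda>u v. mulB u (S v)) b = counit B b \<odot>\<^bsub>B\<^esub> \<one>\<^bsub>B\<^esub>"
  using bij_antipode by (simp_all add: bijective_antipode_def antipode_def tens_lift_SB)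

lemma ring_B: "ring B"
  using bialg by (simp add: bialgebra_def)

lemmas mulB_assoc = monoid.m_assoc[OF ring.is_monoid[OF ring_B]]
lemmas mulB_one_left [simp] = monoid.l_one[OF ring.is_monoid[OF ring_B]]
lemmas mulB_one_right [simp] = monoid.r_one[OF ring.is_monoid[OF ring_B]]
lemmas mulB_smult_right = mod_hom_smult[OF bilinearD(1)[OF bilinear_B]]
lemmas mulB_smult_left = mod_hom_smult[OF bilinearD(2)[OF bilinear_B]]
lemmas smult_closed_B [simp] = module.smult_closed[OF mB]
lemmas mulB_push_right = S_push[OF bilinearD(1)[OF bilinear_B] mB mB]
lemmas mulB_push_left = S_push[OF bilinearD(2)[OF bilinear_B] mB mB]

lemma smult_smult_B:
  "a \<in> carrier R \<Longrightarrow> c \<in> carrier R \<Longrightarrow> x \<in> carrier B \<Longrightarrow> a \<odot>\<^bsub>B\<^esub> (c \<odot>\<^bsub>B\<^esub> x) = (a \<otimes>\<^bsub>R\<^esub> c) \<odot>\<^bsub>B\<^esub> x"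
  by (rule module.smult_assoc1[OF mB, symmetric])

lemma R_mult_closed [simp]: "a \<in> carrier R \<Longrightarrow> c \<in> carrier R \<Longrightarrow> a \<otimes>\<^bsub>R\<^esub> c \<in> carrier R"
  using mB unfolding module_def cring_def by (simp add: monoid.m_closed ring.is_monoid)

lemma R_mult_comm: "a \<in> carrier R \<Longrightarrow> c \<in> carrier R \<Longrightarrow> a \<otimes>\<^bsub>R\<^esub> c = c \<otimes>\<^bsub>R\<^esub> a"
  using mB unfolding module_def cring_def by (simp add: comm_monoid.m_comm)

lemmas smult_push_B = S_push[OF mod_hom_smult_fun[OF mod_hom_id mB] mB mB]

lemma antipode_one: "S \<one>\<^bsub>B\<^esub> = \<one>\<^bsub>B\<^esub>"
proof -
  have "SB B (\<lambda>u v. mulB (S u) v) \<one>\<^bsub>B\<^esub> = mulB (S \<one>\<^bsub>B\<^esub>) \<one>\<^bsub>B\<^esub>"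
    by (intro SB_one bilinearI lin) simp_all
  then show ?thesis
    using antipode_left[OF one_B] bialgebra.counit_one[OF bialg] module.smult_one[OF mB one_B] by simp
qed

text \<open>Both \<open>S (x y)\<close> and \<open>S y S x\<close> are convolution inverses of the product \<open>B \<otimes> B \<rightarrow> B\<close>,
  from the left and from the right.\<close>

lemma antipode_mult:
  assumes x: "x \<in> carrier B" and y: "y \<in> carrier B"
  shows "S (mulB x y) = mulB (S y) (S x)"
proof -
  have inv_right: "SB B (\<lambda>c d. SB B (\<lambda>e f. mulB (mulB c e) (mulB (S f) (S d))) v) u =
      (counit B u \<otimes>\<^bsub>R\<^esub> counit B v) \<odot>\<^bsub>B\<^esub> \<one>\<^bsub>B\<^esub>" if u: "u \<in> carrier B" and v: "v \<in> carrier B" for u v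
  proof -
    have "SB B (\<lambda>c d. SB B (\<lambda>e f. mulB (mulB c e) (mulB (S f) (S d))) v) u =
        SB B (\<lambda>c d. mulB c (mulB (SB B (\<lambda>e f. mulB e (S f)) v) (S d))) u"
      using u v by (simp add: mulB_push_left mulB_push_right mulB_assoc)
    also have "\<dots> = SB B (\<lambda>c d. counit B v \<odot>\<^bsub>B\<^esub> mulB c (S d)) u"
      using u v by (simp add: antipode_right mulB_smult_left mulB_smult_right)
    also have "\<dots> = counit B v \<odot>\<^bsub>B\<^esub> SB B (\<lambda>c d. mulB c (S d)) u"
      using u v by (simp add: smult_push_B)
    also have "\<dots> = (counit B u \<otimes>\<^bsub>R\<^esub> counit B v) \<odot>\<^bsub>B\<^esub> \<one>\<^bsub>B\<^esub>"
      using u v by (simp add: antipode_right smult_smult_B R_mult_comm)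
    finally show ?thesis .
  qed
  have inv_left: "SB B (\<lambda>c d. SB B (\<lambda>e f. mulB (S (mulB c e)) (mulB d f)) v) u =
      (counit B u \<otimes>\<^bsub>R\<^esub> counit B v) \<odot>\<^bsub>B\<^esub> \<one>\<^bsub>B\<^esub>" if u: "u \<in> carrier B" and v: "v \<in> carrier B" for u v
  proof -
    have "SB B (\<lambda>c d. mulB (S c) d) (mulB u v) = SB B (\<lambda>c d. SB B (\<lambda>e f. mulB (S (mulB c e)) (mulB d f)) v) u"
      using u v by (intro SB_mult bilinearI lin) simp_all
    then show ?thesis using u v bialgebra.counit_mult[OF bialg u v] by (simp add: antipode_left)
  qed
  let ?E = "\<lambda>c c' d e e' f. mulB (S (mulB c e)) (mulB (mulB c' e') (mulB (S f) (S d)))"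
  have "S (mulB x y) = SB B (\<lambda>c d. counit B d \<odot>\<^bsub>B\<^esub> S (mulB c y)) x"
    using x y by (intro SB_counit_right[symmetric] lin) simp_all
  also have "\<dots> = SB B (\<lambda>c d. SB B (\<lambda>e f. counit B f \<odot>\<^bsub>B\<^esub> (counit B d \<odot>\<^bsub>B\<^esub> S (mulB c e))) y) x"
    using x y by (intro SB_cong SB_counit_right[symmetric] lin mod_hom_smult_fun[OF _ mB]) simp_all
  also have "\<dots> = SB B (\<lambda>c d. SB B (\<lambda>e f. mulB (S (mulB c e)) ((counit B d \<otimes>\<^bsub>R\<^esub> counit B f) \<odot>\<^bsub>B\<^esub> \<one>\<^bsub>B\<^esub>)) y) x"
    using x y by (simp add: mulB_smult_right smult_smult_B R_mult_comm)
  also have "\<dots> = SB B (\<lambda>c d. SB B (\<lambda>e f. SB B (\<lambda>c' d. SB B (\<lambda>e' f. ?E c c' d e e' f) f) d) y) x"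
    using x y by (simp add: inv_right[symmetric] mulB_push_right)
  also have "\<dots> = SB B (\<lambda>c d. SB B (\<lambda>c' d. SB B (\<lambda>e f. SB B (\<lambda>e' f. ?E c c' d e e' f) f) y) d) x"
    using x y by (intro SB_cong SB_SB_swap) simp_all
  also have "\<dots> = SB B (\<lambda>c d. SB B (\<lambda>c' d. SB B (\<lambda>e f. SB B (\<lambda>e e'. ?E c c' d e e' f) e) y) d) x"
    using x y by (intro SB_cong SB_coassoc[symmetric] lin) simp_all
  also have "\<dots> = SB B (\<lambda>c d. SB B (\<lambda>c c'. SB B (\<lambda>e f. SB B (\<lambda>e e'. ?E c c' d e e' f) e) y) c) x"
    using x y by (intro SB_coassoc[symmetric] bilinearI lin) simp_all
  also have "\<dots> = SB B (\<lambda>c d. SB B (\<lambda>e f. SB B (\<lambda>c c'. SB B (\<lambda>e e'. ?E c c' d e e' f) e) c) y) x"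
    using x y by (intro SB_cong SB_SB_swap) simp_all
  also have "\<dots> = SB B (\<lambda>c d. SB B (\<lambda>e f. mulB (SB B (\<lambda>c c'. SB B (\<lambda>e e'. mulB (S (mulB c e)) (mulB c' e')) e) c)
      (mulB (S f) (S d))) y) x"
    using x y by (simp add: mulB_push_left mulB_assoc)
  also have "\<dots> = SB B (\<lambda>c d. SB B (\<lambda>e f. counit B e \<odot>\<^bsub>B\<^esub> (counit B c \<odot>\<^bsub>B\<^esub> mulB (S f) (S d))) y) x"
    using x y by (simp add: inv_left mulB_smult_left smult_smult_B R_mult_comm)
  also have "\<dots> = SB B (\<lambda>c d. counit B c \<odot>\<^bsub>B\<^esub> mulB (S y) (S d)) x"
    using x y by (intro SB_cong SB_counit_left lin mod_hom_smult_fun[OF _ mB]) simp_all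
  also have "\<dots> = mulB (S y) (S x)"
    using x y by (intro SB_counit_left lin) simp_all
  finally show ?thesis .
qed

definition Si :: "'b \<Rightarrow> 'b" where "Si = antipode_inv B S"

lemma bij_S: "bij_betw S (carrier B) (carrier B)"
  using bij_antipode by (simp add: bijective_antipode_def)

lemma Si_closed [simp]: "b \<in> carrier B \<Longrightarrow> Si b \<in> carrier B"
  unfolding Si_def antipode_inv_def using bij_S by (metis bij_betw_def inv_into_into)

lemma S_Si [simp]: "b \<in> carrier B \<Longrightarrow> S (Si b) = b"
  unfolding Si_def antipode_inv_def using bij_S by (metis bij_betw_def f_inv_into_f)

lemma S_inj: "S b = S c \<Longrightarrow> b \<in> carrier B \<Longrightarrow> c \<in> carrier B \<Longrightarrow> b = c"
  using bij_S by (metis bij_betw_def inj_onD)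

lemma Si_hom: "Si \<in> mod_hom R B B"
proof (rule mod_homI)
  fix x y assume xy: "x \<in> carrier B" "y \<in> carrier B"
  have c: "u \<oplus>\<^bsub>B\<^esub> v \<in> carrier B" if "u \<in> carrier B" "v \<in> carrier B" for u v
    using that mB unfolding module_def abelian_group_def by (simp add: abelian_monoid.a_closed)
  show "Si (x \<oplus>\<^bsub>B\<^esub> y) = Si x \<oplus>\<^bsub>B\<^esub> Si y"
    by (rule S_inj) (use xy c in \<open>simp_all add: mod_hom_add[OF S_hom]\<close>)
next
  fix a x assume "a \<in> carrier R" "x \<in> carrier B"
  then show "Si (a \<odot>\<^bsub>B\<^esub> x) = a \<odot>\<^bsub>B\<^esub> Si x"
    by (rule_tac S_inj) (simp_all add: mod_hom_smult[OF S_hom])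
qed simp

lemmas [lin] = mod_hom_comp[OF Si_hom]

text \<open>The inverse of the antipode is an antipode for the opposite coproduct: apply \<open>S\<close>, which is
  injective, to both sides.\<close>

lemma antipode_inv_left: "b \<in> carrier B \<Longrightarrow> SB B (\<lambda>u v. mulB (Si v) u) b = counit B b \<odot>\<^bsub>B\<^esub> \<one>\<^bsub>B\<^esub>"
  by (rule S_inj)
    (simp_all add: S_mod_push antipode_mult antipode_left mod_hom_smult[OF S_hom] antipode_one)

lemma antipode_inv_right: "b \<in> carrier B \<Longrightarrow> SB B (\<lambda>u v. mulB v (Si u)) b = counit B b \<odot>\<^bsub>B\<^esub> \<one>\<^bsub>B\<^esub>"
  by (rule S_inj)
    (simp_all add: S_mod_push antipode_mult antipode_right mod_hom_smult[OF S_hom] antipode_one)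

text \<open>Inside longer expressions the antipode laws are needed with the product under a linear map \<open>f\<close>.\<close>

lemma hom_antipode:
  assumes "f \<in> mod_hom R B M" "module R M" "b \<in> carrier B"
  shows "SB M (\<lambda>u v. f (mulB (S u) v)) b = counit B b \<odot>\<^bsub>M\<^esub> f \<one>\<^bsub>B\<^esub>"
    and "SB M (\<lambda>u v. f (mulB u (S v))) b = counit B b \<odot>\<^bsub>M\<^esub> f \<one>\<^bsub>B\<^esub>"
    and "SB M (\<lambda>u v. f (mulB (Si v) u)) b = counit B b \<odot>\<^bsub>M\<^esub> f \<one>\<^bsub>B\<^esub>"
    and "SB M (\<lambda>u v. f (mulB v (Si u))) b = counit B b \<odot>\<^bsub>M\<^esub> f \<one>\<^bsub>B\<^esub>"
  using arg_cong[OF antipode_left[OF assms(3)], of f] arg_cong[OF antipode_right[OF assms(3)], of f]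
    arg_cong[OF antipode_inv_left[OF assms(3)], of f] arg_cong[OF antipode_inv_right[OF assms(3)], of f]
    assms by (simp_all add: S_push[OF assms(1)] mod_hom_smult[OF assms(1)])

text \<open>Both sides, as functions of \<open>h\<close>, are convolution inverses of the coproduct.\<close>

lemma antipode_comult:
  assumes M: "module R M" and G: "bilinear R B B M G" and h: "h \<in> carrier B"
  shows "SB M G (S h) = SB M (\<lambda>u v. G (S v) (S u)) h"
proof -
  note [lin] = bilinear_lin1[OF G] bilinear_lin2[OF G] and [simp] = bilinear_closed[OF G] M
  let ?H = "\<lambda>r s d. SB M (\<lambda>u v. G (mulB r (S v)) (mulB s (S u))) d"
  have cancel: "SB M (\<lambda>d e. SB M (\<lambda>b c. ?H (mulB r b) (mulB s c) e) d) d = counit B d \<odot>\<^bsub>M\<^esub> G r s"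
    if r: "r \<in> carrier B" and s: "s \<in> carrier B" and d: "d \<in> carrier B" for r s d
  proof -
    let ?L = "\<lambda>b c u v. G (mulB (mulB r b) (S v)) (mulB (mulB s c) (S u))"
    have "SB M (\<lambda>d e. SB M (\<lambda>b c. SB M (\<lambda>u v. ?L b c u v) e) d) d =
        SB M (\<lambda>b d. SB M (\<lambda>c e. SB M (\<lambda>u v. ?L b c u v) e) d) d"
      by (rule SB_coassoc[OF M _ _ _ d]; (intro bilinearI lin; simp add: r s))
    also have "\<dots> = SB M (\<lambda>b d. SB M (\<lambda>d v. SB M (\<lambda>c u. ?L b c u v) d) d) d"
      by (rule SB_body_eq[OF d], rule SB_coassoc[OF M, symmetric]; ((intro bilinearI lin)?; simp add: r s))
    also have "\<dots> = SB M (\<lambda>b d. SB M (\<lambda>d v. SB M (\<lambda>c u. G (mulB (mulB r b) (S v)) (mulB s (mulB c (S u)))) d) d) d"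
      by (simp add: r s d mulB_assoc)
    also have "\<dots> = SB M (\<lambda>b d. SB M (\<lambda>d v. counit B d \<odot>\<^bsub>M\<^esub> G (mulB (mulB r b) (S v)) (mulB s \<one>\<^bsub>B\<^esub>)) d) d"
    proof (rule SB_body_eq[OF d], rule SB_body_eq, assumption)
      fix b u v w assume b: "b \<in> carrier B" "v \<in> carrier B" "w \<in> carrier B"
      show "SB M (\<lambda>c u. G (mulB (mulB r b) (S w)) (mulB s (mulB c (S u)))) v =
          counit B v \<odot>\<^bsub>M\<^esub> G (mulB (mulB r b) (S w)) (mulB s \<one>\<^bsub>B\<^esub>)"
        by (rule hom_antipode(2)[where f = "\<lambda>x. G (mulB (mulB r b) (S w)) (mulB s x)", OF _ M b(2)])
          (intro lin; simp add: r s b)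
    qed
    also have "\<dots> = SB M (\<lambda>b d. G (mulB (mulB r b) (S d)) (mulB s \<one>\<^bsub>B\<^esub>)) d"
      by (rule SB_body_eq[OF d], rule SB_counit_left[OF M]; ((intro lin)?; simp add: r s))
    also have "\<dots> = SB M (\<lambda>b d. G (mulB r (mulB b (S d))) s) d"
      by (simp add: r s d mulB_assoc)
    also have "\<dots> = counit B d \<odot>\<^bsub>M\<^esub> G (mulB r \<one>\<^bsub>B\<^esub>) s"
      by (rule hom_antipode(2)[where f = "\<lambda>x. G (mulB r x) s", OF _ M d]) (intro lin; simp add: r s)
    finally show ?thesis using r by simp
  qed
  have "SB M G (S h) = SB M (\<lambda>c d. counit B d \<odot>\<^bsub>M\<^esub> SB M G (S c)) h"
    by (rule SB_counit_right[symmetric, OF M _ h]) (intro lin bilinearI; simp)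
  also have "\<dots> = SB M (\<lambda>c d. SB M (\<lambda>p q. counit B d \<odot>\<^bsub>M\<^esub> G p q) (S c)) h"
  proof (rule SB_body_eq[OF h])
    fix u v assume uv: "u \<in> carrier B" "v \<in> carrier B"
    show "counit B v \<odot>\<^bsub>M\<^esub> SB M G (S u) = SB M (\<lambda>p q. counit B v \<odot>\<^bsub>M\<^esub> G p q) (S u)"
      by (rule SB_push[OF mod_hom_smult_fun[OF mod_hom_id M] M M]) (simp_all add: uv)
  qed
  also have "\<dots> = SB M (\<lambda>c d. SB M (\<lambda>p q. SB M (\<lambda>d e. SB M (\<lambda>b c. ?H (mulB p b) (mulB q c) e) d) d) (S c)) h"
    by (rule SB_body_eq[OF h], rule SB_body_eq, simp, rule cancel[symmetric])
  also have "\<dots> = SB M (\<lambda>c d. SB M (\<lambda>d e. SB M (\<lambda>p q. SB M (\<lambda>b c. ?H (mulB p b) (mulB q c) e) d) (S c)) d) h"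
    by (rule SB_body_eq[OF h], rule SB_SB_swap) simp_all
  also have "\<dots> = SB M (\<lambda>c d. SB M (\<lambda>d e. SB M (\<lambda>r s. ?H r s e) (mulB (S c) d)) d) h"
  proof (rule SB_body_eq[OF h], rule SB_body_eq, assumption)
    fix u v d e assume c: "u \<in> carrier B" "d \<in> carrier B" "e \<in> carrier B"
    show "SB M (\<lambda>p q. SB M (\<lambda>b c. ?H (mulB p b) (mulB q c) e) d) (S u) = SB M (\<lambda>r s. ?H r s e) (mulB (S u) d)"
      by (rule SB_mult[symmetric, OF M]; ((intro lin bilinearI)?; simp add: c))
  qed
  also have "\<dots> = SB M (\<lambda>d e. SB M (\<lambda>c d. SB M (\<lambda>r s. ?H r s e) (mulB (S c) d)) d) h"
    by (rule SB_coassoc[OF M _ _ _ h, symmetric]; (intro bilinearI lin; simp))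
  also have "\<dots> = SB M (\<lambda>d e. counit B d \<odot>\<^bsub>M\<^esub> SB M (\<lambda>r s. ?H r s e) \<one>\<^bsub>B\<^esub>) h"
  proof (rule SB_body_eq[OF h])
    fix d e assume d: "d \<in> carrier B" "e \<in> carrier B"
    show "SB M (\<lambda>c d. SB M (\<lambda>r s. ?H r s e) (mulB (S c) d)) d = counit B d \<odot>\<^bsub>M\<^esub> SB M (\<lambda>r s. ?H r s e) \<one>\<^bsub>B\<^esub>"
      by (rule hom_antipode(1)[where f = "SB M (\<lambda>r s. ?H r s e)", OF _ M d(1)])
        (intro lin bilinearI mod_hom_id; simp add: d)
  qed
  also have "\<dots> = SB M (\<lambda>r s. ?H r s h) \<one>\<^bsub>B\<^esub>"
    by (rule SB_counit_left[where f = "\<lambda>h. SB M (\<lambda>r s. ?H r s h) \<one>\<^bsub>B\<^esub>", OF M _ h]) (intro bilinearI lin; simp)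
  also have "\<dots> = ?H \<one>\<^bsub>B\<^esub> \<one>\<^bsub>B\<^esub> h"
    by (rule SB_one[OF M]) (intro bilinearI lin; simp add: h)
  also have "\<dots> = SB M (\<lambda>u v. G (S v) (S u)) h"
    using h by simp
  finally show ?thesis .
qed

section \<open>Invertibility of the cyclic operator over a Hopf algebra\<close>

text \<open>The inverse is \<open>x \<otimes> y \<mapsto> S\<^sup>-\<^sup>1(y\<^sub>(\<^sub>-\<^sub>1\<^sub>)) x \<otimes> y\<^sub>(\<^sub>0\<^sub>)\<close>.\<close>

lemma tinv_inverse_0:
  "\<exists>\<tau> \<in> mod_hom R (T (Suc 0)) (T (Suc 0)). \<forall>\<xi> \<in> carrier (T (Suc 0)). tinv 0 (\<tau> \<xi>) = \<xi> \<and> \<tau> (tinv 0 \<xi>) = \<xi>"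
proof -
  let ?M = "T (Suc 0)"
  let ?h = "\<lambda>x y. SY ?M (\<lambda>b z. cons 0 (actX (Si b) x) (unit z)) y"
  let ?g = "\<lambda>x. nil_lift R ?M (?h x)"
  let ?\<tau> = "cons_lift R X Y ?M ?g"
  have h: "bilinear R X Y ?M ?h" by (intro bilinearI lin) simp_all
  have g: "bilinear R X (T 0) ?M ?g" by (rule nil_lift_bilinear[OF mX mY mT h])
  have \<tau>: "?\<tau> \<in> mod_hom R ?M ?M" by (rule cons_lift_hom[OF mX mY mT g])
  have val: "?\<tau> (cons 0 x (unit y)) = ?h x y" if "x \<in> carrier X" "y \<in> carrier Y" for x y
    using cons_lift_tcons[OF mX mY mT g that(1) unit_closed[OF that(2)]]
      nil_lift_ptens[OF mX mY mT bilinearD(1)[OF h that(1)] that(2)] by simp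
  note \<tau>l [lin] = mod_hom_comp[OF \<tau>]
  note \<tau>p = S_push[OF \<tau> mT mT]
  have c1: "SY ?M (\<lambda>b z. SY ?M (\<lambda>c w. cons 0 (actX c (actX (Si b) x)) (unit w)) z) y = cons 0 x (unit y)"
    if x: "x \<in> carrier X" and y: "y \<in> carrier Y" for x y
  proof -
    have "SY ?M (\<lambda>b z. SY ?M (\<lambda>c w. cons 0 (actX c (actX (Si b) x)) (unit w)) z) y =
        SY ?M (\<lambda>b z. SB ?M (\<lambda>c d. cons 0 (actX d (actX (Si c) x)) (unit z)) b) y"
      using x y by (intro SY_coassoc[symmetric] lin) simp_all
    also have "\<dots> = SY ?M (\<lambda>b z. SB ?M (\<lambda>c d. cons 0 (actX (mulB d (Si c)) x) (unit z)) b) y"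
      using x y by (simp add: actX_mult del: cons_pure)
    also have "\<dots> = SY ?M (\<lambda>b z. counit B b \<odot>\<^bsub>?M\<^esub> cons 0 (actX \<one>\<^bsub>B\<^esub> x) (unit z)) y"
      using x y by (intro SY_cong hom_antipode(4) lin) simp_all
    also have "\<dots> = cons 0 (actX \<one>\<^bsub>B\<^esub> x) (unit y)"
      using x y by (intro SY_counit lin) simp_all
    finally show ?thesis using x by (simp add: actX_one)
  qed
  have c2: "SY ?M (\<lambda>b z. SY ?M (\<lambda>c w. cons 0 (actX (Si c) (actX b x)) (unit w)) z) y = cons 0 x (unit y)"
    if x: "x \<in> carrier X" and y: "y \<in> carrier Y" for x y
  proof -
    have "SY ?M (\<lambda>b z. SY ?M (\<lambda>c w. cons 0 (actX (Si c) (actX b x)) (unit w)) z) y =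
        SY ?M (\<lambda>b z. SB ?M (\<lambda>c d. cons 0 (actX (Si d) (actX c x)) (unit z)) b) y"
      using x y by (intro SY_coassoc[symmetric] lin) simp_all
    also have "\<dots> = SY ?M (\<lambda>b z. SB ?M (\<lambda>c d. cons 0 (actX (mulB (Si d) c) x) (unit z)) b) y"
      using x y by (simp add: actX_mult del: cons_pure)
    also have "\<dots> = SY ?M (\<lambda>b z. counit B b \<odot>\<^bsub>?M\<^esub> cons 0 (actX \<one>\<^bsub>B\<^esub> x) (unit z)) y"
      using x y by (intro SY_cong hom_antipode(3) lin) simp_all
    also have "\<dots> = cons 0 (actX \<one>\<^bsub>B\<^esub> x) (unit y)"
      using x y by (intro SY_counit lin) simp_all
    finally show ?thesis using x by (simp add: actX_one)
  qed
  have e1: "tinv 0 (?\<tau> \<xi>) = \<xi>" if "\<xi> \<in> carrier ?M" for \<xi>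
  proof (rule Suc_eqI[where k = "Suc 0", OF _ _ that])
    fix x \<zeta> assume x: "x \<in> carrier X" and \<zeta>: "\<zeta> \<in> carrier (T 0)"
    show "tinv 0 (?\<tau> (cons 0 x \<zeta>)) = cons 0 x \<zeta>"
    proof (rule nil_eqI[where k = "Suc 0", OF _ _ \<zeta>])
      fix y assume y: "y \<in> carrier Y"
      show "tinv 0 (?\<tau> (cons 0 x (unit y))) = cons 0 x (unit y)"
        using x y by (simp add: val tinv_push tinv_cons rho_unit c1 del: cons_pure)
    qed (use x in \<open>intro lin; simp\<close>)+
  qed (intro lin; simp)+
  have e2: "?\<tau> (tinv 0 \<xi>) = \<xi>" if "\<xi> \<in> carrier ?M" for \<xi>
  proof (rule Suc_eqI[where k = "Suc 0", OF _ _ that])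
    fix x \<zeta> assume x: "x \<in> carrier X" and \<zeta>: "\<zeta> \<in> carrier (T 0)"
    show "?\<tau> (tinv 0 (cons 0 x \<zeta>)) = cons 0 x \<zeta>"
    proof (rule nil_eqI[where k = "Suc 0", OF _ _ \<zeta>])
      fix y assume y: "y \<in> carrier Y"
      show "?\<tau> (tinv 0 (cons 0 x (unit y))) = cons 0 x (unit y)"
        using x y by (simp add: val \<tau>p tinv_cons rho_unit c2 del: cons_pure)
    qed (use x in \<open>intro lin; simp\<close>)+
  qed (intro lin; simp)+
  from e1 e2 \<tau> show ?thesis by blast
qed

text \<open>By induction: on \<open>u \<otimes> \<xi>\<close> with at least two factors from \<open>X\<close>, apply the inverse in lower degree to
  \<open>\<xi>\<close>, which brings the last factor of \<open>\<xi>\<close> to its front, and insert \<open>u\<close> in second position.\<close>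

lemma tinv_inverse:
  "\<exists>\<tau> \<in> mod_hom R (T (Suc n)) (T (Suc n)). \<forall>\<xi> \<in> carrier (T (Suc n)). tinv n (\<tau> \<xi>) = \<xi> \<and> \<tau> (tinv n \<xi>) = \<xi>"
proof (induction n)
  case 0
  show ?case by (rule tinv_inverse_0)
next
  case (Suc n)
  then obtain \<sigma> where \<sigma>: "\<sigma> \<in> mod_hom R (T (Suc n)) (T (Suc n))"
    and \<sigma>1: "\<And>\<xi>. \<xi> \<in> carrier (T (Suc n)) \<Longrightarrow> tinv n (\<sigma> \<xi>) = \<xi>"
    and \<sigma>2: "\<And>\<xi>. \<xi> \<in> carrier (T (Suc n)) \<Longrightarrow> \<sigma> (tinv n \<xi>) = \<xi>" by auto
  let ?M = "T (Suc (Suc n))"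
  note [lin] = mod_hom_comp[OF \<sigma>] and [simp] = mod_hom_closed[OF \<sigma>]
  \<comment> \<open>insertion of a factor in second position\<close>
  define ins where "ins u = cons_lift R X Y ?M (\<lambda>v \<zeta>. cons (Suc n) v (cons n u \<zeta>))" for u
  have ins_b: "bilinear R X (T (Suc n)) ?M ins"
    unfolding ins_def by (intro cons_lift_bilinear lin) simp_all
  note [lin] = bilinear_lin1[OF ins_b] bilinear_lin2[OF ins_b] and [simp] = bilinear_closed[OF ins_b]
  have ins_cons: "ins u (cons n v \<zeta>) = cons (Suc n) v (cons n u \<zeta>)"
    if "u \<in> carrier X" "v \<in> carrier X" "\<zeta> \<in> carrier (T n)" for u v \<zeta>
    unfolding ins_def using that(1)
    by (intro cons_lift_tcons[OF mX mY mT _ that(2,3)] bilinearI lin) simp_all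
  let ?\<tau> = "cons_lift R X Y ?M (\<lambda>u \<xi>. ins u (\<sigma> \<xi>))"
  have b: "bilinear R X (T (Suc n)) ?M (\<lambda>u \<xi>. ins u (\<sigma> \<xi>))" by (intro bilinearI lin) simp_all
  have \<tau>: "?\<tau> \<in> mod_hom R ?M ?M" by (rule cons_lift_hom[OF mX mY mT b])
  note [lin] = mod_hom_comp[OF \<tau>]
  have val: "?\<tau> (cons (Suc n) u \<xi>) = ins u (\<sigma> \<xi>)" if "u \<in> carrier X" "\<xi> \<in> carrier (T (Suc n))" for u \<xi>
    by (rule cons_lift_tcons[OF mX mY mT b that])
  have ti: "tinv (Suc n) (ins u \<xi>) = cons (Suc n) u (tinv n \<xi>)"
    if u: "u \<in> carrier X" and \<xi>: "\<xi> \<in> carrier (T (Suc n))" for u \<xi>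
  proof (rule Suc_eqI[where k = "Suc (Suc n)", OF _ _ \<xi>])
    fix v \<zeta> assume "v \<in> carrier X" "\<zeta> \<in> carrier (T n)"
    then show "tinv (Suc n) (ins u (cons n v \<zeta>)) = cons (Suc n) u (tinv n (cons n v \<zeta>))"
      using u by (simp add: ins_cons tinv_cons rho_cons)
  qed (use u in \<open>intro lin; simp\<close>)+
  have e1: "tinv (Suc n) (?\<tau> \<xi>) = \<xi>" if "\<xi> \<in> carrier ?M" for \<xi>
  proof (rule Suc_eqI[where k = "Suc (Suc n)", OF _ _ that])
    fix u \<xi> assume "u \<in> carrier X" "\<xi> \<in> carrier (T (Suc n))"
    then show "tinv (Suc n) (?\<tau> (cons (Suc n) u \<xi>)) = cons (Suc n) u \<xi>"
      by (simp add: val ti \<sigma>1)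
  qed (intro lin; simp)+
  have e2: "?\<tau> (tinv (Suc n) \<xi>) = \<xi>" if "\<xi> \<in> carrier ?M" for \<xi>
  proof (rule Suc_eqI[where k = "Suc (Suc n)", OF _ _ that])
    fix x \<xi> assume x: "x \<in> carrier X" and \<xi>: "\<xi> \<in> carrier (T (Suc n))"
    show "?\<tau> (tinv (Suc n) (cons (Suc n) x \<xi>)) = cons (Suc n) x \<xi>"
    proof (rule Suc_eqI[where k = "Suc (Suc n)", OF _ _ \<xi>])
      fix u \<zeta> assume u: "u \<in> carrier X" and \<zeta>: "\<zeta> \<in> carrier (T n)"
      have "\<sigma> (rho n x \<zeta>) = cons n x \<zeta>" using \<sigma>2[of "cons n x \<zeta>"] x \<zeta> by (simp add: tinv_cons)
      then show "?\<tau> (tinv (Suc n) (cons (Suc n) x (cons n u \<zeta>))) = cons (Suc n) x (cons n u \<zeta>)"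
        using x u \<zeta> by (simp add: tinv_cons rho_cons val ins_cons)
    qed (use x in \<open>intro lin; simp\<close>)+
  qed (intro lin; simp)+
  from e1 e2 \<tau> show ?case by blast
qed

lemma tinv_bij: "bij_betw (tinv n) (carrier (T (Suc n))) (carrier (T (Suc n)))"
proof -
  obtain \<tau> where \<tau>: "\<tau> \<in> mod_hom R (T (Suc n)) (T (Suc n))"
    "\<forall>\<xi> \<in> carrier (T (Suc n)). tinv n (\<tau> \<xi>) = \<xi> \<and> \<tau> (tinv n \<xi>) = \<xi>" using tinv_inverse by blast
  show ?thesis
    by (rule bij_betw_byWitness[where f' = \<tau>]) (use \<tau> mod_hom_closed[OF \<tau>(1)] in auto)
qed

end

section \<open>Quotients of para-cocyclic modules\<close>

lemma rcoset_diff_mem: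
  assumes "module R M" "submodule K R M" "x \<in> carrier M" "y \<in> carrier M" "K +>\<^bsub>M\<^esub> x = K +>\<^bsub>M\<^esub> y"
  shows "x \<ominus>\<^bsub>M\<^esub> y \<in> K"
  using rcoset_eq_iff[OF assms(1-4)] assms(5) by simp

text \<open>The value on a coset is that at any representative; all representatives give the same value because
  \<open>f\<close> vanishes on \<open>K\<close>.\<close>

lemma quot_lift_ex:
  assumes "module R M" "submodule K R M" "module R N" "f \<in> mod_hom R M N" "\<And>x. x \<in> K \<Longrightarrow> f x = \<zero>\<^bsub>N\<^esub>"
  shows "\<exists>g \<in> mod_hom R (quot_mod M K) N. \<forall>x \<in> carrier M. g (K +>\<^bsub>M\<^esub> x) = f x"
proof -
  define g where "g A = f (SOME x. x \<in> A)" for A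
  have g: "g (K +>\<^bsub>M\<^esub> x) = f x" if x: "x \<in> carrier M" for x
  proof -
    have "(SOME z. z \<in> K +>\<^bsub>M\<^esub> x) \<in> K +>\<^bsub>M\<^esub> x"
      by (rule someI[of "\<lambda>z. z \<in> K +>\<^bsub>M\<^esub> x", OF rcoset_self[OF assms(1,2) x]])
    then have z: "(SOME z. z \<in> K +>\<^bsub>M\<^esub> x) \<in> carrier M"
      and e: "K +>\<^bsub>M\<^esub> (SOME z. z \<in> K +>\<^bsub>M\<^esub> x) = K +>\<^bsub>M\<^esub> x"
      using rcoset_eqI[OF assms(1,2) x] by blast+
    have "f ((SOME z. z \<in> K +>\<^bsub>M\<^esub> x) \<ominus>\<^bsub>M\<^esub> x) = \<zero>\<^bsub>N\<^esub>"
      by (rule assms(5)[OF rcoset_diff_mem[OF assms(1,2) z x e]])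
    then show ?thesis
      unfolding g_def mod_hom_diff[OF assms(4,1,3) z x]
      by (rule module_diff_eq_zeroD[OF assms(3) mod_hom_closed[OF assms(4) z] mod_hom_closed[OF assms(4) x]])
  qed
  have "g \<in> mod_hom R (quot_mod M K) N"
  proof (rule mod_homI)
    fix A assume "A \<in> carrier (quot_mod M K)"
    then obtain x where x: "x \<in> carrier M" "A = K +>\<^bsub>M\<^esub> x" by (auto simp: quot_carrier)
    then show "g A \<in> carrier N" by (simp add: g mod_hom_closed[OF assms(4)])
    fix C assume "C \<in> carrier (quot_mod M K)"
    then obtain y where y: "y \<in> carrier M" "C = K +>\<^bsub>M\<^esub> y" by (auto simp: quot_carrier)
    have s: "x \<oplus>\<^bsub>M\<^esub> y \<in> carrier M"
      using assms(1) x y by (simp add: module_def abelian_group_def abelian_monoid.a_closed)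
    show "g (A \<oplus>\<^bsub>quot_mod M K\<^esub> C) = g A \<oplus>\<^bsub>N\<^esub> g C"
      using x y s by (simp add: quot_add[OF assms(1,2)] g mod_hom_add[OF assms(4)])
  next
    fix a A assume a: "a \<in> carrier R" and "A \<in> carrier (quot_mod M K)"
    then obtain x where x: "x \<in> carrier M" "A = K +>\<^bsub>M\<^esub> x" by (auto simp: quot_carrier)
    then show "g (a \<odot>\<^bsub>quot_mod M K\<^esub> A) = a \<odot>\<^bsub>N\<^esub> g A"
      using a module.smult_closed[OF assms(1) a x(1)]
      by (simp add: quot_smult[OF assms(1,2)] g mod_hom_smult[OF assms(4)])
  qed
  with g show ?thesis by blast
qed

lemma inverse_hom:
  assumes "f \<in> mod_hom R M N" "bij_betw f (carrier M) (carrier N)" "module R M"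
  shows "inv_into (carrier M) f \<in> mod_hom R N M"
proof -
  interpret M: module R M by fact
  let ?g = "inv_into (carrier M) f"
  have g: "?g y \<in> carrier M" "f (?g y) = y" if "y \<in> carrier N" for y
    using assms(2) that by (metis bij_betw_def inv_into_into, metis bij_betw_def f_inv_into_f)
  have eq: "?g (f x) = x" if "x \<in> carrier M" for x
    using assms(2) that by (metis bij_betw_def inv_into_f_f)
  show ?thesis
  proof (rule mod_homI)
    show "?g y \<in> carrier M" if "y \<in> carrier N" for y by (rule g(1)[OF that])
    fix x y assume x: "x \<in> carrier N" and y: "y \<in> carrier N"
    have "f (?g x \<oplus>\<^bsub>M\<^esub> ?g y) = x \<oplus>\<^bsub>N\<^esub> y"
      using mod_hom_add[OF assms(1) g(1)[OF x] g(1)[OF y]] g(2)[OF x] g(2)[OF y] by simp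
    then show "?g (x \<oplus>\<^bsub>N\<^esub> y) = ?g x \<oplus>\<^bsub>M\<^esub> ?g y"
      using eq[of "?g x \<oplus>\<^bsub>M\<^esub> ?g y"] g(1)[OF x] g(1)[OF y] by simp
  next
    fix a x assume a: "a \<in> carrier R" and x: "x \<in> carrier N"
    have "f (a \<odot>\<^bsub>M\<^esub> ?g x) = a \<odot>\<^bsub>N\<^esub> x"
      using mod_hom_smult[OF assms(1) a g(1)[OF x]] g(2)[OF x] by simp
    then show "?g (a \<odot>\<^bsub>N\<^esub> x) = a \<odot>\<^bsub>M\<^esub> ?g x"
      using eq[of "a \<odot>\<^bsub>M\<^esub> ?g x"] g(1)[OF x] a by simp
  qed
qed

lemma inv_op_inverse:
  assumes "bij_betw (u n) (carrier (C n)) (carrier (C n))" "x \<in> carrier (C n)"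
  shows "inv_op C u n x \<in> carrier (C n)" "u n (inv_op C u n x) = x" "inv_op C u n (u n x) = x"
  using assms unfolding inv_op_def bij_betw_def
  by (auto simp: f_inv_into_f inv_into_f_f) (metis inv_into_into)

text \<open>Conjugating the identities for \<open>u\<close> by its inverse gives those for \<open>\<tau>\<close>.\<close>

lemma para_cocyclic_of_bij:
  assumes ap: "almost_para_cocyclic_module R C d u"
    and bij: "\<And>n. bij_betw (u n) (carrier (C n)) (carrier (C n))"
  shows "para_cocyclic_module R C d (inv_op C u)"
proof -
  have t: "inv_op C u n x \<in> carrier (C n)" "u n (inv_op C u n x) = x" "inv_op C u n (u n x) = x"
    if "x \<in> carrier (C n)" for n x
    by (rule inv_op_inverse[of u n C x, OF bij that])+
  have cs: "cosimplicial_module R C d" and mC: "\<And>n. module R (C n)"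
    and u: "\<And>n. u n \<in> mod_hom R (C n) (C n)"
    and d: "\<And>n j. j \<le> n + 1 \<Longrightarrow> d n j \<in> mod_hom R (C n) (C (n + 1))"
    and du: "\<And>n j x. j \<le> n \<Longrightarrow> x \<in> carrier (C n) \<Longrightarrow> d n j (u n x) = u (n + 1) (d n (j + 1) x)"
    and last: "\<And>n x. x \<in> carrier (C n) \<Longrightarrow> d n (n + 1) x = u (n + 1) (d n 0 x)"
    using ap unfolding almost_para_cocyclic_module_def cosimplicial_module_def by auto
  note dc = mod_hom_closed[OF d]
  have "inv_op C u n \<in> mod_hom R (C n) (C n)" for n
    unfolding inv_op_def by (rule inverse_hom[OF u bij mC])
  moreover have "bij_betw (inv_op C u n) (carrier (C n)) (carrier (C n))" for n
    unfolding inv_op_def by (rule bij_betw_inv_into[OF bij])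
  moreover have "inv_op C u (n + 1) (d n j x) = d n (j + 1) (inv_op C u n x)"
    if "j \<le> n" "x \<in> carrier (C n)" for n j x
  proof -
    have "d n j x = u (n + 1) (d n (j + 1) (inv_op C u n x))"
      using du[OF that(1) t(1)[OF that(2)]] t(2)[OF that(2)] by simp
    then show ?thesis using t(3)[OF dc[OF _ t(1)[OF that(2)]], of "j + 1"] that(1) by simp
  qed
  moreover have "inv_op C u (n + 1) (d n (n + 1) x) = d n 0 x" if "x \<in> carrier (C n)" for n x
    using last[OF that] t(3)[OF dc[OF _ that], of 0] by simp
  ultimately show ?thesis using cs unfolding para_cocyclic_module_def by blast
qed

text \<open>Since the projections \<open>q\<close> are onto, each identity can be checked on images of elements of \<open>C\<close>.\<close>

lemma almost_para_cocyclic_quotient: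
  assumes ap: "almost_para_cocyclic_module R C d u"
    and mQ: "\<And>n. module R (Q n)"
    and q: "\<And>n. q n ` carrier (C n) = carrier (Q n)"
    and d': "\<And>n j. j \<le> n + 1 \<Longrightarrow> d' n j \<in> mod_hom R (Q n) (Q (n + 1))"
    and u': "\<And>n. u' n \<in> mod_hom R (Q n) (Q n)"
    and qd: "\<And>n j x. j \<le> n + 1 \<Longrightarrow> x \<in> carrier (C n) \<Longrightarrow> d' n j (q n x) = q (n + 1) (d n j x)"
    and qu: "\<And>n x. x \<in> carrier (C n) \<Longrightarrow> u' n (q n x) = q n (u n x)"
  shows "almost_para_cocyclic_module R Q d' u'"
proof -
  have cs: "cosimplicial_module R C d" and mC: "\<And>n. module R (C n)"
    and u: "\<And>n. u n \<in> mod_hom R (C n) (C n)"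
    and d: "\<And>n j. j \<le> n + 1 \<Longrightarrow> d n j \<in> mod_hom R (C n) (C (n + 1))"
    and dd: "\<And>n i j x. i \<le> j \<Longrightarrow> j \<le> n + 1 \<Longrightarrow> x \<in> carrier (C n) \<Longrightarrow> d (n + 1) i (d n j x) = d (n + 1) (j + 1) (d n i x)"
    and du: "\<And>n j x. j \<le> n \<Longrightarrow> x \<in> carrier (C n) \<Longrightarrow> d n j (u n x) = u (n + 1) (d n (j + 1) x)"
    and last: "\<And>n x. x \<in> carrier (C n) \<Longrightarrow> d n (n + 1) x = u (n + 1) (d n 0 x)"
    using ap unfolding almost_para_cocyclic_module_def cosimplicial_module_def by auto
  note dc = mod_hom_closed[OF d] and uc = mod_hom_closed[OF u]
  have ex: "\<exists>x \<in> carrier (C n). z = q n x" if "z \<in> carrier (Q n)" for n z using that q by blast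
  have "d' (n + 1) i (d' n j z) = d' (n + 1) (j + 1) (d' n i z)"
    if ij: "i \<le> j" "j \<le> n + 1" and z: "z \<in> carrier (Q n)" for n i j z
  proof -
    obtain x where x: "x \<in> carrier (C n)" "z = q n x" using ex[OF z] by blast
    then show ?thesis using dd[OF ij x(1)] ij
      by (simp add: qd[OF _ x(1)] qd[OF _ dc[OF _ x(1)], simplified] )
  qed
  moreover have "d' n j (u' n z) = u' (n + 1) (d' n (j + 1) z)" if j: "j \<le> n" and z: "z \<in> carrier (Q n)" for n j z
  proof -
    obtain x where x: "x \<in> carrier (C n)" "z = q n x" using ex[OF z] by blast
    then show ?thesis using du[OF j x(1)] j
      by (simp add: qd[OF _ x(1)] qd[OF _ uc[OF x(1)]] qu[OF x(1)] qu[OF dc[OF _ x(1)], simplified])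
  qed
  moreover have "d' n (n + 1) z = u' (n + 1) (d' n 0 z)" if z: "z \<in> carrier (Q n)" for n z
  proof -
    obtain x where x: "x \<in> carrier (C n)" "z = q n x" using ex[OF z] by blast
    then show ?thesis using last[OF x(1)]
      by (simp add: qd[OF _ x(1)] qu[OF dc[OF _ x(1)], simplified])
  qed
  ultimately show ?thesis
    unfolding almost_para_cocyclic_module_def cosimplicial_module_def using mQ d' u' by blast
qed

lemma funpow_closed: "(\<And>x. x \<in> A \<Longrightarrow> f x \<in> A) \<Longrightarrow> x \<in> A \<Longrightarrow> (f ^^ k) x \<in> A"
  by (induction k) auto

lemma bij_betw_of_funpow_id:
  assumes "\<And>x. x \<in> A \<Longrightarrow> f x \<in> A" "\<And>x. x \<in> A \<Longrightarrow> (f ^^ Suc k) x = x"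
  shows "bij_betw f A A"
proof (rule bij_betw_byWitness[where f' = "f ^^ k"])
  show "\<forall>x\<in>A. (f ^^ k) (f x) = x" "\<forall>x\<in>A. f ((f ^^ k) x) = x"
    using assms(2) by (simp_all add: funpow_swap1)
  show "f ` A \<subseteq> A" using assms(1) by auto
  show "(f ^^ k) ` A \<subseteq> A" using funpow_closed[of A f _ k] assms(1) by auto
qed

lemma funpow_inverse_id:
  assumes "\<And>x. x \<in> A \<Longrightarrow> f x \<in> A" "\<And>x. x \<in> A \<Longrightarrow> g x \<in> A \<and> f (g x) = x"
    and "\<And>x. x \<in> A \<Longrightarrow> (f ^^ k) x = x" "x \<in> A"
  shows "(g ^^ k) x = x"
proof -
  have "(f ^^ k) ((g ^^ k) x) = x" if "x \<in> A" for x k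
    using that
  proof (induction k)
    case (Suc k)
    have "(g ^^ k) x \<in> A" using funpow_closed[of A g x k] assms(2) Suc.prems by auto
    then have "(f ^^ Suc k) ((g ^^ Suc k) x) = (f ^^ k) ((g ^^ k) x)"
      using assms(2) by (subst funpow_Suc_right) simp
    with Suc show ?case by simp
  qed simp
  moreover have "(g ^^ k) x \<in> A" using funpow_closed[of A g x k] assms(2,4) by auto
  ultimately show ?thesis using assms(3,4) by metis
qed

lemma coinv_sub_submodule:
  assumes "module R M" "left_module R B M act" "\<And>b. b \<in> carrier B \<Longrightarrow> counit B b \<in> carrier R"
  shows "submodule (coinv_sub R B M act) R M"
proof -
  interpret M: module R M by fact
  show ?thesis unfolding coinv_sub_def
    by (rule mod_span_submodule[OF assms(1)])
      (auto intro!: M.minus_closed M.smult_closed left_module.act_closed[OF assms(2)] assms(3))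
qed

lemma coinv_sub_rcoset:
  assumes "module R M" "left_module R B M act" "\<And>b. b \<in> carrier B \<Longrightarrow> counit B b \<in> carrier R"
    and "b \<in> carrier B" "x \<in> carrier M"
  shows "coinv_sub R B M act +>\<^bsub>M\<^esub> act b x = counit B b \<odot>\<^bsub>coinvariants R B M act\<^esub> (coinv_sub R B M act +>\<^bsub>M\<^esub> x)"
proof -
  interpret M: module R M by fact
  note K = coinv_sub_submodule[OF assms(1-3)]
  have "(counit B b \<odot>\<^bsub>M\<^esub> x) \<ominus>\<^bsub>M\<^esub> act b x \<in> coinv_sub R B M act"
    unfolding coinv_sub_def by (rule mod_span_incl) (use assms in blast)
  then have "coinv_sub R B M act +>\<^bsub>M\<^esub> (counit B b \<odot>\<^bsub>M\<^esub> x) = coinv_sub R B M act +>\<^bsub>M\<^esub> act b x"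
    using rcoset_eq_iff[OF assms(1) K] assms left_module.act_closed[OF assms(2)] by blast
  then show ?thesis
    unfolding coinvariants_def using quot_smult[OF assms(1) K assms(3)[OF assms(4)] assms(5)] by simp
qed

text \<open>An equivariant map sends the generator given by \<open>b\<close> and \<open>x\<close> to the one given by \<open>b\<close> and
  \<open>f x\<close>.\<close>

lemma coinv_sub_equivariant:
  assumes "module R M" "left_module R B M act" "module R M'" "left_module R B M' act'"
    and c: "\<And>b. b \<in> carrier B \<Longrightarrow> counit B b \<in> carrier R"
    and f: "f \<in> mod_hom R M M'"
    and eq: "\<And>b x. b \<in> carrier B \<Longrightarrow> x \<in> carrier M \<Longrightarrow> f (act b x) = act' b (f x)"
    and "x \<in> coinv_sub R B M act"
  shows "f x \<in> coinv_sub R B M' act'"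
proof (rule mod_span_hom_image[OF f assms(1,3) coinv_sub_submodule[OF assms(3,4) c] _ _ assms(8)[unfolded coinv_sub_def]])
  interpret M: module R M by fact
  note ac = left_module.act_closed[OF assms(2)]
  show "{(counit B b \<odot>\<^bsub>M\<^esub> x) \<ominus>\<^bsub>M\<^esub> act b x | b x. b \<in> carrier B \<and> x \<in> carrier M} \<subseteq> carrier M"
    by (auto intro!: M.minus_closed M.smult_closed ac c)
  fix y assume "y \<in> {(counit B b \<odot>\<^bsub>M\<^esub> x) \<ominus>\<^bsub>M\<^esub> act b x | b x. b \<in> carrier B \<and> x \<in> carrier M}"
  then obtain b x where y: "y = (counit B b \<odot>\<^bsub>M\<^esub> x) \<ominus>\<^bsub>M\<^esub> act b x" and b: "b \<in> carrier B" and x: "x \<in> carrier M" by blast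
  have "f y = (counit B b \<odot>\<^bsub>M'\<^esub> f x) \<ominus>\<^bsub>M'\<^esub> act' b (f x)"
    unfolding y using b x mod_hom_smult[OF f c[OF b] x]
    by (simp add: mod_hom_diff[OF f assms(1,3)] c ac eq)
  then show "f y \<in> coinv_sub R B M' act'"
    unfolding coinv_sub_def using b mod_hom_closed[OF f x] by (auto intro!: mod_span_incl)
qed simp_all

context sweedler_data
begin

section \<open>The quotient by the commutators\<close>

lemma cof_hom: "j \<le> n + 1 \<Longrightarrow> cof n j \<in> mod_hom R (T (Suc n)) (T (Suc (Suc n)))"
proof (cases "j \<le> n")
  case True
  then show ?thesis by (rule_tac mod_hom_cong[OF spl_hom[OF True] mT]) (simp add: cof_def)
next
  case False
  have hom: "(\<lambda>\<xi>. tinv (Suc n) (spl 0 n \<xi>)) \<in> mod_hom R (T (Suc n)) (T (Suc (Suc n)))"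
    by (intro lin; simp)
  show ?thesis by (rule mod_hom_cong[OF hom mT]) (use False in \<open>simp add: cof_def\<close>)
qed

text \<open>All relations follow from those of the splittings and of the inverse cyclic operator with the
  splittings, since the last coface map is \<open>tinv\<close> after \<open>spl 0\<close>.\<close>

lemma almost_para_cocyclic_T: "almost_para_cocyclic_module R (\<lambda>n. T (Suc n)) cof tinv"
proof -
  have tc: "cof n j (tinv n \<xi>) = tinv (Suc n) (cof n (Suc j) \<xi>)" if "j \<le> n" "\<xi> \<in> carrier (T (Suc n))" for n j \<xi>
    using that spl_tinv_shift[of j n \<xi>] spl_last_tinv[of \<xi> n] by (cases "j = n") (auto simp: cof_def)
  have cc: "cof (Suc n) i (cof n j \<xi>) = cof (Suc n) (Suc j) (cof n i \<xi>)"
    if ij: "i \<le> j" "j \<le> Suc n" and \<xi>: "\<xi> \<in> carrier (T (Suc n))" for n i j \<xi>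
  proof -
    have 0: "spl 0 n \<xi> \<in> carrier (T (Suc (Suc n)))" using \<xi> by simp
    consider "j \<le> n" | "j = Suc n" "i \<le> n" | "j = Suc n" "i = Suc n" using ij by linarith
    then show ?thesis
    proof cases
      case 1 then show ?thesis using ij \<xi> by (simp add: cof_def spl_spl)
    next
      case 2
      have "cof (Suc n) i (cof n j \<xi>) = tinv (Suc (Suc n)) (spl (Suc i) (Suc n) (spl 0 n \<xi>))"
        using 2 spl_tinv_shift[of i "Suc n", OF _ 0] by (simp add: cof_def)
      also have "\<dots> = tinv (Suc (Suc n)) (spl 0 (Suc n) (spl i n \<xi>))"
        using 2 \<xi> by (simp add: spl_spl)
      finally show ?thesis using 2 by (simp add: cof_def)
    next
      case 3
      have "cof (Suc n) i (cof n j \<xi>) = spl (Suc n) (Suc n) (tinv (Suc n) (spl 0 n \<xi>))"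
        using 3 by (simp add: cof_def)
      also have "\<dots> = tinv (Suc (Suc n)) (tinv (Suc (Suc n)) (spl 0 (Suc n) (spl 0 n \<xi>)))"
        by (rule spl_last_tinv[OF 0])
      also have "\<dots> = tinv (Suc (Suc n)) (tinv (Suc (Suc n)) (spl (Suc 0) (Suc n) (spl 0 n \<xi>)))"
        using \<xi> by (simp add: spl_spl[of 0 0])
      also have "\<dots> = tinv (Suc (Suc n)) (spl 0 (Suc n) (tinv (Suc n) (spl 0 n \<xi>)))"
        using spl_tinv_shift[of 0 "Suc n", OF _ 0] by simp
      finally show ?thesis using 3 by (simp add: cof_def)
    qed
  qed
  have la: "cof n (Suc n) \<xi> = tinv (Suc n) (cof n 0 \<xi>)" for n \<xi> by (simp add: cof_def)
  show ?thesis
    unfolding almost_para_cocyclic_module_def cosimplicial_module_def Suc_eq_plus1[symmetric]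
    by (intro conjI allI impI ballI mT tinv_hom la; (elim conjE)?;
        rule cof_hom[unfolded Suc_eq_plus1[symmetric]] tc cc; assumption)
qed

definition tau :: "nat \<Rightarrow> ('x list \<times> 'y \<Rightarrow> 'a) set \<Rightarrow> ('x list \<times> 'y \<Rightarrow> 'a) set"
  where "tau n = inv_into (carrier (T (Suc n))) (tinv n)"

lemma hopf_tinv_bij: "hopf R B \<Longrightarrow> bij_betw (tinv n) (carrier (T (Suc n))) (carrier (T (Suc n)))"
proof -
  assume "hopf R B"
  then obtain S where S: "bijective_antipode R B S" by (auto simp: hopf_def)
  interpret hopf_data R B X actX Y actY coact S
    by (intro hopf_data.intro hopf_data_axioms.intro S sweedler_data_axioms)
  show ?thesis by (rule tinv_bij)
qed

lemma tau_hom: "hopf R B \<Longrightarrow> tau n \<in> mod_hom R (T (Suc n)) (T (Suc n))"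
  unfolding tau_def by (rule inverse_hom[OF tinv_hom hopf_tinv_bij mT])

lemma tau_inverse:
  assumes "hopf R B" "\<xi> \<in> carrier (T (Suc n))"
  shows "tinv n (tau n \<xi>) = \<xi>" "tau n (tinv n \<xi>) = \<xi>" "tau n \<xi> \<in> carrier (T (Suc n))"
  using hopf_tinv_bij[OF assms(1), of n] assms(2) mod_hom_closed[OF tau_hom[OF assms(1)] assms(2)]
  unfolding tau_def bij_betw_def by (auto simp: f_inv_into_f inv_into_f_f)

abbreviation P :: "nat \<Rightarrow> int \<Rightarrow> ('x list \<times> 'y \<Rightarrow> 'a) set \<Rightarrow> ('x list \<times> 'y \<Rightarrow> 'a) set"
  where "P n j \<equiv> T_taupow R X actX Y coact n j"

text \<open>The exponents for which commutators are divided out.\<close>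

definition admissible :: "int \<Rightarrow> bool" where "admissible j \<longleftrightarrow> hopf R B \<or> j \<ge> 0"

lemma funpow_agree:
  "(\<And>x. x \<in> A \<Longrightarrow> f x = g x) \<Longrightarrow> (\<And>x. x \<in> A \<Longrightarrow> g x \<in> A) \<Longrightarrow> x \<in> A \<Longrightarrow> (f ^^ k) x = (g ^^ k) x \<and> (g ^^ k) x \<in> A"
  by (induction k) auto

lemma P_nonneg: "\<xi> \<in> carrier (T (Suc n)) \<Longrightarrow> P n (int k) \<xi> = (tinv n ^^ k) \<xi>"
  using funpow_agree[of "carrier (T (Suc n))" "T_tauinv R X actX Y coact n" "tinv n" \<xi> k]
  by (simp add: T_taupow_def T_tauinv_eq)

lemma P_neg:
  assumes "hopf R B" "\<xi> \<in> carrier (T (Suc n))"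
  shows "P n (- int k) \<xi> = (tau n ^^ k) \<xi>"
proof -
  have "inv_op (T_mod R X Y) (T_tauinv R X actX Y coact) n = tau n"
    unfolding inv_op_def tau_def inv_into_def T_mod_def Suc_eq_plus1[symmetric]
    by (rule ext, rule arg_cong[of _ _ Eps], rule ext) (use T_tauinv_eq in auto)
  then show ?thesis by (cases "k = 0") (simp_all add: T_taupow_def)
qed

lemma P_0: "\<xi> \<in> carrier (T (Suc n)) \<Longrightarrow> P n 0 \<xi> = \<xi>"
  using P_nonneg[of \<xi> n 0] by simp

lemma P_1: "\<xi> \<in> carrier (T (Suc n)) \<Longrightarrow> P n 1 \<xi> = tinv n \<xi>"
  using P_nonneg[of \<xi> n 1] by simp

lemma tau_power_closed: "hopf R B \<Longrightarrow> \<xi> \<in> carrier (T (Suc n)) \<Longrightarrow> (tau n ^^ k) \<xi> \<in> carrier (T (Suc n))"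
  by (induction k) (auto simp: tau_inverse)

lemma P_succ:
  assumes "admissible j" "\<xi> \<in> carrier (T (Suc n))"
  shows "P n (j + 1) \<xi> = tinv n (P n j \<xi>)"
proof (cases "j \<ge> 0")
  case True
  then obtain k where "j = int k" using zero_le_imp_eq_int by blast
  then show ?thesis using P_nonneg[OF assms(2), of k] P_nonneg[OF assms(2), of "Suc k"]
    by (simp add: add.commute)
next
  case False
  then have H: "hopf R B" using assms(1) by (simp add: admissible_def)
  define k where "k = nat (- j - 1)"
  have k: "j = - int (Suc k)" using False by (simp add: k_def)
  then have "P n (j + 1) \<xi> = (tau n ^^ k) \<xi>" using P_neg[OF H assms(2), of k] by simp
  also have "\<dots> = tinv n ((tau n ^^ Suc k) \<xi>)"
    using tau_inverse(1)[OF H tau_power_closed[OF H assms(2)]] by simp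
  finally show ?thesis using P_neg[OF H assms(2), of "Suc k"] k by simp
qed

lemma P_closed: "admissible j \<Longrightarrow> \<xi> \<in> carrier (T (Suc n)) \<Longrightarrow> P n j \<xi> \<in> carrier (T (Suc n))"
proof (cases "j \<ge> 0")
  case True
  assume x: "\<xi> \<in> carrier (T (Suc n))"
  from True obtain k where "j = int k" using zero_le_imp_eq_int by blast
  then show ?thesis using P_nonneg[OF x, of k] tinv_power_closed[OF x] by simp
next
  case False
  assume "admissible j" and x: "\<xi> \<in> carrier (T (Suc n))"
  then have H: "hopf R B" using False by (simp add: admissible_def)
  have "j = - int (nat (- j))" using False by simp
  then obtain k where "j = - int k" by blast
  then show ?thesis using P_neg[OF H x, of k] tau_power_closed[OF H x] by simp
qed

lemma P_pred:
  assumes "hopf R B" "\<xi> \<in> carrier (T (Suc n))"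
  shows "P n (j - 1) \<xi> = tau n (P n j \<xi>)"
proof -
  have a: "admissible i" for i using assms(1) by (simp add: admissible_def)
  show ?thesis
    using P_succ[OF a assms(2), of "j - 1"] tau_inverse(2)[OF assms(1) P_closed[OF a assms(2), of "j - 1"]] by simp
qed

lemma admissible_induct [consumes 1, case_names zero up down]:
  assumes "admissible j" "Q 0" "\<And>j. admissible j \<Longrightarrow> Q j \<Longrightarrow> Q (j + 1)"
    and "\<And>j. hopf R B \<Longrightarrow> Q j \<Longrightarrow> Q (j - 1)"
  shows "Q j"
proof (cases "j \<ge> 0")
  case True
  then show ?thesis
    by (induction j rule: int_ge_induct) (use assms in \<open>auto simp: admissible_def\<close>)
next
  case False
  then have H: "hopf R B" using assms(1) by (simp add: admissible_def)
  from False have "j \<le> 0" by simp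
  then show ?thesis
    by (induction j rule: int_le_induct) (use assms H in auto)
qed

text \<open>Moving \<open>spl i\<close> past one factor \<open>tinv\<close> shifts the index by one, except that
  \<open>spl n\<close> past one factor becomes \<open>spl 0\<close> with two factors.  So a power of \<open>tinv\<close> on one side
  corresponds to a power on the other, and the map that remains is again one of the splittings,
  which commute with the action of \<open>B\<close>.  The last coface map would not.\<close>

lemma spl_P:
  assumes "admissible j" "i \<le> n"
  shows "\<exists>j' i'. admissible j' \<and> i' \<le> n \<and>
    (\<forall>\<xi> \<in> carrier (T (Suc n)). spl i n (P n j \<xi>) = P (Suc n) j' (spl i' n \<xi>))"
  using assms
proof (induction j arbitrary: i rule: admissible_induct)
  case zero
  then show ?case by (intro exI[of _ 0] exI[of _ i]) (auto simp: P_0 admissible_def)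
next
  case (up j)
  have next_adm: "admissible (j' + 1)" if "admissible j'" for j' using that by (auto simp: admissible_def)
  show ?case
  proof (cases "i < n")
    case True
    then obtain j' i' where h: "admissible j'" "i' \<le> n"
      "\<forall>\<xi> \<in> carrier (T (Suc n)). spl (Suc i) n (P n j \<xi>) = P (Suc n) j' (spl i' n \<xi>)"
      using up.IH[of "Suc i"] by auto
    then have "\<forall>\<xi> \<in> carrier (T (Suc n)). spl i n (P n (j + 1) \<xi>) = P (Suc n) (j' + 1) (spl i' n \<xi>)"
      using P_succ[OF up.hyps(1)] P_succ[OF h(1)] P_closed[OF up.hyps(1)] spl_tinv_shift[OF True] by simp
    then show ?thesis using h next_adm by blast
  next
    case False
    then have i: "i = n" using up.prems by simp
    obtain j' i' where h: "admissible j'" "i' \<le> n"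
      "\<forall>\<xi> \<in> carrier (T (Suc n)). spl 0 n (P n j \<xi>) = P (Suc n) j' (spl i' n \<xi>)"
      using up.IH[of 0] by auto
    then have "\<forall>\<xi> \<in> carrier (T (Suc n)). spl i n (P n (j + 1) \<xi>) = P (Suc n) (j' + 1 + 1) (spl i' n \<xi>)"
      using P_succ[OF up.hyps(1)] P_succ[OF h(1)] P_succ[OF next_adm[OF h(1)]] P_closed[OF up.hyps(1)]
      by (simp add: i spl_last_tinv)
    then show ?thesis using h next_adm by blast
  qed
next
  case (down j)
  have adm: "admissible i" for i using down.hyps(1) by (simp add: admissible_def)
  note c = P_closed[OF adm] and t = tau_inverse[OF down.hyps(1)] and pr = P_pred[OF down.hyps(1)]
  show ?case
  proof (cases i)
    case (Suc i0)
    with down.prems have i0: "i0 < n" by simp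
    obtain j' i' where h: "i' \<le> n"
      "\<forall>\<xi> \<in> carrier (T (Suc n)). spl i0 n (P n j \<xi>) = P (Suc n) j' (spl i' n \<xi>)"
      using down.IH[of i0] i0 by auto
    have "spl i n (P n (j - 1) \<xi>) = P (Suc n) (j' - 1) (spl i' n \<xi>)" if \<xi>: "\<xi> \<in> carrier (T (Suc n))" for \<xi>
    proof -
      have "spl i0 n (P n j \<xi>) = tinv (Suc n) (spl i n (tau n (P n j \<xi>)))"
        using spl_tinv_shift[OF i0 t(3)[OF c[OF \<xi>]]] t(1)[OF c[OF \<xi>]] Suc by simp
      then have "spl i n (tau n (P n j \<xi>)) = tau (Suc n) (spl i0 n (P n j \<xi>))"
        using t(2)[of "spl i n (tau n (P n j \<xi>))" "Suc n"] t(3)[OF c[OF \<xi>]] down.prems by simp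
      then show ?thesis using h \<xi> pr by simp
    qed
    then show ?thesis using h(1) adm by blast
  next
    case 0
    obtain j' i' where h: "i' \<le> n"
      "\<forall>\<xi> \<in> carrier (T (Suc n)). spl n n (P n j \<xi>) = P (Suc n) j' (spl i' n \<xi>)"
      using down.IH[of n] by auto
    have "spl i n (P n (j - 1) \<xi>) = P (Suc n) (j' - 1 - 1) (spl i' n \<xi>)" if \<xi>: "\<xi> \<in> carrier (T (Suc n))" for \<xi>
    proof -
      have "spl n n (P n j \<xi>) = tinv (Suc n) (tinv (Suc n) (spl 0 n (tau n (P n j \<xi>))))"
        using spl_last_tinv[OF t(3)[OF c[OF \<xi>]]] t(1)[OF c[OF \<xi>]] by simp
      then have "spl 0 n (tau n (P n j \<xi>)) = tau (Suc n) (tau (Suc n) (spl n n (P n j \<xi>)))"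
        using t(2)[of _ "Suc n"] t(3)[OF c[OF \<xi>]] by simp
      then have "spl i n (P n (j - 1) \<xi>) = tau (Suc n) (tau (Suc n) (P (Suc n) j' (spl i' n \<xi>)))"
        using h \<xi> pr[OF \<xi>] 0 by simp
      also have "\<dots> = P (Suc n) (j' - 1 - 1) (spl i' n \<xi>)"
        by (simp only: pr[OF spl_closed[OF h(1) \<xi>]])
      finally show ?thesis .
    qed
    then show ?thesis using h(1) adm by blast
  qed
qed

abbreviation I :: "nat \<Rightarrow> ('x list \<times> 'y \<Rightarrow> 'a) set set"
  where "I n \<equiv> comm_sub R B X actX Y actY coact n"

abbreviation PCM :: "nat \<Rightarrow> ('a, ('x list \<times> 'y \<Rightarrow> 'a) set set) module"
  where "PCM \<equiv> PCM_mod R B X actX Y actY coact"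

definition cl :: "nat \<Rightarrow> ('x list \<times> 'y \<Rightarrow> 'a) set \<Rightarrow> ('x list \<times> 'y \<Rightarrow> 'a) set set"
  where "cl n \<xi> = I n +>\<^bsub>T (Suc n)\<^esub> \<xi>"

lemma diff_closed_T: "x \<in> carrier (T n) \<Longrightarrow> y \<in> carrier (T n) \<Longrightarrow> x \<ominus>\<^bsub>T n\<^esub> y \<in> carrier (T n)"
  using mT[of n] unfolding module_def by (meson abelian_group.minus_closed)

lemma I_eq: "I n = mod_span R (T (Suc n))
    {actn (Suc n) b (P n j \<xi>) \<ominus>\<^bsub>T (Suc n)\<^esub> P n j (actn (Suc n) b \<xi>) | b j \<xi>.
      b \<in> carrier B \<and> \<xi> \<in> carrier (T (Suc n)) \<and> admissible j}"
proof -
  have "{T_act R B X actX Y actY n b (P n j \<xi>) \<ominus>\<^bsub>T (Suc n)\<^esub> P n j (T_act R B X actX Y actY n b \<xi>) | b j \<xi>.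
          b \<in> carrier B \<and> \<xi> \<in> carrier (T (Suc n)) \<and> (hopf R B \<or> j \<ge> 0)} =
    {actn (Suc n) b (P n j \<xi>) \<ominus>\<^bsub>T (Suc n)\<^esub> P n j (actn (Suc n) b \<xi>) | b j \<xi>.
      b \<in> carrier B \<and> \<xi> \<in> carrier (T (Suc n)) \<and> admissible j}"
    unfolding admissible_def[symmetric]
    by (rule Collect_cong, intro ex_cong1) (auto simp: T_act_eq P_closed)
  then show ?thesis by (simp add: comm_sub_def T_mod_def Let_def)
qed

lemma I_gens_closed:
  "{actn (Suc n) b (P n j \<xi>) \<ominus>\<^bsub>T (Suc n)\<^esub> P n j (actn (Suc n) b \<xi>) | b j \<xi>.
      b \<in> carrier B \<and> \<xi> \<in> carrier (T (Suc n)) \<and> admissible j} \<subseteq> carrier (T (Suc n))"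
  by (auto intro!: diff_closed_T simp: P_closed)

lemma I_submodule: "submodule (I n) R (T (Suc n))"
  unfolding I_eq by (rule mod_span_submodule[OF mT I_gens_closed])

lemma mPCM [simp]: "module R (PCM n)"
  using quot_module[OF mT I_submodule] by (simp add: PCM_mod_def T_mod_def)

lemma cl_hom: "cl n \<in> mod_hom R (T (Suc n)) (PCM n)"
  using quot_proj_hom[OF mT I_submodule] unfolding cl_def by (simp add: PCM_mod_def T_mod_def)

lemma PCM_carrier: "carrier (PCM n) = cl n ` carrier (T (Suc n))"
  unfolding cl_def by (auto simp: PCM_mod_def T_mod_def quot_carrier)

lemma cl_commutes:
  assumes "b \<in> carrier B" "\<xi> \<in> carrier (T (Suc n))" "admissible j"
  shows "cl n (actn (Suc n) b (P n j \<xi>)) = cl n (P n j (actn (Suc n) b \<xi>))"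
proof -
  have "actn (Suc n) b (P n j \<xi>) \<ominus>\<^bsub>T (Suc n)\<^esub> P n j (actn (Suc n) b \<xi>) \<in> I n"
    unfolding I_eq by (rule mod_span_incl) (use assms in blast)
  then show ?thesis unfolding cl_def using rcoset_eq_iff[OF mT I_submodule] assms P_closed by simp
qed

text \<open>A linear map respects the commutators if it identifies both sides of each commutator modulo
  the target submodule.\<close>

lemma I_image:
  assumes "f \<in> mod_hom R (T (Suc n)) M" "module R M" "submodule K R M"
    and "\<And>b j \<xi>. b \<in> carrier B \<Longrightarrow> \<xi> \<in> carrier (T (Suc n)) \<Longrightarrow> admissible j \<Longrightarrow>
      K +>\<^bsub>M\<^esub> f (actn (Suc n) b (P n j \<xi>)) = K +>\<^bsub>M\<^esub> f (P n j (actn (Suc n) b \<xi>))"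
    and "x \<in> I n"
  shows "f x \<in> K"
proof (rule mod_span_hom_image[OF assms(1) mT assms(2,3) I_gens_closed _ assms(5)[unfolded I_eq]])
  fix x assume "x \<in> {actn (Suc n) b (P n j \<xi>) \<ominus>\<^bsub>T (Suc n)\<^esub> P n j (actn (Suc n) b \<xi>) | b j \<xi>.
      b \<in> carrier B \<and> \<xi> \<in> carrier (T (Suc n)) \<and> admissible j}"
  then obtain b j \<xi> where x: "x = actn (Suc n) b (P n j \<xi>) \<ominus>\<^bsub>T (Suc n)\<^esub> P n j (actn (Suc n) b \<xi>)"
    and h: "b \<in> carrier B" "\<xi> \<in> carrier (T (Suc n))" "admissible j" by blast
  have c: "actn (Suc n) b (P n j \<xi>) \<in> carrier (T (Suc n))" "P n j (actn (Suc n) b \<xi>) \<in> carrier (T (Suc n))"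
    using h by (simp_all add: P_closed)
  show "f x \<in> K" unfolding x mod_hom_diff[OF assms(1) mT assms(2) c]
    by (rule rcoset_diff_mem[OF assms(2,3) mod_hom_closed[OF assms(1) c(1)] mod_hom_closed[OF assms(1) c(2)] assms(4)[OF h]])
qed

text \<open>Modulo commutators, \<open>L\<^sub>c L\<^sub>b \<tau>\<^sup>-\<^sup>j\<close> and \<open>L\<^sub>c \<tau>\<^sup>-\<^sup>j L\<^sub>b\<close> both equal \<open>\<tau>\<^sup>-\<^sup>j L\<^sub>c L\<^sub>b\<close>: the first as the
  commutator with \<open>c b\<close>, the second as the commutator with \<open>c\<close>.\<close>

lemma actn_I: "c \<in> carrier B \<Longrightarrow> x \<in> I n \<Longrightarrow> actn (Suc n) c x \<in> I n"
proof (rule I_image[OF bilinearD(1)[OF actn_bilinear] mT I_submodule], assumption)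
  fix b j \<xi> assume c: "c \<in> carrier B" and h: "b \<in> carrier B" "\<xi> \<in> carrier (T (Suc n))" "admissible j"
  have "cl n (actn (Suc n) c (actn (Suc n) b (P n j \<xi>))) = cl n (P n j (actn (Suc n) c (actn (Suc n) b \<xi>)))"
    using c h cl_commutes[of "mulB c b" \<xi> n j] P_closed by (simp add: actn_mult)
  also have "\<dots> = cl n (actn (Suc n) c (P n j (actn (Suc n) b \<xi>)))"
    using c h cl_commutes[of c "actn (Suc n) b \<xi>" n j] by simp
  finally show "I n +>\<^bsub>T (Suc n)\<^esub> actn (Suc n) c (actn (Suc n) b (P n j \<xi>)) =
      I n +>\<^bsub>T (Suc n)\<^esub> actn (Suc n) c (P n j (actn (Suc n) b \<xi>))" by (simp add: cl_def)
qed

lemma cl_tinv_commutes: "b \<in> carrier B \<Longrightarrow> \<xi> \<in> carrier (T (Suc n)) \<Longrightarrow>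
    cl n (tinv n (actn (Suc n) b \<xi>)) = cl n (actn (Suc n) b (tinv n \<xi>))"
  using cl_commutes[of b \<xi> n 1] by (simp add: P_1 admissible_def)

text \<open>Modulo commutators, \<open>\<tau>\<^sup>-\<^sup>1 L\<^sub>b \<tau>\<^sup>-\<^sup>j\<close> equals \<open>L\<^sub>b \<tau>\<^sup>-\<^sup>(\<^sup>j\<^sup>+\<^sup>1\<^sup>)\<close>, hence \<open>\<tau>\<^sup>-\<^sup>(\<^sup>j\<^sup>+\<^sup>1\<^sup>) L\<^sub>b\<close>.\<close>

lemma tinv_I: "x \<in> I n \<Longrightarrow> tinv n x \<in> I n"
proof (rule I_image[OF tinv_hom mT I_submodule])
  fix b j \<xi> assume h: "b \<in> carrier B" "\<xi> \<in> carrier (T (Suc n))" "admissible j"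
  have a: "admissible (j + 1)" using h(3) by (auto simp: admissible_def)
  have "cl n (tinv n (actn (Suc n) b (P n j \<xi>))) = cl n (actn (Suc n) b (P n (j + 1) \<xi>))"
    using h P_closed by (simp add: cl_tinv_commutes P_succ)
  also have "\<dots> = cl n (tinv n (P n j (actn (Suc n) b \<xi>)))"
    using h cl_commutes[OF h(1,2) a] by (simp add: P_succ)
  finally show "I n +>\<^bsub>T (Suc n)\<^esub> tinv n (actn (Suc n) b (P n j \<xi>)) = I n +>\<^bsub>T (Suc n)\<^esub> tinv n (P n j (actn (Suc n) b \<xi>))"
    by (simp add: cl_def)
qed

lemma tau_I: "hopf R B \<Longrightarrow> x \<in> I n \<Longrightarrow> tau n x \<in> I n"
proof (rule I_image[OF tau_hom mT I_submodule], assumption)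
  fix b j \<xi> assume H: "hopf R B" and h: "b \<in> carrier B" "\<xi> \<in> carrier (T (Suc n))" "admissible j"
  have a: "admissible i" for i using H by (simp add: admissible_def)
  have t1: "tau n \<eta> = P n (- 1) \<eta>" if "\<eta> \<in> carrier (T (Suc n))" for \<eta>
    using P_pred[OF H that, of 0] P_0[OF that] by simp
  have "cl n (tau n (actn (Suc n) b (P n j \<xi>))) = cl n (actn (Suc n) b (tau n (P n j \<xi>)))"
    using h cl_commutes[OF h(1) P_closed[OF a h(2)] a, of "-1" j] P_closed[OF a h(2)] by (simp add: t1)
  also have "\<dots> = cl n (actn (Suc n) b (P n (j - 1) \<xi>))" using h P_pred[OF H] by simp
  also have "\<dots> = cl n (tau n (P n j (actn (Suc n) b \<xi>)))"
    using h cl_commutes[OF h(1,2) a, of "j - 1"] by (simp add: P_pred[OF H])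
  finally show "I n +>\<^bsub>T (Suc n)\<^esub> tau n (actn (Suc n) b (P n j \<xi>)) = I n +>\<^bsub>T (Suc n)\<^esub> tau n (P n j (actn (Suc n) b \<xi>))"
    by (simp add: cl_def)
qed

text \<open>By \<open>spl_P\<close>, a splitting sends a commutator to the commutator of \<open>L\<^sub>b\<close> with the power on the other
  side, evaluated at a split tensor.\<close>

lemma spl_I: "i \<le> n \<Longrightarrow> x \<in> I n \<Longrightarrow> spl i n x \<in> I (Suc n)"
proof (rule I_image[OF spl_hom mT I_submodule], assumption)
  fix b j \<xi> assume i: "i \<le> n" and h: "b \<in> carrier B" "\<xi> \<in> carrier (T (Suc n))" "admissible j"
  obtain j' i' where p: "admissible j'" "i' \<le> n"
    "\<And>\<xi>. \<xi> \<in> carrier (T (Suc n)) \<Longrightarrow> spl i n (P n j \<xi>) = P (Suc n) j' (spl i' n \<xi>)"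
    using spl_P[OF h(3) i] by blast
  have "cl (Suc n) (spl i n (actn (Suc n) b (P n j \<xi>))) = cl (Suc n) (actn (Suc (Suc n)) b (P (Suc n) j' (spl i' n \<xi>)))"
    using i h P_closed p by (simp add: actn_spl)
  also have "\<dots> = cl (Suc n) (P (Suc n) j' (actn (Suc (Suc n)) b (spl i' n \<xi>)))"
    using h p by (intro cl_commutes) simp_all
  also have "\<dots> = cl (Suc n) (spl i n (P n j (actn (Suc n) b \<xi>)))"
    using h p by (simp add: actn_spl)
  finally show "I (Suc n) +>\<^bsub>T (Suc (Suc n))\<^esub> spl i n (actn (Suc n) b (P n j \<xi>)) =
      I (Suc n) +>\<^bsub>T (Suc (Suc n))\<^esub> spl i n (P n j (actn (Suc n) b \<xi>))"
    by (simp add: cl_def)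
qed

lemma cof_I: "x \<in> I n \<Longrightarrow> cof n j x \<in> I (Suc n)"
  by (simp add: cof_def spl_I tinv_I)

lemma PCM_act_cl:
  assumes "b \<in> carrier B"
  shows "\<xi> \<in> carrier (T (Suc n)) \<Longrightarrow> PCM_act R B X actX Y actY coact n b (cl n \<xi>) = cl n (actn (Suc n) b \<xi>)"
    and "PCM_act R B X actX Y actY coact n b \<in> mod_hom R (PCM n) (PCM n)"
proof -
  have hom: "T_act R B X actX Y actY n b \<in> mod_hom R (T (Suc n)) (T (Suc n))"
    by (rule mod_hom_cong[OF bilinearD(1)[OF actn_bilinear assms] mT T_act_eq[OF assms]])
  have I: "T_act R B X actX Y actY n b x \<in> I n" if "x \<in> I n" for x
    using that submodule_subset[OF I_submodule, of n] assms by (subst T_act_eq) (auto intro: actn_I)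
  show "\<xi> \<in> carrier (T (Suc n)) \<Longrightarrow> PCM_act R B X actX Y actY coact n b (cl n \<xi>) = cl n (actn (Suc n) b \<xi>)"
    using quot_map_rcoset[OF mT I_submodule mT I_submodule hom I] assms
    by (simp add: PCM_act_def cl_def T_mod_def T_act_eq)
  show "PCM_act R B X actX Y actY coact n b \<in> mod_hom R (PCM n) (PCM n)"
    using quot_map_hom[OF mT I_submodule mT I_submodule hom I]
    by (simp add: PCM_act_def PCM_mod_def T_mod_def)
qed

lemma PCM_coface_cl:
  assumes "j \<le> n + 1"
  shows "\<xi> \<in> carrier (T (Suc n)) \<Longrightarrow> PCM_coface R B X actX Y actY coact n j (cl n \<xi>) = cl (n + 1) (cof n j \<xi>)"
    and "PCM_coface R B X actX Y actY coact n j \<in> mod_hom R (PCM n) (PCM (n + 1))"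
proof -
  have hom: "T_coface R X actX Y coact n j \<in> mod_hom R (T (Suc n)) (T (Suc (Suc n)))"
    by (rule mod_hom_cong[OF cof_hom[OF assms] mT T_coface_eq])
  have I: "T_coface R X actX Y coact n j x \<in> I (Suc n)" if "x \<in> I n" for x
    using that submodule_subset[OF I_submodule, of n] by (subst T_coface_eq) (auto intro: cof_I)
  show "\<xi> \<in> carrier (T (Suc n)) \<Longrightarrow> PCM_coface R B X actX Y actY coact n j (cl n \<xi>) = cl (n + 1) (cof n j \<xi>)"
    using quot_map_rcoset[OF mT I_submodule mT I_submodule hom I] assms
    by (simp add: PCM_coface_def cl_def T_mod_def T_coface_eq)
  show "PCM_coface R B X actX Y actY coact n j \<in> mod_hom R (PCM n) (PCM (n + 1))"
    using quot_map_hom[OF mT I_submodule mT I_submodule hom I]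
    by (simp add: PCM_coface_def PCM_mod_def T_mod_def)
qed

lemma PCM_tauinv_cl:
  shows "\<xi> \<in> carrier (T (Suc n)) \<Longrightarrow> PCM_tauinv R B X actX Y actY coact n (cl n \<xi>) = cl n (tinv n \<xi>)"
    and "PCM_tauinv R B X actX Y actY coact n \<in> mod_hom R (PCM n) (PCM n)"
proof -
  have hom: "T_tauinv R X actX Y coact n \<in> mod_hom R (T (Suc n)) (T (Suc n))"
    by (rule mod_hom_cong[OF tinv_hom mT T_tauinv_eq])
  have I: "T_tauinv R X actX Y coact n x \<in> I n" if "x \<in> I n" for x
    using that submodule_subset[OF I_submodule, of n] by (subst T_tauinv_eq) (auto intro: tinv_I)
  show "\<xi> \<in> carrier (T (Suc n)) \<Longrightarrow> PCM_tauinv R B X actX Y actY coact n (cl n \<xi>) = cl n (tinv n \<xi>)"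
    using quot_map_rcoset[OF mT I_submodule mT I_submodule hom I]
    by (simp add: PCM_tauinv_def cl_def T_mod_def T_tauinv_eq)
  show "PCM_tauinv R B X actX Y actY coact n \<in> mod_hom R (PCM n) (PCM n)"
    using quot_map_hom[OF mT I_submodule mT I_submodule hom I]
    by (simp add: PCM_tauinv_def PCM_mod_def T_mod_def)
qed

abbreviation dP :: "nat \<Rightarrow> nat \<Rightarrow> ('x list \<times> 'y \<Rightarrow> 'a) set set \<Rightarrow> ('x list \<times> 'y \<Rightarrow> 'a) set set"
  where "dP \<equiv> PCM_coface R B X actX Y actY coact"

abbreviation uP :: "nat \<Rightarrow> ('x list \<times> 'y \<Rightarrow> 'a) set set \<Rightarrow> ('x list \<times> 'y \<Rightarrow> 'a) set set"
  where "uP \<equiv> PCM_tauinv R B X actX Y actY coact"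

abbreviation LP :: "nat \<Rightarrow> 'b \<Rightarrow> ('x list \<times> 'y \<Rightarrow> 'a) set set \<Rightarrow> ('x list \<times> 'y \<Rightarrow> 'a) set set"
  where "LP \<equiv> PCM_act R B X actX Y actY coact"

lemma PCM_almost_para_cocyclic: "almost_para_cocyclic_module R PCM dP uP"
  by (rule almost_para_cocyclic_quotient[where C = "\<lambda>n. T (Suc n)" and d = cof and u = tinv and q = cl])
    (rule almost_para_cocyclic_T mPCM PCM_carrier[symmetric]
        PCM_coface_cl(2) PCM_tauinv_cl(2) PCM_coface_cl(1) PCM_tauinv_cl(1); assumption)+

lemma PCM_ex: "z \<in> carrier (PCM n) \<Longrightarrow> \<exists>\<xi> \<in> carrier (T (Suc n)). z = cl n \<xi>"
  unfolding PCM_carrier by blast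

lemma PCM_left_module: "left_module R B (PCM n) (LP n)"
proof (intro left_module.intro left_module_axioms.intro mPCM)
  fix b x assume b: "b \<in> carrier B" and x: "x \<in> carrier (PCM n)"
  show "LP n b x \<in> carrier (PCM n)"
    by (rule mod_hom_closed[OF PCM_act_cl(2)[OF b] x])
next
  fix b c x assume b: "b \<in> carrier B" "c \<in> carrier B" and x: "x \<in> carrier (PCM n)"
  then obtain \<xi> where \<xi>: "\<xi> \<in> carrier (T (Suc n))" "x = cl n \<xi>" using PCM_ex by blast
  have B_add: "b \<oplus>\<^bsub>B\<^esub> c \<in> carrier B"
    using b mB unfolding module_def abelian_group_def by (simp add: abelian_monoid.a_closed)
  show "LP n (b \<oplus>\<^bsub>B\<^esub> c) x = LP n b x \<oplus>\<^bsub>PCM n\<^esub> LP n c x"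
    using b \<xi> B_add by (simp add: PCM_act_cl(1) left_module.act_add_left[OF actn_left_module] mod_hom_add[OF cl_hom])
  show "LP n (b \<otimes>\<^bsub>B\<^esub> c) x = LP n b (LP n c x)"
    using b \<xi> by (simp add: PCM_act_cl(1) actn_mult)
next
  fix a b x assume a: "a \<in> carrier R" and b: "b \<in> carrier B" and x: "x \<in> carrier (PCM n)"
  then obtain \<xi> where \<xi>: "\<xi> \<in> carrier (T (Suc n))" "x = cl n \<xi>" using PCM_ex by blast
  show "LP n (a \<odot>\<^bsub>B\<^esub> b) x = a \<odot>\<^bsub>PCM n\<^esub> LP n b x"
    using a b \<xi> module.smult_closed[OF mB a b]
    by (simp add: PCM_act_cl(1) left_module.act_smult_left[OF actn_left_module] mod_hom_smult[OF cl_hom])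
  show "LP n b (a \<odot>\<^bsub>PCM n\<^esub> x) = a \<odot>\<^bsub>PCM n\<^esub> LP n b x"
    by (rule mod_hom_smult[OF PCM_act_cl(2)[OF b] a x])
next
  fix b x y assume b: "b \<in> carrier B" and x: "x \<in> carrier (PCM n)" "y \<in> carrier (PCM n)"
  show "LP n b (x \<oplus>\<^bsub>PCM n\<^esub> y) = LP n b x \<oplus>\<^bsub>PCM n\<^esub> LP n b y"
    by (rule mod_hom_add[OF PCM_act_cl(2)[OF b] x])
next
  fix x assume x: "x \<in> carrier (PCM n)"
  then obtain \<xi> where \<xi>: "\<xi> \<in> carrier (T (Suc n))" "x = cl n \<xi>" using PCM_ex by blast
  then show "LP n \<one>\<^bsub>B\<^esub> x = x" by (simp add: PCM_act_cl(1) actn_one)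
qed

lemma PCM_tauinv_equivariant:
  assumes "b \<in> carrier B" "z \<in> carrier (PCM n)"
  shows "uP n (LP n b z) = LP n b (uP n z)"
proof -
  obtain \<xi> where "\<xi> \<in> carrier (T (Suc n))" "z = cl n \<xi>" using PCM_ex[OF assms(2)] by blast
  then show ?thesis
    using assms(1) by (simp add: PCM_act_cl(1) PCM_tauinv_cl(1) cl_tinv_commutes)
qed

lemma PCM_coface_equivariant:
  assumes "j \<le> n + 1" "b \<in> carrier B" "z \<in> carrier (PCM n)"
  shows "dP n j (LP n b z) = LP (n + 1) b (dP n j z)"
proof -
  obtain \<xi> where \<xi>: "\<xi> \<in> carrier (T (Suc n))" "z = cl n \<xi>" using PCM_ex[OF assms(3)] by blast
  have "cl (Suc n) (cof n j (actn (Suc n) b \<xi>)) = cl (Suc n) (actn (Suc (Suc n)) b (cof n j \<xi>))"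
    using assms(2) \<xi>(1) by (simp add: cof_def actn_spl cl_tinv_commutes)
  then show ?thesis
    using assms(1,2) \<xi> mod_hom_closed[OF cof_hom[OF assms(1)] \<xi>(1)]
    by (simp add: PCM_act_cl(1) PCM_coface_cl(1)[simplified])
qed

lemma PCM_graded_left_module: "graded_left_module R B PCM LP"
  unfolding graded_left_module_def by (intro allI PCM_left_module)

lemma PCM_cofaces_equivariant: "cofaces_equivariant B PCM LP dP"
  unfolding cofaces_equivariant_def by (intro allI impI ballI PCM_coface_equivariant)

lemma PCM_cosimplicial_B_module: "cosimplicial_B_module R B PCM LP dP"
  unfolding cosimplicial_B_module_def
  by (intro conjI PCM_graded_left_module PCM_cofaces_equivariant
      conjunct1[OF PCM_almost_para_cocyclic[unfolded almost_para_cocyclic_module_def]])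

lemma PCM_almost_para_cocyclic_B_module: "almost_para_cocyclic_B_module R B PCM LP dP uP"
  unfolding almost_para_cocyclic_B_module_def operators_equivariant_def
  by (intro conjI allI ballI PCM_almost_para_cocyclic PCM_graded_left_module PCM_cofaces_equivariant
      PCM_tauinv_equivariant)

lemma PCM_tauinv_bij:
  assumes "hopf R B"
  shows "bij_betw (uP n) (carrier (PCM n)) (carrier (PCM n))"
proof -
  have v: "quot_map (T (Suc n)) (I n) (tau n) (cl n \<xi>) = cl n (tau n \<xi>)" if "\<xi> \<in> carrier (T (Suc n))" for \<xi>
    unfolding cl_def by (rule quot_map_rcoset[OF mT I_submodule mT I_submodule tau_hom[OF assms] tau_I[OF assms] that])
  have vh: "quot_map (T (Suc n)) (I n) (tau n) \<in> mod_hom R (PCM n) (PCM n)"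
    using quot_map_hom[OF mT I_submodule mT I_submodule tau_hom[OF assms] tau_I[OF assms]]
    by (simp add: PCM_mod_def T_mod_def)
  show ?thesis
  proof (rule bij_betw_byWitness[where f' = "quot_map (T (Suc n)) (I n) (tau n)"])
    show "\<forall>z\<in>carrier (PCM n). quot_map (T (Suc n)) (I n) (tau n) (uP n z) = z"
      "\<forall>z\<in>carrier (PCM n). uP n (quot_map (T (Suc n)) (I n) (tau n) z) = z"
      by (simp_all add: PCM_carrier PCM_tauinv_cl(1) v tau_inverse[OF assms])
    show "uP n ` carrier (PCM n) \<subseteq> carrier (PCM n)"
      "quot_map (T (Suc n)) (I n) (tau n) ` carrier (PCM n) \<subseteq> carrier (PCM n)"
      by (rule image_subsetI, rule mod_hom_closed[OF PCM_tauinv_cl(2)], assumption)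
        (rule image_subsetI, rule mod_hom_closed[OF vh], assumption)
  qed
qed

lemma PCM_para_cocyclic_B_module:
  assumes "hopf R B"
  shows "para_cocyclic_B_module R B PCM LP dP (inv_op PCM uP)"
proof -
  note t = inv_op_inverse[of uP _ PCM, OF PCM_tauinv_bij[OF assms]]
  have "inv_op PCM uP n (LP n b z) = LP n b (inv_op PCM uP n z)" if "b \<in> carrier B" "z \<in> carrier (PCM n)" for n b z
  proof -
    have c: "LP n b (inv_op PCM uP n z) \<in> carrier (PCM n)"
      by (rule left_module.act_closed[OF PCM_left_module that(1) t(1)[OF that(2)]])
    have "LP n b z = uP n (LP n b (inv_op PCM uP n z))"
      using PCM_tauinv_equivariant[OF that(1) t(1)[OF that(2)]] t(2)[OF that(2)] by simp
    then show ?thesis using t(3)[OF c] by simp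
  qed
  then show ?thesis
    unfolding para_cocyclic_B_module_def operators_equivariant_def
    by (intro conjI para_cocyclic_of_bij[OF PCM_almost_para_cocyclic PCM_tauinv_bij[OF assms]]
        PCM_graded_left_module PCM_cofaces_equivariant) blast
qed

section \<open>Coinvariants\<close>

abbreviation J :: "nat \<Rightarrow> ('x list \<times> 'y \<Rightarrow> 'a) set set set"
  where "J n \<equiv> coinv_sub R B (PCM n) (LP n)"

abbreviation CM :: "nat \<Rightarrow> ('a, ('x list \<times> 'y \<Rightarrow> 'a) set set set) module"
  where "CM \<equiv> CM_mod R B X actX Y actY coact"

abbreviation dC :: "nat \<Rightarrow> nat \<Rightarrow> ('x list \<times> 'y \<Rightarrow> 'a) set set set \<Rightarrow> ('x list \<times> 'y \<Rightarrow> 'a) set set set"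
  where "dC \<equiv> CM_coface R B X actX Y actY coact"

abbreviation uC :: "nat \<Rightarrow> ('x list \<times> 'y \<Rightarrow> 'a) set set set \<Rightarrow> ('x list \<times> 'y \<Rightarrow> 'a) set set set"
  where "uC \<equiv> CM_tauinv R B X actX Y actY coact"

definition co :: "nat \<Rightarrow> ('x list \<times> 'y \<Rightarrow> 'a) set set \<Rightarrow> ('x list \<times> 'y \<Rightarrow> 'a) set set set"
  where "co n z = J n +>\<^bsub>PCM n\<^esub> z"

lemma J_submodule: "submodule (J n) R (PCM n)"
  by (rule coinv_sub_submodule[OF mPCM PCM_left_module counit_closed])

lemma CM_eq: "CM n = quot_mod (PCM n) (J n)"
  by (simp add: CM_mod_def coinvariants_def)

lemma mCM [simp]: "module R (CM n)"
  unfolding CM_eq by (rule quot_module[OF mPCM J_submodule])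

lemma co_hom: "co n \<in> mod_hom R (PCM n) (CM n)"
  using quot_proj_hom[OF mPCM J_submodule] unfolding co_def CM_eq .

lemma CM_carrier: "carrier (CM n) = co n ` carrier (PCM n)"
  unfolding co_def CM_eq quot_carrier ..

lemma co_act:
  assumes "b \<in> carrier B" "z \<in> carrier (PCM n)"
  shows "co n (LP n b z) = counit B b \<odot>\<^bsub>CM n\<^esub> co n z"
  using coinv_sub_rcoset[OF mPCM PCM_left_module counit_closed assms]
  unfolding co_def CM_mod_def by simp

lemma CM_coface_co:
  assumes "j \<le> n + 1"
  shows "z \<in> carrier (PCM n) \<Longrightarrow> dC n j (co n z) = co (n + 1) (dP n j z)"
    and "dC n j \<in> mod_hom R (CM n) (CM (n + 1))"
proof -
  note hom = PCM_coface_cl(2)[OF assms]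
  have J: "dP n j x \<in> J (n + 1)" if "x \<in> J n" for x
    by (rule coinv_sub_equivariant[where f = "dP n j" and M = "PCM n" and act = "LP n"])
      (rule mPCM PCM_left_module hom that counit_closed PCM_coface_equivariant[OF assms]; assumption)+
  show "z \<in> carrier (PCM n) \<Longrightarrow> dC n j (co n z) = co (n + 1) (dP n j z)"
    unfolding CM_coface_def co_def
    by (rule quot_map_rcoset[where M = "PCM n" and f = "dP n j"])
      (rule mPCM J_submodule hom J; assumption)+
  show "dC n j \<in> mod_hom R (CM n) (CM (n + 1))"
    unfolding CM_coface_def CM_eq
    by (rule quot_map_hom[where M = "PCM n" and f = "dP n j"])
      (rule mPCM J_submodule hom J; assumption)+
qed

lemma CM_tauinv_co:
  shows "z \<in> carrier (PCM n) \<Longrightarrow> uC n (co n z) = co n (uP n z)"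
    and "uC n \<in> mod_hom R (CM n) (CM n)"
proof -
  note hom = PCM_tauinv_cl(2)[of n]
  have J: "uP n x \<in> J n" if "x \<in> J n" for x
    by (rule coinv_sub_equivariant[where f = "uP n" and M = "PCM n" and act = "LP n"])
      (rule mPCM PCM_left_module hom that counit_closed PCM_tauinv_equivariant; assumption)+
  show "z \<in> carrier (PCM n) \<Longrightarrow> uC n (co n z) = co n (uP n z)"
    unfolding CM_tauinv_def co_def
    by (rule quot_map_rcoset[where M = "PCM n" and f = "uP n"])
      (rule mPCM J_submodule hom J; assumption)+
  show "uC n \<in> mod_hom R (CM n) (CM n)"
    unfolding CM_tauinv_def CM_eq
    by (rule quot_map_hom[where M = "PCM n" and f = "uP n"])
      (rule mPCM J_submodule hom J; assumption)+
qed

lemma CM_almost_para_cocyclic: "almost_para_cocyclic_module R CM dC uC"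
  by (rule almost_para_cocyclic_quotient[where C = PCM and d = dP and u = uP and q = co])
    (rule PCM_almost_para_cocyclic mCM CM_carrier[symmetric]
        CM_coface_co(2) CM_tauinv_co(2) CM_coface_co(1) CM_tauinv_co(1); assumption)+

definition pr :: "nat \<Rightarrow> ('x list \<times> 'y \<Rightarrow> 'a) set \<Rightarrow> ('x list \<times> 'y \<Rightarrow> 'a) set set set"
  where "pr n \<xi> = co n (cl n \<xi>)"

lemma pr_hom: "pr n \<in> mod_hom R (T (Suc n)) (CM n)"
  unfolding pr_def by (rule mod_hom_comp[OF co_hom cl_hom])

lemma CM_carrier_pr: "carrier (CM n) = pr n ` carrier (T (Suc n))"
  unfolding CM_carrier PCM_carrier pr_def by auto

lemma cl_closed: "\<xi> \<in> carrier (T (Suc n)) \<Longrightarrow> cl n \<xi> \<in> carrier (PCM n)"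
  by (rule mod_hom_closed[OF cl_hom])

lemma pr_act:
  "b \<in> carrier B \<Longrightarrow> \<xi> \<in> carrier (T (Suc n)) \<Longrightarrow> pr n (actn (Suc n) b \<xi>) = counit B b \<odot>\<^bsub>CM n\<^esub> pr n \<xi>"
  unfolding pr_def using co_act[OF _ cl_closed] by (simp add: PCM_act_cl(1)[symmetric])

lemma CM_tauinv_pr: "\<xi> \<in> carrier (T (Suc n)) \<Longrightarrow> uC n (pr n \<xi>) = pr n (tinv n \<xi>)"
  unfolding pr_def by (simp add: CM_tauinv_co(1) cl_closed PCM_tauinv_cl(1))

lemma CM_coface_pr: "j \<le> n + 1 \<Longrightarrow> \<xi> \<in> carrier (T (Suc n)) \<Longrightarrow> dC n j (pr n \<xi>) = pr (n + 1) (cof n j \<xi>)"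
  unfolding pr_def using CM_coface_co(1)[of j n "cl n \<xi>"] by (simp add: cl_closed PCM_coface_cl(1)[simplified])

lemma CM_tauinv_power:
  assumes "zero_stable R Y actY coact" "z \<in> carrier (CM n)"
  shows "(uC n ^^ Suc n) z = z"
proof -
  obtain \<xi> where \<xi>: "\<xi> \<in> carrier (T (Suc n))" "z = pr n \<xi>" using assms(2) CM_carrier_pr by blast
  have "(uC n ^^ k) (pr n \<xi>) = pr n ((tinv n ^^ k) \<xi>)" for k
    by (induction k) (simp_all add: CM_tauinv_pr tinv_power_closed[OF \<xi>(1)])
  then show ?thesis
    using coinvariant_tinv_power[OF assms(1) pr_hom mCM pr_act \<xi>(1)] \<xi>(2) by (simp del: funpow.simps)
qed

text \<open>An operator of finite order is invertible.\<close>

lemma CM_tauinv_bij: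
  assumes "zero_stable R Y actY coact"
  shows "bij_betw (uC n) (carrier (CM n)) (carrier (CM n))"
  by (rule bij_betw_of_funpow_id[OF mod_hom_closed[OF CM_tauinv_co(2)] CM_tauinv_power[OF assms]])

lemma CM_cocyclic:
  assumes "zero_stable R Y actY coact"
  shows "cocyclic_module R CM dC (inv_op CM uC)"
proof -
  note bij = CM_tauinv_bij[OF assms]
  have t: "inv_op CM uC n z \<in> carrier (CM n) \<and> uC n (inv_op CM uC n z) = z" if "z \<in> carrier (CM n)" for n z
    using inv_op_inverse[of uC n CM z, OF bij that] by blast
  have "(inv_op CM uC n ^^ Suc n) z = z" if "z \<in> carrier (CM n)" for n z
    by (rule funpow_inverse_id[OF mod_hom_closed[OF CM_tauinv_co(2)] _ CM_tauinv_power[OF assms] that]) (simp_all add: t)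
  then show ?thesis
    using para_cocyclic_of_bij[OF CM_almost_para_cocyclic bij]
    unfolding cocyclic_module_def Suc_eq_plus1[symmetric] by blast
qed

end

section \<open>Functoriality of cyclic homology\<close>

lemma rcoset_image:
  assumes "N \<subseteq> A" "x \<in> A" "\<And>x y. x \<in> A \<Longrightarrow> y \<in> A \<Longrightarrow> \<Phi> (x \<oplus>\<^bsub>K\<^esub> y) = \<Phi> x \<oplus>\<^bsub>K'\<^esub> \<Phi> y"
  shows "\<Phi> ` (N +>\<^bsub>K\<^esub> x) = (\<Phi> ` N) +>\<^bsub>K'\<^esub> \<Phi> x"
proof -
  have "\<Phi> (h \<oplus>\<^bsub>K\<^esub> x) = \<Phi> h \<oplus>\<^bsub>K'\<^esub> \<Phi> x" if "h \<in> N" for h using assms that by auto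
  then show ?thesis by (simp add: a_r_coset_def' image_UN)
qed

text \<open>The isomorphism sends a class, as a set of cocycles, to its image under \<open>\<Phi> n\<close>.\<close>

lemma cochain_homology_iso:
  assumes mK: "\<And>n. module R (K n)" and mK': "\<And>n. module R (K' n)"
    and \<Phi>: "\<And>n. \<Phi> n \<in> mod_hom R (K n) (K' n)"
    and bij: "\<And>n. bij_betw (\<Phi> n) (carrier (K n)) (carrier (K' n))"
    and D: "\<And>n x. x \<in> carrier (K n) \<Longrightarrow> D n x \<in> carrier (K (n + 1))"
    and comm: "\<And>n x. x \<in> carrier (K n) \<Longrightarrow> \<Phi> (n + 1) (D n x) = D' n (\<Phi> n x)"
  shows "mod_isomorphic R (cochain_homology K D n) (cochain_homology K' D' n)"
proof -
  define Z where "Z = a_kernel (K n) (K (n + 1)) (D n)"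
  define Z' where "Z' = a_kernel (K' n) (K' (n + 1)) (D' n)"
  define N where "N = (case n of 0 \<Rightarrow> {\<zero>\<^bsub>K 0\<^esub>} | Suc m \<Rightarrow> D m ` carrier (K m))"
  define N' where "N' = (case n of 0 \<Rightarrow> {\<zero>\<^bsub>K' 0\<^esub>} | Suc m \<Rightarrow> D' m ` carrier (K' m))"
  interpret K: module R "K n" by (rule mK)
  interpret K': module R "K' n" by (rule mK')
  have inj: "inj_on (\<Phi> k) (carrier (K k))" and im: "\<Phi> k ` carrier (K k) = carrier (K' k)" for k
    using bij[of k] by (auto simp: bij_betw_def)
  have Z: "Z \<subseteq> carrier (K n)" unfolding Z_def a_kernel_def' by auto
  have Z': "Z' = \<Phi> n ` Z"
  proof -
    have Zc: "Z' \<subseteq> \<Phi> n ` carrier (K n)" unfolding im Z'_def a_kernel_def' by blast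
    have "x \<in> Z \<longleftrightarrow> \<Phi> n x \<in> Z'" if x: "x \<in> carrier (K n)" for x
    proof -
      have "D n x = \<zero>\<^bsub>K (n + 1)\<^esub> \<longleftrightarrow> \<Phi> (n + 1) (D n x) = \<Phi> (n + 1) \<zero>\<^bsub>K (n + 1)\<^esub>"
        using inj_on_eq_iff[OF inj D[OF x], of "\<zero>\<^bsub>K (n + 1)\<^esub>"] mK[of "n + 1"]
        by (auto simp: module_def abelian_group_def abelian_monoid.zero_closed)
      also have "\<dots> \<longleftrightarrow> D' n (\<Phi> n x) = \<zero>\<^bsub>K' (n + 1)\<^esub>"
        by (simp add: comm[OF x, simplified] mod_hom_zero[OF \<Phi> mK mK'])
      finally show ?thesis
        unfolding Z_def Z'_def a_kernel_def' using x mod_hom_closed[OF \<Phi> x] by simp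
    qed
    then show ?thesis using Z Zc by blast
  qed
  have N: "N \<subseteq> carrier (K n)" unfolding N_def using D K.zero_closed by (cases n) auto
  have N': "N' = \<Phi> n ` N"
  proof (cases n)
    case 0
    then show ?thesis using mod_hom_zero[OF \<Phi> mK mK', of 0] by (simp add: N_def N'_def)
  next
    case (Suc m)
    have "\<Phi> (m + 1) ` D m ` carrier (K m) = D' m ` \<Phi> m ` carrier (K m)"
      unfolding image_image using comm[of _ m] by (intro image_cong) auto
    then show ?thesis unfolding im by (simp only: N_def N'_def Suc nat.case Suc_eq_plus1[symmetric])
  qed
  have add: "\<Phi> n (x \<oplus>\<^bsub>K n\<^esub> y) = \<Phi> n x \<oplus>\<^bsub>K' n\<^esub> \<Phi> n y" if "x \<in> carrier (K n)" "y \<in> carrier (K n)" for x y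
    by (rule mod_hom_add[OF \<Phi> that])
  have sm: "\<Phi> n (a \<odot>\<^bsub>K n\<^esub> x) = a \<odot>\<^bsub>K' n\<^esub> \<Phi> n x" if "a \<in> carrier R" "x \<in> carrier (K n)" for a x
    by (rule mod_hom_smult[OF \<Phi> that])
  have coset: "\<Phi> n ` (N +>\<^bsub>K n\<^esub> x) = N' +>\<^bsub>K' n\<^esub> \<Phi> n x" if "x \<in> carrier (K n)" for x
    unfolding N' by (rule rcoset_image[OF N that add])
  have cosub: "N +>\<^bsub>K n\<^esub> x \<subseteq> carrier (K n)" if "x \<in> carrier (K n)" for x
    using N that by (auto simp: a_r_coset_def')
  let ?H = "cochain_homology K D n" and ?H' = "cochain_homology K' D' n"
  have upd: "A +>\<^bsub>M\<lparr>carrier := Z0\<rparr>\<^esub> x = A +>\<^bsub>M\<^esub> x" for M :: "('x, 'y, 'z) module_scheme" and Z0 A x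
    by (simp add: a_r_coset_def')
  have H: "carrier ?H = (\<lambda>x. N +>\<^bsub>K n\<^esub> x) ` Z"
    unfolding cochain_homology_def Z_def[symmetric] N_def[symmetric] quot_carrier upd by simp
  have H': "carrier ?H' = (\<lambda>x. N' +>\<^bsub>K' n\<^esub> x) ` Z'"
    unfolding cochain_homology_def Z'_def[symmetric] N'_def[symmetric] quot_carrier upd by simp
  have Hsub: "A \<subseteq> carrier (K n)" if "A \<in> carrier ?H" for A
    using that cosub Z unfolding H by auto
  have Hadd: "A \<oplus>\<^bsub>?H\<^esub> C = (\<Union>a\<in>A. \<Union>c\<in>C. {a \<oplus>\<^bsub>K n\<^esub> c})" for A C
    by (simp add: cochain_homology_def quot_mod_def set_add_def')
  have Hadd': "A \<oplus>\<^bsub>?H'\<^esub> C = (\<Union>a\<in>A. \<Union>c\<in>C. {a \<oplus>\<^bsub>K' n\<^esub> c})" for A C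
    by (simp add: cochain_homology_def quot_mod_def set_add_def')
  have Hsm: "a \<odot>\<^bsub>?H\<^esub> A = (\<Union>x\<in>A. N +>\<^bsub>K n\<^esub> (a \<odot>\<^bsub>K n\<^esub> x))" for a A
    by (simp add: cochain_homology_def quot_mod_def N_def upd)
  have Hsm': "a \<odot>\<^bsub>?H'\<^esub> A = (\<Union>x\<in>A. N' +>\<^bsub>K' n\<^esub> (a \<odot>\<^bsub>K' n\<^esub> x))" for a A
    by (simp add: cochain_homology_def quot_mod_def N'_def upd)
  have hom: "(\<lambda>A. \<Phi> n ` A) \<in> mod_hom R ?H ?H'"
  proof (rule mod_homI)
    fix A assume "A \<in> carrier ?H"
    then show "\<Phi> n ` A \<in> carrier ?H'"
      unfolding H H' Z' using coset Z by auto
  next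
    fix A C assume "A \<in> carrier ?H" "C \<in> carrier ?H"
    then have "A \<subseteq> carrier (K n)" "C \<subseteq> carrier (K n)" by (auto dest: Hsub)
    then show "\<Phi> n ` (A \<oplus>\<^bsub>?H\<^esub> C) = \<Phi> n ` A \<oplus>\<^bsub>?H'\<^esub> \<Phi> n ` C"
      unfolding Hadd Hadd' image_UN by (simp add: add subset_iff)
  next
    fix a A assume a: "a \<in> carrier R" and "A \<in> carrier ?H"
    then have A: "A \<subseteq> carrier (K n)" by (auto dest: Hsub)
    have "\<Phi> n ` (a \<odot>\<^bsub>?H\<^esub> A) = (\<Union>x\<in>A. \<Phi> n ` (N +>\<^bsub>K n\<^esub> (a \<odot>\<^bsub>K n\<^esub> x)))"
      unfolding Hsm image_UN ..
    also have "\<dots> = (\<Union>x\<in>A. N' +>\<^bsub>K' n\<^esub> (a \<odot>\<^bsub>K' n\<^esub> \<Phi> n x))"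
    proof (intro SUP_cong refl)
      fix x assume "x \<in> A"
      then have x: "x \<in> carrier (K n)" using A by blast
      show "\<Phi> n ` (N +>\<^bsub>K n\<^esub> (a \<odot>\<^bsub>K n\<^esub> x)) = N' +>\<^bsub>K' n\<^esub> (a \<odot>\<^bsub>K' n\<^esub> \<Phi> n x)"
        using coset[OF K.smult_closed[OF a x]] unfolding sm[OF a x] .
    qed
    also have "\<dots> = a \<odot>\<^bsub>?H'\<^esub> \<Phi> n ` A" unfolding Hsm' by simp
    finally show "\<Phi> n ` (a \<odot>\<^bsub>?H\<^esub> A) = a \<odot>\<^bsub>?H'\<^esub> \<Phi> n ` A" .
  qed
  have "inj_on (\<lambda>A. \<Phi> n ` A) (carrier ?H)"
    by (rule inj_onI) (use inj_on_image_eq_iff[OF inj] Hsub in blast)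
  moreover have "(\<lambda>A. \<Phi> n ` A) ` carrier ?H = carrier ?H'"
    unfolding H H' Z' image_image using coset Z by (intro image_cong) auto
  ultimately show ?thesis unfolding mod_isomorphic_def bij_betw_def using hom by blast
qed

lemma tot_mod_module:
  assumes "\<And>n. module R (C n)"
  shows "module R (tot_mod C n)"
proof -
  have cr: "cring R" using assms[of 0] by (simp add: module_def)
  note ag = module.axioms(2)[OF assms]
  have am: "abelian_monoid (C k)" for k using ag by (simp add: abelian_group_def)
  have closed: "x \<oplus>\<^bsub>C k\<^esub> y \<in> carrier (C k)" if "x \<in> carrier (C k)" "y \<in> carrier (C k)" for x y k
    by (rule abelian_monoid.a_closed[OF am that])
  have rest: "(\<lambda>p\<in>{..n}. x p) = x" if "x \<in> (\<Pi>\<^sub>E p\<in>{..n}. carrier (C (n - p)))" for x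
    using that by (rule PiE_restrict)
  show ?thesis
  proof (rule moduleI[OF cr])
    show "abelian_group (tot_mod C n)"
    proof (rule abelian_groupI)
      fix x assume x: "x \<in> carrier (tot_mod C n)"
      show "\<exists>y\<in>carrier (tot_mod C n). y \<oplus>\<^bsub>tot_mod C n\<^esub> x = \<zero>\<^bsub>tot_mod C n\<^esub>"
        using x abelian_group.a_inv_closed[OF ag] abelian_group.l_neg[OF ag]
        by (intro bexI[of _ "\<lambda>p\<in>{..n}. \<ominus>\<^bsub>C (n - p)\<^esub> x p"]) (auto simp: tot_mod_def PiE_def Pi_def intro!: restrict_ext)
    next
      fix x y assume "x \<in> carrier (tot_mod C n)" "y \<in> carrier (tot_mod C n)"
      then show "x \<oplus>\<^bsub>tot_mod C n\<^esub> y \<in> carrier (tot_mod C n)"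
        by (auto simp: tot_mod_def PiE_def Pi_def intro!: closed)
    next
      show "\<zero>\<^bsub>tot_mod C n\<^esub> \<in> carrier (tot_mod C n)"
        by (auto simp: tot_mod_def abelian_monoid.zero_closed[OF am])
    next
      fix x y z assume "x \<in> carrier (tot_mod C n)" "y \<in> carrier (tot_mod C n)" "z \<in> carrier (tot_mod C n)"
      then show "x \<oplus>\<^bsub>tot_mod C n\<^esub> y \<oplus>\<^bsub>tot_mod C n\<^esub> z = x \<oplus>\<^bsub>tot_mod C n\<^esub> (y \<oplus>\<^bsub>tot_mod C n\<^esub> z)"
        by (auto simp: tot_mod_def PiE_def Pi_def abelian_monoid.a_assoc[OF am] intro!: restrict_ext)
    next
      fix x y assume "x \<in> carrier (tot_mod C n)" "y \<in> carrier (tot_mod C n)"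
      then show "x \<oplus>\<^bsub>tot_mod C n\<^esub> y = y \<oplus>\<^bsub>tot_mod C n\<^esub> x"
        by (auto simp: tot_mod_def PiE_def Pi_def abelian_monoid.a_comm[OF am] intro!: restrict_ext)
    next
      fix x assume x: "x \<in> carrier (tot_mod C n)"
      then have "\<zero>\<^bsub>tot_mod C n\<^esub> \<oplus>\<^bsub>tot_mod C n\<^esub> x = (\<lambda>p\<in>{..n}. x p)"
        by (auto simp: tot_mod_def PiE_def Pi_def abelian_monoid.l_zero[OF am] intro!: restrict_ext)
      then show "\<zero>\<^bsub>tot_mod C n\<^esub> \<oplus>\<^bsub>tot_mod C n\<^esub> x = x" using rest x by (simp add: tot_mod_def)
    qed
  next
    fix a x assume "a \<in> carrier R" "x \<in> carrier (tot_mod C n)"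
    then show "a \<odot>\<^bsub>tot_mod C n\<^esub> x \<in> carrier (tot_mod C n)"
      by (auto simp: tot_mod_def PiE_def Pi_def intro!: module.smult_closed[OF assms])
  next
    fix a b x assume "a \<in> carrier R" "b \<in> carrier R" "x \<in> carrier (tot_mod C n)"
    then show "(a \<oplus>\<^bsub>R\<^esub> b) \<odot>\<^bsub>tot_mod C n\<^esub> x = a \<odot>\<^bsub>tot_mod C n\<^esub> x \<oplus>\<^bsub>tot_mod C n\<^esub> b \<odot>\<^bsub>tot_mod C n\<^esub> x"
      by (auto simp: tot_mod_def PiE_def Pi_def module.smult_l_distr[OF assms] intro!: restrict_ext)
  next
    fix a x y assume "a \<in> carrier R" "x \<in> carrier (tot_mod C n)" "y \<in> carrier (tot_mod C n)"
    then show "a \<odot>\<^bsub>tot_mod C n\<^esub> (x \<oplus>\<^bsub>tot_mod C n\<^esub> y) = a \<odot>\<^bsub>tot_mod C n\<^esub> x \<oplus>\<^bsub>tot_mod C n\<^esub> a \<odot>\<^bsub>tot_mod C n\<^esub> y"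
      by (auto simp: tot_mod_def PiE_def Pi_def module.smult_r_distr[OF assms] intro!: restrict_ext)
  next
    fix a b x assume "a \<in> carrier R" "b \<in> carrier R" "x \<in> carrier (tot_mod C n)"
    then show "(a \<otimes>\<^bsub>R\<^esub> b) \<odot>\<^bsub>tot_mod C n\<^esub> x = a \<odot>\<^bsub>tot_mod C n\<^esub> (b \<odot>\<^bsub>tot_mod C n\<^esub> x)"
      by (auto simp: tot_mod_def PiE_def Pi_def module.smult_assoc1[OF assms] intro!: restrict_ext)
  next
    fix x assume x: "x \<in> carrier (tot_mod C n)"
    then have "\<one>\<^bsub>R\<^esub> \<odot>\<^bsub>tot_mod C n\<^esub> x = (\<lambda>p\<in>{..n}. x p)"
      by (auto simp: tot_mod_def PiE_def Pi_def module.smult_one[OF assms] intro!: restrict_ext)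
    then show "\<one>\<^bsub>R\<^esub> \<odot>\<^bsub>tot_mod C n\<^esub> x = x" using rest x by (simp add: tot_mod_def)
  qed
qed

context
  fixes R :: "('a, 'r) ring_scheme"
    and C :: "nat \<Rightarrow> ('a, 'm, 's) module_scheme" and d :: "nat \<Rightarrow> nat \<Rightarrow> 'm \<Rightarrow> 'm" and u :: "nat \<Rightarrow> 'm \<Rightarrow> 'm"
    and C' :: "nat \<Rightarrow> ('a, 'n, 't) module_scheme" and d' :: "nat \<Rightarrow> nat \<Rightarrow> 'n \<Rightarrow> 'n" and u' :: "nat \<Rightarrow> 'n \<Rightarrow> 'n"
    and f :: "nat \<Rightarrow> 'm \<Rightarrow> 'n"
  assumes mC: "\<And>n. module R (C n)" and mC': "\<And>n. module R (C' n)"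
    and f: "\<And>n. f n \<in> mod_hom R (C n) (C' n)"
    and bij_f: "\<And>n. bij_betw (f n) (carrier (C n)) (carrier (C' n))"
    and d_closed: "\<And>n j x. j \<le> n + 1 \<Longrightarrow> x \<in> carrier (C n) \<Longrightarrow> d n j x \<in> carrier (C (n + 1))"
    and bij_u: "\<And>n. bij_betw (u n) (carrier (C n)) (carrier (C n))"
    and fd: "\<And>n j x. j \<le> n + 1 \<Longrightarrow> x \<in> carrier (C n) \<Longrightarrow> f (n + 1) (d n j x) = d' n j (f n x)"
    and fu: "\<And>n x. x \<in> carrier (C n) \<Longrightarrow> f n (u n x) = u' n (f n x)"
begin

lemma bij_u': "bij_betw (u' n) (carrier (C' n)) (carrier (C' n))"
proof -
  let ?g = "inv_into (carrier (C n)) (f n)"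
  have g: "bij_betw ?g (carrier (C' n)) (carrier (C n))" by (rule bij_betw_inv_into[OF bij_f])
  have "bij_betw (f n \<circ> u n \<circ> ?g) (carrier (C' n)) (carrier (C' n))"
    by (rule bij_betw_trans[OF g bij_betw_trans[OF bij_u bij_f], unfolded comp_assoc[symmetric]])
  moreover have "(f n \<circ> u n \<circ> ?g) y = u' n y" if "y \<in> carrier (C' n)" for y
  proof -
    have "?g y \<in> carrier (C n)" "f n (?g y) = y"
      using that bij_f[of n] by (metis bij_betw_def inv_into_into, metis bij_betw_def f_inv_into_f)
    then show ?thesis using fu[of "?g y" n] by simp
  qed
  ultimately show ?thesis using bij_betw_cong[of "carrier (C' n)" "f n \<circ> u n \<circ> ?g" "u' n"] by blast
qed

lemma signed_closed: "x \<in> carrier (C n) \<Longrightarrow> signed (C n) k x \<in> carrier (C n)"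
  using abelian_group.a_inv_closed[OF module.axioms(2)[OF mC]] by (simp add: signed_def)

lemma f_signed: "x \<in> carrier (C n) \<Longrightarrow> f n (signed (C n) k x) = signed (C' n) k (f n x)"
  by (simp add: signed_def mod_hom_a_inv[OF f mC mC'])

text \<open>The bicomplex is built from the inverse of its cyclic operator.  When that operator is the inverse
  of \<open>u\<close>, only \<open>u\<close> itself appears, and compatibility of \<open>f\<close> with \<open>u\<close> suffices.\<close>

lemma sign_eq: "x \<in> carrier (C n) \<Longrightarrow> cyc_sign C (inv_op C u) n x = signed (C n) n (u n x)"
  by (simp add: cyc_sign_def inv_op_def inv_into_inv_into_eq[OF bij_u])

lemma sign_eq': "x \<in> carrier (C' n) \<Longrightarrow> cyc_sign C' (inv_op C' u') n x = signed (C' n) n (u' n x)"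
  by (simp add: cyc_sign_def inv_op_def inv_into_inv_into_eq[OF bij_u'])

lemma u_closed: "x \<in> carrier (C n) \<Longrightarrow> u n x \<in> carrier (C n)"
  using bij_u bij_betwE by blast

lemma f_closed: "x \<in> carrier (C n) \<Longrightarrow> f n x \<in> carrier (C' n)"
  by (rule mod_hom_closed[OF f])

lemma sign_closed: "x \<in> carrier (C n) \<Longrightarrow> cyc_sign C (inv_op C u) n x \<in> carrier (C n)"
  by (simp add: sign_eq signed_closed u_closed)

lemma f_sign: "x \<in> carrier (C n) \<Longrightarrow> f n (cyc_sign C (inv_op C u) n x) = cyc_sign C' (inv_op C' u') n (f n x)"
  by (simp add: sign_eq sign_eq' f_closed f_signed u_closed fu)

lemma sign_power_closed: "x \<in> carrier (C n) \<Longrightarrow> (cyc_sign C (inv_op C u) n ^^ k) x \<in> carrier (C n)"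
  by (induction k) (auto simp: sign_closed)

lemma f_sign_power:
  "x \<in> carrier (C n) \<Longrightarrow> f n ((cyc_sign C (inv_op C u) n ^^ k) x) = (cyc_sign C' (inv_op C' u') n ^^ k) (f n x)"
  by (induction k) (auto simp: f_sign sign_power_closed)

lemma finsum_closed_C: "(\<And>i. i \<in> A \<Longrightarrow> g i \<in> carrier (C n)) \<Longrightarrow> finsum (C n) g A \<in> carrier (C n)"
  using abelian_monoid.finsum_closed[of "C n" g A] module.axioms(2)[OF mC, of n]
  by (auto simp: abelian_group_def)

lemma f_finsum:
  assumes "finite A" "\<And>i. i \<in> A \<Longrightarrow> g i \<in> carrier (C n)" "\<And>i. i \<in> A \<Longrightarrow> f n (g i) = h i"
  shows "f n (\<Oplus>\<^bsub>C n\<^esub>i\<in>A. g i) = (\<Oplus>\<^bsub>C' n\<^esub>i\<in>A. h i)"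
proof -
  have "f n (\<Oplus>\<^bsub>C n\<^esub>i\<in>A. g i) = (\<Oplus>\<^bsub>C' n\<^esub>i\<in>A. f n (g i))"
    by (rule mod_hom_finsum[OF f mC mC' assms(1,2)])
  also have "\<dots> = (\<Oplus>\<^bsub>C' n\<^esub>i\<in>A. h i)" by (rule finsum_agree) (rule assms(3))
  finally show ?thesis .
qed

lemma bdiff_closed: "x \<in> carrier (C q) \<Longrightarrow> bdiff C d q x \<in> carrier (C (q + 1))"
  and bdiff'_closed: "x \<in> carrier (C q) \<Longrightarrow> bdiff' C d q x \<in> carrier (C (q + 1))"
  unfolding bdiff_def bdiff'_def by (auto intro!: finsum_closed_C signed_closed d_closed[simplified])

lemma vert_closed: "x \<in> carrier (C q) \<Longrightarrow> cyc_vert C d p q x \<in> carrier (C (q + 1))"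
  using bdiff_closed abelian_group.a_inv_closed[OF module.axioms(2)[OF mC] bdiff'_closed]
  by (simp add: cyc_vert_def)

lemma horiz_closed: "x \<in> carrier (C q) \<Longrightarrow> cyc_horiz C (inv_op C u) p q x \<in> carrier (C q)"
  unfolding cyc_horiz_def cyc_norm_def
  using abelian_group.minus_closed[OF module.axioms(2)[OF mC]]
  by (auto intro!: finsum_closed_C sign_power_closed sign_closed)

lemma f_vert: "x \<in> carrier (C q) \<Longrightarrow> f (q + 1) (cyc_vert C d p q x) = cyc_vert C' d' p q (f q x)"
proof -
  assume x: "x \<in> carrier (C q)"
  have s: "f (q + 1) (signed (C (q + 1)) j (d q j x)) = signed (C' (q + 1)) j (d' q j (f q x))" if "j \<le> q + 1" for j
    using f_signed[OF d_closed[OF that x]] fd[OF that x] by simp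
  have 1: "f (q + 1) (bdiff C d q x) = bdiff C' d' q (f q x)"
    unfolding bdiff_def by (rule f_finsum) (auto intro!: signed_closed d_closed x s simp del: One_nat_def add_Suc_right)
  have 2: "f (q + 1) (bdiff' C d q x) = bdiff' C' d' q (f q x)"
    unfolding bdiff'_def by (rule f_finsum) (auto intro!: signed_closed d_closed x s simp del: One_nat_def add_Suc_right)
  show ?thesis
    unfolding cyc_vert_def using 1 2 mod_hom_a_inv[OF f mC mC' bdiff'_closed[OF x]] by simp
qed

lemma f_horiz:
  "x \<in> carrier (C q) \<Longrightarrow> f q (cyc_horiz C (inv_op C u) p q x) = cyc_horiz C' (inv_op C' u') p q (f q x)"
proof -
  assume x: "x \<in> carrier (C q)"
  have "f q (cyc_norm C (inv_op C u) q x) = cyc_norm C' (inv_op C' u') q (f q x)"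
    unfolding cyc_norm_def by (rule f_finsum) (auto intro!: sign_power_closed x f_sign_power)
  then show ?thesis
    unfolding cyc_horiz_def using mod_hom_diff[OF f mC mC' x sign_closed[OF x]] f_sign[OF x] by simp
qed

abbreviation Tot :: "nat \<Rightarrow> ('a, nat \<Rightarrow> 'm) module" where "Tot \<equiv> tot_mod C"
abbreviation Tot' :: "nat \<Rightarrow> ('a, nat \<Rightarrow> 'n) module" where "Tot' \<equiv> tot_mod C'"

lemma zero_closed_C: "\<zero>\<^bsub>C n\<^esub> \<in> carrier (C n)"
  using module.axioms(2)[OF mC, of n] by (simp add: abelian_group_def abelian_monoid.zero_closed)

lemma add_closed_C: "x \<in> carrier (C n) \<Longrightarrow> y \<in> carrier (C n) \<Longrightarrow> x \<oplus>\<^bsub>C n\<^esub> y \<in> carrier (C n)"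
  using module.axioms(2)[OF mC, of n] by (simp add: abelian_group_def abelian_monoid.a_closed)

lemma tot_summands_closed:
  assumes "x \<in> carrier (Tot n)" "p \<le> n + 1"
  shows "(if p \<le> n then cyc_vert C d p (n - p) (x p) else \<zero>\<^bsub>C (n + 1 - p)\<^esub>) \<in> carrier (C (n + 1 - p))"
    and "(if p \<ge> 1 then cyc_horiz C (inv_op C u) (p - 1) (n + 1 - p) (x (p - 1)) else \<zero>\<^bsub>C (n + 1 - p)\<^esub>) \<in> carrier (C (n + 1 - p))"
proof -
  have x: "x q \<in> carrier (C (n - q))" if "q \<le> n" for q using assms(1) that by (auto simp: tot_mod_def PiE_def)
  have "cyc_vert C d p (n - p) (x p) \<in> carrier (C (n + 1 - p))" if "p \<le> n"
  proof -
    have "n - p + 1 = n + 1 - p" using that by simp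
    then show ?thesis using vert_closed[OF x[OF that], of p] by simp
  qed
  then show "(if p \<le> n then cyc_vert C d p (n - p) (x p) else \<zero>\<^bsub>C (n + 1 - p)\<^esub>) \<in> carrier (C (n + 1 - p))"
    using zero_closed_C by simp
  have "cyc_horiz C (inv_op C u) (p - 1) (n + 1 - p) (x (p - 1)) \<in> carrier (C (n + 1 - p))" if "p \<ge> 1"
  proof -
    have "n - (p - 1) = n + 1 - p" using that by simp
    then show ?thesis using horiz_closed[of "x (p - 1)" "n + 1 - p" "p - 1"] x[of "p - 1"] assms(2) by simp
  qed
  then show "(if p \<ge> 1 then cyc_horiz C (inv_op C u) (p - 1) (n + 1 - p) (x (p - 1)) else \<zero>\<^bsub>C (n + 1 - p)\<^esub>) \<in> carrier (C (n + 1 - p))"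
    using zero_closed_C by simp
qed

lemma tot_diff_closed: "x \<in> carrier (Tot n) \<Longrightarrow> tot_diff C d (inv_op C u) n x \<in> carrier (Tot (n + 1))"
  using tot_summands_closed[of x n] add_closed_C unfolding tot_diff_def
  by (auto simp: tot_mod_def simp del: One_nat_def)

definition tot_map :: "nat \<Rightarrow> (nat \<Rightarrow> 'm) \<Rightarrow> nat \<Rightarrow> 'n"
  where "tot_map n x = (\<lambda>p\<in>{..n}. f (n - p) (x p))"

lemma tot_map_hom: "tot_map n \<in> mod_hom R (Tot n) (Tot' n)"
proof (rule mod_homI)
  fix x assume x: "x \<in> carrier (Tot n)"
  then show "tot_map n x \<in> carrier (Tot' n)" by (auto simp: tot_map_def tot_mod_def intro!: f_closed)
  fix y assume y: "y \<in> carrier (Tot n)"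
  show "tot_map n (x \<oplus>\<^bsub>Tot n\<^esub> y) = tot_map n x \<oplus>\<^bsub>Tot' n\<^esub> tot_map n y"
    using x y by (auto simp: tot_map_def tot_mod_def PiE_def Pi_def mod_hom_add[OF f] intro!: restrict_ext)
next
  fix a x assume "a \<in> carrier R" "x \<in> carrier (Tot n)"
  then show "tot_map n (a \<odot>\<^bsub>Tot n\<^esub> x) = a \<odot>\<^bsub>Tot' n\<^esub> tot_map n x"
    by (auto simp: tot_map_def tot_mod_def PiE_def Pi_def mod_hom_smult[OF f] intro!: restrict_ext)
qed

lemma tot_map_bij: "bij_betw (tot_map n) (carrier (Tot n)) (carrier (Tot' n))"
proof (rule bij_betw_byWitness[where f' = "\<lambda>y. \<lambda>p\<in>{..n}. inv_into (carrier (C (n - p))) (f (n - p)) (y p)"])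
  have g: "inv_into (carrier (C k)) (f k) y \<in> carrier (C k)" "f k (inv_into (carrier (C k)) (f k) y) = y"
    if "y \<in> carrier (C' k)" for k y
    using that bij_f[of k] by (metis bij_betw_def inv_into_into, metis bij_betw_def f_inv_into_f)
  have h: "inv_into (carrier (C k)) (f k) (f k x) = x" if "x \<in> carrier (C k)" for k x
    using that bij_f[of k] by (metis bij_betw_def inv_into_f_f)
  show "\<forall>x\<in>carrier (Tot n). (\<lambda>p\<in>{..n}. inv_into (carrier (C (n - p))) (f (n - p)) (tot_map n x p)) = x"
  proof
    fix x assume x: "x \<in> carrier (Tot n)"
    then have "(\<lambda>p\<in>{..n}. inv_into (carrier (C (n - p))) (f (n - p)) (tot_map n x p)) = (\<lambda>p\<in>{..n}. x p)"
      by (auto simp: tot_map_def tot_mod_def PiE_def Pi_def h intro!: restrict_ext)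
    also have "\<dots> = x" using x by (auto simp: tot_mod_def PiE_restrict)
    finally show "(\<lambda>p\<in>{..n}. inv_into (carrier (C (n - p))) (f (n - p)) (tot_map n x p)) = x" .
  qed
  show "\<forall>y\<in>carrier (Tot' n). tot_map n (\<lambda>p\<in>{..n}. inv_into (carrier (C (n - p))) (f (n - p)) (y p)) = y"
  proof
    fix y assume y: "y \<in> carrier (Tot' n)"
    then have "tot_map n (\<lambda>p\<in>{..n}. inv_into (carrier (C (n - p))) (f (n - p)) (y p)) = (\<lambda>p\<in>{..n}. y p)"
      by (auto simp: tot_map_def tot_mod_def PiE_def Pi_def g intro!: restrict_ext)
    also have "\<dots> = y" using y by (auto simp: tot_mod_def PiE_restrict)
    finally show "tot_map n (\<lambda>p\<in>{..n}. inv_into (carrier (C (n - p))) (f (n - p)) (y p)) = y" .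
  qed
  show "tot_map n ` carrier (Tot n) \<subseteq> carrier (Tot' n)"
    using mod_hom_closed[OF tot_map_hom] by blast
  show "(\<lambda>y. \<lambda>p\<in>{..n}. inv_into (carrier (C (n - p))) (f (n - p)) (y p)) ` carrier (Tot' n) \<subseteq> carrier (Tot n)"
    by (auto simp: tot_mod_def PiE_def Pi_def g)
qed

lemma tot_map_diff:
  assumes x: "x \<in> carrier (Tot n)"
  shows "tot_map (n + 1) (tot_diff C d (inv_op C u) n x) = tot_diff C' d' (inv_op C' u') n (tot_map n x)"
  unfolding tot_map_def tot_diff_def
proof (rule restrict_ext)
  fix p assume pm: "p \<in> {..n + 1}"
  then have p: "p \<le> n + 1" by simp
  have xc: "x q \<in> carrier (C (n - q))" if "q \<le> n" for q using x that by (auto simp: tot_mod_def PiE_def)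
  let ?v = "if p \<le> n then cyc_vert C d p (n - p) (x p) else \<zero>\<^bsub>C (n + 1 - p)\<^esub>"
  let ?h = "if p \<ge> 1 then cyc_horiz C (inv_op C u) (p - 1) (n + 1 - p) (x (p - 1)) else \<zero>\<^bsub>C (n + 1 - p)\<^esub>"
  have z: "f k \<zero>\<^bsub>C k\<^esub> = \<zero>\<^bsub>C' k\<^esub>" for k by (rule mod_hom_zero[OF f mC mC'])
  have "f (n + 1 - p) (cyc_vert C d p (n - p) (x p)) = cyc_vert C' d' p (n - p) (f (n - p) (x p))" if "p \<le> n"
  proof -
    have "n - p + 1 = n + 1 - p" using that by simp
    then show ?thesis using f_vert[OF xc[OF that], of p] by simp
  qed
  then have v: "f (n + 1 - p) ?v = (if p \<le> n then cyc_vert C' d' p (n - p) (f (n - p) (x p)) else \<zero>\<^bsub>C' (n + 1 - p)\<^esub>)"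
    by (simp add: z)
  have "f (n + 1 - p) (cyc_horiz C (inv_op C u) (p - 1) (n + 1 - p) (x (p - 1))) =
      cyc_horiz C' (inv_op C' u') (p - 1) (n + 1 - p) (f (n - (p - 1)) (x (p - 1)))" if "p \<ge> 1"
  proof -
    have "n - (p - 1) = n + 1 - p" using that by simp
    then show ?thesis using f_horiz[of "x (p - 1)" "n + 1 - p" "p - 1"] xc[of "p - 1"] p by simp
  qed
  then have h: "f (n + 1 - p) ?h =
      (if p \<ge> 1 then cyc_horiz C' (inv_op C' u') (p - 1) (n + 1 - p) (f (n - (p - 1)) (x (p - 1))) else \<zero>\<^bsub>C' (n + 1 - p)\<^esub>)"
    by (simp add: z)
  have "f (n + 1 - p) (?v \<oplus>\<^bsub>C (n + 1 - p)\<^esub> ?h) = f (n + 1 - p) ?v \<oplus>\<^bsub>C' (n + 1 - p)\<^esub> f (n + 1 - p) ?h"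
    by (rule mod_hom_add[OF f tot_summands_closed[OF x p]])
  moreover have "(if p \<le> n then cyc_vert C' d' p (n - p) ((\<lambda>p\<in>{..n}. f (n - p) (x p)) p) else \<zero>\<^bsub>C' (n + 1 - p)\<^esub>) =
      f (n + 1 - p) ?v" unfolding v by simp
  moreover have "(if p \<ge> 1 then cyc_horiz C' (inv_op C' u') (p - 1) (n + 1 - p) ((\<lambda>p\<in>{..n}. f (n - p) (x p)) (p - 1))
      else \<zero>\<^bsub>C' (n + 1 - p)\<^esub>) = f (n + 1 - p) ?h" unfolding h using p by (cases p) simp_all
  ultimately show "f (n + 1 - p) ((\<lambda>p\<in>{..n + 1}.
      (if p \<le> n then cyc_vert C d p (n - p) (x p) else \<zero>\<^bsub>C (n + 1 - p)\<^esub>) \<oplus>\<^bsub>C (n + 1 - p)\<^esub>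
      (if p \<ge> 1 then cyc_horiz C (inv_op C u) (p - 1) (n + 1 - p) (x (p - 1)) else \<zero>\<^bsub>C (n + 1 - p)\<^esub>)) p) =
      (if p \<le> n then cyc_vert C' d' p (n - p) ((\<lambda>p\<in>{..n}. f (n - p) (x p)) p) else \<zero>\<^bsub>C' (n + 1 - p)\<^esub>) \<oplus>\<^bsub>C' (n + 1 - p)\<^esub>
      (if p \<ge> 1 then cyc_horiz C' (inv_op C' u') (p - 1) (n + 1 - p) ((\<lambda>p\<in>{..n}. f (n - p) (x p)) (p - 1)) else \<zero>\<^bsub>C' (n + 1 - p)\<^esub>)"
    by (simp only: restrict_apply'[OF pm])
qed

lemma cyclic_homology_iso:
  "mod_isomorphic R (cyclic_homology C d (inv_op C u) n) (cyclic_homology C' d' (inv_op C' u') n)"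
  unfolding cyclic_homology_def
  by (rule cochain_homology_iso[where \<Phi> = tot_map])
    (rule tot_mod_module mC mC' tot_map_hom tot_map_bij tot_diff_closed tot_map_diff; assumption?)+

end

context sweedler_data
begin

section \<open>Iterated coproducts\<close>

lemma icomult_hom: "(\<lambda>b. icomult R B n b) \<in> mod_hom R B (tens R B n B)"
proof (induction n)
  case 0
  then show ?case using ptens_Nil_hom[OF mB mB] by simp
next
  case (Suc n)
  note mTB = tens_module[OF mB mB]
  have "(\<lambda>b. SB (tens R B (Suc n) B) (\<lambda>u v. tcons R B B n u (icomult R B n v)) b) \<in> mod_hom R B (tens R B (Suc n) B)"
    by (intro SB_arg mTB mod_hom_id bilinearI bilinear_lin1[OF tcons_bilinear[OF mB mB]]
        bilinear_lin2[OF tcons_bilinear[OF mB mB]] Suc) simp_all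
  then show ?case by (rule mod_hom_cong[OF _ mB icomult_Suc])
qed

text \<open>A function of all factors of an iterated coproduct takes a list of length \<open>n + 1\<close>.\<close>

definition list_linear :: "nat \<Rightarrow> ('a, 'm, 'u) module_scheme \<Rightarrow> ('b list \<Rightarrow> 'm) \<Rightarrow> bool"
  where "list_linear n M F \<longleftrightarrow>
    (\<forall>l i. length l = Suc n \<longrightarrow> set l \<subseteq> carrier B \<longrightarrow> i \<le> n \<longrightarrow> (\<lambda>u. F (l[i := u])) \<in> mod_hom R B M)"

text \<open>The expression \<open>F [h\<^sub>(\<^sub>1\<^sub>), \<dots>, h\<^sub>(\<^sub>n\<^sub>+\<^sub>1\<^sub>)]\<close>, summed in \<open>M\<close>.\<close>

definition IC :: "nat \<Rightarrow> ('a, 'm, 'u) module_scheme \<Rightarrow> ('b list \<Rightarrow> 'm) \<Rightarrow> 'b \<Rightarrow> 'm"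
  where "IC n M F h = tens_lift R M (\<lambda>(bs, c). F (bs @ [c])) (icomult R B n h)"

lemma list_linearD:
  "list_linear n M F \<Longrightarrow> length l = Suc n \<Longrightarrow> set l \<subseteq> carrier B \<Longrightarrow> i \<le> n \<Longrightarrow> (\<lambda>u. F (l[i := u])) \<in> mod_hom R B M"
  by (simp add: list_linear_def)

lemma list_linear_closed:
  assumes "list_linear n M F" "length l = Suc n" "set l \<subseteq> carrier B"
  shows "F l \<in> carrier M"
proof -
  have "l ! 0 \<in> carrier B" using assms by (metis nth_mem subset_iff zero_less_Suc)
  then show ?thesis using mod_hom_closed[OF list_linearD[OF assms, of 0], of "l ! 0"] by (simp add: list_update_id)
qed

lemma list_linear_multilinear:
  assumes "list_linear n M F"
  shows "multilinear R B n B M (\<lambda>(bs, c). F (bs @ [c]))"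
proof -
  have cl: "F (bs @ [c]) \<in> carrier M" if "(bs, c) \<in> tens_gens B n B" for bs c
    using that by (intro list_linear_closed[OF assms]) (auto simp: tens_gens_def)
  have last: "(\<lambda>u. F (bs @ [u])) \<in> mod_hom R B M" if "(bs, c) \<in> tens_gens B n B" for bs c
    using that list_linearD[OF assms, of "bs @ [c]" n] by (auto simp: tens_gens_def list_update_append)
  have upd: "(\<lambda>u. F (bs[i := u] @ [c])) \<in> mod_hom R B M" if "(bs, c) \<in> tens_gens B n B" "i < n" for bs c i
    using that list_linearD[OF assms, of "bs @ [c]" i] by (auto simp: tens_gens_def list_update_append)
  show ?thesis unfolding multilinear_def using cl last upd by auto
qed

lemma list_linear_Cons: "list_linear (Suc n) M F \<Longrightarrow> u \<in> carrier B \<Longrightarrow> list_linear n M (\<lambda>l. F (u # l))"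
  unfolding list_linear_def
proof (intro allI impI)
  fix l :: "'b list" and i
  assume F: "\<forall>l i. length l = Suc (Suc n) \<longrightarrow> set l \<subseteq> carrier B \<longrightarrow> i \<le> Suc n \<longrightarrow> (\<lambda>u. F (l[i := u])) \<in> mod_hom R B M"
    and u: "u \<in> carrier B" and l: "length l = Suc n" "set l \<subseteq> carrier B" "i \<le> n"
  show "(\<lambda>v. F (u # l[i := v])) \<in> mod_hom R B M"
    using F[rule_format, of "u # l" "Suc i"] u l by simp
qed

lemma list_linear_snoc: "list_linear (Suc n) M F \<Longrightarrow> v \<in> carrier B \<Longrightarrow> list_linear n M (\<lambda>l. F (l @ [v]))"
  unfolding list_linear_def
proof (intro allI impI)
  fix l :: "'b list" and i
  assume F: "\<forall>l i. length l = Suc (Suc n) \<longrightarrow> set l \<subseteq> carrier B \<longrightarrow> i \<le> Suc n \<longrightarrow> (\<lambda>u. F (l[i := u])) \<in> mod_hom R B M"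
    and v: "v \<in> carrier B" and l: "length l = Suc n" "set l \<subseteq> carrier B" "i \<le> n"
  show "(\<lambda>u. F (l[i := u] @ [v])) \<in> mod_hom R B M"
    using F[rule_format, of "l @ [v]" i] v l by (simp add: list_update_append)
qed

lemma IC_hom: "module R M \<Longrightarrow> list_linear n M F \<Longrightarrow> (\<lambda>h. IC n M F h) \<in> mod_hom R B M"
  unfolding IC_def
  by (rule mod_hom_comp[OF tens_lift_hom[OF mB mB _ list_linear_multilinear] icomult_hom])

lemma IC_0: "module R M \<Longrightarrow> list_linear 0 M F \<Longrightarrow> h \<in> carrier B \<Longrightarrow> IC 0 M F h = F [h]"
  unfolding IC_def using tens_lift_ptens[OF mB mB _ list_linear_multilinear, of M 0 F "[]" h] by simp

lemma IC_Suc: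
  assumes "module R M" "list_linear (Suc n) M F" "h \<in> carrier B"
  shows "IC (Suc n) M F h = SB M (\<lambda>u v. IC n M (\<lambda>l. F (u # l)) v) h"
proof -
  note ml = list_linear_multilinear[OF assms(2)]
  note tb = bilinear_closed[OF tcons_bilinear[OF mB mB]]
  have "IC (Suc n) M F h = SB M (\<lambda>u v. tens_lift R M (\<lambda>(bs, c). F (bs @ [c])) (tcons R B B n u (icomult R B n v))) h"
    unfolding IC_def icomult_Suc[OF assms(3)]
    by (rule SB_push[OF tens_lift_hom[OF mB mB assms(1) ml] tens_module[OF mB mB] assms(1,3)]) (simp add: tb)
  also have "\<dots> = SB M (\<lambda>u v. IC n M (\<lambda>l. F (u # l)) v) h"
    unfolding IC_def using assms(3)
    by (intro SB_cong) (simp_all add: tens_lift_tcons[OF mB mB assms(1) ml])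
  finally show ?thesis .
qed

text \<open>By coassociativity an iterated coproduct may be built up at the last factor as well.\<close>

lemma IC_Suc_snoc:
  assumes "module R M" "list_linear (Suc n) M F" "h \<in> carrier B"
  shows "IC (Suc n) M F h = SB M (\<lambda>u v. IC n M (\<lambda>l. F (l @ [v])) u) h"
  using assms(2,3)
proof (induction n arbitrary: F h)
  case 0
  have "IC (Suc 0) M F h = SB M (\<lambda>u v. IC 0 M (\<lambda>l. F (u # l)) v) h" by (rule IC_Suc[OF assms(1) 0])
  also have "\<dots> = SB M (\<lambda>u v. IC 0 M (\<lambda>l. F (l @ [v])) u) h"
    using 0 by (intro SB_cong)
      (simp_all add: IC_0[OF assms(1) list_linear_Cons] IC_0[OF assms(1) list_linear_snoc])
  finally show ?case .
next
  case (Suc n)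
  note F = Suc.prems(1)
  have L: "list_linear n M (\<lambda>l. F (u # l @ [v]))" if "u \<in> carrier B" "v \<in> carrier B" for u v
    using list_linear_snoc[OF list_linear_Cons[OF F that(1)] that(2)] by simp
  have lin1: "(\<lambda>u. IC n M (\<lambda>l. F (u # l @ [v])) w) \<in> mod_hom R B M" if v: "v \<in> carrier B" and w: "w \<in> carrier B" for v w
    unfolding IC_def
  proof (rule tens_lift_fun_hom[OF mB mB assms(1) icomult_closed[OF w]])
    fix g assume "g \<in> tens_gens B n B"
    then show "(\<lambda>u. case g of (bs, c) \<Rightarrow> F (u # (bs @ [c]) @ [v])) \<in> mod_hom R B M"
      using list_linearD[OF F, of "v # (fst g @ [snd g]) @ [v]" 0] v
      by (cases g) (auto simp: tens_gens_def)
  qed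
  have lin2: "(\<lambda>v. IC n M (\<lambda>l. F (u # l @ [v])) w) \<in> mod_hom R B M" if u: "u \<in> carrier B" and w: "w \<in> carrier B" for u w
    unfolding IC_def
  proof (rule tens_lift_fun_hom[OF mB mB assms(1) icomult_closed[OF w]])
    fix g assume "g \<in> tens_gens B n B"
    then show "(\<lambda>v. case g of (bs, c) \<Rightarrow> F (u # (bs @ [c]) @ [v])) \<in> mod_hom R B M"
      using list_linearD[OF F, of "(u # (fst g @ [snd g])) @ [u]" "Suc (Suc n)"] u
      by (cases g) (auto simp: tens_gens_def list_update_append)
  qed
  have "IC (Suc (Suc n)) M F h = SB M (\<lambda>u w. IC (Suc n) M (\<lambda>l. F (u # l)) w) h"
    by (rule IC_Suc[OF assms(1) Suc.prems])
  also have "\<dots> = SB M (\<lambda>u w. SB M (\<lambda>w v. IC n M (\<lambda>l. F (u # l @ [v])) w) w) h"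
    using Suc.prems(2) Suc.IH[OF list_linear_Cons[OF F]] by (intro SB_cong) simp_all
  also have "\<dots> = SB M (\<lambda>w v. SB M (\<lambda>u w. IC n M (\<lambda>l. F (u # l @ [v])) w) w) h"
    by (rule SB_coassoc[symmetric, OF assms(1) _ _ _ Suc.prems(2)])
      (auto intro: lin1 lin2 IC_hom[OF assms(1)] L)
  also have "\<dots> = SB M (\<lambda>w v. IC (Suc n) M (\<lambda>l. F (l @ [v])) w) h"
    using Suc.prems(2) IC_Suc[OF assms(1) list_linear_snoc[OF F]] by (intro SB_cong) simp_all
  finally show ?case .
qed

end

section \<open>The Connes--Moscovici module\<close>

text \<open>For \<open>X = B\<close> and stable anti-Yetter-Drinfeld coefficients, \<open>T n\<close> is the degree \<open>n\<close> part of the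
  Connes--Moscovici module, while \<open>T (Suc n)\<close> is that of \<open>\<bbbT>\<^sub>*(B,Y)\<close>.\<close>

locale connes_moscovici = hopf_data R B B "\<lambda>x y. x \<otimes>\<^bsub>B\<^esub> y" Y actY coact S
  for R :: "('a, 'r) ring_scheme"
    and B :: "('a, 'b, 'q) coalg_scheme"
    and Y :: "('a, 'y, 't) module_scheme"
    and actY :: "'b \<Rightarrow> 'y \<Rightarrow> 'y"
    and coact :: "'y \<Rightarrow> ('b list \<times> 'y \<Rightarrow> 'a) set"
    and S :: "'b \<Rightarrow> 'b" +
  assumes stable: "stable R S Y actY coact"
    and ayd: "anti_yetter_drinfeld R B S Y actY coact"
begin

lemma SX_eq_SB [simp]: "SX = SB"
  by (intro ext) (simp add: SX_def SB_def)

text \<open>On coinvariants \<open>h \<otimes> \<xi>\<close> and \<open>1 \<otimes> S(h) \<xi>\<close> agree.\<close>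

definition collapse :: "nat \<Rightarrow> ('b list \<times> 'y \<Rightarrow> 'a) set \<Rightarrow> ('b list \<times> 'y \<Rightarrow> 'a) set"
  where "collapse n = cons_lift R B Y (T n) (\<lambda>h \<xi>. actn n (S h) \<xi>)"

lemma collapse_bilinear: "bilinear R B (T n) (T n) (\<lambda>h \<xi>. actn n (S h) \<xi>)"
  by (intro bilinearI lin; simp)

lemma collapse_hom: "collapse n \<in> mod_hom R (T (Suc n)) (T n)"
  unfolding collapse_def by (rule cons_lift_hom[OF mB mY mT collapse_bilinear])

lemmas [lin] = mod_hom_comp[OF collapse_hom]
lemmas collapse_closed [simp] = mod_hom_closed[OF collapse_hom]
lemmas collapse_push = S_push[OF collapse_hom mT mT]

lemma collapse_cons: "h \<in> carrier B \<Longrightarrow> \<xi> \<in> carrier (T n) \<Longrightarrow> collapse n (cons n h \<xi>) = actn n (S h) \<xi>"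
  unfolding collapse_def by (rule cons_lift_tcons[OF mB mY mT collapse_bilinear])

lemma collapse_one: "\<xi> \<in> carrier (T n) \<Longrightarrow> collapse n (cons n \<one>\<^bsub>B\<^esub> \<xi>) = \<xi>"
  by (simp add: collapse_cons antipode_one actn_one)

text \<open>\<open>S(b\<^sub>(\<^sub>1\<^sub>) x) b\<^sub>(\<^sub>2\<^sub>) \<zeta> = S(x) S(b\<^sub>(\<^sub>1\<^sub>)) b\<^sub>(\<^sub>2\<^sub>) \<zeta>\<close>, and the antipode law applies.\<close>

lemma collapse_act:
  assumes b: "b \<in> carrier B" and "\<xi> \<in> carrier (T (Suc n))"
  shows "collapse n (actn (Suc n) b \<xi>) = counit B b \<odot>\<^bsub>T n\<^esub> collapse n \<xi>"
proof (rule Suc_eqI[where k = n, OF _ _ assms(2)])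
  show "(\<lambda>\<xi>. collapse n (actn (Suc n) b \<xi>)) \<in> mod_hom R (T (Suc n)) (T n)"
    by (intro lin; simp add: b)
  show "(\<lambda>\<xi>. counit B b \<odot>\<^bsub>T n\<^esub> collapse n \<xi>) \<in> mod_hom R (T (Suc n)) (T n)"
    by (rule mod_hom_smult_fun[OF collapse_hom mT counit_closed[OF b]])
  fix x \<zeta> assume x: "x \<in> carrier B" and \<zeta>: "\<zeta> \<in> carrier (T n)"
  have "collapse n (actn (Suc n) b (cons n x \<zeta>)) =
      SB (T n) (\<lambda>c d. actn n (mulB (S x) (mulB (S c) d)) \<zeta>) b"
    using b x \<zeta> by (simp add: actn_cons collapse_push collapse_cons antipode_mult actn_mult)
  also have "\<dots> = counit B b \<odot>\<^bsub>T n\<^esub> actn n (mulB (S x) \<one>\<^bsub>B\<^esub>) \<zeta>"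
    by (rule hom_antipode(1)[where f = "\<lambda>w. actn n (mulB (S x) w) \<zeta>", OF _ mT b]) (intro lin; simp add: x \<zeta>)
  finally show "collapse n (actn (Suc n) b (cons n x \<zeta>)) = counit B b \<odot>\<^bsub>T n\<^esub> collapse n (cons n x \<zeta>)"
    using x \<zeta> by (simp add: collapse_cons)
qed

text \<open>In coinvariants \<open>1 \<otimes> S(h) \<zeta>\<close> equals \<open>h\<^sub>(\<^sub>1\<^sub>) (1 \<otimes> S(h\<^sub>(\<^sub>2\<^sub>)) \<zeta>)\<close>, which is
  \<open>h\<^sub>(\<^sub>1\<^sub>) \<otimes> h\<^sub>(\<^sub>2\<^sub>) S(h\<^sub>(\<^sub>3\<^sub>)) \<zeta> = h \<otimes> \<zeta>\<close>.\<close>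

lemma coinvariant_collapse:
  assumes \<pi>: "\<pi> \<in> mod_hom R (T (Suc n)) M" and M: "module R M"
    and inv: "\<And>b \<xi>. b \<in> carrier B \<Longrightarrow> \<xi> \<in> carrier (T (Suc n)) \<Longrightarrow> \<pi> (actn (Suc n) b \<xi>) = counit B b \<odot>\<^bsub>M\<^esub> \<pi> \<xi>"
    and \<xi>: "\<xi> \<in> carrier (T (Suc n))"
  shows "\<pi> (cons n \<one>\<^bsub>B\<^esub> (collapse n \<xi>)) = \<pi> \<xi>"
proof (rule tens_hom_Suc_eqI[OF mB mY _ \<pi> M \<xi>])
  note [lin] = mod_hom_comp[OF \<pi>]
  show "(\<lambda>\<xi>. \<pi> (cons n \<one>\<^bsub>B\<^esub> (collapse n \<xi>))) \<in> mod_hom R (T (Suc n)) M"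
    by (intro lin collapse_hom; simp)
  fix h \<zeta> assume h: "h \<in> carrier B" and \<zeta>: "\<zeta> \<in> carrier (T n)"
  have "\<pi> (cons n \<one>\<^bsub>B\<^esub> (collapse n (cons n h \<zeta>))) = \<pi> (cons n \<one>\<^bsub>B\<^esub> (actn n (S h) \<zeta>))"
    using h \<zeta> by (simp add: collapse_cons)
  also have "\<dots> = SB M (\<lambda>c d. counit B c \<odot>\<^bsub>M\<^esub> \<pi> (cons n \<one>\<^bsub>B\<^esub> (actn n (S d) \<zeta>))) h"
    by (rule SB_counit_left[symmetric, OF M _ h]) (intro lin; simp add: \<zeta>)
  also have "\<dots> = SB M (\<lambda>c d. SB M (\<lambda>e f. \<pi> (cons n e (actn n (mulB f (S d)) \<zeta>))) c) h"
    by (rule SB_body_eq[OF h])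
      (simp add: inv[symmetric] \<zeta> actn_cons S_push[OF \<pi> mT M] actn_mult)
  also have "\<dots> = SB M (\<lambda>e d. SB M (\<lambda>f g. \<pi> (cons n e (actn n (mulB f (S g)) \<zeta>))) d) h"
    by (rule SB_coassoc[OF M _ _ _ h]; (intro lin; simp add: \<zeta>))
  also have "\<dots> = SB M (\<lambda>e d. counit B d \<odot>\<^bsub>M\<^esub> \<pi> (cons n e (actn n \<one>\<^bsub>B\<^esub> \<zeta>))) h"
  proof (rule SB_body_eq[OF h])
    fix u v assume u: "u \<in> carrier B" and v: "v \<in> carrier B"
    show "SB M (\<lambda>f g. \<pi> (cons n u (actn n (mulB f (S g)) \<zeta>))) v = counit B v \<odot>\<^bsub>M\<^esub> \<pi> (cons n u (actn n \<one>\<^bsub>B\<^esub> \<zeta>))"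
      by (rule hom_antipode(2)[where f = "\<lambda>w. \<pi> (cons n u (actn n w \<zeta>))", OF _ M v])
        (intro lin mod_hom_id; simp add: u \<zeta>)
  qed
  also have "\<dots> = \<pi> (cons n h (actn n \<one>\<^bsub>B\<^esub> \<zeta>))"
    by (rule SB_counit_right[OF M _ h]) (intro lin; simp add: \<zeta>)
  finally show "\<pi> (cons n \<one>\<^bsub>B\<^esub> (collapse n (cons n h \<zeta>))) = \<pi> (cons n h \<zeta>)"
    using \<zeta> by (simp add: actn_one)
qed

text \<open>The anti-Yetter-Drinfeld condition for Sweedler sums.\<close>

lemma SY_act:
  assumes M: "module R M" and G: "bilinear R B Y M G" and b: "b \<in> carrier B" and y: "y \<in> carrier Y"
  shows "SY M G (actY b y) =
    SB M (\<lambda>c d. SB M (\<lambda>e f. SY M (\<lambda>u z. G (mulB (mulB c u) (Si f)) (actY e z)) y) d) b"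
proof -
  let ?N = "tens R B (Suc 0) Y"
  have tl: "(\<lambda>u. ptens R B Y [u] z) \<in> mod_hom R B ?N" if "z \<in> carrier Y" for z
    using ptens_Cons_hom[OF mB mY, of "[]" z 0] that by simp
  have tr: "(\<lambda>z. ptens R B Y [u] z) \<in> mod_hom R Y ?N" if "u \<in> carrier B" for u
    by (rule ptens_snd_hom[OF mB mY, of _ y]) (simp add: that y)
  note [lin] = mod_hom_comp[OF tl] mod_hom_comp[OF tr]
  let ?F = "\<lambda>l. SY ?N (\<lambda>u z. ptens R B Y [mulB (mulB (l ! 0) u) (Si (l ! 2))] (actY (l ! 1) z)) y"
  have F: "list_linear (Suc (Suc 0)) ?N ?F"
    unfolding list_linear_def
  proof (intro allI impI)
    fix l :: "'b list" and i assume l: "length l = Suc (Suc (Suc 0))" "set l \<subseteq> carrier B" "i \<le> Suc (Suc 0)"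
    then obtain p q r where l': "l = [p, q, r]" by (auto simp: length_Suc_conv)
    consider "i = 0" | "i = 1" | "i = 2" using l(3) by linarith
    then show "(\<lambda>u. ?F (l[i := u])) \<in> mod_hom R B ?N"
      by cases (use l y in \<open>simp_all add: l', (intro lin; simp add: mT)+\<close>)
  qed
  have "coact (actY b y) = tens_lift R ?N
      (\<lambda>(bs, b3). tens_lift R ?N (\<lambda>(cs, z). ptens R B Y [mulB (mulB (bs ! 0) (hd cs)) (Si b3)] (actY (bs ! 1) z)) (coact y))
      (icomult R B (Suc (Suc 0)) b)"
    using ayd b y unfolding anti_yetter_drinfeld_def Si_def by (simp add: numeral_2_eq_2 del: icomult.simps)
  also have "\<dots> = IC (Suc (Suc 0)) ?N ?F b"
    unfolding IC_def
  proof (rule tens_lift_agree[OF mB mB icomult_closed[OF b]])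
    fix g assume "g \<in> tens_gens B (Suc (Suc 0)) B"
    then obtain p q r where "g = ([p, q], r)" by (cases g) (auto simp: tens_gens_def length_Suc_conv)
    then show "(case g of (bs, b3) \<Rightarrow> tens_lift R ?N (\<lambda>(cs, z). ptens R B Y [mulB (mulB (bs ! 0) (hd cs)) (Si b3)] (actY (bs ! 1) z)) (coact y)) =
        (case g of (bs, c) \<Rightarrow> ?F (bs @ [c]))"
      using y by (simp add: tens_lift_SY)
  qed
  also have "\<dots> = SB ?N (\<lambda>c d. IC (Suc 0) ?N (\<lambda>l. ?F (c # l)) d) b"
    by (rule IC_Suc[OF mT F b])
  also have "\<dots> = SB ?N (\<lambda>c d. SB ?N (\<lambda>e f. ?F [c, e, f]) d) b"
  proof (rule SB_body_eq[OF b])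
    fix c d assume c: "c \<in> carrier B" and d: "d \<in> carrier B"
    have "IC (Suc 0) ?N (\<lambda>l. ?F (c # l)) d = SB ?N (\<lambda>e f. IC 0 ?N (\<lambda>l. ?F (c # e # l)) f) d"
      by (rule IC_Suc[OF mT list_linear_Cons[OF F c] d])
    also have "\<dots> = SB ?N (\<lambda>e f. ?F [c, e, f]) d"
      by (rule SB_body_eq[OF d], rule IC_0[OF mT list_linear_Cons[OF list_linear_Cons[OF F c]]])
    finally show "IC (Suc 0) ?N (\<lambda>l. ?F (c # l)) d = SB ?N (\<lambda>e f. ?F [c, e, f]) d" .
  qed
  finally have e: "coact (actY b y) = SB ?N (\<lambda>c d. SB ?N (\<lambda>e f. ?F [c, e, f]) d) b" .
  show ?thesis
    unfolding SY_def[of M G "actY b y"] e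
    using M y b by (simp add: S_push[OF pair_lift_hom[OF mB mY M G]] pair_lift_ptens[OF mB mY M G])
qed

text \<open>The anti-Yetter-Drinfeld condition, carried to the tensor powers.  Over \<open>Y\<close> it turns the inserted
  factor into \<open>b\<^sub>(\<^sub>1\<^sub>) y\<^sub>(\<^sub>-\<^sub>1\<^sub>) S\<^sup>-\<^sup>1(b\<^sub>(\<^sub>3\<^sub>)) u\<close>, in which \<open>b\<^sub>(\<^sub>1\<^sub>)\<close> continues the diagonal action.\<close>

lemma rho_act:
  assumes "u \<in> carrier B" "b \<in> carrier B" "\<xi> \<in> carrier (T n)"
  shows "rho n u (actn n b \<xi>) = SB (T (Suc n)) (\<lambda>c d. actn (Suc n) c (rho n (mulB (Si d) u) \<xi>)) b"
  using assms(2,3)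
proof (induction n arbitrary: b \<xi>)
  case 0
  note u = assms(1) and b = 0(1)
  let ?M = "T (Suc 0)"
  show ?case
  proof (rule nil_eqI[where k = "Suc 0", OF _ _ 0(2)])
    show "(\<lambda>\<xi>. rho 0 u (actn 0 b \<xi>)) \<in> mod_hom R (T 0) ?M" by (intro lin mod_hom_id; simp add: u b)
    show "(\<lambda>\<xi>. SB ?M (\<lambda>c d. actn (Suc 0) c (rho 0 (mulB (Si d) u) \<xi>)) b) \<in> mod_hom R (T 0) ?M"
      by (intro lin mod_hom_id; simp add: u b)
    fix y assume y: "y \<in> carrier Y"
    have "rho 0 u (actn 0 b (unit y)) = SY ?M (\<lambda>b z. cons 0 (mulB b u) (unit z)) (actY b y)"
      using u b y by (simp add: actn_unit rho_unit del: cons_pure)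
    also have "\<dots> = SB ?M (\<lambda>c d. SB ?M (\<lambda>e f. SY ?M (\<lambda>w z. cons 0 (mulB (mulB (mulB c w) (Si f)) u) (unit (actY e z))) y) d) b"
      by (rule SY_act[OF mT _ b y]) (intro bilinearI lin; simp add: u)
    also have "\<dots> = SB ?M (\<lambda>c d. SB ?M (\<lambda>e f. SY ?M (\<lambda>w z. cons 0 (mulB (mulB (mulB e w) (Si d)) u) (unit (actY f z))) y) c) b"
      by (rule SB_coassoc[OF mT _ _ _ b, symmetric]; (intro lin; simp add: u y))
    also have "\<dots> = SB ?M (\<lambda>c d. SY ?M (\<lambda>w z. SB ?M (\<lambda>e f. cons 0 (mulB (mulB (mulB e w) (Si d)) u) (unit (actY f z))) c) y) b"
      by (rule SB_body_eq[OF b], rule SB_SY_swap) (simp_all add: u y)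
    also have "\<dots> = SB ?M (\<lambda>c d. actn (Suc 0) c (rho 0 (mulB (Si d) u) (unit y))) b"
      by (rule SB_body_eq[OF b])
        (simp add: u y rho_unit push actn_cons actn_unit mulB_assoc del: cons_pure)
    finally show "rho 0 u (actn 0 b (unit y)) = SB ?M (\<lambda>c d. actn (Suc 0) c (rho 0 (mulB (Si d) u) (unit y))) b" .
  qed
next
  case (Suc n)
  note u = assms(1) and b = Suc(2)
  let ?M = "T (Suc (Suc n))"
  show ?case
  proof (rule Suc_eqI[where k = "Suc (Suc n)", OF _ _ Suc(3)])
    show "(\<lambda>\<xi>. rho (Suc n) u (actn (Suc n) b \<xi>)) \<in> mod_hom R (T (Suc n)) ?M" by (intro lin mod_hom_id; simp add: u b)
    show "(\<lambda>\<xi>. SB ?M (\<lambda>c d. actn (Suc (Suc n)) c (rho (Suc n) (mulB (Si d) u) \<xi>)) b) \<in> mod_hom R (T (Suc n)) ?M"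
      by (intro lin mod_hom_id; simp add: u b)
    fix v \<zeta> assume v: "v \<in> carrier B" and \<zeta>: "\<zeta> \<in> carrier (T n)"
    have "rho (Suc n) u (actn (Suc n) b (cons n v \<zeta>)) = SB ?M (\<lambda>c d. cons (Suc n) (mulB c v) (rho n u (actn n d \<zeta>))) b"
      using u b v \<zeta> by (simp add: actn_cons rho_push rho_cons)
    also have "\<dots> = SB ?M (\<lambda>c d. SB ?M (\<lambda>e f. cons (Suc n) (mulB c v) (actn (Suc n) e (rho n (mulB (Si f) u) \<zeta>))) d) b"
      by (rule SB_body_eq[OF b]) (simp add: u v \<zeta> Suc.IH cons_push)
    also have "\<dots> = SB ?M (\<lambda>c d. SB ?M (\<lambda>e f. cons (Suc n) (mulB e v) (actn (Suc n) f (rho n (mulB (Si d) u) \<zeta>))) c) b"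
      by (rule SB_coassoc[OF mT _ _ _ b, symmetric]; (intro lin; simp add: u v \<zeta>))
    also have "\<dots> = SB ?M (\<lambda>c d. actn (Suc (Suc n)) c (rho (Suc n) (mulB (Si d) u) (cons n v \<zeta>))) b"
      by (rule SB_body_eq[OF b]) (simp add: u v \<zeta> rho_cons actn_cons)
    finally show "rho (Suc n) u (actn (Suc n) b (cons n v \<zeta>)) =
      SB ?M (\<lambda>c d. actn (Suc (Suc n)) c (rho (Suc n) (mulB (Si d) u) (cons n v \<zeta>))) b" .
  qed
qed

text \<open>After \<open>rho_act\<close> the action on the outside collapses to a counit, and what remains is
  \<open>S\<^sup>-\<^sup>1(b\<^sub>(\<^sub>2\<^sub>)) b\<^sub>(\<^sub>1\<^sub>) = \<epsilon>(b)\<close> in the inserted factor.\<close>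

lemma collapse_tinv_act:
  assumes b: "b \<in> carrier B" and "\<xi> \<in> carrier (T (Suc n))"
  shows "collapse n (tinv n (actn (Suc n) b \<xi>)) = counit B b \<odot>\<^bsub>T n\<^esub> collapse n (tinv n \<xi>)"
proof (rule Suc_eqI[where k = n, OF _ _ assms(2)])
  show "(\<lambda>\<xi>. collapse n (tinv n (actn (Suc n) b \<xi>))) \<in> mod_hom R (T (Suc n)) (T n)"
    by (intro lin mod_hom_id; simp add: b)
  show "(\<lambda>\<xi>. counit B b \<odot>\<^bsub>T n\<^esub> collapse n (tinv n \<xi>)) \<in> mod_hom R (T (Suc n)) (T n)"
    by (rule mod_hom_smult_fun[OF _ mT counit_closed[OF b]]) (intro lin mod_hom_id)
  fix x \<zeta> assume x: "x \<in> carrier B" and \<zeta>: "\<zeta> \<in> carrier (T n)"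
  have "collapse n (tinv n (actn (Suc n) b (cons n x \<zeta>))) = SB (T n) (\<lambda>c d. collapse n (rho n (mulB c x) (actn n d \<zeta>))) b"
    using b x \<zeta> by (simp add: actn_cons push collapse_push tinv_cons)
  also have "\<dots> = SB (T n) (\<lambda>c d. SB (T n) (\<lambda>e f. counit B e \<odot>\<^bsub>T n\<^esub> collapse n (rho n (mulB (Si f) (mulB c x)) \<zeta>)) d) b"
    by (rule SB_body_eq[OF b]) (simp add: x \<zeta> rho_act collapse_push collapse_act)
  also have "\<dots> = SB (T n) (\<lambda>c d. collapse n (rho n (mulB (Si d) (mulB c x)) \<zeta>)) b"
    by (rule SB_body_eq[OF b], rule SB_counit_left[OF mT]; ((intro lin)?; simp add: x \<zeta>))
  also have "\<dots> = SB (T n) (\<lambda>c d. collapse n (rho n (mulB (mulB (Si d) c) x) \<zeta>)) b"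
    by (rule SB_body_eq[OF b]) (simp add: x mulB_assoc)
  also have "\<dots> = counit B b \<odot>\<^bsub>T n\<^esub> collapse n (rho n (mulB \<one>\<^bsub>B\<^esub> x) \<zeta>)"
    by (rule hom_antipode(3)[where f = "\<lambda>w. collapse n (rho n (mulB w x) \<zeta>)", OF _ mT b]) (intro lin mod_hom_id; simp add: x \<zeta>)
  finally show "collapse n (tinv n (actn (Suc n) b (cons n x \<zeta>))) = counit B b \<odot>\<^bsub>T n\<^esub> collapse n (tinv n (cons n x \<zeta>))"
    using x \<zeta> by (simp add: tinv_cons)
qed

lemma zero_stable_Y: "zero_stable R Y actY coact"
  using stable by (simp add: stable_def)

text \<open>The operator that \<open>tinv\<close> induces on the coinvariants, transported to \<open>T n\<close>.\<close>

definition tC :: "nat \<Rightarrow> ('b list \<times> 'y \<Rightarrow> 'a) set \<Rightarrow> ('b list \<times> 'y \<Rightarrow> 'a) set"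
  where "tC n \<zeta> = collapse n (tinv n (cons n \<one>\<^bsub>B\<^esub> \<zeta>))"

lemma tC_hom: "tC n \<in> mod_hom R (T n) (T n)"
proof -
  have "(\<lambda>\<zeta>. collapse n (tinv n (cons n \<one>\<^bsub>B\<^esub> \<zeta>))) \<in> mod_hom R (T n) (T n)"
    by (intro lin mod_hom_id; simp)
  then show ?thesis by (rule mod_hom_cong[OF _ mT tC_def])
qed

lemma tC_power_hom: "tC n ^^ k \<in> mod_hom R (T n) (T n)"
proof (induction k)
  case 0 show ?case using mod_hom_id by (simp add: id_def)
next
  case (Suc k) then show ?case using mod_hom_comp[OF tC_hom Suc] by (simp add: comp_def)
qed

lemma collapse_tinv: "\<xi> \<in> carrier (T (Suc n)) \<Longrightarrow> collapse n (tinv n \<xi>) = tC n (collapse n \<xi>)"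
  unfolding tC_def
  by (rule coinvariant_collapse[where \<pi> = "\<lambda>\<xi>. collapse n (tinv n \<xi>)", symmetric, OF mod_hom_comp[OF collapse_hom tinv_hom] mT collapse_tinv_act])

lemma collapse_tinv_power:
  "\<xi> \<in> carrier (T (Suc n)) \<Longrightarrow> collapse n ((tinv n ^^ k) \<xi>) = (tC n ^^ k) (collapse n \<xi>)"
  by (induction k) (simp_all add: collapse_tinv tinv_power_closed)

lemma tC_order: "\<xi> \<in> carrier (T (Suc n)) \<Longrightarrow> (tC n ^^ Suc n) (collapse n \<xi>) = collapse n \<xi>"
  using coinvariant_tinv_power[where \<xi> = \<xi> and n = n, OF zero_stable_Y collapse_hom mT collapse_act]
    collapse_tinv_power[of \<xi> n "Suc n"] by (simp del: funpow.simps)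

text \<open>The operator \<open>tC\<close> has finite order, so its inverse is one of its powers, and negative
  exponents reduce to positive ones.\<close>

lemma collapse_P:
  "admissible j \<Longrightarrow> \<exists>k. \<forall>\<xi> \<in> carrier (T (Suc n)). collapse n (P n j \<xi>) = (tC n ^^ k) (collapse n \<xi>)"
proof (induction j rule: admissible_induct)
  case zero
  show ?case by (rule exI[of _ 0]) (simp add: P_0)
next
  case (up j)
  then obtain k where "\<And>\<xi>. \<xi> \<in> carrier (T (Suc n)) \<Longrightarrow> collapse n (P n j \<xi>) = (tC n ^^ k) (collapse n \<xi>)" by blast
  then show ?case using up(1) by (intro exI[of _ "Suc k"]) (simp add: P_succ P_closed collapse_tinv)
next
  case (down j)
  then obtain k where k: "\<And>\<xi>. \<xi> \<in> carrier (T (Suc n)) \<Longrightarrow> collapse n (P n j \<xi>) = (tC n ^^ k) (collapse n \<xi>)" by blast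
  have a: "admissible j" using down(1) by (simp add: admissible_def)
  have "collapse n (P n (j - 1) \<xi>) = (tC n ^^ (n + k)) (collapse n \<xi>)" if \<xi>: "\<xi> \<in> carrier (T (Suc n))" for \<xi>
  proof -
    \<comment> \<open>the inverse of \<open>tC n\<close> is \<open>tC n ^^ n\<close>\<close>
    note \<eta> = tau_inverse[OF down(1) P_closed[OF a \<xi>]]
    have "(tC n ^^ k) (collapse n \<xi>) = tC n (collapse n (tau n (P n j \<xi>)))"
      using k[OF \<xi>] collapse_tinv[OF \<eta>(3)] \<eta>(1) by simp
    then have "(tC n ^^ n) ((tC n ^^ k) (collapse n \<xi>)) = collapse n (tau n (P n j \<xi>))"
      using tC_order[OF \<eta>(3)] by (simp add: funpow_swap1)
    then show ?thesis using P_pred[OF down(1) \<xi>] by (simp add: funpow_add)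
  qed
  then show ?case by blast
qed

text \<open>A commutator \<open>[L\<^sub>b, \<tau>\<^sup>-\<^sup>j]\<close> collapses to zero because \<open>\<tau>\<^sup>-\<^sup>j\<close> induces a linear operator after collapsing,
  while \<open>L\<^sub>b\<close> becomes a scalar.\<close>

lemma collapse_I:
  assumes "x \<in> I n"
  shows "collapse n x = \<zero>\<^bsub>T n\<^esub>"
proof -
  have "collapse n x \<in> {\<zero>\<^bsub>T n\<^esub>}"
  proof (rule I_image[OF collapse_hom mT submodule_zero[OF mT] _ assms])
    fix b j \<xi> assume b: "b \<in> carrier B" and \<xi>: "\<xi> \<in> carrier (T (Suc n))" and j: "admissible j"
    obtain k where k: "\<And>\<xi>. \<xi> \<in> carrier (T (Suc n)) \<Longrightarrow> collapse n (P n j \<xi>) = (tC n ^^ k) (collapse n \<xi>)"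
      using collapse_P[OF j, of n] by blast
    have "collapse n (P n j (actn (Suc n) b \<xi>)) = (tC n ^^ k) (counit B b \<odot>\<^bsub>T n\<^esub> collapse n \<xi>)"
      using b \<xi> by (simp add: k collapse_act)
    also have "\<dots> = counit B b \<odot>\<^bsub>T n\<^esub> collapse n (P n j \<xi>)"
      using mod_hom_smult[OF tC_power_hom counit_closed[OF b] collapse_closed[OF \<xi>]] k[OF \<xi>] by simp
    also have "\<dots> = collapse n (actn (Suc n) b (P n j \<xi>))"
      by (rule collapse_act[symmetric, OF b P_closed[OF j \<xi>]])
    finally show "{\<zero>\<^bsub>T n\<^esub>} +>\<^bsub>T n\<^esub> collapse n (actn (Suc n) b (P n j \<xi>)) =
        {\<zero>\<^bsub>T n\<^esub>} +>\<^bsub>T n\<^esub> collapse n (P n j (actn (Suc n) b \<xi>))" by simp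
  qed
  then show ?thesis by simp
qed

lemma collapse_descends:
  "\<exists>g \<in> mod_hom R (CM n) (T n). \<forall>\<xi> \<in> carrier (T (Suc n)). g (pr n \<xi>) = collapse n \<xi>"
proof -
  have PCM_eq: "PCM n = quot_mod (T (Suc n)) (I n)" by (simp add: PCM_mod_def T_mod_def)
  obtain f where f: "f \<in> mod_hom R (PCM n) (T n)"
    and fc: "\<And>\<xi>. \<xi> \<in> carrier (T (Suc n)) \<Longrightarrow> f (cl n \<xi>) = collapse n \<xi>"
    using quot_lift_ex[OF mT I_submodule[of n] mT collapse_hom collapse_I]
    unfolding PCM_eq[symmetric] cl_def[symmetric] by auto
  have J: "f z = \<zero>\<^bsub>T n\<^esub>" if "z \<in> J n" for z
  proof -
    interpret PM: module R "PCM n" by simp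
    interpret TM: module R "T n" by (rule mT)
    have "f z \<in> {\<zero>\<^bsub>T n\<^esub>}"
    proof (rule mod_span_hom_image[OF f mPCM mT submodule_zero[OF mT] _ _ that[unfolded coinv_sub_def]])
      show "{(counit B b \<odot>\<^bsub>PCM n\<^esub> x) \<ominus>\<^bsub>PCM n\<^esub> LP n b x | b x. b \<in> carrier B \<and> x \<in> carrier (PCM n)} \<subseteq> carrier (PCM n)"
        using left_module.act_closed[OF PCM_left_module] by auto
      fix x assume "x \<in> {(counit B b \<odot>\<^bsub>PCM n\<^esub> x) \<ominus>\<^bsub>PCM n\<^esub> LP n b x | b x. b \<in> carrier B \<and> x \<in> carrier (PCM n)}"
      then obtain b z where x: "x = (counit B b \<odot>\<^bsub>PCM n\<^esub> z) \<ominus>\<^bsub>PCM n\<^esub> LP n b z" and b: "b \<in> carrier B" and z: "z \<in> carrier (PCM n)" by blast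
      obtain \<xi> where \<xi>: "\<xi> \<in> carrier (T (Suc n))" "z = cl n \<xi>" using PCM_ex[OF z] by blast
      have "f x = f (counit B b \<odot>\<^bsub>PCM n\<^esub> z) \<ominus>\<^bsub>T n\<^esub> f (LP n b z)"
        unfolding x using b z left_module.act_closed[OF PCM_left_module b z]
        by (intro mod_hom_diff[OF f mPCM mT]) simp_all
      also have "f (counit B b \<odot>\<^bsub>PCM n\<^esub> z) = counit B b \<odot>\<^bsub>T n\<^esub> collapse n \<xi>"
        using mod_hom_smult[OF f counit_closed[OF b] z] \<xi> fc by simp
      also have "f (LP n b z) = counit B b \<odot>\<^bsub>T n\<^esub> collapse n \<xi>"
        using b \<xi> by (simp add: PCM_act_cl(1) fc collapse_act)
      finally show "f x \<in> {\<zero>\<^bsub>T n\<^esub>}"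
        using TM.r_neg[of "counit B b \<odot>\<^bsub>T n\<^esub> collapse n \<xi>"] b \<xi> by (simp add: TM.minus_eq)
    qed
    then show ?thesis by simp
  qed
  obtain g where g: "g \<in> mod_hom R (CM n) (T n)"
    and gc: "\<And>z. z \<in> carrier (PCM n) \<Longrightarrow> g (co n z) = f z"
    using quot_lift_ex[OF mPCM J_submodule mT f J]
    unfolding CM_eq[symmetric] co_def[symmetric] by auto
  have "\<forall>\<xi> \<in> carrier (T (Suc n)). g (pr n \<xi>) = collapse n \<xi>"
    by (simp add: pr_def gc cl_closed fc)
  with g show ?thesis by blast
qed

definition collapseC :: "nat \<Rightarrow> ('b list \<times> 'y \<Rightarrow> 'a) set set set \<Rightarrow> ('b list \<times> 'y \<Rightarrow> 'a) set"
  where "collapseC n = (SOME g. g \<in> mod_hom R (CM n) (T n) \<and> (\<forall>\<xi> \<in> carrier (T (Suc n)). g (pr n \<xi>) = collapse n \<xi>))"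

lemma collapseC: "collapseC n \<in> mod_hom R (CM n) (T n)"
  "\<xi> \<in> carrier (T (Suc n)) \<Longrightarrow> collapseC n (pr n \<xi>) = collapse n \<xi>"
  using someI_ex[OF collapse_descends[of n, unfolded Bex_def]] unfolding collapseC_def by blast+

lemma pr_collapse:
  "z \<in> carrier (CM n) \<Longrightarrow> collapseC n z \<in> carrier (T n) \<and> z = pr n (cons n \<one>\<^bsub>B\<^esub> (collapseC n z))"
proof -
  assume "z \<in> carrier (CM n)"
  then obtain \<xi> where \<xi>: "\<xi> \<in> carrier (T (Suc n))" "z = pr n \<xi>" using CM_carrier_pr by blast
  then show ?thesis
    using coinvariant_collapse[where \<xi> = \<xi> and n = n, OF pr_hom mCM pr_act] by (simp add: collapseC(2))
qed

lemma collapseC_bij: "bij_betw (collapseC n) (carrier (CM n)) (carrier (T n))"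
proof (rule bij_betw_byWitness[where f' = "\<lambda>\<zeta>. pr n (cons n \<one>\<^bsub>B\<^esub> \<zeta>)"])
  show "\<forall>z\<in>carrier (CM n). pr n (cons n \<one>\<^bsub>B\<^esub> (collapseC n z)) = z" using pr_collapse by force
  show "\<forall>\<zeta>\<in>carrier (T n). collapseC n (pr n (cons n \<one>\<^bsub>B\<^esub> \<zeta>)) = \<zeta>" by (simp add: collapseC(2) collapse_one)
  show "collapseC n ` carrier (CM n) \<subseteq> carrier (T n)" using pr_collapse by blast
  show "(\<lambda>\<zeta>. pr n (cons n \<one>\<^bsub>B\<^esub> \<zeta>)) ` carrier (T n) \<subseteq> carrier (CM n)"
    using mod_hom_closed[OF pr_hom] by auto
qed

text \<open>Putting \<open>1\<close> in front gives \<open>\<partial>\<^sub>0\<close> a second \<open>1\<close>, shifts the splittings by one, and lets the last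
  coface map move one copy of this \<open>1\<close> to the end, where it becomes \<open>y\<^sub>(\<^sub>-\<^sub>1\<^sub>)\<close>.\<close>

lemma collapse_coface:
  assumes j: "j \<le> n + 1" and \<zeta>: "\<zeta> \<in> carrier (T n)"
  shows "collapse (n + 1) (cof n j (cons n \<one>\<^bsub>B\<^esub> \<zeta>)) = conmos_coface R B Y coact n j \<zeta>"
proof -
  have s0: "spl 0 n (cons n \<one>\<^bsub>B\<^esub> \<zeta>) = cons (Suc n) \<one>\<^bsub>B\<^esub> (cons n \<one>\<^bsub>B\<^esub> \<zeta>)"
    using \<zeta> by (simp add: spl_0_cons) (rule SB_one[OF mT], intro bilinearI lin; simp)
  consider "j = 0" | i m where "n = Suc m" "j = Suc i" "i \<le> m" | "j = Suc n"
  proof -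
    assume h: "j = 0 \<Longrightarrow> thesis" "\<And>m i. n = Suc m \<Longrightarrow> j = Suc i \<Longrightarrow> i \<le> m \<Longrightarrow> thesis" "j = Suc n \<Longrightarrow> thesis"
    show thesis using h j by (cases j; cases n) (auto simp: le_Suc_eq)
  qed
  then show ?thesis
  proof cases
    case 1
    have "tens_lift R (T (Suc n)) (\<lambda>(hs, y). ptens R B Y (\<one>\<^bsub>B\<^esub> # hs) y) \<zeta> = cons n \<one>\<^bsub>B\<^esub> \<zeta>"
      by (rule tens_lift_eqI[OF mB mY tcons_hom[OF mB mY one_B] mT \<zeta>]) simp
    then show ?thesis
      using 1 s0 \<zeta> by (simp add: cof_def conmos_coface_def conmos_mod_def collapse_one)
  next
    case (2 i m)
    then show ?thesis
      using \<zeta> split_at_eq[of i m \<zeta>]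
      by (simp add: cof_def conmos_coface_def spl_Suc_cons collapse_one)
  next
    case 3
    have "tens_lift R (T (Suc n)) (\<lambda>(hs, y). tens_lift R (T (Suc n)) (\<lambda>(bs, z). ptens R B Y (hs @ bs) z) (coact y)) \<zeta> =
        rho n \<one>\<^bsub>B\<^esub> \<zeta>"
    proof (rule tens_lift_eqI[OF mB mY bilinearD(1)[OF rho_bilinear one_B] mT \<zeta>])
      fix hs y assume g: "(hs, y) \<in> tens_gens B n Y"
      then show "(case (hs, y) of (hs, y) \<Rightarrow> tens_lift R (T (Suc n)) (\<lambda>(bs, z). ptens R B Y (hs @ bs) z) (coact y)) =
          rho n \<one>\<^bsub>B\<^esub> (ptens R B Y hs y)"
        by (simp add: rho_pure tens_lift_SY[OF gens_Y[OF g]] gens_Y[OF g])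
    qed
    then show ?thesis
      using 3 s0 \<zeta> by (simp add: cof_def conmos_coface_def conmos_mod_def tinv_cons rho_cons collapse_one)
  qed
qed

lemma antipode_factors_gens:
  assumes "(ks, z) \<in> tens_gens B n Y" "set l \<subseteq> carrier B" "n \<le> length l" "w \<in> carrier Y"
  shows "(map2 (\<lambda>g k. mulB (S g) k) l ks, w) \<in> tens_gens B n Y"
proof -
  have "mulB (S a) b \<in> carrier B" if "(a, b) \<in> set (zip l ks)" for a b
    using set_zip_leftD[OF that] set_zip_rightD[OF that] assms by (auto simp: tens_gens_def subset_iff)
  then show ?thesis using assms by (auto simp: tens_gens_def)
qed

text \<open>The list \<open>rev l\<close> has one entry more than \<open>ks\<close>, so \<open>map2\<close> drops its last entry, which is \<open>hd l\<close>
  and acts on \<open>z\<close> instead.\<close>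

lemma antipode_factors_list_linear:
  assumes "(ks, z) \<in> tens_gens B n Y"
  shows "list_linear n (T n) (\<lambda>l. ptens R B Y (map2 (\<lambda>g k. mulB (S g) k) (rev l) ks) (actY (S (hd l)) z))"
  unfolding list_linear_def
proof (intro allI impI)
  fix l :: "'b list" and i assume l: "length l = Suc n" "set l \<subseteq> carrier B" and i: "i \<le> n"
  have ks: "length ks = n" "set ks \<subseteq> carrier B" and z: "z \<in> carrier Y" using assms by (auto simp: tens_gens_def)
  obtain a m where m: "l = a # m" "length m = n" "set m \<subseteq> carrier B" and a: "a \<in> carrier B"
    using l by (cases l) auto
  let ?f = "\<lambda>g k. mulB (S g) k"
  have drop: "map2 ?f (rev m' @ [a']) ks = map2 ?f (rev m') ks" if "length m' = n" for m' a'
    using zip_append[of "rev m'" ks "[a']" "[]"] that ks(1) by simp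
  have g: "(map2 ?f (rev m) ks, w) \<in> tens_gens B n Y" if "w \<in> carrier Y" for w
    using antipode_factors_gens[OF assms, of "rev m"] m(2,3) that by simp
  show "(\<lambda>u. ptens R B Y (map2 ?f (rev (l[i := u])) ks) (actY (S (hd (l[i := u]))) z)) \<in> mod_hom R B (T n)"
  proof (cases i)
    case 0
    have "(\<lambda>u. ptens R B Y (map2 ?f (rev m) ks) (actY (S u) z)) \<in> mod_hom R B (T n)"
      by (rule mod_hom_comp[OF ptens_snd_hom[OF mB mY g[OF z]]]) (intro lin mod_hom_id; simp add: z)
    then show ?thesis using 0 m by (simp add: drop)
  next
    case (Suc j)
    then have j: "n - Suc j < n" using i by simp
    have k: "ks ! (n - Suc j) \<in> carrier B" using ks j by (auto simp: subset_iff)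
    have "map2 ?f (rev (m[j := u])) ks = (map2 ?f (rev m) ks)[n - Suc j := mulB (S u) (ks ! (n - Suc j))]" for u
      using m(2) ks(1) j Suc i by (simp add: rev_update map2_update)
    moreover have "(\<lambda>u. ptens R B Y ((map2 ?f (rev m) ks)[n - Suc j := mulB (S u) (ks ! (n - Suc j))]) (actY (S a) z)) \<in> mod_hom R B (T n)"
      by (rule mod_hom_comp[OF ptens_update_hom[OF mB mY g j]]) ((intro lin mod_hom_id)?; simp add: a z k)+
    ultimately show ?thesis using Suc m by (simp add: drop)
  qed
qed

text \<open>The antipode reverses coproducts, so the diagonal action of \<open>S(h)\<close> uses the factors of the iterated
  coproduct of \<open>h\<close> from the last to the first.\<close>

lemma actn_antipode_pure:
  assumes "(ks, z) \<in> tens_gens B n Y" "h \<in> carrier B"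
  shows "actn n (S h) (ptens R B Y ks z) =
    IC n (T n) (\<lambda>l. ptens R B Y (map2 (\<lambda>g k. mulB (S g) k) (rev l) ks) (actY (S (hd l)) z)) h"
  using assms
proof (induction n arbitrary: ks h)
  case 0
  then show ?case
    using IC_0[OF mT antipode_factors_list_linear[OF 0(1)] 0(2)] by (simp add: tens_gens_0 actn_unit)
next
  case (Suc n)
  then obtain k ks' where ks: "ks = k # ks'" "k \<in> carrier B" and g: "(ks', z) \<in> tens_gens B n Y"
    by (auto simp: tens_gens_Suc)
  let ?F = "\<lambda>ks l. ptens R B Y (map2 (\<lambda>g k. mulB (S g) k) (rev l) ks) (actY (S (hd l)) z)"
  have p: "ptens R B Y ks' z \<in> carrier (T n)" using g by simp
  have "actn (Suc n) (S h) (ptens R B Y ks z) = SB (T (Suc n)) (\<lambda>c d. cons n (mulB c k) (actn n d (ptens R B Y ks' z))) (S h)"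
    using ks g Suc.prems(2) actn_cons[OF S_closed ks(2) p] by simp
  also have "\<dots> = SB (T (Suc n)) (\<lambda>u v. cons n (mulB (S v) k) (actn n (S u) (ptens R B Y ks' z))) h"
    by (rule antipode_comult[OF mT _ Suc.prems(2)]) (intro bilinearI lin mod_hom_id; simp add: ks p)
  also have "\<dots> = SB (T (Suc n)) (\<lambda>u v. IC n (T (Suc n)) (\<lambda>l. ?F ks (l @ [v])) u) h"
  proof (rule SB_body_eq[OF Suc.prems(2)])
    fix u v assume u: "u \<in> carrier B" and v: "v \<in> carrier B"
    have "cons n (mulB (S v) k) (actn n (S u) (ptens R B Y ks' z)) = cons n (mulB (S v) k) (IC n (T n) (?F ks') u)"
      using Suc.IH[OF g u] by simp
    also have "\<dots> = IC n (T (Suc n)) (\<lambda>l. cons n (mulB (S v) k) (?F ks' l)) u"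
      unfolding IC_def
    proof (subst mod_hom_tens_lift[OF mB mB tcons_hom[OF mB mY] mT mT icomult_closed[OF u]])
      fix q assume "q \<in> tens_gens B n B"
      then show "(case q of (bs, c) \<Rightarrow> ?F ks' (bs @ [c])) \<in> carrier (T n)"
        using list_linear_closed[OF antipode_factors_list_linear[OF g], of "fst q @ [snd q]"] by (cases q) (simp add: tens_gens_def)
    qed (auto simp: u v ks case_prod_unfold)
    also have "\<dots> = IC n (T (Suc n)) (\<lambda>l. ?F ks (l @ [v])) u"
      unfolding IC_def
    proof (rule tens_lift_agree[OF mB mB icomult_closed[OF u]])
      fix q assume q: "q \<in> tens_gens B n B"
      then obtain bs c where bc: "q = (bs, c)" "length bs = n" "set bs \<subseteq> carrier B" "c \<in> carrier B" by (cases q) (auto simp: tens_gens_def)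
      have gg: "(map2 (\<lambda>g k. mulB (S g) k) (c # rev bs) ks', w) \<in> tens_gens B n Y" if "w \<in> carrier Y" for w
        using antipode_factors_gens[OF g, of "c # rev bs"] bc that by simp
      have "actY (S (hd (bs @ [c]))) z \<in> carrier Y"
        using bc g by (cases bs) (auto simp: tens_gens_def)
      moreover have "hd (bs @ [c, v]) = hd (bs @ [c])" by (cases bs) auto
      ultimately show "(case q of (bs, c) \<Rightarrow> cons n (mulB (S v) k) (?F ks' (bs @ [c]))) = (case q of (bs, c) \<Rightarrow> ?F ks ((bs @ [c]) @ [v]))"
        using bc v ks gg by simp
    qed
    finally show "cons n (mulB (S v) k) (actn n (S u) (ptens R B Y ks' z)) = IC n (T (Suc n)) (\<lambda>l. ?F ks (l @ [v])) u" .
  qed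
  also have "\<dots> = IC (Suc n) (T (Suc n)) (?F ks) h"
    by (rule IC_Suc_snoc[symmetric, OF mT antipode_factors_list_linear[OF Suc.prems(1)] Suc.prems(2)])
  finally show ?case .
qed

text \<open>In degree \<open>0\<close> stability makes the operator trivial.  In higher degrees it inserts \<open>y\<^sub>(\<^sub>-\<^sub>1\<^sub>)\<close> at the end
  and then lets \<open>S(h)\<close> act on the remaining factors, which is the formula of Connes and Moscovici.\<close>

lemma tC_eq_conmos_tinv:
  assumes \<zeta>: "\<zeta> \<in> carrier (T n)"
  shows "tC n \<zeta> = conmos_tinv R B S Y actY coact n \<zeta>"
proof (cases n)
  case 0
  have "tC 0 \<zeta> = \<zeta>"
  proof (rule nil_eqI[where k = 0, OF tC_hom mod_hom_id \<zeta>[unfolded 0]])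
    fix y assume y: "y \<in> carrier Y"
    have u: "(\<lambda>z. unit z) \<in> mod_hom R Y (T 0)" by (rule ptens_Nil_hom[OF mB mY])
    have "tC 0 (unit y) = SY (T 0) (\<lambda>b z. unit (actY (S b) z)) y"
      using y by (simp add: tC_def tinv_cons rho_unit collapse_push collapse_cons actn_unit del: cons_pure)
    also have "\<dots> = unit (SY Y (\<lambda>b z. actY (S b) z) y)"
      using y by (simp add: S_push[OF u mY mT])
    also have "SY Y (\<lambda>b z. actY (S b) z) y = y"
      using stable y by (simp add: stable_def tens_lift_SY)
    finally show "tC 0 (unit y) = unit y" .
  qed
  then show ?thesis by (simp add: 0 conmos_tinv_def)
next
  case (Suc m)
  let ?G = "\<lambda>hs z l. ptens R B Y (map2 (\<lambda>g k. mulB (S g) k) (rev l) hs) (actY (S (hd l)) z)"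
  let ?L = "\<lambda>(hs, y). tens_lift R (T n)
         (\<lambda>(as, c). tens_lift R (T n)
           (\<lambda>(bs, z). ptens R B Y (map2 (\<lambda>g k. mulB (S g) k) (c # rev as) (tl hs @ bs)) (actY (S (hd as)) z))
           (coact y)) (icomult R B n (hd hs))"
  have "tens_lift R (T n) ?L \<zeta> = tC n \<zeta>"
  proof (rule tens_lift_eqI[OF mB mY tC_hom mT \<zeta>])
    fix hs y assume hs0: "(hs, y) \<in> tens_gens B n Y"
    then obtain h hs' where hs: "hs = h # hs'" and h: "h \<in> carrier B" and g: "(hs', y) \<in> tens_gens B m Y"
      unfolding Suc by (auto simp: tens_gens_Suc)
    have y: "y \<in> carrier Y" using gens_Y[OF hs0] .
    note dYc = mod_hom_closed[OF dY y]
    have gg: "(hs' @ [b], z) \<in> tens_gens B n Y" if "b \<in> carrier B" "z \<in> carrier Y" for b z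
      using gens_snd[OF g that(2)] that(1) Suc by simp
    have Gc: "?G (hs' @ bs) z (as @ [c]) \<in> carrier (T n)"
      if as: "(as, c) \<in> tens_gens B n B" and bs: "(bs, z) \<in> tens_gens B (Suc 0) Y" for as c bs z
    proof -
      obtain b where "bs = [b]" "b \<in> carrier B" "z \<in> carrier Y" using bs by (auto simp: tens_gens_Suc tens_gens_0)
      then show ?thesis
        using list_linear_closed[OF antipode_factors_list_linear[OF gg], of b z "as @ [c]"] as by (simp add: tens_gens_def)
    qed
    have "?L (hs, y) = tens_lift R (T n) (\<lambda>(as, c). tens_lift R (T n) (\<lambda>(bs, z). ?G (hs' @ bs) z (as @ [c])) (coact y)) (icomult R B n h)"
      unfolding hs case_prod_conv list.sel
    proof (rule tens_lift_agree[OF mB mB icomult_closed[OF h]])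
      fix q assume "q \<in> tens_gens B n B"
      then obtain a as c where "q = (a # as, c)" unfolding Suc by (cases q) (auto simp: tens_gens_Suc)
      then show "(case q of (as, c) \<Rightarrow> tens_lift R (T n)
           (\<lambda>(bs, z). ptens R B Y (map2 (\<lambda>g k. mulB (S g) k) (c # rev as) (hs' @ bs)) (actY (S (hd as)) z)) (coact y)) =
         (case q of (as, c) \<Rightarrow> tens_lift R (T n) (\<lambda>(bs, z). ?G (hs' @ bs) z (as @ [c])) (coact y))" by simp
    qed
    \<comment> \<open>the coproduct of \<open>h\<close> and the coaction of \<open>y\<close> are independent\<close>
    also have "\<dots> = tens_lift R (T n) (\<lambda>(bs, z). tens_lift R (T n) (\<lambda>(as, c). ?G (hs' @ bs) z (as @ [c])) (icomult R B n h)) (coact y)"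
      using tens_lift_swap[OF mB mB mB mY mT icomult_closed[OF h] dYc,
          of n "\<lambda>(as, c) (bs, z). ?G (hs' @ bs) z (as @ [c])" n] Gc
      by (auto simp: case_prod_unfold)
    also have "\<dots> = SY (T n) (\<lambda>b z. IC n (T n) (?G (hs' @ [b]) z) h) y"
      by (rule tens_lift_SY[OF y]) (simp add: IC_def)
    also have "\<dots> = SY (T n) (\<lambda>b z. actn n (S h) (ptens R B Y (hs' @ [b]) z)) y"
      using y h by (simp add: actn_antipode_pure gg)
    also have "\<dots> = tC n (ptens R B Y hs y)"
    proof -
      have g1: "ptens R B Y hs y = cons m h (ptens R B Y hs' y)" using hs h g by simp
      have p: "ptens R B Y hs' y \<in> carrier (T m)" using g by simp
      have "tC n (ptens R B Y hs y) = collapse (Suc m) (cons (Suc m) h (rho m \<one>\<^bsub>B\<^esub> (ptens R B Y hs' y)))"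
        unfolding g1 Suc tC_def using h p by (simp add: tinv_cons rho_cons del: cons_pure)
      also have "\<dots> = actn (Suc m) (S h) (SY (T (Suc m)) (\<lambda>b z. ptens R B Y (hs' @ [mulB b \<one>\<^bsub>B\<^esub>]) z) y)"
        using h p g by (simp add: collapse_cons rho_pure[symmetric])
      also have "\<dots> = SY (T n) (\<lambda>b z. actn n (S h) (ptens R B Y (hs' @ [b]) z)) y"
        unfolding Suc using h y gg[unfolded Suc] by (simp add: actn_push)
      finally show ?thesis ..
    qed
    finally show "?L (hs, y) = tC n (ptens R B Y hs y)" .
  qed
  then show ?thesis using Suc by (simp add: conmos_tinv_def conmos_mod_def)
qed

lemma cyclic_homology_CM_conmos:
  "mod_isomorphic R (cyclic_homology CM dC (inv_op CM uC) n)
    (cyclic_homology (conmos_mod R B Y) (conmos_coface R B Y coact)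
      (inv_op (conmos_mod R B Y) (conmos_tinv R B S Y actY coact)) n)"
proof (rule cyclic_homology_iso[where f = collapseC])
  show "module R (CM n)" for n by simp
  show "module R (conmos_mod R B Y n)" for n by (simp add: conmos_mod_def)
  show "collapseC n \<in> mod_hom R (CM n) (conmos_mod R B Y n)" for n
    unfolding conmos_mod_def by (rule collapseC(1))
  show "bij_betw (collapseC n) (carrier (CM n)) (carrier (conmos_mod R B Y n))" for n
    unfolding conmos_mod_def by (rule collapseC_bij)
  show "bij_betw (uC n) (carrier (CM n)) (carrier (CM n))" for n
    by (rule CM_tauinv_bij[OF zero_stable_Y])
  fix n z assume z: "z \<in> carrier (CM n)"
  obtain \<zeta> where \<zeta>: "\<zeta> \<in> carrier (T n)" "collapseC n z = \<zeta>" and zp: "z = pr n (cons n \<one>\<^bsub>B\<^esub> \<zeta>)"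
    using pr_collapse[OF z] by blast
  show "collapseC n (uC n z) = conmos_tinv R B S Y actY coact n (collapseC n z)"
    unfolding \<zeta>(2) using \<zeta>(1)
    by (simp add: zp CM_tauinv_pr collapseC(2) tC_eq_conmos_tinv[symmetric] tC_def)
  fix j assume j: "j \<le> n + 1"
  show "dC n j z \<in> carrier (CM (n + 1))"
    by (rule mod_hom_closed[OF CM_coface_co(2)[OF j] z])
  have c: "cof n j (cons n \<one>\<^bsub>B\<^esub> \<zeta>) \<in> carrier (T (Suc (n + 1)))"
    using mod_hom_closed[OF cof_hom[OF j], of "cons n \<one>\<^bsub>B\<^esub> \<zeta>"] \<zeta>(1) by simp
  have "collapseC (n + 1) (dC n j z) = collapse (n + 1) (cof n j (cons n \<one>\<^bsub>B\<^esub> \<zeta>))"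
    using \<zeta>(1) by (simp only: zp CM_coface_pr[OF j cons_closed[OF one_B \<zeta>(1)]] collapseC(2)[OF c])
  then show "collapseC (n + 1) (dC n j z) = conmos_coface R B Y coact n j (collapseC n z)"
    unfolding \<zeta>(2) using collapse_coface[OF j \<zeta>(1)] by simp
qed

end

theorem theorem4p4:
  fixes R :: "('a, 'r) ring_scheme"
    and B :: "('a, 'b, 'q) coalg_scheme"
    and X :: "('a, 'x, 's) coalg_scheme"
    and actX :: "'b \<Rightarrow> 'x \<Rightarrow> 'x"
    and Y :: "('a, 'y, 't) module_scheme"
    and actY :: "'b \<Rightarrow> 'y \<Rightarrow> 'y"
    and coact :: "'y \<Rightarrow> ('b list \<times> 'y \<Rightarrow> 'a) set"
  assumes "field R"
    and "bialgebra R B"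
    and "module_coalgebra R B X actX"
    and "module_comodule R B Y actY coact"
    and "zero_stable R Y actY coact"
  shows
    "(cosimplicial_B_module R B
        (PCM_mod R B X actX Y actY coact)
        (PCM_act R B X actX Y actY coact)
        (PCM_coface R B X actX Y actY coact) \<and>
     almost_para_cocyclic_B_module R B
        (PCM_mod R B X actX Y actY coact)
        (PCM_act R B X actX Y actY coact)
        (PCM_coface R B X actX Y actY coact)
        (PCM_tauinv R B X actX Y actY coact)) \<and>
    (hopf R B \<longrightarrow>
       (\<forall>n. bij_betw (PCM_tauinv R B X actX Y actY coact n)
          (carrier (PCM_mod R B X actX Y actY coact n))
          (carrier (PCM_mod R B X actX Y actY coact n))) \<and>
       para_cocyclic_B_module R B
          (PCM_mod R B X actX Y actY coact)
          (PCM_act R B X actX Y actY coact)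
          (PCM_coface R B X actX Y actY coact)
          (inv_op (PCM_mod R B X actX Y actY coact) (PCM_tauinv R B X actX Y actY coact))) \<and>
    ((\<forall>n. bij_betw (CM_tauinv R B X actX Y actY coact n)
          (carrier (CM_mod R B X actX Y actY coact n))
          (carrier (CM_mod R B X actX Y actY coact n))) \<and>
     cocyclic_module R
        (CM_mod R B X actX Y actY coact)
        (CM_coface R B X actX Y actY coact)
        (inv_op (CM_mod R B X actX Y actY coact) (CM_tauinv R B X actX Y actY coact))) \<and>
    (\<forall>S. bijective_antipode R B S \<and> stable R S Y actY coact \<and>
         anti_yetter_drinfeld R B S Y actY coact \<longrightarrow>
       (\<forall>n. mod_isomorphic R
          (cyclic_homology
             (CM_mod R B B (monoid.mult B) Y actY coact)
             (CM_coface R B B (monoid.mult B) Y actY coact)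
             (inv_op (CM_mod R B B (monoid.mult B) Y actY coact)
                     (CM_tauinv R B B (monoid.mult B) Y actY coact))
             n)
          (cyclic_homology
             (conmos_mod R B Y)
             (conmos_coface R B Y coact)
             (inv_op (conmos_mod R B Y) (conmos_tinv R B S Y actY coact))
             n)))"
proof -
  interpret sweedler_data R B X actX Y actY coact
    using assms(2-4) by (rule sweedler_data.intro)
  have part4: "mod_isomorphic R
          (cyclic_homology
             (CM_mod R B B (monoid.mult B) Y actY coact)
             (CM_coface R B B (monoid.mult B) Y actY coact)
             (inv_op (CM_mod R B B (monoid.mult B) Y actY coact)
                     (CM_tauinv R B B (monoid.mult B) Y actY coact))
             n)
          (cyclic_homology
             (conmos_mod R B Y)
             (conmos_coface R B Y coact)
             (inv_op (conmos_mod R B Y) (conmos_tinv R B S Y actY coact))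
             n)"
    if S: "bijective_antipode R B S" "stable R S Y actY coact" "anti_yetter_drinfeld R B S Y actY coact" for S n
  proof -
    have "connes_moscovici R B Y actY coact S"
      using S assms(2,4) module_coalgebra_regular[OF assms(2)]
      by (intro connes_moscovici.intro hopf_data.intro sweedler_data.intro hopf_data_axioms.intro connes_moscovici_axioms.intro)
    then show ?thesis by (rule connes_moscovici.cyclic_homology_CM_conmos)
  qed
  show ?thesis
    by (intro conjI impI allI; (elim conjE)?)
      (rule PCM_cosimplicial_B_module PCM_almost_para_cocyclic_B_module PCM_tauinv_bij PCM_para_cocyclic_B_module
        CM_tauinv_bij[OF assms(5)] CM_cocyclic[OF assms(5)] part4; assumption)+
qed

end
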